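(* Let $(d,h)$ be a minimal higher matrix factorization with respect to a regular sequence $f_1,\dots,f_c$ in a local ring $S$, let $R=S/(f_1,\dots,f_c)$, and let $M$ be the HMF module of $(d,h)$. Then: (1) The Poincaré series $\mathcal P^R_M(x)=\sum_{i\ge0}b_i^R(M)x^i$ of $M$ over $R$ is $$\mathcal P^R_M(x)=\sum_{1\le p\le c}\frac1{(1-x^2)^{c-p+1}}\Big(x\,\operatorname{rank}(B_1(p))+\operatorname{rank}(B_0(p))\Big).$$ (2) The Betti numbers of $M$ over $R$ are given by the following two polynomials in $z$ (for integers $z\ge0$): $$b^R_{2z}(M)=\sum_{1\le p\le c}\binom{c-p+z}{c-p}\operatorname{rank}(B_0(p)),\qquad b^R_{2z+1}(M)=\sum_{1\le p\le c}\binom{c-p+z}{c-p}\operatorname{rank}(B_1(p)).$$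
   Context: All rings are commutative and Noetherian, all modules finitely generated. A higher matrix factorization (HMF) $(d,h)$ with respect to $f_1,\dots,f_c\in S$ consists of: (1) finitely generated free $S$-modules $A_0,A_1$ with filtrations $0=A_s(0)\subseteq A_s(1)\subseteq\cdots\subseteq A_s(c)=A_s$ ($s=0,1$) such that each $A_s(p-1)$ is a free summand of $A_s(p)$; (2) $S$-linear maps $d:A_1\to A_0$ and $h:\bigoplus_{q=1}^cA_0(q)\to A_1$ preserving filtrations, where $\bigoplus_qA_0(q)$ is filtered by the submodules $\bigoplus_{q\le p}A_0(q)$; such that, writing $d_p:A_1(p)\to A_0(p)$ and $h_p:A_0(p)\to A_1(p)$ for the induced maps ($h_p$ is the restriction of $h$ to the $p$-th summand), $B_s(p)=A_s(p)/A_s(p-1)$ (free modules), and $\pi_p:A_1(p)\to B_1(p)$ for the projection, one has for all $1\le p\le c$: (a) $d_ph_p\equiv f_p\,\mathrm{Id}_{A_0(p)}$ modulo $(f_1,\dots,f_{p-1})A_0(p)$; (b) $\pi_ph_pd_p\equiv f_p\,\pi_p$ modulo $(f_1,\dots,f_{p-1})B_1(p)$. The HMF module of $(d,h)$ is $M=\operatorname{coker}(R\otimes_S d)$. $(d,h)$ is minimal if the images of $d$ and $h$ are contained in the maximal ideal times their targets. $b_i^R(M)=\dim_k\operatorname{Tor}_i^R(M,k)$, $k$ the residue field. *)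

theory Defs
  imports
    "HOL-Algebra.Module"
    "HOL-Algebra.QuotRing"
    "HOL-Algebra.Ring_Divisibility"
    "HOL-Computational_Algebra.Formal_Power_Series"
begin

section \<open>Modules\<close>

text \<open>The type of modules in HOL-Algebra extends that of rings. The fields \<open>mult\<close> and \<open>one\<close>
  carry no information for a module, and are left \<open>undefined\<close> in the constructions below.\<close>

definition module_hom ::
  "('r, 'x) ring_scheme \<Rightarrow> ('r, 'a, 'y) module_scheme \<Rightarrow> ('r, 'b, 'z) module_scheme \<Rightarrow> ('a \<Rightarrow> 'b) set"
  where "module_hom R M N =
    {g \<in> carrier M \<rightarrow> carrier N.
       (\<forall>x\<in>carrier M. \<forall>y\<in>carrier M. g (x \<oplus>\<^bsub>M\<^esub> y) = g x \<oplus>\<^bsub>N\<^esub> g y) \<and>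
       (\<forall>a\<in>carrier R. \<forall>x\<in>carrier M. g (a \<odot>\<^bsub>M\<^esub> x) = a \<odot>\<^bsub>N\<^esub> g x)}"

definition mod_kernel :: "('r, 'a, 'y) module_scheme \<Rightarrow> ('r, 'b, 'z) module_scheme \<Rightarrow> ('a \<Rightarrow> 'b) \<Rightarrow> 'a set"
  where "mod_kernel M N g = {x \<in> carrier M. g x = \<zero>\<^bsub>N\<^esub>}"

definition mod_span :: "('r, 'x) ring_scheme \<Rightarrow> ('r, 'a, 'y) module_scheme \<Rightarrow> 'a set \<Rightarrow> 'a set"
  where "mod_span R M G = \<Inter>{H. submodule H R M \<and> G \<subseteq> H}"

definition ideal_smult ::
  "('r, 'x) ring_scheme \<Rightarrow> 'r set \<Rightarrow> ('r, 'a, 'y) module_scheme \<Rightarrow> 'a set"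
  where "ideal_smult R I M = mod_span R M {a \<odot>\<^bsub>M\<^esub> x | a x. a \<in> I \<and> x \<in> carrier M}"

definition quot_mod :: "('r, 'a, 'y) module_scheme \<Rightarrow> 'a set \<Rightarrow> ('r, 'a set) module"
  where "quot_mod M N =
    \<lparr>carrier = a_rcosets\<^bsub>M\<^esub> N, mult = undefined, one = undefined, zero = N, add = set_add M,
     smult = (\<lambda>a U. \<Union>x\<in>U. N +>\<^bsub>M\<^esub> (a \<odot>\<^bsub>M\<^esub> x))\<rparr>"

definition mod_coker ::
  "('r, 'a, 'y) module_scheme \<Rightarrow> ('r, 'b, 'z) module_scheme \<Rightarrow> ('a \<Rightarrow> 'b) \<Rightarrow> ('r, 'b set) module"
  where "mod_coker M N g = quot_mod N (g ` carrier M)"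

definition direct_sum_mod :: "'i set \<Rightarrow> ('i \<Rightarrow> ('r, 'a, 'y) module_scheme) \<Rightarrow> ('r, 'i \<Rightarrow> 'a) module"
  \<comment> \<open>the external direct sum, for finite index sets only\<close>
  where "direct_sum_mod I M =
    \<lparr>carrier = (\<Pi>\<^sub>E i\<in>I. carrier (M i)), mult = undefined, one = undefined,
     zero = (\<lambda>i\<in>I. \<zero>\<^bsub>M i\<^esub>), add = (\<lambda>x y. \<lambda>i\<in>I. x i \<oplus>\<^bsub>M i\<^esub> y i),
     smult = (\<lambda>a x. \<lambda>i\<in>I. a \<odot>\<^bsub>M i\<^esub> x i)\<rparr>"

definition direct_sum_incl :: "'i set \<Rightarrow> ('i \<Rightarrow> ('r, 'a, 'y) module_scheme) \<Rightarrow> 'i \<Rightarrow> 'a \<Rightarrow> 'i \<Rightarrow> 'a"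
  where "direct_sum_incl I M p x = (\<lambda>i\<in>I. if i = p then x else \<zero>\<^bsub>M i\<^esub>)"

definition direct_summand :: "('r, 'x) ring_scheme \<Rightarrow> 'a set \<Rightarrow> ('r, 'a, 'y) module_scheme \<Rightarrow> bool"
  where "direct_summand R N M \<longleftrightarrow> submodule N R M \<and>
    (\<exists>C. submodule C R M \<and> N \<inter> C = {\<zero>\<^bsub>M\<^esub>} \<and> N <+>\<^bsub>M\<^esub> C = carrier M)"


section \<open>Finitely generated free modules\<close>

definition mod_basis :: "('r, 'x) ring_scheme \<Rightarrow> ('r, 'a, 'y) module_scheme \<Rightarrow> 'a set \<Rightarrow> bool"
  where "mod_basis R M B \<longleftrightarrow> finite B \<and> B \<subseteq> carrier M \<and>
    (\<forall>x\<in>carrier M. \<exists>!a. a \<in> B \<rightarrow>\<^sub>E carrier R \<and> x = (\<Oplus>\<^bsub>M\<^esub>b\<in>B. a b \<odot>\<^bsub>M\<^esub> b))"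

definition fg_free :: "('r, 'x) ring_scheme \<Rightarrow> ('r, 'a, 'y) module_scheme \<Rightarrow> bool"
  where "fg_free R M \<longleftrightarrow> module R M \<and> (\<exists>B. mod_basis R M B)"

definition mod_rank :: "('r, 'x) ring_scheme \<Rightarrow> ('r, 'a, 'y) module_scheme \<Rightarrow> nat"
  \<comment> \<open>over a field this is the dimension of a finite-dimensional vector space\<close>
  where "mod_rank R M = card (SOME B. mod_basis R M B)"

definition free_mod :: "('r, 'x) ring_scheme \<Rightarrow> 'i set \<Rightarrow> ('r, 'i \<Rightarrow> 'r) module"
  \<comment> \<open>the free module on a possibly infinite set \<open>I\<close>: finitely supported functions on \<open>I\<close>,
      extended by zero to the whole type\<close>
  where "free_mod R I =
    \<lparr>carrier = {u. (\<forall>x. u x \<in> carrier R) \<and> finite {x. u x \<noteq> \<zero>\<^bsub>R\<^esub>} \<and> {x. u x \<noteq> \<zero>\<^bsub>R\<^esub>} \<subseteq> I},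
     mult = undefined, one = undefined,
     zero = (\<lambda>x. \<zero>\<^bsub>R\<^esub>), add = (\<lambda>u v x. u x \<oplus>\<^bsub>R\<^esub> v x), smult = (\<lambda>a u x. a \<otimes>\<^bsub>R\<^esub> u x)\<rparr>"

definition free_gen :: "('r, 'x) ring_scheme \<Rightarrow> 'i \<Rightarrow> 'i \<Rightarrow> 'r"
  where "free_gen R x = (\<lambda>y. if y = x then \<one>\<^bsub>R\<^esub> else \<zero>\<^bsub>R\<^esub>)"


section \<open>Tensor products and base change\<close>

definition tensor_rels ::
  "('r, 'x) ring_scheme \<Rightarrow> ('r, 'a, 'y) module_scheme \<Rightarrow> ('r, 'b, 'z) module_scheme \<Rightarrow> ('a \<times> 'b \<Rightarrow> 'r) set"
  where "tensor_rels R M N =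
    (let F = free_mod R (carrier M \<times> carrier N); e = (\<lambda>x y. free_gen R (x, y)) in
      {e (x \<oplus>\<^bsub>M\<^esub> x') y \<ominus>\<^bsub>F\<^esub> (e x y \<oplus>\<^bsub>F\<^esub> e x' y) | x x' y.
          x \<in> carrier M \<and> x' \<in> carrier M \<and> y \<in> carrier N} \<union>
      {e x (y \<oplus>\<^bsub>N\<^esub> y') \<ominus>\<^bsub>F\<^esub> (e x y \<oplus>\<^bsub>F\<^esub> e x y') | x y y'.
          x \<in> carrier M \<and> y \<in> carrier N \<and> y' \<in> carrier N} \<union>
      {e (a \<odot>\<^bsub>M\<^esub> x) y \<ominus>\<^bsub>F\<^esub> (a \<odot>\<^bsub>F\<^esub> e x y) | a x y.
          a \<in> carrier R \<and> x \<in> carrier M \<and> y \<in> carrier N} \<union>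
      {e x (a \<odot>\<^bsub>N\<^esub> y) \<ominus>\<^bsub>F\<^esub> (a \<odot>\<^bsub>F\<^esub> e x y) | a x y.
          a \<in> carrier R \<and> x \<in> carrier M \<and> y \<in> carrier N})"

definition tensor_ker ::
  "('r, 'x) ring_scheme \<Rightarrow> ('r, 'a, 'y) module_scheme \<Rightarrow> ('r, 'b, 'z) module_scheme \<Rightarrow> ('a \<times> 'b \<Rightarrow> 'r) set"
  where "tensor_ker R M N =
    mod_span R (free_mod R (carrier M \<times> carrier N)) (tensor_rels R M N)"

definition tensor ::
  "('r, 'x) ring_scheme \<Rightarrow> ('r, 'a, 'y) module_scheme \<Rightarrow> ('r, 'b, 'z) module_scheme \<Rightarrow>
   ('r, ('a \<times> 'b \<Rightarrow> 'r) set) module"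
  where "tensor R M N = quot_mod (free_mod R (carrier M \<times> carrier N)) (tensor_ker R M N)"

definition tensor_pure ::
  "('r, 'x) ring_scheme \<Rightarrow> ('r, 'a, 'y) module_scheme \<Rightarrow> ('r, 'b, 'z) module_scheme \<Rightarrow>
   'a \<Rightarrow> 'b \<Rightarrow> ('a \<times> 'b \<Rightarrow> 'r) set"
  where "tensor_pure R M N x y =
    tensor_ker R M N +>\<^bsub>free_mod R (carrier M \<times> carrier N)\<^esub> free_gen R (x, y)"

text \<open>For linear maps \<open>g : M \<rightarrow> M'\<close> and \<open>g' : N \<rightarrow> N'\<close>, the map \<open>g \<otimes> g'\<close> is the
  unique linear map that takes \<open>x \<otimes> y\<close> to \<open>g x \<otimes> g' y\<close>; it is made extensional so that the
  description determines it as a HOL function.\<close>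

definition tensor_map ::
  "('r, 'x) ring_scheme \<Rightarrow> ('r, 'a, 'y) module_scheme \<Rightarrow> ('r, 'b, 'z) module_scheme \<Rightarrow>
   ('r, 'c, 'u) module_scheme \<Rightarrow> ('r, 'd, 'v) module_scheme \<Rightarrow> ('a \<Rightarrow> 'c) \<Rightarrow> ('b \<Rightarrow> 'd) \<Rightarrow>
   ('a \<times> 'b \<Rightarrow> 'r) set \<Rightarrow> ('c \<times> 'd \<Rightarrow> 'r) set"
  where "tensor_map R M N M' N' g g' =
    (THE t. t \<in> module_hom R (tensor R M N) (tensor R M' N') \<and>
            t \<in> extensional (carrier (tensor R M N)) \<and>
            (\<forall>x\<in>carrier M. \<forall>y\<in>carrier N.
               t (tensor_pure R M N x y) = tensor_pure R M' N' (g x) (g' y)))"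

definition alg_mod :: "('k, 'y) ring_scheme \<Rightarrow> ('r \<Rightarrow> 'k) \<Rightarrow> ('r, 'k) module"
  \<comment> \<open>the ring \<open>K\<close> as a module over \<open>R\<close> along a ring homomorphism \<open>\<phi> : R \<rightarrow> K\<close>\<close>
  where "alg_mod K \<phi> =
    \<lparr>carrier = carrier K, mult = mult K, one = \<one>\<^bsub>K\<^esub>, zero = \<zero>\<^bsub>K\<^esub>, add = add K,
     smult = (\<lambda>a x. \<phi> a \<otimes>\<^bsub>K\<^esub> x)\<rparr>"

text \<open>The \<open>K\<close>-module \<open>K \<otimes>\<^sub>R M\<close>; a scalar \<open>b \<in> K\<close> acts as \<open>(multiplication by b) \<otimes> id\<close>.\<close>

definition base_change ::
  "('r, 'x) ring_scheme \<Rightarrow> ('k, 'y) ring_scheme \<Rightarrow> ('r \<Rightarrow> 'k) \<Rightarrow> ('r, 'a, 'z) module_scheme \<Rightarrow>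
   ('k, ('k \<times> 'a \<Rightarrow> 'r) set) module"
  where "base_change R K \<phi> M =
    (let T = tensor R (alg_mod K \<phi>) M in
      \<lparr>carrier = carrier T, mult = undefined, one = undefined, zero = \<zero>\<^bsub>T\<^esub>, add = add T,
       smult = (\<lambda>b. tensor_map R (alg_mod K \<phi>) M (alg_mod K \<phi>) M (\<lambda>x. b \<otimes>\<^bsub>K\<^esub> x) (\<lambda>y. y))\<rparr>)"

definition base_change_map ::
  "('r, 'x) ring_scheme \<Rightarrow> ('k, 'y) ring_scheme \<Rightarrow> ('r \<Rightarrow> 'k) \<Rightarrow>
   ('r, 'a, 'z) module_scheme \<Rightarrow> ('r, 'b, 'u) module_scheme \<Rightarrow> ('a \<Rightarrow> 'b) \<Rightarrow>
   ('k \<times> 'a \<Rightarrow> 'r) set \<Rightarrow> ('k \<times> 'b \<Rightarrow> 'r) set"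
  where "base_change_map R K \<phi> M N g =
    tensor_map R (alg_mod K \<phi>) M (alg_mod K \<phi>) N (\<lambda>x. x) g"

definition quot_proj :: "('r, 'x) ring_scheme \<Rightarrow> 'r set \<Rightarrow> 'r \<Rightarrow> 'r set"
  where "quot_proj R I a = I +>\<^bsub>R\<^esub> a"


section \<open>Local rings, regular sequences\<close>

definition noeth_local_ring :: "('r, 'x) ring_scheme \<Rightarrow> bool"
  where "noeth_local_ring R \<longleftrightarrow> cring R \<and> noetherian_ring R \<and> (\<exists>!I. maximalideal I R)"

definition max_ideal :: "('r, 'x) ring_scheme \<Rightarrow> 'r set"
  where "max_ideal R = (THE I. maximalideal I R)"

definition residue_field :: "('r, 'x) ring_scheme \<Rightarrow> 'r set ring"
  where "residue_field R = R Quot (max_ideal R)"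

definition seq_ideal :: "('r, 'x) ring_scheme \<Rightarrow> (nat \<Rightarrow> 'r) \<Rightarrow> nat \<Rightarrow> 'r set"
  \<comment> \<open>the ideal \<open>(f\<^sub>1, \<dots>, f\<^sub>p)\<close>; it is the zero ideal for \<open>p = 0\<close>\<close>
  where "seq_ideal R f p = Idl\<^bsub>R\<^esub> (f ` {1..p})"

definition regular_sequence :: "('r, 'x) ring_scheme \<Rightarrow> nat \<Rightarrow> (nat \<Rightarrow> 'r) \<Rightarrow> bool"
  where "regular_sequence R c f \<longleftrightarrow>
    f \<in> {1..c} \<rightarrow> carrier R \<and>
    (\<forall>p\<in>{1..c}. \<forall>x\<in>carrier R.
       f p \<otimes>\<^bsub>R\<^esub> x \<in> seq_ideal R f (p - 1) \<longrightarrow> x \<in> seq_ideal R f (p - 1)) \<and>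
    seq_ideal R f c \<noteq> carrier R"


section \<open>Free resolutions, Tor and Betti numbers\<close>

text \<open>A resolution \<open>\<dots> \<rightarrow> R\<^bsup>n 1\<^esup> \<rightarrow> R\<^bsup>n 0\<^esup> \<rightarrow> M \<rightarrow> 0\<close>
  by finitely generated free modules, with differentials \<open>\<delta> i : R\<^bsup>n (i + 1)\<^esup> \<rightarrow> R\<^bsup>n i\<^esup>\<close>
  and augmentation \<open>\<epsilon>\<close>.\<close>

definition free_resolution ::
  "('r, 'x) ring_scheme \<Rightarrow> ('r, 'a, 'y) module_scheme \<Rightarrow> (nat \<Rightarrow> nat) \<Rightarrow>
   (nat \<Rightarrow> (nat \<Rightarrow> 'r) \<Rightarrow> (nat \<Rightarrow> 'r)) \<Rightarrow> ((nat \<Rightarrow> 'r) \<Rightarrow> 'a) \<Rightarrow> bool"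
  where "free_resolution R M n \<delta> \<epsilon> \<longleftrightarrow>
    (let F = (\<lambda>i. free_mod R {..<n i}) in
      (\<forall>i. \<delta> i \<in> module_hom R (F (Suc i)) (F i)) \<and>
      \<epsilon> \<in> module_hom R (F 0) M \<and>
      \<epsilon> ` carrier (F 0) = carrier M \<and>
      \<delta> 0 ` carrier (F 1) = mod_kernel (F 0) M \<epsilon> \<and>
      (\<forall>i. \<delta> (Suc i) ` carrier (F (Suc (Suc i))) = mod_kernel (F (Suc i)) (F i) (\<delta> i)))"

text \<open>\<open>Tor\<^sub>i\<^sup>R(M, K)\<close> with its \<open>K\<close>-module structure, for a finitely generated module \<open>M\<close> over a
  Noetherian ring \<open>R\<close> and an \<open>R\<close>-algebra \<open>\<phi> : R \<rightarrow> K\<close>: the \<open>i\<close>-th homology of \<open>K \<otimes>\<^sub>R F\<close>, where \<open>F\<close>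
  is a resolution of \<open>M\<close> by finitely generated free modules.\<close>

definition tor ::
  "('r, 'x) ring_scheme \<Rightarrow> ('r, 'a, 'y) module_scheme \<Rightarrow> ('k, 'z) ring_scheme \<Rightarrow> ('r \<Rightarrow> 'k) \<Rightarrow> nat \<Rightarrow>
   ('k, ('k \<times> (nat \<Rightarrow> 'r) \<Rightarrow> 'r) set set) module"
  where "tor R M K \<phi> i =
    (let (n, \<delta>) = (SOME (n, \<delta>). \<exists>\<epsilon>. free_resolution R M n \<delta> \<epsilon>);
         F = (\<lambda>j. free_mod R {..<n j});
         T = (\<lambda>j. base_change R K \<phi> (F j));
         D = (\<lambda>j. base_change_map R K \<phi> (F (Suc j)) (F j) (\<delta> j));
         Z = (if i = 0 then carrier (T 0) else mod_kernel (T i) (T (i - 1)) (D (i - 1)))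
     in quot_mod ((T i)\<lparr>carrier := Z\<rparr>) (D i ` carrier (T (Suc i))))"

definition betti :: "('r, 'x) ring_scheme \<Rightarrow> ('r, 'a, 'y) module_scheme \<Rightarrow> nat \<Rightarrow> nat"
  where "betti R M i =
    mod_rank (residue_field R) (tor R M (residue_field R) (quot_proj R (max_ideal R)) i)"

definition poincare_series :: "('r, 'x) ring_scheme \<Rightarrow> ('r, 'a, 'y) module_scheme \<Rightarrow> rat fps"
  where "poincare_series R M = Abs_fps (\<lambda>i. of_nat (betti R M i))"


section \<open>Higher matrix factorizations\<close>

definition filt_mod :: "('r, 'a) module \<Rightarrow> (nat \<Rightarrow> 'a set) \<Rightarrow> nat \<Rightarrow> ('r, 'a) module"
  where "filt_mod A F p = A\<lparr>carrier := F p\<rparr>"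

definition filt_quot :: "('r, 'a) module \<Rightarrow> (nat \<Rightarrow> 'a set) \<Rightarrow> nat \<Rightarrow> ('r, 'a set) module"
  \<comment> \<open>\<open>B(p) = A(p) / A(p - 1)\<close>, for \<open>p \<ge> 1\<close>\<close>
  where "filt_quot A F p = quot_mod (filt_mod A F p) (F (p - 1))"

definition filt_proj :: "('r, 'a) module \<Rightarrow> (nat \<Rightarrow> 'a set) \<Rightarrow> nat \<Rightarrow> 'a \<Rightarrow> 'a set"
  where "filt_proj A F p x = F (p - 1) +>\<^bsub>filt_mod A F p\<^esub> x"

locale filtered_free_module =
  fixes S :: "('s, 'x) ring_scheme" and c :: nat and A :: "('s, 'a) module" and F :: "nat \<Rightarrow> 'a set"
  assumes fg_free: "fg_free S A"
    and filt_bot: "F 0 = {\<zero>\<^bsub>A\<^esub>}"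
    and filt_top: "F c = carrier A"
    and filt_submodule: "p \<le> c \<Longrightarrow> submodule (F p) S A"
    and filt_free: "p \<le> c \<Longrightarrow> fg_free S (filt_mod A F p)"
    and filt_summand: "p \<in> {1..c} \<Longrightarrow> direct_summand S (F (p - 1)) (filt_mod A F p)"
    and filt_quot_free: "p \<in> {1..c} \<Longrightarrow> fg_free S (filt_quot A F p)"

definition hmf_source :: "nat \<Rightarrow> ('s, 'a) module \<Rightarrow> (nat \<Rightarrow> 'a set) \<Rightarrow> ('s, nat \<Rightarrow> 'a) module"
  \<comment> \<open>the source \<open>\<Oplus>\<^sub>q A\<^sub>0(q)\<close> of \<open>h\<close>\<close>
  where "hmf_source c A F = direct_sum_mod {1..c} (filt_mod A F)"

definition hmf_source_filt :: "nat \<Rightarrow> ('s, 'a) module \<Rightarrow> (nat \<Rightarrow> 'a set) \<Rightarrow> nat \<Rightarrow> (nat \<Rightarrow> 'a) set"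
  where "hmf_source_filt c A F p =
    {x \<in> carrier (hmf_source c A F). \<forall>q\<in>{1..c}. p < q \<longrightarrow> x q = \<zero>\<^bsub>A\<^esub>}"

definition hmf_part ::
  "nat \<Rightarrow> ('s, 'a) module \<Rightarrow> (nat \<Rightarrow> 'a set) \<Rightarrow> ((nat \<Rightarrow> 'a) \<Rightarrow> 'b) \<Rightarrow> nat \<Rightarrow> 'a \<Rightarrow> 'b"
  \<comment> \<open>\<open>h\<^sub>p\<close>, the restriction of \<open>h\<close> to the \<open>p\<close>-th summand\<close>
  where "hmf_part c A F h p x = h (direct_sum_incl {1..c} (filt_mod A F) p x)"

locale higher_matrix_factorization =
  A0: filtered_free_module S c A0 F0 + A1: filtered_free_module S c A1 F1
  for S :: "('s, 'x) ring_scheme" and c :: nat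
    and A0 :: "('s, 'a) module" and F0 :: "nat \<Rightarrow> 'a set"
    and A1 :: "('s, 'b) module" and F1 :: "nat \<Rightarrow> 'b set" +
  fixes f :: "nat \<Rightarrow> 's" and d :: "'b \<Rightarrow> 'a" and h :: "(nat \<Rightarrow> 'a) \<Rightarrow> 'b"
  assumes f_closed: "f \<in> {1..c} \<rightarrow> carrier S"
    and d_hom: "d \<in> module_hom S A1 A0"
    and d_filt: "p \<le> c \<Longrightarrow> d ` F1 p \<subseteq> F0 p"
    and h_hom: "h \<in> module_hom S (hmf_source c A0 F0) A1"
    and h_filt: "p \<le> c \<Longrightarrow> h ` hmf_source_filt c A0 F0 p \<subseteq> F1 p"
    and dh: "\<lbrakk>p \<in> {1..c}; x \<in> F0 p\<rbrakk> \<Longrightarrow>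
      d (hmf_part c A0 F0 h p x) \<ominus>\<^bsub>filt_mod A0 F0 p\<^esub> f p \<odot>\<^bsub>filt_mod A0 F0 p\<^esub> x
        \<in> ideal_smult S (seq_ideal S f (p - 1)) (filt_mod A0 F0 p)"
    and hd: "\<lbrakk>p \<in> {1..c}; y \<in> F1 p\<rbrakk> \<Longrightarrow>
      filt_proj A1 F1 p (hmf_part c A0 F0 h p (d y))
          \<ominus>\<^bsub>filt_quot A1 F1 p\<^esub> f p \<odot>\<^bsub>filt_quot A1 F1 p\<^esub> filt_proj A1 F1 p y
        \<in> ideal_smult S (seq_ideal S f (p - 1)) (filt_quot A1 F1 p)"

definition hmf_minimal ::
  "('s, 'x) ring_scheme \<Rightarrow> nat \<Rightarrow> ('s, 'a) module \<Rightarrow> (nat \<Rightarrow> 'a set) \<Rightarrow> ('s, 'b) module \<Rightarrow>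
   ('b \<Rightarrow> 'a) \<Rightarrow> ((nat \<Rightarrow> 'a) \<Rightarrow> 'b) \<Rightarrow> bool"
  where "hmf_minimal S c A0 F0 A1 d h \<longleftrightarrow>
    d ` carrier A1 \<subseteq> ideal_smult S (max_ideal S) A0 \<and>
    h ` carrier (hmf_source c A0 F0) \<subseteq> ideal_smult S (max_ideal S) A1"

definition hmf_ring :: "('s, 'x) ring_scheme \<Rightarrow> nat \<Rightarrow> (nat \<Rightarrow> 's) \<Rightarrow> 's set ring"
  where "hmf_ring S c f = S Quot (seq_ideal S f c)"

definition hmf_module ::
  "('s, 'x) ring_scheme \<Rightarrow> nat \<Rightarrow> (nat \<Rightarrow> 's) \<Rightarrow> ('s, 'a) module \<Rightarrow> ('s, 'b) module \<Rightarrow> ('b \<Rightarrow> 'a) \<Rightarrow>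
   ('s set, ('s set \<times> 'a \<Rightarrow> 's) set set) module"
  \<comment> \<open>\<open>coker (R \<otimes>\<^sub>S d)\<close> over \<open>R = S/(f\<^sub>1, \<dots>, f\<^sub>c)\<close>\<close>
  where "hmf_module S c f A0 A1 d =
    (let R = hmf_ring S c f; \<phi> = quot_proj S (seq_ideal S f c) in
      mod_coker (base_change S R \<phi> A1) (base_change S R \<phi> A0) (base_change_map S R \<phi> A1 A0 d))"

end

theory Submission
  imports Defs "HOL-Library.Poly_Mapping"
begin

text \<open>Write \<open>I\<^sub>p = (f\<^sub>1, \<dots>, f\<^sub>p)\<close>. The Betti numbers are read off from a minimal free resolution \<open>T\<close> of \<open>M\<close> over
  \<open>S/I\<^sub>c\<close> due to Eisenbud and Peeva. Its generators are the products of a monomial in variables \<open>y\<^sub>q\<close> of degree 2 with an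
  element \<open>b\<close> of a basis of \<open>B\<^sub>0(p)\<close> (degree 0) or \<open>B\<^sub>1(p)\<close> (degree 1), where only the variables \<open>y\<^sub>p, \<dots>, y\<^sub>c\<close> may occur
  next to \<open>b\<close>. There are \<open>c - p + z choose c - p\<close> monomials of degree \<open>2z\<close> in these variables, which gives the
  polynomials, and their generating function gives the Poincare series.

  The resolution is built by induction on the level \<open>p\<close>; let \<open>T(p)\<close> be the part on the generators with \<open>b\<close> and all
  variables of level at most \<open>p\<close>. Two steps lead from \<open>T(p - 1)\<close>, a resolution over \<open>S/I\<^sub>p\<^sub>-\<^sub>1\<close>, to \<open>T(p)\<close>. First, the
  generators of \<open>B\<^sub>0(p)\<close> and \<open>B\<^sub>1(p)\<close> are added, with \<open>d\<close> as differential. The result is still exact over \<open>S/I\<^sub>p\<^sub>-\<^sub>1\<close>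
  in positive degrees, because condition (b) shows that \<open>f\<^sub>p\<close> annihilates the \<open>B\<^sub>1(p)\<close>-component of a cycle of degree one
  (\<open>cone_exact\<close>). Second, the variable \<open>y\<^sub>p\<close> is adjoined, as in the construction of Shamash: the differential \<open>D\<close> is
  extended degree by degree so that \<open>D\<^sup>2 = f\<^sub>p t\<^sub>p\<close> modulo \<open>I\<^sub>p\<^sub>-\<^sub>1\<close>, where \<open>t\<^sub>p\<close> is division by \<open>y\<^sub>p\<close>
  (\<open>partial_lift_step\<close>); condition (a) says that \<open>h\<^sub>p\<close> is a correct value in the first degree. Regularity of \<open>f\<^sub>p\<close> and the
  formula for \<open>D\<^sup>2\<close> imply that \<open>T(p)\<close> is exact modulo \<open>I\<^sub>p\<close> (\<open>level_differential_Suc\<close>).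

  Minimality of \<open>D\<close> follows from minimality in degrees one and two, where \<open>D\<close> is given by \<open>d\<close> and \<open>h\<close>. Indeed \<open>D\<^sup>2\<close>
  is a combination of the \<open>f\<^sub>q\<close> whose coefficients are, up to terms for smaller \<open>q\<close>, the divisions by the variables;
  as the sequence is regular, \<open>D\<^sup>2 w\<close> determines modulo the maximal ideal whether \<open>w\<close> vanishes (\<open>sq_detects\<close>).
  Applied to \<open>w = D x\<close>, with \<open>D\<^sup>2 D x = D D\<^sup>2 x\<close>, this propagates minimality from lower to higher degrees
  (\<open>D_minimal\<close>).

  The definition of \<open>Tor\<close> selects an arbitrary free resolution. It is compared with the minimal one through chain maps
  and homotopies (\<open>homology_presented\<close>), so that the dimension of \<open>Tor\<close> is the number of generators of \<open>T\<close>
  (\<open>tor_rank\<close>).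

  To make all of this plain linear algebra, a commutative ring structure on a whole type \<open>'p\<close> is chosen with a
  surjection \<open>\<pi>\<close> onto \<open>S\<close> (\<open>ring_cover_exists\<close>). Linear maps are then maps between vectors with coefficients in
  \<open>'p\<close>, and an equation over \<open>S\<close>, over \<open>S/I\<^sub>p\<close> or over the residue field becomes a congruence modulo the kernel of
  the composite surjection. The modules of the statement enter through their presentations by such vectors
  (\<open>presents\<close>).\<close>

section \<open>Vectors of finite support over a commutative ring\<close>

abbreviation "lookup \<equiv> Poly_Mapping.lookup"
abbreviation "keys \<equiv> Poly_Mapping.keys"

lift_definition smul :: "'p::comm_ring_1 \<Rightarrow> ('i \<Rightarrow>\<^sub>0 'p) \<Rightarrow> ('i \<Rightarrow>\<^sub>0 'p)"
  is "\<lambda>a x i. a * x i"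
  by (rule finite_subset[rotated]) auto

lemma lookup_smul [simp]: "lookup (smul a x) i = a * lookup x i"
  by transfer simp

definition bas :: "'i \<Rightarrow> 'i \<Rightarrow>\<^sub>0 'p::comm_ring_1"
  where "bas i = Poly_Mapping.single i 1"

lemma lookup_bas: "lookup (bas i) j = (if i = j then 1 else 0)"
  by (auto simp: bas_def lookup_single)

lemma keys_bas [simp]: "keys (bas i :: 'i \<Rightarrow>\<^sub>0 'p::comm_ring_1) = {i}"
  by (auto simp: bas_def)

lemma smul_simps:
  "smul a (x + y) = smul a x + smul a y" "smul a (x - y) = smul a x - smul a y"
  "smul (a + b) x = smul a x + smul b x" "smul (a - b) x = smul a x - smul b x"
  "smul a (smul b x) = smul (a * b) x" "smul a 0 = 0" "smul 0 x = 0" "smul 1 x = x"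
  "smul a (- x) = - smul a x"
  by (auto intro!: poly_mapping_eqI simp: lookup_add lookup_minus algebra_simps)

lemma lookup_sum': "lookup (\<Sum>i\<in>A. g i) j = (\<Sum>i\<in>A. lookup (g i) j)"
  by (induction A rule: infinite_finite_induct) (auto simp: lookup_add)

definition lin :: "(('i \<Rightarrow>\<^sub>0 'p::comm_ring_1) \<Rightarrow> ('j \<Rightarrow>\<^sub>0 'p)) \<Rightarrow> bool"
  where "lin L \<longleftrightarrow> (\<forall>x y. L (x + y) = L x + L y) \<and> (\<forall>a x. L (smul a x) = smul a (L x))"

lemma linI:
  assumes "\<And>x y. L (x + y) = L x + L y" "\<And>a x. L (smul a x) = smul a (L x)"
  shows "lin L"
  using assms by (auto simp: lin_def)

lemma lin_add: "lin L \<Longrightarrow> L (x + y) = L x + L y"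
  and lin_smul: "lin L \<Longrightarrow> L (smul a x) = smul a (L x)"
  by (auto simp: lin_def)

lemma lin_0: "lin L \<Longrightarrow> L 0 = 0"
  using lin_smul[of L 0 0] by (simp add: smul_simps)

lemma lin_diff: "lin L \<Longrightarrow> L (x - y) = L x - L y"
  using lin_add[of L "x - y" y] by simp

lemma lin_sum: "lin L \<Longrightarrow> L (\<Sum>i\<in>A. g i) = (\<Sum>i\<in>A. L (g i))"
  by (induction A rule: infinite_finite_induct) (auto simp: lin_0 lin_add)

lemma lin_comp: "lin L \<Longrightarrow> lin M \<Longrightarrow> lin (\<lambda>x. L (M x))"
  by (simp add: lin_def)

lemma lin_sub: "lin L \<Longrightarrow> lin M \<Longrightarrow> lin (\<lambda>x. L x - M x)"
  and lin_scale: "lin L \<Longrightarrow> lin (\<lambda>x. smul a (L x))"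
  by (auto simp: lin_def smul_simps algebra_simps)

lemma lin_id: "lin (\<lambda>x. x)" and lin_zero: "lin (\<lambda>x. 0)"
  by (auto simp: lin_def smul_simps)

definition linext :: "('i \<Rightarrow> ('j \<Rightarrow>\<^sub>0 'p)) \<Rightarrow> ('i \<Rightarrow>\<^sub>0 'p::comm_ring_1) \<Rightarrow> ('j \<Rightarrow>\<^sub>0 'p)"
  where "linext v x = (\<Sum>i\<in>keys x. smul (lookup x i) (v i))"

lemma linext_superset:
  "finite A \<Longrightarrow> keys x \<subseteq> A \<Longrightarrow> linext v x = (\<Sum>i\<in>A. smul (lookup x i) (v i))"
  unfolding linext_def
  by (rule sum.mono_neutral_left) (auto simp: in_keys_iff smul_simps)

lemma lin_linext:
  fixes v :: "'i \<Rightarrow> ('j \<Rightarrow>\<^sub>0 'p::comm_ring_1)"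
  shows "lin (linext v)"
proof (rule linI)
  fix x y :: "'i \<Rightarrow>\<^sub>0 'p"
  let ?A = "keys x \<union> keys y"
  have "linext v (x + y) = (\<Sum>i\<in>?A. smul (lookup (x + y) i) (v i))"
    by (rule linext_superset) (auto simp: keys_add)
  also have "\<dots> = linext v x + linext v y"
    by (simp add: linext_superset[of ?A] lookup_add smul_simps sum.distrib)
  finally show "linext v (x + y) = linext v x + linext v y" .
next
  fix a and x :: "'i \<Rightarrow>\<^sub>0 'p"
  have "linext v (smul a x) = (\<Sum>i\<in>keys x. smul (lookup (smul a x) i) (v i))"
    by (rule linext_superset) (auto simp: in_keys_iff)
  also have "\<dots> = smul a (linext v x)"
    by (simp add: linext_def smul_simps(5)[symmetric] lin_sum[OF lin_scale[OF lin_id]])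
  finally show "linext v (smul a x) = smul a (linext v x)" .
qed

lemma linext_bas [simp]: "linext v (bas i) = v i"
  by (simp add: linext_def lookup_bas smul_simps)

lemma vec_expand: "x = (\<Sum>i\<in>keys x. smul (lookup x i) (bas i))"
  by (rule poly_mapping_eqI)
    (simp add: lookup_sum' lookup_bas if_distrib[where f = "(*) _"] sum.delta in_keys_iff cong: if_cong)

lemma lin_expand:
  assumes "lin L"
  shows "L x = (\<Sum>i\<in>keys x. smul (lookup x i) (L (bas i)))"
  by (subst vec_expand) (simp only: lin_sum[OF assms] lin_smul[OF assms])

definition submod :: "('i \<Rightarrow>\<^sub>0 'p::comm_ring_1) set \<Rightarrow> bool"
  where "submod W \<longleftrightarrow> 0 \<in> W \<and> (\<forall>x\<in>W. \<forall>y\<in>W. x + y \<in> W) \<and> (\<forall>a. \<forall>x\<in>W. smul a x \<in> W)"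

lemma submod_sum:
  assumes "submod W" "\<And>i. i \<in> A \<Longrightarrow> g i \<in> W"
  shows "(\<Sum>i\<in>A. g i) \<in> W"
  using assms(2) by (induction A rule: infinite_finite_induct) (use assms(1) in \<open>auto simp: submod_def\<close>)

lemma submod_diff: "submod W \<Longrightarrow> x \<in> W \<Longrightarrow> y \<in> W \<Longrightarrow> x - y \<in> W"
proof -
  assume "submod W" "x \<in> W" "y \<in> W"
  then have "x + smul (-1) y \<in> W" by (auto simp: submod_def)
  moreover have "smul (-1) y = - y" by (rule poly_mapping_eqI) simp
  ultimately show ?thesis by simp
qed

lemma submod_Int: "submod W \<Longrightarrow> submod W' \<Longrightarrow> submod (W \<inter> W')"
  by (auto simp: submod_def)

text \<open>The free module on \<open>X\<close> is \<open>vec X\<close>; its submodule of multiples of an ideal \<open>J\<close> is \<open>vec X \<inter> vmod J\<close>, so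
  congruence modulo \<open>J\<close> is membership of a difference in \<open>vmod J\<close>.\<close>

definition vec :: "'i set \<Rightarrow> ('i \<Rightarrow>\<^sub>0 'p::comm_ring_1) set"
  where "vec X = {x. keys x \<subseteq> X}"

definition vmod :: "'p::comm_ring_1 set \<Rightarrow> ('i \<Rightarrow>\<^sub>0 'p) set"
  where "vmod J = {x. \<forall>i. lookup x i \<in> J}"

definition is_ideal :: "'p::comm_ring_1 set \<Rightarrow> bool"
  where "is_ideal J \<longleftrightarrow> 0 \<in> J \<and> (\<forall>a\<in>J. \<forall>b\<in>J. a + b \<in> J) \<and> (\<forall>a. \<forall>b\<in>J. a * b \<in> J)"

lemma vec_iff: "x \<in> vec X \<longleftrightarrow> (\<forall>i. i \<notin> X \<longrightarrow> lookup x i = 0)"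
  by (auto simp: vec_def in_keys_iff)

lemma submod_vec: "submod (vec X)"
  by (auto simp: submod_def vec_iff lookup_add)

lemma submod_vmod: "is_ideal J \<Longrightarrow> submod (vmod J)"
  by (auto simp: submod_def vmod_def lookup_add is_ideal_def)

lemma bas_vec: "bas i \<in> vec X \<longleftrightarrow> i \<in> X"
  by (simp add: vec_def)

lemma vec_mono: "X \<subseteq> Y \<Longrightarrow> vec X \<subseteq> vec Y"
  by (auto simp: vec_def)

lemma vmod_mono: "I \<subseteq> J \<Longrightarrow> vmod I \<subseteq> vmod J"
  by (auto simp: vmod_def)

lemma lin_vec_submod:
  assumes "lin L" "submod W" "\<And>i. i \<in> X \<Longrightarrow> L (bas i) \<in> W" "x \<in> vec X"
  shows "L x \<in> W"
proof -
  have "(\<Sum>i\<in>keys x. smul (lookup x i) (L (bas i))) \<in> W"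
    using assms by (intro submod_sum) (auto simp: submod_def vec_def)
  then show ?thesis by (simp add: lin_expand[OF assms(1), of x])
qed

lemma lin_vec_eq:
  assumes "lin L" "lin M" "\<And>i. i \<in> X \<Longrightarrow> L (bas i) = M (bas i)" "x \<in> vec X"
  shows "L x = M x"
proof -
  have "(\<lambda>x. L x - M x) x \<in> {0}"
    by (rule lin_vec_submod[OF lin_sub[OF assms(1,2)] _ _ assms(4)])
      (auto simp: assms(3) submod_def smul_simps)
  then show ?thesis by simp
qed

lemma lin_eq:
  assumes "lin L" "lin M" "\<And>i. L (bas i) = M (bas i)"
  shows "L x = M x"
  by (rule lin_vec_eq[OF assms(1,2), of UNIV]) (auto simp: assms vec_def)

text \<open>If the coefficients of a vector lie in \<open>I\<close> and a linear map vanishes modulo \<open>J\<close>, every term of the image is a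
  product of an element of \<open>I\<close> and an element of \<open>J\<close>.\<close>

lemma lin_vmod_mult:
  assumes L: "lin L" and K: "is_ideal K" and IJ: "\<And>a b. a \<in> I \<Longrightarrow> b \<in> J \<Longrightarrow> a * b \<in> K"
    and x: "x \<in> vec X" "x \<in> vmod I" and LX: "\<And>i. i \<in> X \<Longrightarrow> L (bas i) \<in> vmod J"
  shows "L x \<in> vmod K"
proof -
  have "(\<Sum>i\<in>keys x. smul (lookup x i) (L (bas i))) \<in> vmod K"
  proof (rule submod_sum[OF submod_vmod[OF K]])
    fix i assume "i \<in> keys x"
    then have "L (bas i) \<in> vmod J" using x LX by (auto simp: vec_def)
    then show "smul (lookup x i) (L (bas i)) \<in> vmod K"
      using x(2) IJ by (simp add: vmod_def)
  qed
  then show ?thesis by (simp add: lin_expand[OF L, of x])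
qed

lemma lin_vmod:
  assumes "lin L" "is_ideal J" "x \<in> vmod J"
  shows "L x \<in> vmod J"
proof (rule lin_vmod_mult[OF assms(1,2) _ _ assms(3), where J = UNIV and X = UNIV])
  show "a * b \<in> J" if "a \<in> J" for a b
    using that assms(2) by (metis is_ideal_def mult.commute)
qed (auto simp: vec_def vmod_def)

lemma vmod_add: "is_ideal J \<Longrightarrow> x \<in> vmod J \<Longrightarrow> y \<in> vmod J \<Longrightarrow> x + y \<in> vmod J"
  and vmod_smul: "is_ideal J \<Longrightarrow> x \<in> vmod J \<Longrightarrow> smul a x \<in> vmod J"
  and vmod_zero: "is_ideal J \<Longrightarrow> 0 \<in> vmod J"
  using submod_vmod[of J] by (auto simp: submod_def)

lemma vmod_diff: "is_ideal J \<Longrightarrow> x \<in> vmod J \<Longrightarrow> y \<in> vmod J \<Longrightarrow> x - y \<in> vmod J"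
  by (rule submod_diff[OF submod_vmod])

lemma vec_add: "x \<in> vec X \<Longrightarrow> y \<in> vec X \<Longrightarrow> x + y \<in> vec X"
  and vec_smul: "x \<in> vec X \<Longrightarrow> smul a x \<in> vec X"
  and vec_zero: "0 \<in> vec X"
  using submod_vec[of X] by (auto simp: submod_def)

lemma vec_diff: "x \<in> vec X \<Longrightarrow> y \<in> vec X \<Longrightarrow> x - y \<in> vec X"
  by (rule submod_diff[OF submod_vec])

lemma is_ideal_diff: "is_ideal J \<Longrightarrow> a \<in> J \<Longrightarrow> b \<in> J \<Longrightarrow> a - b \<in> J"
  unfolding is_ideal_def by (metis diff_conv_add_uminus mult_minus1)

lemma is_ideal_sum: "is_ideal I \<Longrightarrow> (\<And>i. i \<in> A \<Longrightarrow> g i \<in> I) \<Longrightarrow> (\<Sum>i\<in>A. g i) \<in> I"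
  by (induction A rule: infinite_finite_induct) (auto simp: is_ideal_def)

section \<open>Exactness of the cone over the previous level\<close>

text \<open>The generator \<open>(e, b)\<close> stands for the product of \<open>b\<close> with the variables \<open>y\<^sub>q\<close> for \<open>q \<in> e\<close>.\<close>

definition gens :: "'b set \<Rightarrow> ('b \<Rightarrow> nat) \<Rightarrow> ('b \<Rightarrow> nat) \<Rightarrow> nat \<Rightarrow> nat \<Rightarrow> (nat multiset \<times> 'b) set"
  where "gens B lev par p n =
    {(e, b). b \<in> B \<and> lev b \<le> p \<and> set_mset e \<subseteq> {lev b..p} \<and> 2 * size e + par b = n}"

type_synonym ('b, 'p) hvec = "(nat multiset \<times> 'b) \<Rightarrow>\<^sub>0 'p"

text \<open>A higher matrix factorization in coordinates: the elements \<open>b\<close> of \<open>B\<close> with \<open>lev b = p\<close> and \<open>par b = s\<close> form a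
  basis of \<open>B\<^sub>s(p)\<close>, and the conditions are congruences modulo the ideals \<open>J p\<close>, the preimages of
  \<open>(f\<^sub>1, \<dots>, f\<^sub>p)\<close> under a surjection. Here \<open>J 0\<close> is its kernel and need not be zero.\<close>

locale hmf_core =
  fixes c :: nat and J :: "nat \<Rightarrow> 'p::comm_ring_1 set" and f :: "nat \<Rightarrow> 'p"
    and B :: "'b set" and lev par :: "'b \<Rightarrow> nat"
    and d :: "('b, 'p) hvec \<Rightarrow> ('b, 'p) hvec"
    and h :: "nat \<Rightarrow> ('b, 'p) hvec \<Rightarrow> ('b, 'p) hvec"
  assumes J: "p \<le> c \<Longrightarrow> is_ideal (J p)"
    and J_Suc: "p < c \<Longrightarrow> J (Suc p) = {j + f (Suc p) * r | j r. j \<in> J p}"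
    and reg: "p < c \<Longrightarrow> f (Suc p) * a \<in> J p \<Longrightarrow> a \<in> J p"
    and lev: "b \<in> B \<Longrightarrow> 1 \<le> lev b" "b \<in> B \<Longrightarrow> lev b \<le> c"
    and par: "b \<in> B \<Longrightarrow> par b \<le> 1"
    and lin_d: "lin d" and lin_h: "lin (h p)"
    and d_T: "p \<le> c \<Longrightarrow> x \<in> vec (gens B lev par p 1) \<Longrightarrow> d x \<in> vec (gens B lev par p 0)"
    and h_T: "p < c \<Longrightarrow> x \<in> vec (gens B lev par (Suc p) 0) \<Longrightarrow> h (Suc p) x \<in> vec (gens B lev par (Suc p) 1)"
    and dh: "p < c \<Longrightarrow> x \<in> vec (gens B lev par (Suc p) 0) \<Longrightarrow> d (h (Suc p) x) - smul (f (Suc p)) x \<in> vmod (J p)"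
    and hd: "p < c \<Longrightarrow> x \<in> vec (gens B lev par (Suc p) 1) \<Longrightarrow> b \<in> B \<Longrightarrow> lev b = Suc p \<Longrightarrow>
      lookup (h (Suc p) (d x) - smul (f (Suc p)) x) ({#}, b) \<in> J p"
begin

abbreviation X :: "nat \<Rightarrow> nat \<Rightarrow> (nat multiset \<times> 'b) set" where "X \<equiv> gens B lev par"

definition T :: "nat \<Rightarrow> nat \<Rightarrow> ('b, 'p) hvec set" where "T p n = vec (X p n)"

definition y :: "nat \<Rightarrow> ('b, 'p) hvec \<Rightarrow> ('b, 'p) hvec"
  where "y p = linext (\<lambda>(e, b). bas (add_mset p e, b))"

definition t :: "nat \<Rightarrow> ('b, 'p) hvec \<Rightarrow> ('b, 'p) hvec"
  where "t p = linext (\<lambda>(e, b). if p \<in># e then bas (e - {#p#}, b) else 0)"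

lemma lin_y: "lin (y p)" and lin_t: "lin (t p)"
  by (simp_all add: y_def t_def lin_linext)

lemma y_bas: "y p (bas (e, b)) = bas (add_mset p e, b)"
  by (simp add: y_def)

lemma t_bas: "t p (bas (e, b)) = (if p \<in># e then bas (e - {#p#}, b) else 0)"
  by (simp add: t_def)

lemma t_y [simp]: "t p (y p x) = x"
proof -
  have "(\<lambda>x. t p (y p x)) x = (\<lambda>x. x) x"
    by (rule lin_eq[OF lin_comp[OF lin_t lin_y] lin_id]) (auto simp: y_bas t_bas split: prod.splits)
  then show ?thesis by simp
qed

definition free_of :: "nat \<Rightarrow> (nat multiset \<times> 'b) set" where "free_of p = {(e, b). p \<notin># e}"

lemma t_free: "x \<in> vec (free_of p) \<Longrightarrow> t p x = 0"
  using lin_vec_eq[OF lin_t lin_zero, of "free_of p" p x]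
  by (auto simp: free_of_def t_bas)

lemma pr_free: "x - y p (t p x) \<in> vec (free_of p)"
proof -
  have "bas (e, b) - y p (t p (bas (e, b))) \<in> vec (free_of p)" for e b
  proof (cases "p \<in># e")
    case True
    then have "y p (t p (bas (e, b))) = bas (e, b)" by (simp add: t_bas y_bas)
    then show ?thesis by (simp add: vec_zero)
  next
    case False
    then have "y p (t p (bas (e, b))) = 0" by (simp add: t_bas lin_0[OF lin_y])
    then show ?thesis using False by (simp add: bas_vec free_of_def)
  qed
  note * = this
  have "(\<lambda>x. x - y p (t p x)) x \<in> vec (free_of p)"
  proof (rule lin_vec_submod[OF lin_sub[OF lin_id lin_comp[OF lin_y lin_t]] submod_vec])
    show "x \<in> vec UNIV" by (simp add: vec_def)
    fix i show "bas i - y p (t p (bas i)) \<in> vec (free_of p)"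
      using * by (cases i) simp
  qed
  then show ?thesis by simp
qed

lemma gens_low: "(e, b) \<in> X p n \<Longrightarrow> n \<le> 1 \<Longrightarrow> e = {#}"
  by (cases e) (auto simp: gens_def)

lemma T_mono: "p \<le> q \<Longrightarrow> x \<in> T p n \<Longrightarrow> x \<in> T q n"
  unfolding T_def by (erule rev_subsetD, rule vec_mono) (auto simp: gens_def)

lemma y_T: "x \<in> T p n \<Longrightarrow> y p x \<in> T p (n + 2)"
  unfolding T_def
  by (rule lin_vec_submod[OF lin_y submod_vec]) (auto simp: y_bas bas_vec gens_def)

lemma t_T: "x \<in> T p (n + 2) \<Longrightarrow> t p x \<in> T p n"
  unfolding T_def
proof (rule lin_vec_submod[OF lin_t submod_vec, of "X p (n + 2)"])
  fix i assume i: "i \<in> X p (n + 2)"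
  show "t p (bas i) \<in> vec (X p n)"
  proof (cases "p \<in># fst i")
    case True
    then obtain e' b where "i = (add_mset p e', b)"
      by (metis multi_member_split prod.collapse)
    then show ?thesis using i by (auto simp: t_bas bas_vec gens_def)
  next
    case False
    then show ?thesis by (cases i) (auto simp: t_bas vec_zero)
  qed
qed

lemma T_low_free:
  assumes "n \<le> 1" "x \<in> T p n"
  shows "x \<in> vec (free_of q)"
proof -
  have "X p n \<subseteq> free_of q"
  proof safe
    fix e b assume "(e, b) \<in> X p n"
    then have "e = {#}" using gens_low assms(1) by blast
    then show "(e, b) \<in> free_of q" by (simp add: free_of_def)
  qed
  then show ?thesis using assms(2) vec_mono unfolding T_def by blast
qed

lemma t_T_low: "n \<le> 1 \<Longrightarrow> x \<in> T p n \<Longrightarrow> t q x = 0"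
  using T_low_free t_free by blast

lemma y_t_T: "x \<in> T q n \<Longrightarrow> y q (t q x) \<in> T q n"
proof (cases "n \<le> 1")
  case True
  assume "x \<in> T q n"
  then have "t q x = 0" using True t_T_low by blast
  then show ?thesis by (simp add: lin_0[OF lin_y] T_def vec_zero)
next
  case False
  assume x: "x \<in> T q n"
  obtain l where l: "n = l + 2" using False by (metis add.commute le_Suc_ex less_eq_Suc_le not_less numeral_2_eq_2 One_nat_def)
  then show ?thesis using y_T[OF t_T[of x q l]] x by simp
qed

lemma T_0: "T 0 n = {0}"
proof -
  have "X 0 n = {}" using lev(1) by (force simp: gens_def)
  then show ?thesis by (auto simp: T_def vec_def)
qed

text \<open>A monomial of positive degree that avoids the largest variable belongs to the previous level: it involves some
  variable of lower level, which bounds the level of its factor in \<open>B\<close>.\<close>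

lemma T_free: "x \<in> T (Suc p) (n + 2) \<Longrightarrow> x \<in> vec (free_of (Suc p)) \<Longrightarrow> x \<in> T p (n + 2)"
proof -
  have "X (Suc p) (n + 2) \<inter> free_of (Suc p) \<subseteq> X p (n + 2)"
  proof safe
    fix e b assume *: "(e, b) \<in> X (Suc p) (n + 2)" "(e, b) \<in> free_of (Suc p)"
    have sub: "set_mset e \<subseteq> {lev b..p}"
    proof
      fix q assume "q \<in># e"
      then have "lev b \<le> q" "q \<le> Suc p" "q \<noteq> Suc p" using * by (auto simp: gens_def free_of_def)
      then show "q \<in> {lev b..p}" by simp
    qed
    have "e \<noteq> {#}" using * par[of b] by (auto simp: gens_def)
    then obtain q where "q \<in># e" by auto
    then have "lev b \<le> p" using sub by force
    then show "(e, b) \<in> X p (n + 2)" using * sub by (auto simp: gens_def)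
  qed
  then show "x \<in> T (Suc p) (n + 2) \<Longrightarrow> x \<in> vec (free_of (Suc p)) \<Longrightarrow> x \<in> T p (n + 2)"
    by (auto simp: T_def vec_def)
qed

text \<open>The induction hypothesis of the construction. The formula for \<open>D\<^sup>2\<close> is kept for all levels up to \<open>p\<close>, since the
  proof of minimality descends through them.\<close>

definition level_differential :: "nat \<Rightarrow> (('b, 'p) hvec \<Rightarrow> ('b, 'p) hvec) \<Rightarrow> bool" where
  "level_differential p D \<longleftrightarrow> lin D \<and>
    (\<forall>n. \<forall>x\<in>T p (Suc n). D x \<in> T p n) \<and> (\<forall>x\<in>T c 0. D x = 0) \<and> (\<forall>x\<in>T c 1. D x = d x) \<and>
    (\<forall>q<p. \<forall>x\<in>T (Suc q) 0. D (y (Suc q) x) = h (Suc q) x) \<and>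
    (\<forall>q<p. \<forall>n. \<forall>x\<in>T (Suc q) n. D (D x) - smul (f (Suc q)) (t (Suc q) x) \<in> vmod (J q)) \<and>
    (\<forall>n. \<forall>x\<in>T p (Suc n). D x \<in> vmod (J p) \<longrightarrow> (\<exists>z\<in>T p (n + 2). x - D z \<in> vmod (J p)))"

text \<open>In degrees zero and one, \<open>T(p + 1)\<close> differs from \<open>T(p)\<close> only by the basis elements of level \<open>p + 1\<close>.\<close>

lemma T_vmod_coeff:
  assumes "x \<in> T (Suc p) n" "n \<le> 1" "\<And>b. b \<in> B \<Longrightarrow> lev b = Suc p \<Longrightarrow> lookup x ({#}, b) \<in> I" "is_ideal I"
  obtains x' where "x' \<in> T p n" "x - x' \<in> vmod I"
proof -
  define x' where "x' = linext (\<lambda>(e, b). if lev b = Suc p then 0 else bas (e, b)) x"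
  have l: "lookup x' (e, b) = (if lev b = Suc p then 0 else lookup x (e, b))" for e b
  proof -
    have "lookup x' (e, b) =
        (\<Sum>i\<in>keys x. lookup x i * lookup (case i of (e, b) \<Rightarrow> if lev b = Suc p then 0 else bas (e, b)) (e, b))"
      by (simp only: x'_def linext_def lookup_sum' lookup_smul)
    also have "\<dots> = (\<Sum>i\<in>keys x. if (e, b) = i then (if lev b = Suc p then 0 else lookup x i) else 0)"
      by (rule sum.cong) (auto simp: lookup_bas split: prod.splits)
    also have "\<dots> = (if lev b = Suc p then 0 else lookup x (e, b))"
      by (subst sum.delta') (auto simp: in_keys_iff)
    finally show ?thesis .
  qed
  show thesis
  proof (rule that)
    show "x' \<in> T p n"
      unfolding T_def vec_iff
    proof safe
      fix e b assume eb: "(e, b) \<notin> X p n"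
      show "lookup x' (e, b) = 0"
      proof (cases "lev b = Suc p \<or> (e, b) \<notin> X (Suc p) n")
        case True
        then show ?thesis using assms(1) by (auto simp: l T_def vec_iff)
      next
        case False
        then have "e = {#}" using gens_low assms(2) by blast
        then show ?thesis using False eb by (auto simp: gens_def)
      qed
    qed
    show "x - x' \<in> vmod I"
      unfolding vmod_def
    proof (safe)
      fix e b
      have "lookup x (e, b) \<in> I" if "lev b = Suc p"
      proof (cases "(e, b) \<in> X (Suc p) n")
        case True
        then have "e = {#}" "b \<in> B" using gens_low[OF True assms(2)] by (auto simp: gens_def)
        then show ?thesis using assms(3)[of b] that by simp
      next
        case False
        then show ?thesis using assms(1,4) by (auto simp: T_def vec_iff is_ideal_def)
      qed
      then show "lookup (x - x') (e, b) \<in> I"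
        using assms(4) by (auto simp: lookup_minus l is_ideal_def)
    qed
  qed
qed

text \<open>Adding the new generators in degrees zero and one keeps the complex exact modulo \<open>J p\<close>. By condition (b), \<open>f\<^sub>p\<^sub>+\<^sub>1\<close>
  times the component of a cycle of degree one in the new generators is zero modulo \<open>J p\<close>; by regularity this
  component vanishes, and the cycle comes from \<open>T(p)\<close>.\<close>

lemma cone_exact:
  assumes D: "level_differential p D" and p: "p < c" and x: "x \<in> T (Suc p) (Suc n)" "x \<in> vec (free_of (Suc p))"
    and Dx: "D x \<in> vmod (J p)"
  obtains s where "s \<in> T (Suc p) (n + 2)" "s \<in> vec (free_of (Suc p))" "x - D s \<in> vmod (J p)"
proof -
  note goal = that
  have I: "is_ideal (J p)" using J p by simp
  have *: thesis if x: "x' \<in> T p (Suc n)" "x - x' \<in> vmod (J p)" for x'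
  proof -
    have linD: "lin D" using D by (simp add: level_differential_def)
    have "D x' = D x - D (x - x')" by (simp add: lin_diff[OF linD])
    then have "D x' \<in> vmod (J p)"
      using Dx lin_vmod[OF linD I x(2)] vmod_diff[OF I] by simp
    then obtain z where z: "z \<in> T p (n + 2)" "x' - D z \<in> vmod (J p)"
      using D x(1) unfolding level_differential_def by blast
    have "x - D z = (x - x') + (x' - D z)" by simp
    then have "x - D z \<in> vmod (J p)" using vmod_add[OF I x(2) z(2)] by simp
    moreover have "z \<in> T (Suc p) (n + 2)" using T_mono[OF _ z(1)] by simp
    moreover have "z \<in> vec (free_of (Suc p))"
      using z(1) unfolding T_def
      by (rule rev_subsetD) (rule vec_mono, auto simp: gens_def free_of_def)
    ultimately show thesis using goal by blast
  qed
  show thesis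
  proof (cases n)
    case 0
    have x1: "x \<in> T (Suc p) 1" using x(1) 0 by simp
    then have "x \<in> T c 1" using T_mono[of "Suc p" c] p by simp
    then have dx: "d x \<in> vmod (J p)" using Dx D by (simp add: level_differential_def)
    have "lookup x ({#}, b) \<in> J p" if b: "b \<in> B" "lev b = Suc p" for b
    proof -
      have "h (Suc p) (d x) \<in> vmod (J p)" by (rule lin_vmod[OF lin_h I dx])
      then have "lookup (h (Suc p) (d x)) ({#}, b) \<in> J p" by (simp add: vmod_def)
      moreover have "lookup (h (Suc p) (d x) - smul (f (Suc p)) x) ({#}, b) \<in> J p"
        using hd[OF p _ b] x1 by (simp add: T_def)
      ultimately have "f (Suc p) * lookup x ({#}, b) \<in> J p"
        using is_ideal_diff[OF I] by (fastforce simp: lookup_minus)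
      then show ?thesis by (rule reg[OF p])
    qed
    then obtain x' where "x' \<in> T p 1" "x - x' \<in> vmod (J p)"
      using T_vmod_coeff[OF x1 _ _ I] by blast
    then show thesis using * 0 by simp
  next
    case (Suc m)
    then have "x \<in> T p (Suc n)" using T_free[of x p m] x by simp
    then show thesis using * I by (simp add: vmod_zero)
  qed
qed

section \<open>Adjoining a variable\<close>

lemma J_mono1: "p < c \<Longrightarrow> J p \<subseteq> J (Suc p)"
proof
  fix a assume "p < c" "a \<in> J p"
  then show "a \<in> J (Suc p)" unfolding J_Suc[OF \<open>p < c\<close>] by (intro CollectI exI[of _ a] exI[of _ 0]) simp
qed

lemma f_J: "p < c \<Longrightarrow> f (Suc p) * a \<in> J (Suc p)"
proof -
  assume p: "p < c"
  then have "0 \<in> J p" using J[of p] by (simp add: is_ideal_def)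
  then show ?thesis unfolding J_Suc[OF p] by (intro CollectI exI[of _ 0] exI[of _ a]) simp
qed

lemma level_differential_sq:
  assumes D: "level_differential p D" and p: "p \<le> c" and x: "x \<in> T p n"
  shows "D (D x) \<in> vmod (J p)"
proof (cases p)
  case 0
  then have "x = 0" using x T_0 by simp
  moreover have "lin D" using D by (simp add: level_differential_def)
  ultimately show ?thesis using J[OF p] by (simp add: lin_0 vmod_zero)
next
  case (Suc q)
  then have q: "q < c" using p by simp
  have "D (D x) - smul (f (Suc q)) (t (Suc q) x) \<in> vmod (J q)"
    using D x Suc unfolding level_differential_def by blast
  then have "D (D x) - smul (f (Suc q)) (t (Suc q) x) \<in> vmod (J p)"
    using vmod_mono[OF J_mono1[OF q]] Suc by blast
  moreover have "smul (f (Suc q)) (t (Suc q) x) \<in> vmod (J p)"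
    using f_J[OF q] Suc by (simp add: vmod_def)
  ultimately show ?thesis using vmod_add[OF J[OF p]] by fastforce
qed

text \<open>In degrees up to \<open>n\<close>, the map \<open>D\<close> extends \<open>D'\<close> from the vectors without the variable \<open>y\<^sub>p\<^sub>+\<^sub>1\<close> to \<open>T(p + 1)\<close>.\<close>

definition partial_lift ::
  "nat \<Rightarrow> (('b, 'p) hvec \<Rightarrow> ('b, 'p) hvec) \<Rightarrow> nat \<Rightarrow> (('b, 'p) hvec \<Rightarrow> ('b, 'p) hvec) \<Rightarrow> bool"
  where "partial_lift p D' n D \<longleftrightarrow> lin D \<and>
    (\<forall>k<n. \<forall>x\<in>T (Suc p) (Suc k). D x \<in> T (Suc p) k) \<and>
    (\<forall>x\<in>vec (free_of (Suc p)). D x = D' x) \<and>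
    (\<forall>x\<in>T (Suc p) 0. D (y (Suc p) x) = h (Suc p) x) \<and>
    (\<forall>k\<le>n. \<forall>x\<in>T (Suc p) k. D (D x) - smul (f (Suc p)) (t (Suc p) x) \<in> vmod (J p)) \<and>
    (\<forall>k\<le>n. \<forall>x\<in>T (Suc p) k. t (Suc p) (D x) = D (t (Suc p) x))"

context
  fixes p D'
  assumes level_differential: "level_differential p D'" and p: "p < c"
begin

abbreviation (input) "P \<equiv> Suc p"

lemma ideal_Jp: "is_ideal (J p)" using J p by simp

lemma P_le: "P \<le> c" using p by simp

lemma lin_D': "lin D'" using level_differential by (simp add: level_differential_def)

lemma T_P_c: "x \<in> T P n \<Longrightarrow> x \<in> T c n" using T_mono[OF P_le] .

lemma T_p_P: "x \<in> T p n \<Longrightarrow> x \<in> T P n" using T_mono[of p P] by simp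

lemma T_p_free: "x \<in> T p n \<Longrightarrow> x \<in> vec (free_of P)"
  unfolding T_def by (erule rev_subsetD, rule vec_mono) (auto simp: gens_def free_of_def)

lemma D'_0: "x \<in> T P 0 \<Longrightarrow> D' x = 0" and D'_1: "x \<in> T P 1 \<Longrightarrow> D' x = d x"
  using level_differential T_P_c unfolding level_differential_def by blast+

lemma D'_T_free: "x \<in> T P (Suc k) \<Longrightarrow> x \<in> vec (free_of P) \<Longrightarrow> D' x \<in> T P k"
proof (cases k)
  case 0
  assume "x \<in> T P (Suc k)"
  then show ?thesis using D'_1[of x] d_T[OF P_le, of x] 0 by (simp add: T_def)
next
  case (Suc m)
  assume "x \<in> T P (Suc k)" "x \<in> vec (free_of P)"
  then have "x \<in> T p (Suc k)" using T_free[of x p m] Suc by simp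
  then have "D' x \<in> T p k" using level_differential unfolding level_differential_def by blast
  then show ?thesis using T_p_P by blast
qed

lemma D'_free: "x \<in> T P (Suc k) \<Longrightarrow> x \<in> vec (free_of P) \<Longrightarrow> D' x \<in> vec (free_of P)"
proof (cases k)
  case 0
  assume "x \<in> T P (Suc k)" "x \<in> vec (free_of P)"
  then have "D' x \<in> T P 0" using D'_T_free 0 by blast
  then show ?thesis using T_low_free[of 0] by simp
next
  case (Suc m)
  assume "x \<in> T P (Suc k)" "x \<in> vec (free_of P)"
  then have "x \<in> T p (Suc k)" using T_free[of x p m] Suc by simp
  then have "D' x \<in> T p k" using level_differential unfolding level_differential_def by blast
  then show ?thesis using T_p_free by blast
qed

lemma D'_sq_free: "x \<in> T P k \<Longrightarrow> x \<in> vec (free_of P) \<Longrightarrow> D' (D' x) \<in> vmod (J p)"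
proof -
  assume x: "x \<in> T P k" "x \<in> vec (free_of P)"
  consider "k = 0" | "k = 1" | m where "k = m + 2" by (metis One_nat_def add_2_eq_Suc' not0_implies_Suc)
  then show ?thesis
  proof cases
    case 1
    then show ?thesis using x D'_0 lin_0[OF lin_D'] vmod_zero[OF ideal_Jp] by simp
  next
    case 2
    then have "D' x \<in> T P 0" using D'_T_free x by simp
    then show ?thesis using D'_0 vmod_zero[OF ideal_Jp] by simp
  next
    case 3
    then have "x \<in> T p k" using T_free x by blast
    then show ?thesis using level_differential_sq[OF level_differential] p by simp
  qed
qed

lemma gens_with: "(e, b) \<in> X P (k + 2) \<Longrightarrow> P \<in># e \<Longrightarrow> (e - {#P#}, b) \<in> X P k"
  by (auto simp: gens_def dest!: multi_member_split)

text \<open>Degree two contains the products \<open>y\<^sub>p\<^sub>+\<^sub>1 b\<close>, which are sent to \<open>h b\<close>; the formula for \<open>D\<^sup>2\<close> is then condition (a).\<close>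

lemma partial_lift_start: "\<exists>D. partial_lift p D' 2 D"
proof -
  define D where "D = linext (\<lambda>(e, b). if e = {#P#} \<and> par b = 0 then h P (bas ({#}, b)) else D' (bas (e, b)))"
  have linD: "lin D" by (simp add: D_def lin_linext)
  have free: "D x = D' x" if "x \<in> vec (free_of P)" for x
    by (rule lin_vec_eq[OF linD lin_D' _ that]) (auto simp: D_def free_of_def)
  have y: "D (y P x) = h P x" if "x \<in> T P 0" for x
  proof (rule lin_vec_eq[OF lin_comp[OF linD lin_y] lin_h _ that[unfolded T_def]])
    fix i assume i: "i \<in> X P 0"
    obtain e b where eb: "i = (e, b)" by force
    then have "e = {#}" "par b = 0" using i by (auto simp: gens_def)
    then show "D (y P (bas i)) = h P (bas i)" using eb by (simp add: y_bas D_def)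
  qed
  have D0: "D x = 0" if "x \<in> T P 0" for x
    using that D'_0 free T_low_free[of 0] by simp
  have DT1: "D x \<in> T P 0" if "x \<in> T P 1" for x
    using that free T_low_free[of 1 x] D'_T_free[of x 0] by simp
  have split2: "x - y P (t P x) \<in> T P 2 \<and> t P x \<in> T P 0" if "x \<in> T P 2" for x
    using that t_T[of x P 0] y_T[of "t P x" P 0] vec_diff by (simp add: numeral_2_eq_2 T_def)
  have D2: "D x = D' (x - y P (t P x)) + h P (t P x)" if "x \<in> T P 2" for x
  proof -
    have "D x = D (x - y P (t P x)) + D (y P (t P x))" by (simp add: lin_diff[OF linD])
    then show ?thesis using free[OF pr_free] y split2[OF that] by simp
  qed
  have hT: "h P x \<in> T P 1" if "x \<in> T P 0" for x using h_T[OF p, of x] that by (simp add: T_def)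
  have DT2: "D x \<in> T P 1" if x: "x \<in> T P 2" for x
  proof -
    have "D' (x - y P (t P x)) \<in> T P 1"
      using D'_T_free[of _ 1] pr_free split2[OF x] by (simp add: numeral_2_eq_2)
    then show ?thesis using D2[OF x] hT split2[OF x] by (simp add: T_def vec_add)
  qed
  have "partial_lift p D' 2 D"
    unfolding partial_lift_def
  proof (intro conjI allI impI ballI)
    show "lin D" by fact
    show "D x \<in> T P k" if "k < 2" "x \<in> T P (Suc k)" for k x
      using that DT1 DT2 by (cases k) (auto simp: numeral_2_eq_2 less_Suc_eq)
    show "D x = D' x" if "x \<in> vec (free_of P)" for x using free that .
    show "D (y P x) = h P x" if "x \<in> T P 0" for x using y that .
    fix k x assume k: "k \<le> (2::nat)" and x: "x \<in> T P k"
    then consider "k = 0" | "k = 1" | "k = 2" by linarith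
    note cs = this
    show "D (D x) - smul (f P) (t P x) \<in> vmod (J p)"
      using cs
    proof cases
      case 1
      then show ?thesis using x D0 t_T_low[of 0] lin_0[OF linD] vmod_zero[OF ideal_Jp] by (simp add: smul_simps)
    next
      case 2
      then show ?thesis using x D0 DT1 t_T_low[of 1] vmod_zero[OF ideal_Jp] by (simp add: smul_simps)
    next
      case 3
      let ?q = "x - y P (t P x)"
      have q: "?q \<in> T P 2" "t P x \<in> T P 0" "?q \<in> vec (free_of P)"
        using split2 x 3 pr_free by auto
      have "h P (t P x) \<in> T P 1" using hT q by simp
      then have Dh: "D (h P (t P x)) = d (h P (t P x))" using free T_low_free[of 1] D'_1 by simp
      have "D (D x) = D (D' ?q) + D (h P (t P x))"
        using D2 x 3 by (simp add: lin_add[OF linD])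
      also have "D (D' ?q) = D' (D' ?q)"
        using free D'_free[of _ 1] q by (simp add: numeral_2_eq_2)
      finally have *: "D (D x) - smul (f P) (t P x) = D' (D' ?q) + (d (h P (t P x)) - smul (f P) (t P x))"
        using Dh by simp
      show ?thesis
        unfolding * by (rule vmod_add[OF ideal_Jp D'_sq_free[OF q(1,3)] dh[OF p q(2)[unfolded T_def]]])
    qed
    show "t P (D x) = D (t P x)"
      using cs
    proof cases
      case 1
      then show ?thesis using x D0 t_T_low[of 0] lin_0[OF linD] lin_0[OF lin_t] by simp
    next
      case 2
      then show ?thesis using x t_T_low[OF _ DT1, of x] t_T_low[of 1 x] lin_0[OF linD] by simp
    next
      case 3
      then show ?thesis using x t_T_low[OF _ DT2, of x] D0 split2 by simp
    qed
  qed
  then show ?thesis by blast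
qed

text \<open>A value \<open>w\<close> for \<open>y\<^sub>p\<^sub>+\<^sub>1 z\<close>. The requirement \<open>t w = D z\<close> leaves \<open>w = y D z + s\<close> with \<open>s\<close> free of the variable,
  and \<open>D w = f z\<close> asks for \<open>D s = f z - D y D z\<close>. The right-hand side is, modulo \<open>J p\<close>, a cycle free of the variable:
  its division by the variable is \<open>f t z - D D z = 0\<close>, and its differential is \<open>f D z - f t y D z = 0\<close>. So \<open>s\<close> exists
  by exactness of the cone.\<close>

lemma partial_lift_value:
  assumes D: "partial_lift p D' (Suc m) D" and m: "m \<ge> 1" and z: "z \<in> T P m"
  obtains w where "w \<in> T P (Suc m)" "t P w = D z" "D w - smul (f P) z \<in> vmod (J p)"
proof -
  have linD: "lin D"
    and DT: "k < Suc m \<Longrightarrow> x \<in> T P (Suc k) \<Longrightarrow> D x \<in> T P k"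
    and free: "x \<in> vec (free_of P) \<Longrightarrow> D x = D' x"
    and sq: "k \<le> Suc m \<Longrightarrow> x \<in> T P k \<Longrightarrow> D (D x) - smul (f P) (t P x) \<in> vmod (J p)"
    and tD: "k \<le> Suc m \<Longrightarrow> x \<in> T P k \<Longrightarrow> t P (D x) = D (t P x)" for k x
    using D unfolding partial_lift_def by blast+
  obtain l where l: "m = Suc l" using m by (cases m) auto
  have Dz: "D z \<in> T P l" using DT[of l z] z l by simp
  have yDz: "y P (D z) \<in> T P (Suc m)" using y_T[OF Dz] l by simp
  define v where "v = smul (f P) z - D (y P (D z))"
  have v: "v \<in> T P m"
    using z DT[OF _ yDz] unfolding v_def T_def by (simp add: vec_diff vec_smul)
  define v' where "v' = v - y P (t P v)"
  have "t P v = smul (f P) (t P z) - D (D z)"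
    using tD[OF _ yDz] by (simp add: v_def lin_diff[OF lin_t] lin_smul[OF lin_t])
  then have "t P v = 0 - (D (D z) - smul (f P) (t P z))" by simp
  then have tv: "t P v \<in> vmod (J p)"
    using sq[OF _ z] vmod_diff[OF ideal_Jp] vmod_zero[OF ideal_Jp] by (simp del: diff_0)
  then have ytv: "y P (t P v) \<in> vmod (J p)" by (rule lin_vmod[OF lin_y ideal_Jp])
  have v'_free: "v' \<in> vec (free_of P)" unfolding v'_def by (rule pr_free)
  have "y P (t P v) \<in> T P m" by (rule y_t_T[OF v])
  then have v'_T: "v' \<in> T P m" using v by (simp add: v'_def T_def vec_diff)
  have "D v = - (D (D (y P (D z))) - smul (f P) (t P (y P (D z))))"
    by (simp add: v_def lin_diff[OF linD] lin_smul[OF linD])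
  then have "D v = 0 - (D (D (y P (D z))) - smul (f P) (t P (y P (D z))))" by simp
  then have "D v \<in> vmod (J p)"
    using sq[OF _ yDz] vmod_diff[OF ideal_Jp] vmod_zero[OF ideal_Jp] by (simp del: diff_0)
  then have "D v' \<in> vmod (J p)"
    using lin_vmod[OF linD ideal_Jp ytv] vmod_diff[OF ideal_Jp] by (simp add: v'_def lin_diff[OF linD])
  then have "D' v' \<in> vmod (J p)" using free[OF v'_free] by simp
  then obtain s where s: "s \<in> T P (l + 2)" "s \<in> vec (free_of P)" "v' - D' s \<in> vmod (J p)"
    using cone_exact[OF level_differential p, of v' l] v'_T v'_free l by blast
  show thesis
  proof (rule that)
    show "y P (D z) + s \<in> T P (Suc m)" using yDz s(1) l by (simp add: T_def vec_add)
    show "t P (y P (D z) + s) = D z" using t_free[OF s(2)] by (simp add: lin_add[OF lin_t])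
    have "D (y P (D z) + s) - smul (f P) z = 0 - ((v' - D' s) + y P (t P v))"
      using free[OF s(2)] by (simp add: lin_add[OF linD] v'_def v_def)
    then show "D (y P (D z) + s) - smul (f P) z \<in> vmod (J p)"
      using vmod_diff[OF ideal_Jp vmod_zero[OF ideal_Jp] vmod_add[OF ideal_Jp s(3) ytv]] by (simp del: diff_0)
  qed
qed

lemma partial_lift_step:
  assumes D: "partial_lift p D' (Suc m) D" and m: "m \<ge> 1"
  shows "\<exists>E. partial_lift p D' (Suc (Suc m)) E \<and> (\<forall>k\<le>Suc m. \<forall>x\<in>T P k. E x = D x)"
proof -
  let ?n = "Suc m"
  have linD: "lin D"
    and DT: "k < ?n \<Longrightarrow> x \<in> T P (Suc k) \<Longrightarrow> D x \<in> T P k"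
    and free: "x \<in> vec (free_of P) \<Longrightarrow> D x = D' x"
    and sq: "k \<le> ?n \<Longrightarrow> x \<in> T P k \<Longrightarrow> D (D x) - smul (f P) (t P x) \<in> vmod (J p)"
    and tD: "k \<le> ?n \<Longrightarrow> x \<in> T P k \<Longrightarrow> t P (D x) = D (t P x)" 
    and yh: "x \<in> T P 0 \<Longrightarrow> D (y P x) = h P x" for k x
    using D unfolding partial_lift_def by blast+
  have "\<exists>w. w \<in> T P ?n \<and> t P w = D (bas i) \<and> D w - smul (f P) (bas i) \<in> vmod (J p)" if "i \<in> X P m" for i
    using partial_lift_value[OF D m, of "bas i"] that by (auto simp: T_def bas_vec)
  then obtain w where w: "\<And>i. i \<in> X P m \<Longrightarrow> w i \<in> T P ?n" "\<And>i. i \<in> X P m \<Longrightarrow> t P (w i) = D (bas i)"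
      "\<And>i. i \<in> X P m \<Longrightarrow> D (w i) - smul (f P) (bas i) \<in> vmod (J p)"
    by metis
  \<comment> \<open>Only the generators of degree \<open>m + 2\<close> that are divisible by the new variable get new values.\<close>
  define E where "E = linext (\<lambda>(e, b). if (e, b) \<in> X P (Suc ?n) \<and> P \<in># e then w (e - {#P#}, b) else D (bas (e, b)))"
  have linE: "lin E" by (simp add: E_def lin_linext)
  have agree: "E x = D x" if "k \<le> ?n" "x \<in> T P k" for k x
    by (rule lin_vec_eq[OF linE linD _ that(2)[unfolded T_def]])
      (use that(1) in \<open>auto simp: E_def gens_def\<close>)
  have freeE: "E x = D' x" if "x \<in> vec (free_of P)" for x
  proof -
    have "E x = D x"
      by (rule lin_vec_eq[OF linE linD _ that]) (auto simp: E_def free_of_def)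
    then show ?thesis using free that by simp
  qed
  have E_with: "E (bas (e, b)) = w (e - {#P#}, b) \<and> (e - {#P#}, b) \<in> X P m \<and>
      t P (bas (e, b)) = bas (e - {#P#}, b)"
    if "(e, b) \<in> X P (Suc ?n)" "P \<in># e" for e b
    using that gens_with[of e b m] by (simp add: E_def t_bas)
  have ET: "E x \<in> T P ?n" if "x \<in> T P (Suc ?n)" for x
  proof -
    have "E x \<in> vec (X P ?n)"
    proof (rule lin_vec_submod[OF linE submod_vec _ that[unfolded T_def]], safe)
      fix e b assume eb: "(e, b) \<in> X P (Suc ?n)"
      show "E (bas (e, b)) \<in> vec (X P ?n)"
      proof (cases "P \<in># e")
        case True
        then show ?thesis using w(1) E_with[OF eb] by (simp add: T_def)
      next
        case False
        then have "bas (e, b) \<in> vec (free_of P)" by (simp add: bas_vec free_of_def)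
        then show ?thesis using freeE D'_T_free[of "bas (e, b)" ?n] eb by (simp add: T_def bas_vec)
      qed
    qed
    then show ?thesis by (simp add: T_def)
  qed
  have "partial_lift p D' (Suc ?n) E"
    unfolding partial_lift_def
  proof (intro conjI allI impI ballI)
    show "lin E" by fact
    show "E x \<in> T P k" if "k < Suc ?n" "x \<in> T P (Suc k)" for k x
      using that ET agree[of "Suc k" x] DT[of k x] by (cases "k = ?n") auto
    show "E x = D' x" if "x \<in> vec (free_of P)" for x using freeE that .
    show "E (y P x) = h P x" if "x \<in> T P 0" for x
      using agree[OF _ y_T[OF that]] yh[OF that] m by simp
    fix k x assume k: "k \<le> Suc ?n" and x: "x \<in> T P k"
    show "E (E x) - smul (f P) (t P x) \<in> vmod (J p)"
    proof (cases "k = Suc ?n")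
      case False
      then have "k \<le> ?n" using k by simp
      moreover have "E (D x) = D (D x)"
      proof (cases k)
        case 0
        then have "D x = 0" using x free T_low_free[of 0] D'_0 by simp
        then show ?thesis by (simp add: lin_0[OF linD] lin_0[OF linE])
      next
        case (Suc l)
        then show ?thesis using DT[of l x] agree[of l "D x"] x \<open>k \<le> ?n\<close> by simp
      qed
      ultimately show ?thesis using sq[OF _ x] agree[OF _ x] by simp
    next
      case True
      have "(\<lambda>x. E (E x) - smul (f P) (t P x)) x \<in> vmod (J p)"
      proof (rule lin_vec_submod[OF lin_sub[OF lin_comp[OF linE linE] lin_scale[OF lin_t]] submod_vmod[OF ideal_Jp]
            _ x[unfolded T_def True]], safe)
        fix e b assume eb: "(e, b) \<in> X P (Suc ?n)"
        show "E (E (bas (e, b))) - smul (f P) (t P (bas (e, b))) \<in> vmod (J p)"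
        proof (cases "P \<in># e")
          case True
          note E_with[OF eb True]
          moreover have "E (w (e - {#P#}, b)) = D (w (e - {#P#}, b))"
            using agree[of ?n] w(1) calculation by simp
          ultimately show ?thesis using w(3) by simp
        next
          case False
          then have fr: "bas (e, b) \<in> vec (free_of P)" by (simp add: bas_vec free_of_def)
          have bT: "bas (e, b) \<in> T P (Suc ?n)" using eb by (simp add: T_def bas_vec)
          show ?thesis
            using freeE[OF fr] freeE[OF D'_free[OF bT fr]] D'_sq_free[OF bT fr] t_free[OF fr]
            by (simp add: smul_simps)
        qed
      qed
      then show ?thesis by simp
    qed
    show "t P (E x) = E (t P x)"
    proof (cases "k = Suc ?n")
      case False
      then have kn: "k \<le> ?n" using k by simp
      have "E (t P x) = D (t P x)"
      proof (cases "k \<le> 1")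
        case True
        then show ?thesis using t_T_low x by (simp add: lin_0[OF linD] lin_0[OF linE])
      next
        case False
        then obtain l where l: "k = l + 2" by (metis add.commute le_Suc_ex less_eq_Suc_le not_less numeral_2_eq_2 One_nat_def)
        then show ?thesis using agree[of l] t_T[of x P l] x kn by simp
      qed
      then show ?thesis using tD[OF kn x] agree[OF kn x] by simp
    next
      case True
      show ?thesis
      proof (rule lin_vec_eq[OF lin_comp[OF lin_t linE] lin_comp[OF linE lin_t] _ x[unfolded T_def True]], safe)
        fix e b assume eb: "(e, b) \<in> X P (Suc ?n)"
        show "t P (E (bas (e, b))) = E (t P (bas (e, b)))"
        proof (cases "P \<in># e")
          case True
          note * = E_with[OF eb True]
          then have "E (bas (e - {#P#}, b)) = D (bas (e - {#P#}, b))"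
            using agree[of m] by (simp add: T_def bas_vec)
          then show ?thesis using w(2) * by simp
        next
          case False
          then have fr: "bas (e, b) \<in> vec (free_of P)" by (simp add: bas_vec free_of_def)
          have bT: "bas (e, b) \<in> T P (Suc ?n)" using eb by (simp add: T_def bas_vec)
          show ?thesis
            using freeE[OF fr] t_free[OF D'_free[OF bT fr]] t_free[OF fr] by (simp add: lin_0[OF linE])
        qed
      qed
    qed
  qed
  then show ?thesis using agree by blast
qed

lemma vmod_J_Suc:
  assumes z: "z \<in> T q n" "z \<in> vmod (J P)"
  obtains a where "a \<in> T q n" "z - smul (f P) a \<in> vmod (J p)"
proof -
  have "\<exists>r. lookup z i - f P * r \<in> J p" for i
  proof -
    have "lookup z i \<in> J P" using z(2) by (cases i) (simp add: vmod_def)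
    then have "lookup z i \<in> {j + f P * r | j r. j \<in> J p}" unfolding J_Suc[OF p] .
    then obtain j r where "lookup z i = j + f P * r" "j \<in> J p" by blast
    then show ?thesis by (intro exI[of _ r]) simp
  qed
  then obtain r where r: "\<And>i. lookup z i - f P * r i \<in> J p" by metis
  define a where "a = (\<Sum>i\<in>keys z. smul (r i) (bas i))"
  have l: "lookup a i = (if i \<in> keys z then r i else 0)" for i
    by (simp add: a_def lookup_sum' lookup_bas if_distrib[where f = "(*) _"] sum.delta cong: if_cong)
  show thesis
  proof (rule that)
    show "a \<in> T q n" using z(1) by (auto simp: T_def vec_iff l in_keys_iff)
    show "z - smul (f P) a \<in> vmod (J p)"
      using r ideal_Jp by (auto simp: vmod_def lookup_minus l in_keys_iff is_ideal_def)
  qed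
qed

text \<open>The partial lifts fit together. For exactness let \<open>D x = f a\<close> modulo \<open>J p\<close>. Then \<open>f t x = D D x = f D a\<close>, hence
  \<open>t x = D a\<close> by regularity, and \<open>x - D (y a)\<close> has zero division by the variable: it is a cycle of the cone, hence a
  boundary.\<close>

lemma level_differential_Suc: "\<exists>D. level_differential P D"
proof -
  \<comment> \<open>The sequence starts in degree two, where the values are prescribed by \<open>h\<close>.\<close>
  have "\<exists>g. \<forall>n. partial_lift p D' (n + 2) (g n) \<and> (\<forall>k\<le>n + 2. \<forall>x\<in>T P k. g (Suc n) x = g n x)"
  proof (rule dependent_nat_choice)
    show "\<exists>D. partial_lift p D' (0 + 2) D" using partial_lift_start by (simp only: add_0)
    fix D n assume "partial_lift p D' (n + 2) D"
    then show "\<exists>E. partial_lift p D' (Suc n + 2) E \<and> (\<forall>k\<le>n + 2. \<forall>x\<in>T P k. E x = D x)"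
      using partial_lift_step[of "Suc n" D] by simp
  qed
  then obtain g where g: "\<And>n. partial_lift p D' (n + 2) (g n)"
      "\<And>n k x. k \<le> n + 2 \<Longrightarrow> x \<in> T P k \<Longrightarrow> g (Suc n) x = g n x" by blast
  have g_agree: "g (n + m) x = g n x" if "k \<le> n + 2" "x \<in> T P k" for n m k x
  proof (induction m)
    case (Suc m)
    then show ?case using g(2)[of k "n + m" x] that by simp
  qed simp
  have lin_g: "lin (g n)" and g_free: "x \<in> vec (free_of P) \<Longrightarrow> g n x = D' x" for n x
    using g(1)[of n] unfolding partial_lift_def by blast+
  have gT: "k < n + 2 \<Longrightarrow> x \<in> T P (Suc k) \<Longrightarrow> g n x \<in> T P k"
    and gy: "x \<in> T P 0 \<Longrightarrow> g n (y P x) = h P x"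
    and gsq: "k \<le> n + 2 \<Longrightarrow> x \<in> T P k \<Longrightarrow> g n (g n x) - smul (f P) (t P x) \<in> vmod (J p)"
    and gt: "k \<le> n + 2 \<Longrightarrow> x \<in> T P k \<Longrightarrow> t P (g n x) = g n (t P x)" for n k x
    using g(1)[of n] unfolding partial_lift_def by blast+
  \<comment> \<open>On a generator of degree \<open>k\<close> all \<open>g n\<close> with \<open>n \<ge> k\<close> agree; \<open>g k\<close> is used.\<close>
  define D where "D = linext (\<lambda>(e, b). g (2 * size e + par b) (bas (e, b)))"
  have linD: "lin D" by (simp add: D_def lin_linext)
  have Dg: "D x = g n x" if "x \<in> T P k" "k \<le> n" for x k n
  proof (rule lin_vec_eq[OF linD lin_g _ that(1)[unfolded T_def]])
    fix i assume i: "i \<in> X P k"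
    obtain e b where eb: "i = (e, b)" by force
    then have "2 * size e + par b = k" using i by (auto simp: gens_def)
    then have "D (bas i) = g k (bas i)" using eb by (simp add: D_def)
    also have "\<dots> = g n (bas i)"
      using g_agree[of k k "bas i" "n - k"] i that(2) by (simp add: T_def bas_vec)
    finally show "D (bas i) = g n (bas i)" .
  qed
  have free: "D x = D' x" if "x \<in> vec (free_of P)" for x
    by (rule lin_vec_eq[OF linD lin_D' _ that]) (auto simp: D_def bas_vec g_free split: prod.splits)
  have DT: "D x \<in> T P k" if "x \<in> T P (Suc k)" for x k
    using gT[of k "Suc k" x] that Dg[OF that, of "Suc k"] by simp
  have D0: "D x = 0" if "x \<in> T P 0" for x
    using that free T_low_free[of 0] D'_0 by simp
  have yh: "D (y P x) = h P x" if "x \<in> T P 0" for x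
    using gy Dg[OF y_T[OF that], of 2] that by simp
  have sq: "D (D x) - smul (f P) (t P x) \<in> vmod (J p)" if x: "x \<in> T P k" for x k
  proof -
    have "D (D x) = g k (g k x)"
    proof (cases k)
      case 0
      then show ?thesis using x D0 Dg[OF x, of k] by (simp add: lin_0[OF lin_g] lin_0[OF linD])
    next
      case (Suc l)
      then show ?thesis using x Dg[of x k k] DT[of x l] Dg[of "D x" l k] by simp
    qed
    then show ?thesis using gsq[OF _ x, of k] by simp
  qed
  have tD: "t P (D x) = D (t P x)" if x: "x \<in> T P k" for x k
  proof -
    have "D (t P x) = g k (t P x)"
    proof (cases "k \<le> 1")
      case True
      then show ?thesis using t_T_low x by (simp add: lin_0[OF linD] lin_0[OF lin_g])
    next
      case False
      then obtain l where l: "k = l + 2" by (metis add.commute le_Suc_ex less_eq_Suc_le not_less numeral_2_eq_2 One_nat_def)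
      then show ?thesis using Dg[of "t P x" l k] t_T[of x P l] x by simp
    qed
    then show ?thesis using gt[OF _ x, of k] Dg[OF x, of k] by simp
  qed
  have "level_differential P D"
    unfolding level_differential_def
  proof (intro conjI allI impI ballI)
    show "lin D" by fact
    show "D x \<in> T P n" if "x \<in> T P (Suc n)" for n x using DT that .
    show "D x = 0" if "x \<in> T c 0" for x
      using that free T_low_free[of 0] level_differential unfolding level_differential_def by simp
    show "D x = d x" if "x \<in> T c 1" for x
      using that free T_low_free[of 1] level_differential unfolding level_differential_def by simp
    show "D (y (Suc q) x) = h (Suc q) x" if "q < P" "x \<in> T (Suc q) 0" for q x
    proof (cases "q = p")
      case False
      then have q: "q < p" using that by simp
      have "y (Suc q) x \<in> T p 2" using T_mono[OF _ y_T[OF that(2)], of p] q by (simp add: numeral_2_eq_2)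
      then show ?thesis using free T_p_free level_differential q that(2) unfolding level_differential_def by simp
    qed (use yh that in simp)
    show "D (D x) - smul (f (Suc q)) (t (Suc q) x) \<in> vmod (J q)" if "q < P" "x \<in> T (Suc q) n" for q n x
    proof (cases "q = p")
      case False
      then have q: "q < p" using that by simp
      have xp: "x \<in> T p n" using T_mono[OF _ that(2)] q by simp
      have "D (D' x) = D' (D' x)"
      proof (cases n)
        case 0
        then show ?thesis using D'_0[of x] T_p_P[OF xp] by (simp add: lin_0[OF linD] lin_0[OF lin_D'])
      next
        case (Suc m)
        then have "D' x \<in> T p m" using xp level_differential unfolding level_differential_def by blast
        then show ?thesis using free T_p_free by blast
      qed
      then have "D (D x) = D' (D' x)" using free[OF T_p_free[OF xp]] by simp
      then show ?thesis using level_differential q that(2) unfolding level_differential_def by simp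
    qed (use sq that in simp)
    fix n x assume x: "x \<in> T P (Suc n)" and Dx: "D x \<in> vmod (J P)"
    obtain a where a: "a \<in> T P n" "D x - smul (f P) a \<in> vmod (J p)"
      using vmod_J_Suc[OF DT[OF x] Dx] by blast
    have "smul (f P) (t P x - D a) = D (D x - smul (f P) a) - (D (D x) - smul (f P) (t P x))"
      by (simp add: lin_diff[OF linD] lin_smul[OF linD] smul_simps)
    also have "\<dots> \<in> vmod (J p)"
      by (rule vmod_diff[OF ideal_Jp lin_vmod[OF linD ideal_Jp a(2)] sq[OF x]])
    finally have ta: "t P x - D a \<in> vmod (J p)"
      using reg[OF p] by (simp add: vmod_def)
    have yaT: "y P a \<in> T P (n + 2)" by (rule y_T[OF a(1)])
    define x1 where "x1 = x - D (y P a)"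
    define x2 where "x2 = x1 - y P (t P x1)"
    have x1T: "x1 \<in> T P (Suc n)" using x DT[of _ "Suc n"] yaT by (simp add: x1_def T_def vec_diff)
    have x2T: "x2 \<in> T P (Suc n)" using x1T y_t_T[OF x1T] by (simp add: x2_def T_def vec_diff)
    have x2_free: "x2 \<in> vec (free_of P)" unfolding x2_def by (rule pr_free)
    have "t P x1 = t P x - D a" using tD[OF yaT] by (simp add: x1_def lin_diff[OF lin_t])
    then have x12: "y P (t P x1) \<in> vmod (J p)" using lin_vmod[OF lin_y ideal_Jp] ta by simp
    have "D x1 = (D x - smul (f P) a) - (D (D (y P a)) - smul (f P) (t P (y P a)))"
      by (simp add: x1_def lin_diff[OF linD])
    then have "D x1 \<in> vmod (J p)" using vmod_diff[OF ideal_Jp a(2) sq[OF yaT]] by simp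
    then have "D x2 \<in> vmod (J p)"
      using vmod_diff[OF ideal_Jp _ lin_vmod[OF linD ideal_Jp x12]] by (simp add: x2_def lin_diff[OF linD])
    then have "D' x2 \<in> vmod (J p)" using free[OF x2_free] by simp
    then obtain s where s: "s \<in> T P (n + 2)" "s \<in> vec (free_of P)" "x2 - D' s \<in> vmod (J p)"
      using cone_exact[OF level_differential p x2T x2_free] by blast
    have "x - D (y P a + s) = y P (t P x1) + (x2 - D' s)"
      using free[OF s(2)] by (simp add: x2_def x1_def lin_add[OF linD])
    then have "x - D (y P a + s) \<in> vmod (J P)"
      using vmod_add[OF ideal_Jp x12 s(3)] vmod_mono[OF J_mono1[OF p]] by auto
    moreover have "y P a + s \<in> T P (n + 2)" using yaT s(1) by (simp add: T_def vec_add)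
    ultimately show "\<exists>z\<in>T P (n + 2). x - D z \<in> vmod (J P)" by blast
  qed
  then show ?thesis by blast
qed

end

lemma level_differential_0: "\<exists>D. level_differential 0 D"
proof -
  define D where "D = linext (\<lambda>(e, b). if (e, b) \<in> X c 1 then d (bas (e, b)) else 0)"
  have linD: "lin D" by (simp add: D_def lin_linext)
  have "D x = 0" if "x \<in> T c 0" for x
    by (rule lin_vec_eq[OF linD lin_zero _ that[unfolded T_def]]) (auto simp: D_def gens_def)
  moreover have "D x = d x" if "x \<in> T c 1" for x
    by (rule lin_vec_eq[OF linD lin_d _ that[unfolded T_def]]) (auto simp: D_def)
  ultimately have "level_differential 0 D"
    using J[of 0] by (auto simp: level_differential_def T_0 linD lin_0 vmod_zero)
  then show ?thesis by blast
qed

lemma level_differential_exists: "p \<le> c \<Longrightarrow> \<exists>D. level_differential p D"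
proof (induction p)
  case (Suc p)
  then show ?case using level_differential_Suc[of p] by auto
qed (rule level_differential_0)

section \<open>Minimality\<close>

lemma J_rep:
  assumes "p \<le> c" "a \<in> J p"
  shows "\<exists>r. \<exists>j\<in>J 0. a = (\<Sum>i=1..p. f i * r i) + j"
  using assms
proof (induction p arbitrary: a)
  case (Suc p)
  then obtain j s where a: "a = j + f (Suc p) * s" "j \<in> J p" using J_Suc[of p] by auto
  then obtain r j' where r: "j' \<in> J 0" "j = (\<Sum>i=1..p. f i * r i) + j'" using Suc by fastforce
  have "a = (\<Sum>i=1..Suc p. f i * (r(Suc p := s)) i) + j'"
    using a r by (simp add: algebra_simps cong: sum.cong_simp)
  then show ?case using r(1) by blast
qed simp

lemma J_mono: "i \<le> k \<Longrightarrow> k \<le> c \<Longrightarrow> J i \<subseteq> J k"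
proof (induction k)
  case (Suc k)
  show ?case
  proof (cases "i = Suc k")
    case False
    then have "J i \<subseteq> J k" using Suc by simp
    then show ?thesis using J_mono1[of k] Suc.prems by auto
  qed simp
qed simp

text \<open>The syzygies of a regular sequence have coefficients in its ideal: the last coefficient is a combination of the
  earlier \<open>f\<^sub>i\<close> by regularity, and substituting this combination gives a shorter syzygy.\<close>

lemma syzygy_coeff:
  assumes "n \<le> c" "(\<Sum>i=1..n. f i * v i) \<in> J 0" "i \<in> {1..n}"
  shows "v i \<in> J n"
  using assms
proof (induction n arbitrary: v i)
  case (Suc n)
  have n: "n < c" using Suc by simp
  have J0: "is_ideal (J 0)" and Jn: "is_ideal (J n)" and JS: "is_ideal (J (Suc n))" using J Suc by auto
  have rep: "(\<Sum>i=1..n. f i * a i) \<in> J n" for a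
  proof -
    have "f i * a i \<in> J n" if "i \<in> {1..n}" for i
    proof -
      have "f i * a i \<in> J i" using f_J[of "i - 1" "a i"] that n by (cases i) auto
      moreover have "J i \<subseteq> J n" using J_mono[of i n] that n by simp
      ultimately show ?thesis by blast
    qed
    then show ?thesis by (rule is_ideal_sum[OF Jn])
  qed
  have "f (Suc n) * v (Suc n) = (\<Sum>i=1..Suc n. f i * v i) - (\<Sum>i=1..n. f i * v i)" by simp
  moreover have "(\<Sum>i=1..Suc n. f i * v i) \<in> J n"
    by (rule subsetD[OF J_mono Suc.prems(2)]) (use n in simp_all)
  ultimately have "f (Suc n) * v (Suc n) \<in> J n"
    using is_ideal_diff[OF Jn _ rep] by presburger
  then have vS: "v (Suc n) \<in> J n" by (rule reg[OF n])
  then obtain r j where r: "j \<in> J 0" "v (Suc n) = (\<Sum>i=1..n. f i * r i) + j"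
    using J_rep[of n] n by fastforce
  have "(\<Sum>i=1..n. f i * (v i + f (Suc n) * r i)) = (\<Sum>i=1..Suc n. f i * v i) - f (Suc n) * j"
    by (simp add: r(2) algebra_simps sum.distrib sum_distrib_left)
  also have "\<dots> \<in> J 0"
    using is_ideal_diff[OF J0 Suc.prems(2)] r(1) J0 by (simp add: is_ideal_def)
  finally have *: "i \<in> {1..n} \<Longrightarrow> v i + f (Suc n) * r i \<in> J n" for i
    using Suc.IH[of "\<lambda>i. v i + f (Suc n) * r i"] n by simp
  show ?case
  proof (cases "i = Suc n")
    case True
    then show ?thesis using vS J_mono1[OF n] by blast
  next
    case False
    then have "v i + f (Suc n) * r i \<in> J (Suc n)" using * Suc.prems J_mono1[OF n] by auto
    then show ?thesis using is_ideal_diff[OF JS _ f_J[OF n, of "r i"]] by fastforce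
  qed
qed simp

context
  fixes m D
  assumes m: "is_ideal m" and Jm: "J c \<subseteq> m"
    and d_min: "\<And>x. x \<in> T c 1 \<Longrightarrow> d x \<in> vmod m"
    and h_min: "\<And>q x. q < c \<Longrightarrow> x \<in> T (Suc q) 0 \<Longrightarrow> h (Suc q) x \<in> vmod m"
    and level_differential: "level_differential c D"
begin

text \<open>The ideal \<open>m (f\<^sub>1, \<dots>, f\<^sub>c)\<close>, enlarged by the kernel \<open>J 0\<close>.\<close>

definition K :: "'p set"
  where "K = {(\<Sum>i=1..c. f i * u i) + j | u j. (\<forall>i. u i \<in> m) \<and> j \<in> J 0}"

lemma is_ideal_K: "is_ideal K"
  unfolding is_ideal_def
proof safe
  have J0: "is_ideal (J 0)" using J by simp
  show "0 \<in> K"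
    unfolding K_def using m J0 by (intro CollectI exI[of _ "\<lambda>_. 0"] exI[of _ 0]) (auto simp: is_ideal_def)
  fix a b assume b: "b \<in> K"
  then obtain u j where u: "b = (\<Sum>i=1..c. f i * u i) + j" "\<forall>i. u i \<in> m" "j \<in> J 0" by (auto simp: K_def)
  show "a * b \<in> K"
    unfolding K_def using u m J0
    by (intro CollectI exI[of _ "\<lambda>i. a * u i"] exI[of _ "a * j"])
      (auto simp: is_ideal_def algebra_simps sum_distrib_left)
  assume "a \<in> K"
  then obtain u' j' where u': "a = (\<Sum>i=1..c. f i * u' i) + j'" "\<forall>i. u' i \<in> m" "j' \<in> J 0" by (auto simp: K_def)
  show "a + b \<in> K"
    unfolding K_def using u u' m J0
    by (intro CollectI exI[of _ "\<lambda>i. u' i + u i"] exI[of _ "j' + j"])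
      (auto simp: is_ideal_def algebra_simps sum.distrib)
qed

lemma mult_K: "a \<in> m \<Longrightarrow> b \<in> J c \<Longrightarrow> a * b \<in> K"
proof -
  assume a: "a \<in> m" and b: "b \<in> J c"
  obtain r j where r: "j \<in> J 0" "b = (\<Sum>i=1..c. f i * r i) + j" using J_rep[OF _ b] by auto
  have "r i * a \<in> m" for i using a m by (simp add: is_ideal_def)
  moreover have "a * j \<in> J 0" using r(1) J[of 0] by (simp add: is_ideal_def)
  moreover have "a * b = (\<Sum>i=1..c. f i * (r i * a)) + a * j"
    by (simp add: r(2) algebra_simps sum_distrib_left)
  ultimately show ?thesis
    unfolding K_def by (intro CollectI exI[of _ "\<lambda>i. r i * a"] exI[of _ "a * j"]) simp
qed

lemma coeff_K:
  assumes p: "p < c" and K: "f (Suc p) * a + b \<in> K" and b: "b \<in> J p"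
  shows "a \<in> m"
proof -
  obtain u j where u: "f (Suc p) * a + b = (\<Sum>i=1..c. f i * u i) + j" "\<forall>i. u i \<in> m" "j \<in> J 0"
    using K by (auto simp: K_def)
  obtain r j' where r: "j' \<in> J 0" "b = (\<Sum>i=1..p. f i * r i) + j'" using J_rep[OF _ b] p by auto
  let ?v = "\<lambda>i. (if i = Suc p then a else if i \<le> p then r i else 0)"
  have "(\<Sum>i=1..c. f i * ?v i) = (\<Sum>i\<in>{1..Suc p}. f i * ?v i)"
    by (rule sum.mono_neutral_right) (use p in auto)
  also have "\<dots> = f (Suc p) * a + (\<Sum>i=1..p. f i * r i)" by (simp add: add.commute)
  finally have "(\<Sum>i=1..c. f i * (?v i - u i)) = j - j'"
    using u(1) r(2) by (simp add: right_diff_distrib sum_subtractf algebra_simps)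
  then have "(\<Sum>i=1..c. f i * (?v i - u i)) \<in> J 0" using is_ideal_diff[OF J[of 0]] u(3) r(1) by simp
  then have "?v (Suc p) - u (Suc p) \<in> J c" by (rule syzygy_coeff[rotated]) (use p in auto)
  then have "a - u (Suc p) \<in> m" using Jm by auto
  then have "(a - u (Suc p)) + u (Suc p) \<in> m" using u(2) m unfolding is_ideal_def by blast
  then show ?thesis by simp
qed

lemma linD: "lin D" using level_differential by (simp add: level_differential_def)

lemma sq_K:
  assumes "x \<in> T c n" "x \<in> vmod m"
  shows "D (D x) \<in> vmod K"
proof (rule lin_vmod_mult[OF lin_comp[OF linD linD] is_ideal_K _ assms(1)[unfolded T_def] assms(2)])
  show "a * b \<in> K" if "a \<in> m" "b \<in> J c" for a b using that mult_K by blast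
  fix i assume "i \<in> X c n"
  then show "D (D (bas i)) \<in> vmod (J c)" using level_differential_sq[OF level_differential] by (simp add: T_def bas_vec)
qed

text \<open>The square of \<open>D\<close> detects the vectors that are zero modulo \<open>m\<close>: its leading term, at the largest variable \<open>y\<^sub>p\<close>, is
  \<open>f\<^sub>p\<close> times the division by this variable. Once that quotient is known to vanish modulo \<open>m\<close>, the multiples of \<open>y\<^sub>p\<close>
  can be removed, which lowers the level.\<close>

lemma sq_detects:
  assumes "p \<le> c" "w \<in> T p (k + 2)" "D (D w) \<in> vmod K"
  shows "w \<in> vmod m"
  using assms
proof (induction p arbitrary: w)
  case 0
  then show ?case using T_0 vmod_zero[OF m] by auto
next
  case (Suc p)
  let ?t = "t (Suc p) w"
  have p: "p < c" using Suc by simp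
  have sq: "D (D w) - smul (f (Suc p)) ?t \<in> vmod (J p)"
    using level_differential p Suc.prems(2) unfolding level_differential_def by blast
  have "?t \<in> vmod m"
    unfolding vmod_def
  proof (safe)
    fix e :: "nat multiset" and b :: 'b
    let ?i = "(e, b)"
    have "f (Suc p) * lookup ?t ?i + lookup (D (D w) - smul (f (Suc p)) ?t) ?i \<in> K"
      using Suc.prems(3) by (simp add: vmod_def lookup_minus)
    then show "lookup ?t ?i \<in> m"
      by (rule coeff_K[OF p]) (use sq in \<open>auto simp: vmod_def\<close>)
  qed
  \<comment> \<open>The multiples of the largest variable are themselves zero modulo \<open>m\<close> and may be subtracted.\<close>
  then have yt: "y (Suc p) ?t \<in> vmod m" by (rule lin_vmod[OF lin_y m])
  have ytT: "y (Suc p) ?t \<in> T (Suc p) (k + 2)" using y_T[OF t_T[OF Suc.prems(2)]] .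
  then have "D (D (y (Suc p) ?t)) \<in> vmod K" using sq_K[OF _ yt] T_mono Suc.prems(1) by blast
  then have "D (D (w - y (Suc p) ?t)) \<in> vmod K"
    using vmod_diff[OF is_ideal_K Suc.prems(3)] by (simp add: lin_diff[OF linD])
  moreover have "w - y (Suc p) ?t \<in> T p (k + 2)"
    using T_free[OF _ pr_free] Suc.prems(2) ytT by (simp add: T_def vec_diff)
  ultimately have "w - y (Suc p) ?t \<in> vmod m" using Suc.IH p by simp
  then show ?case using vmod_add[OF m _ yt] by fastforce
qed

text \<open>In degrees one and two this is minimality of \<open>d\<close> and \<open>h\<close>. In higher degrees, \<open>D (D (D x))\<close> has coefficients in \<open>K\<close>,
  because those of \<open>D (D x)\<close> lie in \<open>J c\<close> and \<open>D\<close> is minimal in the degree of \<open>D (D x)\<close>; so \<open>D x\<close> vanishes modulo \<open>m\<close>.\<close>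

lemma D_minimal: "x \<in> T c (Suc n) \<Longrightarrow> D x \<in> vmod m"
proof (induction n arbitrary: x rule: less_induct)
  case (less n)
  consider "n = 0" | "n = 1" | k where "n = k + 2" by (metis One_nat_def add_2_eq_Suc' not0_implies_Suc)
  then show ?case
  proof cases
    case 1
    then show ?thesis using less.prems level_differential d_min by (simp add: level_differential_def)
  next
    case 2
    have x: "x \<in> vec (X c 2)" using less.prems 2 by (simp add: T_def numeral_2_eq_2)
    show ?thesis
    proof (rule lin_vec_submod[OF linD submod_vmod[OF m] _ x], safe)
      fix e b assume eb: "(e, b) \<in> X c 2"
      then have "size e = 1" "par b = 0" using par[of b] by (auto simp: gens_def) presburger+
      then obtain q where e: "e = {#q#}" by (metis One_nat_def size_1_singleton_mset)
      then obtain q' where q': "q = Suc q'" "q' < c" using eb lev[of b] by (cases q) (auto simp: gens_def)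
      have b: "bas ({#}, b) \<in> T q 0" using eb e \<open>par b = 0\<close> by (auto simp: T_def bas_vec gens_def)
      have "D (y q (bas ({#}, b))) = h q (bas ({#}, b))" using level_differential q' b unfolding level_differential_def by blast
      then show "D (bas (e, b)) \<in> vmod m" using h_min[of q'] q' b e by (simp add: y_bas)
    qed
  next
    case (3 k)
    have DT: "D x \<in> T c l" if "x \<in> T c (Suc l)" for x l using level_differential that unfolding level_differential_def by blast
    have Dx: "D x \<in> T c (k + 2)" using DT less.prems 3 by simp
    then have DDx: "D (D x) \<in> T c (Suc k)" using DT by simp
    have "D (D (D x)) \<in> vmod K"
    proof (rule lin_vmod_mult[OF linD is_ideal_K _ DDx[unfolded T_def] level_differential_sq[OF level_differential _ less.prems]])
      show "a * b \<in> K" if "a \<in> J c" "b \<in> m" for a b using mult_K that by (metis mult.commute)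
      show "D (bas i) \<in> vmod m" if "i \<in> X c (Suc k)" for i
        using less.IH[of k "bas i"] that 3 by (simp add: T_def bas_vec)
    qed simp
    then show ?thesis using sq_detects[OF _ Dx] by simp
  qed
qed

end

theorem resolution_exists:
  assumes m: "is_ideal m" and Jm: "J c \<subseteq> m"
    and d_min: "\<And>x. x \<in> T c 1 \<Longrightarrow> d x \<in> vmod m"
    and h_min: "\<And>q x. q < c \<Longrightarrow> x \<in> T (Suc q) 0 \<Longrightarrow> h (Suc q) x \<in> vmod m"
  shows "\<exists>D. lin D \<and> (\<forall>n. \<forall>x\<in>T c (Suc n). D x \<in> T c n \<and> D x \<in> vmod m) \<and>
    (\<forall>x\<in>T c 1. D x = d x) \<and> (\<forall>n. \<forall>x\<in>T c n. D (D x) \<in> vmod (J c)) \<and>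
    (\<forall>n. \<forall>x\<in>T c (Suc n). D x \<in> vmod (J c) \<longrightarrow> (\<exists>z\<in>T c (n + 2). x - D z \<in> vmod (J c)))"
proof -
  obtain D where D: "level_differential c D" using level_differential_exists by blast
  have "\<forall>n. \<forall>x\<in>T c (Suc n). D x \<in> vmod m"
    using D_minimal[OF m Jm d_min h_min D] by blast
  moreover have "\<forall>n. \<forall>x\<in>T c n. D (D x) \<in> vmod (J c)" using level_differential_sq[OF D] by blast
  ultimately show ?thesis using D unfolding level_differential_def by (intro exI[of _ D]) blast
qed

end

section \<open>Covering a ring by a commutative ring on a whole type\<close>

text \<open>The product of all commutative rings whose elements have type \<open>'s\<close>. Every one of them is a quotient of the product,
  by projection. The additional factor \<open>int\<close> keeps \<open>0 \<noteq> 1\<close> when all these rings are zero.\<close>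

typedef ('s, 'x) rcover =
  "{(\<phi> :: ('s, 'x) ring_scheme \<Rightarrow> 's, n :: int). (\<forall>T. cring T \<longrightarrow> \<phi> T \<in> carrier T) \<and> (\<forall>T. \<not> cring T \<longrightarrow> \<phi> T = undefined)}"
  by (rule exI[of _ "(\<lambda>T. if cring T then \<zero>\<^bsub>T\<^esub> else undefined, 0)"])
    (auto intro: cring.cring_simprules)

setup_lifting type_definition_rcover

instantiation rcover :: (type, type) comm_ring_1
begin

lift_definition zero_rcover :: "('a, 'b) rcover"
  is "(\<lambda>T. if cring T then \<zero>\<^bsub>T\<^esub> else undefined, 0)"
  by (auto simp: cring.cring_simprules)

lift_definition one_rcover :: "('a, 'b) rcover"
  is "(\<lambda>T. if cring T then \<one>\<^bsub>T\<^esub> else undefined, 1)"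
  by (auto simp: cring.cring_simprules)

lift_definition plus_rcover :: "('a, 'b) rcover \<Rightarrow> ('a, 'b) rcover \<Rightarrow> ('a, 'b) rcover"
  is "\<lambda>(\<phi>, m) (\<psi>, n). (\<lambda>T. if cring T then \<phi> T \<oplus>\<^bsub>T\<^esub> \<psi> T else undefined, m + n)"
  by (auto simp: cring.cring_simprules)

lift_definition times_rcover :: "('a, 'b) rcover \<Rightarrow> ('a, 'b) rcover \<Rightarrow> ('a, 'b) rcover"
  is "\<lambda>(\<phi>, m) (\<psi>, n). (\<lambda>T. if cring T then \<phi> T \<otimes>\<^bsub>T\<^esub> \<psi> T else undefined, m * n)"
  by (auto simp: cring.cring_simprules)

lift_definition uminus_rcover :: "('a, 'b) rcover \<Rightarrow> ('a, 'b) rcover"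
  is "\<lambda>(\<phi>, m). (\<lambda>T. if cring T then \<ominus>\<^bsub>T\<^esub> \<phi> T else undefined, - m)"
  by (auto simp: cring.cring_simprules)

definition minus_rcover :: "('a, 'b) rcover \<Rightarrow> ('a, 'b) rcover \<Rightarrow> ('a, 'b) rcover"
  where "minus_rcover x y = x + - y"

instance
proof
  fix x y z :: "('a, 'b) rcover"
  show "x * y * z = x * (y * z)" by transfer (auto simp: fun_eq_iff cring.cring_simprules)
  show "x * y = y * x" by transfer (auto simp: fun_eq_iff cring.cring_simprules)
  show "1 * x = x"
    by transfer (auto simp: fun_eq_iff cring.cring_simprules(13) monoid.l_one[OF ring.is_monoid[OF cring.axioms(1)]])
  show "x + y + z = x + (y + z)" by transfer (auto simp: fun_eq_iff cring.cring_simprules)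
  show "x + y = y + x" by transfer (auto simp: fun_eq_iff cring.cring_simprules)
  show "0 + x = x" by transfer (auto simp: fun_eq_iff cring.cring_simprules)
  show "- x + x = 0" by transfer (auto simp: fun_eq_iff cring.cring_simprules)
  show "x - y = x + - y" by (rule minus_rcover_def)
  show "(x + y) * z = x * z + y * z"
    by transfer (auto simp: fun_eq_iff cring.cring_simprules distrib_right)
  show "(0 :: ('a, 'b) rcover) \<noteq> 1" by transfer auto
qed

end

locale ring_cover = cring S for S (structure) +
  fixes \<pi> :: "'p::comm_ring_1 \<Rightarrow> 'a"
  assumes closed [simp]: "\<pi> a \<in> carrier S"
    and add: "\<pi> (a + b) = \<pi> a \<oplus> \<pi> b"
    and mult: "\<pi> (a * b) = \<pi> a \<otimes> \<pi> b"
    and one: "\<pi> 1 = \<one>"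
    and surj: "s \<in> carrier S \<Longrightarrow> \<exists>a. \<pi> a = s"

lemma ring_cover_exists:
  fixes S :: "('s, 'x) ring_scheme" (structure)
  assumes "cring S"
  shows "\<exists>\<pi> :: ('s, 'x) rcover \<Rightarrow> 's. ring_cover S \<pi>"
proof (intro exI)
  interpret cring S by fact
  show "ring_cover S (\<lambda>a. fst (Rep_rcover a) S)"
  proof
    fix a b :: "('s, 'x) rcover" and s
    show "fst (Rep_rcover a) S \<in> carrier S" using Rep_rcover[of a] assms by (auto split: if_splits)
    show "fst (Rep_rcover (a + b)) S = fst (Rep_rcover a) S \<oplus> fst (Rep_rcover b) S"
      using assms by (simp add: plus_rcover.rep_eq split: prod.splits)
    show "fst (Rep_rcover (a * b)) S = fst (Rep_rcover a) S \<otimes> fst (Rep_rcover b) S"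
      using assms by (simp add: times_rcover.rep_eq split: prod.splits)
    show "fst (Rep_rcover (1 :: ('s, 'x) rcover)) S = \<one>"
      using assms by (simp add: one_rcover.rep_eq)
    assume s: "s \<in> carrier S"
    let ?\<phi> = "(\<lambda>T. if T = S then s else if cring T then \<zero>\<^bsub>T\<^esub> else undefined, 0 :: int)"
    have "Rep_rcover (Abs_rcover ?\<phi>) = ?\<phi>"
      by (rule Abs_rcover_inverse) (use s assms in \<open>auto intro: cring.cring_simprules\<close>)
    then show "\<exists>a :: ('s, 'x) rcover. fst (Rep_rcover a) S = s"
      by (intro exI[of _ "Abs_rcover ?\<phi>"]) simp
  qed
qed

context ring_cover
begin

lemma zero: "\<pi> 0 = \<zero>"
proof -
  have "\<pi> 0 \<oplus> \<pi> 0 = \<pi> 0" using add[of 0 0] by simp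
  then show ?thesis using add.r_cancel_one closed by blast
qed

lemma neg: "\<pi> (- a) = \<ominus> \<pi> a"
proof -
  have "\<pi> (- a) \<oplus> \<pi> a = \<zero>" using add[of "- a" a] zero by simp
  then show ?thesis using minus_equality closed by metis
qed

lemma diff: "\<pi> (a - b) = \<pi> a \<ominus> \<pi> b"
  using add[of a "- b"] neg[of b] by (simp add: a_minus_def)

definition pre :: "'a set \<Rightarrow> 'p set" where "pre I = {a. \<pi> a \<in> I}"

lemma image_pre:
  assumes "I \<subseteq> carrier S"
  shows "\<pi> ` pre I = I"
proof
  show "\<pi> ` pre I \<subseteq> I" by (auto simp: pre_def)
  show "I \<subseteq> \<pi> ` pre I"
  proof
    fix s assume s: "s \<in> I"
    then obtain a where "\<pi> a = s" using surj assms by blast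
    then show "s \<in> \<pi> ` pre I" using s by (auto simp: pre_def)
  qed
qed

lemma is_ideal_pre: "ideal I S \<Longrightarrow> is_ideal (pre I)"
proof -
  assume "ideal I S"
  then interpret I: ideal I S .
  show ?thesis
    unfolding is_ideal_def pre_def using I.I_l_closed I.a_closed I.zero_closed
    by (auto simp: zero add mult)
qed

lemma eq_iff: "\<pi> a = \<pi> b \<longleftrightarrow> a - b \<in> pre {\<zero>}"
  using diff[of a b] closed by (simp add: pre_def)

text \<open>Ideals of the quotient \<open>S\<close> correspond to ideals that contain the kernel.\<close>

lemma ideal_image:
  assumes "is_ideal m" "pre {\<zero>} \<subseteq> m"
  shows "ideal (\<pi> ` m) S" "pre (\<pi> ` m) = m"
proof -
  show "ideal (\<pi> ` m) S"
  proof (rule idealI)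
    show "ring S" by (rule ring_axioms)
    show "subgroup (\<pi> ` m) (add_monoid S)"
    proof (rule subgroup.intro)
      show "\<pi> ` m \<subseteq> carrier (add_monoid S)" by auto
      show "\<one>\<^bsub>add_monoid S\<^esub> \<in> \<pi> ` m"
        using assms(1) by (auto simp: is_ideal_def zero[symmetric])
      fix x y assume "x \<in> \<pi> ` m"
      then obtain a where a: "a \<in> m" "x = \<pi> a" by blast
      have "- a \<in> m" using is_ideal_diff[OF assms(1) _ a(1), of 0] assms(1) by (simp add: is_ideal_def)
      then have "\<ominus> x \<in> \<pi> ` m" using a by (auto simp: neg[symmetric])
      then show "inv\<^bsub>add_monoid S\<^esub> x \<in> \<pi> ` m" by (simp add: a_inv_def)
      assume "y \<in> \<pi> ` m"
      then show "x \<otimes>\<^bsub>add_monoid S\<^esub> y \<in> \<pi> ` m"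
        using a assms(1) by (auto simp: is_ideal_def add[symmetric])
    qed
    fix a x assume a: "a \<in> \<pi> ` m" and x: "x \<in> carrier S"
    obtain b where b: "\<pi> b = x" using surj x by blast
    show "x \<otimes> a \<in> \<pi> ` m" using a b assms(1) by (auto simp: is_ideal_def mult[symmetric])
    then show "a \<otimes> x \<in> \<pi> ` m" using m_comm x a by auto
  qed
  show "pre (\<pi> ` m) = m"
  proof
    show "m \<subseteq> pre (\<pi> ` m)" by (auto simp: pre_def)
    show "pre (\<pi> ` m) \<subseteq> m"
    proof
      fix a assume "a \<in> pre (\<pi> ` m)"
      then obtain b where b: "b \<in> m" "\<pi> a = \<pi> b" by (auto simp: pre_def)
      then have "a - b \<in> m" using eq_iff assms(2) by blast
      then have "(a - b) + b \<in> m" using b(1) assms(1) unfolding is_ideal_def by blast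
      then show "a \<in> m" by simp
    qed
  qed
qed

end

section \<open>Maximal ideals\<close>

definition is_maximal :: "'p::comm_ring_1 set \<Rightarrow> bool"
  where "is_maximal m \<longleftrightarrow> is_ideal m \<and> 1 \<notin> m \<and> (\<forall>m'. is_ideal m' \<longrightarrow> m \<subseteq> m' \<longrightarrow> m' = m \<or> 1 \<in> m')"

lemma is_ideal_one: "is_ideal m \<Longrightarrow> 1 \<in> m \<Longrightarrow> m = UNIV"
  unfolding is_ideal_def by (metis UNIV_eq_I mult.right_neutral)

lemma is_maximal_exists:
  assumes I: "is_ideal I" "1 \<notin> I"
  shows "\<exists>m. is_maximal m \<and> I \<subseteq> m"
proof -
  let ?A = "{m. is_ideal m \<and> I \<subseteq> m \<and> 1 \<notin> m}"
  have "\<exists>M\<in>?A. \<forall>X\<in>?A. M \<subseteq> X \<longrightarrow> X = M"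
  proof (rule subset_Zorn_nonempty)
    show "?A \<noteq> {}" using I by blast
    fix C assume C: "C \<noteq> {}" "subset.chain ?A C"
    have CA: "\<And>M. M \<in> C \<Longrightarrow> is_ideal M \<and> I \<subseteq> M \<and> 1 \<notin> M"
      and tot: "\<And>M N. M \<in> C \<Longrightarrow> N \<in> C \<Longrightarrow> M \<subseteq> N \<or> N \<subseteq> M"
      using C by (auto simp: subset_chain_def)
    have "is_ideal (\<Union>C)"
      unfolding is_ideal_def
    proof (intro conjI ballI allI)
      show "0 \<in> \<Union>C" using C(1) CA by (auto simp: is_ideal_def)
      fix b assume b: "b \<in> \<Union>C"
      then obtain X where X: "X \<in> C" "b \<in> X" by blast
      have "is_ideal X" using CA[OF X(1)] by blast
      then have "a * b \<in> X" for a using X(2) by (simp add: is_ideal_def)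
      then show "a * b \<in> \<Union>C" for a using X(1) by (rule UnionI[rotated])
      fix a assume "a \<in> \<Union>C"
      then obtain M N where MN: "a \<in> M" "b \<in> N" "M \<in> C" "N \<in> C" using b by blast
      then have "M \<subseteq> N \<or> N \<subseteq> M" using tot by blast
      then obtain L where L: "L \<in> C" "a \<in> L" "b \<in> L" using MN by blast
      have "is_ideal L" using CA[OF L(1)] by blast
      then have "a + b \<in> L" using L by (simp add: is_ideal_def)
      then show "a + b \<in> \<Union>C" using L(1) by (rule UnionI[rotated])
    qed
    moreover obtain M where "M \<in> C" using C(1) by blast
    then have "I \<subseteq> \<Union>C" using CA by blast
    moreover have "1 \<notin> \<Union>C" using CA by blast
    ultimately show "\<Union>C \<in> ?A" by simp
  qed
  then obtain m where m: "m \<in> ?A" "\<forall>X\<in>?A. m \<subseteq> X \<longrightarrow> X = m" ..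
  have "m' = m \<or> 1 \<in> m'" if "is_ideal m'" "m \<subseteq> m'" for m'
  proof (rule disjCI)
    assume "1 \<notin> m'"
    then have "m' \<in> ?A" using that m(1) by auto
    then show "m' = m" using m(2) that(2) by blast
  qed
  then have "is_maximal m" using m(1) by (simp add: is_maximal_def)
  then show ?thesis using m(1) by auto
qed

text \<open>Otherwise \<open>m + (a)\<close> would be a proper ideal larger than \<open>m\<close>.\<close>

lemma is_maximal_inverse:
  assumes m: "is_maximal m" and a: "a \<notin> m"
  shows "\<exists>b. 1 - a * b \<in> m"
proof -
  let ?m' = "{x + a * b | x b. x \<in> m}"
  have I: "is_ideal m" using m by (simp add: is_maximal_def)
  have "is_ideal ?m'"
    unfolding is_ideal_def
  proof safe
    show "\<exists>x b. 0 = x + a * b \<and> x \<in> m" using I by (intro exI[of _ 0]) (simp add: is_ideal_def)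
    fix x b x' b' assume "x \<in> m" "x' \<in> m"
    then show "\<exists>z c. (x + a * b) + (x' + a * b') = z + a * c \<and> z \<in> m" using I
      by (intro exI[of _ "x + x'"] exI[of _ "b + b'"]) (simp add: is_ideal_def algebra_simps)
  next
    fix r x b assume "x \<in> m"
    then show "\<exists>z c. r * (x + a * b) = z + a * c \<and> z \<in> m" using I
      by (intro exI[of _ "r * x"] exI[of _ "r * b"]) (simp add: is_ideal_def algebra_simps)
  qed
  moreover have sub: "m \<subseteq> ?m'" by (force intro: exI[of _ 0])
  moreover have "a \<in> ?m'" using I by (intro CollectI exI[of _ 0] exI[of _ 1]) (simp add: is_ideal_def)
  ultimately have "1 \<in> ?m'" using m a unfolding is_maximal_def by blast
  then obtain x b where "1 = x + a * b" "x \<in> m" by blast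
  then have "1 - a * b \<in> m" by (simp add: eq_diff_eq[symmetric])
  then show ?thesis ..
qed

context ring_cover
begin

lemma maximal_pre: "maximalideal I S \<Longrightarrow> is_maximal (pre I)"
proof -
  assume "maximalideal I S"
  then interpret I: maximalideal I S .
  have sub: "I \<subseteq> carrier S" by (rule I.a_subset)
  have ker: "pre {\<zero>} \<subseteq> pre I" using I.zero_closed by (auto simp: pre_def)
  show ?thesis
    unfolding is_maximal_def
  proof (intro conjI allI impI)
    show "is_ideal (pre I)" by (rule is_ideal_pre[OF I.is_ideal])
    show "1 \<notin> pre I" using I.I_notcarr I.one_imp_carrier by (auto simp: pre_def one)
    fix m' assume m': "is_ideal m'" "pre I \<subseteq> m'"
    then have *: "ideal (\<pi> ` m') S" "pre (\<pi> ` m') = m'" using ideal_image ker by auto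
    have "I \<subseteq> \<pi> ` m'" using image_pre[OF sub] m'(2) by auto
    moreover have "\<pi> ` m' \<subseteq> carrier S" by auto
    ultimately have "\<pi> ` m' = I \<or> \<pi> ` m' = carrier S"
      by (rule I.I_maximal[OF *(1)])
    then show "m' = pre I \<or> 1 \<in> m'" using *(2) by (auto simp: pre_def)
  qed
qed

lemma maximal_image:
  assumes m: "is_maximal m" "pre {\<zero>} \<subseteq> m"
  shows "maximalideal (\<pi> ` m) S" "pre (\<pi> ` m) = m"
proof -
  have I: "is_ideal m" using m by (simp add: is_maximal_def)
  note * = ideal_image[OF I m(2)]
  show "pre (\<pi> ` m) = m" by (rule *(2))
  show "maximalideal (\<pi> ` m) S"
  proof (rule maximalidealI[OF *(1)])
    have "1 \<notin> pre (\<pi> ` m)" using m(1) *(2) by (simp add: is_maximal_def)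
    then show "carrier S \<noteq> \<pi> ` m" by (auto simp: pre_def)
    fix I' assume I': "ideal I' S" "\<pi> ` m \<subseteq> I'" "I' \<subseteq> carrier S"
    have "m \<subseteq> pre I'" using I'(2) by (auto simp: pre_def)
    then have "pre I' = m \<or> 1 \<in> pre I'" using m(1) is_ideal_pre[OF I'(1)] unfolding is_maximal_def by blast
    then show "I' = \<pi> ` m \<or> I' = carrier S"
    proof
      assume "pre I' = m"
      then show ?thesis using image_pre[OF I'(3)] by auto
    next
      assume "1 \<in> pre I'"
      then have "pre I' = UNIV" using is_ideal_one is_ideal_pre[OF I'(1)] by blast
      then have "\<pi> a \<in> I'" for a by (auto simp: pre_def)
      then have "carrier S \<subseteq> I'" using surj by (metis subsetI)
      then show ?thesis using I'(3) by blast
    qed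
  qed
qed

lemma max_ideal_eq:
  assumes m: "is_maximal m" "pre {\<zero>} \<subseteq> m"
    and unique: "\<And>m'. is_maximal m' \<Longrightarrow> pre {\<zero>} \<subseteq> m' \<Longrightarrow> m' = m"
  shows "maximalideal (max_ideal S) S" "pre (max_ideal S) = m"
proof -
  have "max_ideal S = \<pi> ` m"
    unfolding max_ideal_def
  proof (rule the_equality)
    show "maximalideal (\<pi> ` m) S" using maximal_image[OF m] by simp
    fix I assume I: "maximalideal I S"
    then interpret I: maximalideal I S .
    have "pre {\<zero>} \<subseteq> pre I" using I.zero_closed by (auto simp: pre_def)
    then have "pre I = m" using unique maximal_pre[OF I] by blast
    then show "I = \<pi> ` m" using image_pre[OF I.a_subset] by simp
  qed
  then show "maximalideal (max_ideal S) S" "pre (max_ideal S) = m" using maximal_image[OF m] by auto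
qed

text \<open>A quotient of a covered ring is covered by the composite surjection.\<close>

lemma quotient_cover:
  assumes I: "ideal I S"
  shows "ring_cover (S Quot I) (\<lambda>a. I +> \<pi> a)"
    and "ring_cover.pre (\<lambda>a. I +> \<pi> a) {\<zero>\<^bsub>S Quot I\<^esub>} = pre I"
proof -
  interpret I: ideal I S by fact
  interpret Q: cring "S Quot I" by (rule I.quotient_is_cring[OF is_cring])
  have hom: "(+>) I \<in> ring_hom S (S Quot I)" by (rule I.rcos_ring_hom)
  interpret C: ring_cover "S Quot I" "\<lambda>a. I +> \<pi> a"
  proof
    fix a b s
    show "I +> \<pi> a \<in> carrier (S Quot I)" using ring_hom_closed[OF hom] by simp
    show "I +> \<pi> (a + b) = (I +> \<pi> a) \<oplus>\<^bsub>S Quot I\<^esub> (I +> \<pi> b)"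
      using ring_hom_add[OF hom] by (simp add: add)
    show "I +> \<pi> (a * b) = (I +> \<pi> a) \<otimes>\<^bsub>S Quot I\<^esub> (I +> \<pi> b)"
      using ring_hom_mult[OF hom] by (simp add: mult)
    show "I +> \<pi> 1 = \<one>\<^bsub>S Quot I\<^esub>" using ring_hom_one[OF hom] by (simp add: one)
    assume "s \<in> carrier (S Quot I)"
    then obtain x where "x \<in> carrier S" "s = I +> x" by (auto simp: FactRing_simps)
    then show "\<exists>a. I +> \<pi> a = s" using surj by metis
  qed
  show "ring_cover (S Quot I) (\<lambda>a. I +> \<pi> a)" by unfold_locales
  show "C.pre {\<zero>\<^bsub>S Quot I\<^esub>} = pre I"
    using I.a_rcos_const I.a_rcos_self by (auto simp: C.pre_def pre_def FactRing_def)
qed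

end

section \<open>Modules presented by vectors\<close>

text \<open>The module \<open>M\<close> is identified with the quotient \<open>Z/N\<close> through \<open>\<theta>\<close>. That \<open>M\<close> is a module is a consequence
  (\<open>presents_module\<close>), so constructions on modules only have to be traced on \<open>Z\<close> and \<open>N\<close>.\<close>

definition presents ::
  "('p::comm_ring_1 \<Rightarrow> 'r) \<Rightarrow> ('r, 'a, 'y) module_scheme \<Rightarrow> ('i \<Rightarrow>\<^sub>0 'p) set \<Rightarrow> ('i \<Rightarrow>\<^sub>0 'p) set \<Rightarrow>
    (('i \<Rightarrow>\<^sub>0 'p) \<Rightarrow> 'a) \<Rightarrow> bool"
  where "presents \<pi> M Z N \<theta> \<longleftrightarrow> submod Z \<and> submod N \<and> N \<subseteq> Z \<and> \<theta> ` Z = carrier M \<and> \<theta> 0 = \<zero>\<^bsub>M\<^esub> \<and>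
    (\<forall>x\<in>Z. \<forall>y\<in>Z. \<theta> (x + y) = \<theta> x \<oplus>\<^bsub>M\<^esub> \<theta> y) \<and> (\<forall>a. \<forall>x\<in>Z. \<theta> (smul a x) = \<pi> a \<odot>\<^bsub>M\<^esub> \<theta> x) \<and>
    (\<forall>x\<in>Z. \<forall>y\<in>Z. \<theta> x = \<theta> y \<longleftrightarrow> x - y \<in> N)"

lemma presentsI:
  assumes "submod Z" "submod N" "N \<subseteq> Z" "\<theta> ` Z = carrier M" "\<theta> 0 = \<zero>\<^bsub>M\<^esub>"
    "\<And>x y. x \<in> Z \<Longrightarrow> y \<in> Z \<Longrightarrow> \<theta> (x + y) = \<theta> x \<oplus>\<^bsub>M\<^esub> \<theta> y"
    "\<And>a x. x \<in> Z \<Longrightarrow> \<theta> (smul a x) = \<pi> a \<odot>\<^bsub>M\<^esub> \<theta> x"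
    "\<And>x y. x \<in> Z \<Longrightarrow> y \<in> Z \<Longrightarrow> \<theta> x = \<theta> y \<longleftrightarrow> x - y \<in> N"
  shows "presents \<pi> M Z N \<theta>"
  using assms by (simp add: presents_def)

lemma presentsD:
  assumes "presents \<pi> M Z N \<theta>"
  shows "submod Z" "submod N" "N \<subseteq> Z" "\<theta> ` Z = carrier M" "\<theta> 0 = \<zero>\<^bsub>M\<^esub>"
    "x \<in> Z \<Longrightarrow> y \<in> Z \<Longrightarrow> \<theta> (x + y) = \<theta> x \<oplus>\<^bsub>M\<^esub> \<theta> y"
    "x \<in> Z \<Longrightarrow> \<theta> (smul a x) = \<pi> a \<odot>\<^bsub>M\<^esub> \<theta> x"
    "x \<in> Z \<Longrightarrow> y \<in> Z \<Longrightarrow> \<theta> x = \<theta> y \<longleftrightarrow> x - y \<in> N"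
    "x \<in> Z \<Longrightarrow> \<theta> x \<in> carrier M"
    "x \<in> Z \<Longrightarrow> \<theta> x = \<zero>\<^bsub>M\<^esub> \<longleftrightarrow> x \<in> N"
proof -
  note * = assms[unfolded presents_def]
  show "submod Z" "submod N" "N \<subseteq> Z" "\<theta> ` Z = carrier M" "\<theta> 0 = \<zero>\<^bsub>M\<^esub>"
    "x \<in> Z \<Longrightarrow> y \<in> Z \<Longrightarrow> \<theta> (x + y) = \<theta> x \<oplus>\<^bsub>M\<^esub> \<theta> y"
    "x \<in> Z \<Longrightarrow> \<theta> (smul a x) = \<pi> a \<odot>\<^bsub>M\<^esub> \<theta> x"
    "x \<in> Z \<Longrightarrow> y \<in> Z \<Longrightarrow> \<theta> x = \<theta> y \<longleftrightarrow> x - y \<in> N"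
    "x \<in> Z \<Longrightarrow> \<theta> x \<in> carrier M"
    using * by blast+
  have "0 \<in> Z" using * by (simp add: submod_def)
  then show "x \<in> Z \<Longrightarrow> \<theta> x = \<zero>\<^bsub>M\<^esub> \<longleftrightarrow> x \<in> N"
    using * by (metis diff_zero)
qed

lemma presents_carrier:
  assumes "presents \<pi> M Z N \<theta>" "v \<in> carrier M"
  obtains x where "x \<in> Z" "v = \<theta> x"
  using presentsD(4)[OF assms(1)] assms(2) by blast

lemma presents_module:
  fixes R (structure)
  assumes R: "ring_cover R \<pi>" and P: "presents \<pi> M Z N \<theta>"
  shows "module R M"
proof -
  interpret ring_cover R \<pi> by fact
  note D = presentsD[OF P]
  have Z: "x \<in> Z \<Longrightarrow> y \<in> Z \<Longrightarrow> x + y \<in> Z" "x \<in> Z \<Longrightarrow> smul a x \<in> Z" "0 \<in> Z" for x y a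
    using D(1) by (auto simp: submod_def)
  have ab: "abelian_group M"
  proof (rule abelian_groupI)
    show "\<zero>\<^bsub>M\<^esub> \<in> carrier M" using D(5,9) Z(3) by metis
    fix u assume "u \<in> carrier M"
    then obtain x where x: "x \<in> Z" "u = \<theta> x" by (rule presents_carrier[OF P])
    show "\<zero>\<^bsub>M\<^esub> \<oplus>\<^bsub>M\<^esub> u = u" using D(6)[OF Z(3) x(1)] x(2) D(5) by simp
    have "smul (-1) x + x = 0" by (rule poly_mapping_eqI) (simp add: lookup_add)
    then have "\<theta> (smul (-1) x) \<oplus>\<^bsub>M\<^esub> u = \<zero>\<^bsub>M\<^esub>"
      using D(6)[OF Z(2) x(1), OF x(1)] D(5) x(2) by metis
    then show "\<exists>v\<in>carrier M. v \<oplus>\<^bsub>M\<^esub> u = \<zero>\<^bsub>M\<^esub>" using D(9)[OF Z(2)[OF x(1)]] by blast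
    fix v assume "v \<in> carrier M"
    then obtain y where y: "y \<in> Z" "v = \<theta> y" by (rule presents_carrier[OF P])
    show "u \<oplus>\<^bsub>M\<^esub> v \<in> carrier M" using D(6,9) Z x y by metis
    show "u \<oplus>\<^bsub>M\<^esub> v = v \<oplus>\<^bsub>M\<^esub> u" using D(6) x y by (metis add.commute)
    fix w assume "w \<in> carrier M"
    then obtain z where z: "z \<in> Z" "w = \<theta> z" by (rule presents_carrier[OF P])
    show "u \<oplus>\<^bsub>M\<^esub> v \<oplus>\<^bsub>M\<^esub> w = u \<oplus>\<^bsub>M\<^esub> (v \<oplus>\<^bsub>M\<^esub> w)"
      using x y z Z by (simp add: D(6)[symmetric] add.assoc)
  qed
  show ?thesis
  proof (rule moduleI[OF is_cring ab])
    fix r u assume "r \<in> carrier R" "u \<in> carrier M"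
    then obtain a x where ax: "x \<in> Z" "u = \<theta> x" "r = \<pi> a" using surj presents_carrier[OF P] by metis
    show "r \<odot>\<^bsub>M\<^esub> u \<in> carrier M" using ax D(7,9) Z by metis
    fix s assume "s \<in> carrier R"
    then obtain b where b: "s = \<pi> b" using surj by metis
    have Za: "smul c x \<in> Z" for c using Z ax by blast
    show "(r \<oplus> s) \<odot>\<^bsub>M\<^esub> u = r \<odot>\<^bsub>M\<^esub> u \<oplus>\<^bsub>M\<^esub> s \<odot>\<^bsub>M\<^esub> u"
      using ax b D(6)[OF Za Za] D(7)[OF ax(1)] by (simp add: add[symmetric] smul_simps(3)[symmetric])
    show "(r \<otimes> s) \<odot>\<^bsub>M\<^esub> u = r \<odot>\<^bsub>M\<^esub> (s \<odot>\<^bsub>M\<^esub> u)"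
    proof -
      have "\<theta> (smul (a * b) x) = \<theta> (smul a (smul b x))" by (simp add: smul_simps)
      then show ?thesis using ax b D(7)[OF ax(1)] D(7)[OF Za] by (simp add: mult)
    qed
  next
    fix r u v assume "r \<in> carrier R" "u \<in> carrier M" "v \<in> carrier M"
    then obtain a x y where ax: "x \<in> Z" "u = \<theta> x" "r = \<pi> a" "y \<in> Z" "v = \<theta> y"
      using surj presents_carrier[OF P] by metis
    show "r \<odot>\<^bsub>M\<^esub> (u \<oplus>\<^bsub>M\<^esub> v) = r \<odot>\<^bsub>M\<^esub> u \<oplus>\<^bsub>M\<^esub> r \<odot>\<^bsub>M\<^esub> v"
      using ax Z by (simp add: D(6,7)[symmetric] smul_simps)
  next
    fix u assume "u \<in> carrier M"
    then obtain x where x: "x \<in> Z" "u = \<theta> x" by (rule presents_carrier[OF P])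
    show "\<one> \<odot>\<^bsub>M\<^esub> u = u" using D(7)[OF x(1), of 1] x(2) by (simp add: one smul_simps)
  qed
qed

lemma presents_sum:
  assumes R: "ring_cover R \<pi>" and P: "presents \<pi> M Z N \<theta>" and A: "finite A" "\<And>i. i \<in> A \<Longrightarrow> g i \<in> Z"
  shows "\<theta> (\<Sum>i\<in>A. g i) = (\<Oplus>\<^bsub>M\<^esub>i\<in>A. \<theta> (g i))"
proof -
  interpret module R M by (rule presents_module[OF R P])
  note D = presentsD[OF P]
  show ?thesis using A
  proof (induction A rule: finite_induct)
    case (insert i A)
    have "(\<Sum>i\<in>A. g i) \<in> Z" using insert by (intro submod_sum[OF D(1)]) auto
    then show ?case using insert D(6,9) by simp
  qed (simp add: D(5))
qed

lemma presents_diff: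
  assumes R: "ring_cover R \<pi>" and P: "presents \<pi> M Z N \<theta>" and x: "x \<in> Z" "y \<in> Z"
  shows "\<theta> (x - y) = \<theta> x \<ominus>\<^bsub>M\<^esub> \<theta> y"
proof -
  interpret module R M by (rule presents_module[OF R P])
  note D = presentsD[OF P]
  have "x - y \<in> Z" using submod_diff[OF D(1) x] .
  then have "\<theta> x = \<theta> (x - y) \<oplus>\<^bsub>M\<^esub> \<theta> y" using D(6)[of "x - y" y] x by simp
  then show ?thesis using D(9)[OF \<open>x - y \<in> Z\<close>] D(9)[OF x(2)]
    by (simp add: M.minus_eq M.a_assoc M.r_neg)
qed

lemma presents_sub:
  assumes P: "presents \<pi> M Z N \<theta>" and W: "submod W" "N \<subseteq> W" "W \<subseteq> Z"
  shows "presents \<pi> (M\<lparr>carrier := \<theta> ` W\<rparr>) W N \<theta>"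
proof -
  note D = presentsD[OF P]
  have "x \<in> Z" if "x \<in> W" for x using W(3) that by blast
  then show ?thesis by (intro presentsI) (use W D in simp_all)
qed

lemma presents_image_iff:
  assumes P: "presents \<pi> M Z N \<theta>" and W: "submod W" "N \<subseteq> W" "W \<subseteq> Z" and x: "x \<in> Z"
  shows "\<theta> x \<in> \<theta> ` W \<longleftrightarrow> x \<in> W"
proof
  assume "\<theta> x \<in> \<theta> ` W"
  then obtain w where w: "w \<in> W" "\<theta> x = \<theta> w" by blast
  then have "x - w \<in> W" using presentsD(8)[OF P] x W by blast
  then have "(x - w) + w \<in> W" using w(1) W(1) unfolding submod_def by blast
  then show "x \<in> W" by simp
qed auto

text \<open>Dividing out a submodule enlarges \<open>N\<close> to its preimage.\<close>

lemma presents_quot: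
  assumes R: "ring_cover R \<pi>" and P: "presents \<pi> M Z N \<theta>" and W: "submod W" "N \<subseteq> W" "W \<subseteq> Z"
  shows "presents \<pi> (quot_mod M (\<theta> ` W)) Z W (\<lambda>x. \<theta> ` W +>\<^bsub>M\<^esub> \<theta> x)"
proof -
  interpret module R M by (rule presents_module[OF R P])
  note D = presentsD[OF P]
  let ?H = "\<theta> ` W"
  have Hsub: "?H \<subseteq> carrier M" using D(9) W(3) by blast
  have Z: "x \<in> Z \<Longrightarrow> y \<in> Z \<Longrightarrow> x + y \<in> Z" "x \<in> Z \<Longrightarrow> smul a x \<in> Z" "0 \<in> Z" for x y a
    using D(1) by (auto simp: submod_def)
  have coset: "?H +>\<^bsub>M\<^esub> \<theta> x = {\<theta> (w + x) | w. w \<in> W}" if x: "x \<in> Z" for x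
  proof -
    have "\<theta> w \<oplus>\<^bsub>M\<^esub> \<theta> x = \<theta> (w + x)" if "w \<in> W" for w using D(6) W(3) x that by auto
    then have "(\<Union>w\<in>W. {\<theta> w \<oplus>\<^bsub>M\<^esub> \<theta> x}) = (\<Union>w\<in>W. {\<theta> (w + x)})" by simp
    then show ?thesis by (auto simp: a_r_coset_def r_coset_def)
  qed
  have W_add: "w \<in> W \<Longrightarrow> w' \<in> W \<Longrightarrow> w + w' \<in> W" and W_diff: "w \<in> W \<Longrightarrow> w' \<in> W \<Longrightarrow> w - w' \<in> W"
    and W_smul: "w \<in> W \<Longrightarrow> smul a w \<in> W" and W0: "0 \<in> W" for w w' a
    using W(1) submod_diff[OF W(1)] by (auto simp: submod_def)
  show ?thesis
  proof (rule presentsI[OF D(1) W(1,3)])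
    show "(\<lambda>x. ?H +>\<^bsub>M\<^esub> \<theta> x) ` Z = carrier (quot_mod M ?H)"
      unfolding quot_mod_def by (simp add: A_RCOSETS_def RCOSETS_def a_r_coset_def D(4)[symmetric]) blast
    show "?H +>\<^bsub>M\<^esub> \<theta> 0 = \<zero>\<^bsub>quot_mod M ?H\<^esub>"
      by (auto simp: coset[OF Z(3)] quot_mod_def)
    fix x assume x: "x \<in> Z"
    show "?H +>\<^bsub>M\<^esub> \<theta> (smul a x) = \<pi> a \<odot>\<^bsub>quot_mod M ?H\<^esub> (?H +>\<^bsub>M\<^esub> \<theta> x)" for a
    proof -
      have *: "?H +>\<^bsub>M\<^esub> (\<pi> a \<odot>\<^bsub>M\<^esub> \<theta> (w + x)) = ?H +>\<^bsub>M\<^esub> \<theta> (smul a x)" if w: "w \<in> W" for w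
      proof -
        have wx: "w + x \<in> Z" using Z w x W(3) by blast
        have "{\<theta> (v + smul a (w + x)) |v. v \<in> W} = {\<theta> (v + smul a x) |v. v \<in> W}" (is "?A = ?B")
        proof (intro equalityI subsetI)
          fix u assume "u \<in> ?A"
          then obtain v where v: "v \<in> W" "u = \<theta> (v + smul a (w + x))" by blast
          then have "u = \<theta> ((v + smul a w) + smul a x)" by (simp add: smul_simps add.assoc)
          then show "u \<in> ?B" using W_add W_smul w v by blast
        next
          fix u assume "u \<in> ?B"
          then obtain v where v: "v \<in> W" "u = \<theta> (v + smul a x)" by blast
          then have "u = \<theta> ((v - smul a w) + smul a (w + x))" by (simp add: smul_simps)
          then show "u \<in> ?A" using W_diff W_smul w v by blast
        qed
        then show ?thesis using D(7)[OF wx, of a, symmetric] Z wx x by (simp add: coset)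
      qed
      have "\<pi> a \<odot>\<^bsub>quot_mod M ?H\<^esub> (?H +>\<^bsub>M\<^esub> \<theta> x) =
          (\<Union>w\<in>W. ?H +>\<^bsub>M\<^esub> (\<pi> a \<odot>\<^bsub>M\<^esub> \<theta> (w + x)))"
        by (auto simp: quot_mod_def coset[OF x])
      also have "\<dots> = ?H +>\<^bsub>M\<^esub> \<theta> (smul a x)" using * W0 by auto
      finally show ?thesis ..
    qed
    fix y assume y: "y \<in> Z"
    show "?H +>\<^bsub>M\<^esub> \<theta> (x + y) = (?H +>\<^bsub>M\<^esub> \<theta> x) \<oplus>\<^bsub>quot_mod M ?H\<^esub> (?H +>\<^bsub>M\<^esub> \<theta> y)"
    proof -
      have "{\<theta> (v + (x + y)) |v. v \<in> W} = {\<theta> (v + x) \<oplus>\<^bsub>M\<^esub> \<theta> (w + y) |v w. v \<in> W \<and> w \<in> W}" (is "?A = ?B")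
      proof (intro equalityI subsetI)
        fix u assume "u \<in> ?A"
        then obtain v where v: "v \<in> W" "u = \<theta> (v + (x + y))" by blast
        have "\<theta> (v + x) \<oplus>\<^bsub>M\<^esub> \<theta> (0 + y) = u"
          using D(6)[of "v + x" "0 + y"] Z v W(3) x y by (auto simp: add.assoc)
        then show "u \<in> ?B" using v W0 by blast
      next
        fix u assume "u \<in> ?B"
        then obtain v w where v: "v \<in> W" "w \<in> W" "u = \<theta> (v + x) \<oplus>\<^bsub>M\<^esub> \<theta> (w + y)" by blast
        have "v + x \<in> Z" "w + y \<in> Z" using Z(1) v x y W(3) by blast+
        then have "u = \<theta> ((v + x) + (w + y))" using D(6) v(3) by simp
        then have "u = \<theta> ((v + w) + (x + y))" by (simp add: algebra_simps)
        then show "u \<in> ?A" using W_add v by blast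
      qed
      then show ?thesis
        using Z x y by (auto simp: quot_mod_def set_add_def set_mult_def coset)
    qed
    show "(?H +>\<^bsub>M\<^esub> \<theta> x = ?H +>\<^bsub>M\<^esub> \<theta> y) \<longleftrightarrow> x - y \<in> W"
    proof
      assume "?H +>\<^bsub>M\<^esub> \<theta> x = ?H +>\<^bsub>M\<^esub> \<theta> y"
      moreover have "\<theta> x \<in> ?H +>\<^bsub>M\<^esub> \<theta> x"
        unfolding coset[OF x] using W0 by (intro CollectI exI[of _ 0]) simp
      ultimately obtain w where w: "w \<in> W" "\<theta> x = \<theta> (w + y)" using coset[OF y] by auto
      then have "x - (w + y) \<in> W" using D(8)[OF x Z(1)[OF _ y]] W by blast
      then have "(x - (w + y)) + w \<in> W" using W_add w by blast
      then show "x - y \<in> W" by (simp add: algebra_simps)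
    next
      assume xy: "x - y \<in> W"
      have "{\<theta> (v + x) |v. v \<in> W} = {\<theta> (v + y) |v. v \<in> W}" (is "?A = ?B")
      proof (intro equalityI subsetI)
        fix u assume "u \<in> ?A"
        then obtain v where v: "v \<in> W" "u = \<theta> (v + x)" by blast
        then have "u = \<theta> ((v + (x - y)) + y)" by simp
        then show "u \<in> ?B" using W_add v xy by blast
      next
        fix u assume "u \<in> ?B"
        then obtain v where v: "v \<in> W" "u = \<theta> (v + y)" by blast
        then have "u = \<theta> ((v - (x - y)) + x)" by simp
        then show "u \<in> ?A" using W_diff v xy by blast
      qed
      then show "?H +>\<^bsub>M\<^esub> \<theta> x = ?H +>\<^bsub>M\<^esub> \<theta> y" using x y by (simp add: coset)
    qed
  qed
qed

text \<open>A linear map of vectors that respects the relations induces a homomorphism of the presented modules.\<close>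

lemma presents_hom:
  assumes R: "ring_cover R \<pi>" and P: "presents \<pi> M Z N \<theta>" and P': "presents \<pi> M' Z' N' \<theta>'"
    and G: "lin G" "\<And>x. x \<in> Z \<Longrightarrow> G x \<in> Z'" "\<And>x. x \<in> N \<Longrightarrow> G x \<in> N'"
  shows "\<exists>g. g \<in> module_hom R M M' \<and> (\<forall>x\<in>Z. g (\<theta> x) = \<theta>' (G x))"
proof -
  interpret ring_cover R \<pi> by fact
  note D = presentsD[OF P] and D' = presentsD[OF P']
  define g where "g u = \<theta>' (G (SOME x. x \<in> Z \<and> u = \<theta> x))" for u
  have g: "g (\<theta> x) = \<theta>' (G x)" if x: "x \<in> Z" for x
  proof -
    let ?x = "SOME z. z \<in> Z \<and> \<theta> x = \<theta> z"
    have *: "?x \<in> Z \<and> \<theta> x = \<theta> ?x" by (rule someI[of _ x]) (use x in simp)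
    then have "?x - x \<in> N" using D(8) x by metis
    then have "G ?x - G x \<in> N'" using G(3) by (metis lin_diff[OF G(1)])
    then show ?thesis unfolding g_def using D'(8) G(2) x * by blast
  qed
  have Z: "x \<in> Z \<Longrightarrow> y \<in> Z \<Longrightarrow> x + y \<in> Z" "x \<in> Z \<Longrightarrow> smul a x \<in> Z" for x y a
    using D(1) by (auto simp: submod_def)
  have "g \<in> module_hom R M M'"
    unfolding module_hom_def
  proof (intro CollectI conjI ballI Pi_I)
    fix u assume "u \<in> carrier M"
    then obtain x where x: "x \<in> Z" "u = \<theta> x" by (rule presents_carrier[OF P])
    show "g u \<in> carrier M'" using x g G(2) D'(9) by simp
    fix v assume "v \<in> carrier M"
    then obtain y where y: "y \<in> Z" "v = \<theta> y" by (rule presents_carrier[OF P])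
    show "g (u \<oplus>\<^bsub>M\<^esub> v) = g u \<oplus>\<^bsub>M'\<^esub> g v"
      using x y g[OF Z(1)[OF x(1) y(1)]] g G(2) by (simp add: D(6)[symmetric] D'(6)[symmetric] lin_add[OF G(1)])
  next
    fix r u assume "r \<in> carrier R" "u \<in> carrier M"
    then obtain a x where x: "x \<in> Z" "u = \<theta> x" "r = \<pi> a" using surj presents_carrier[OF P] by metis
    show "g (r \<odot>\<^bsub>M\<^esub> u) = r \<odot>\<^bsub>M'\<^esub> g u"
      using x g[OF Z(2)[OF x(1)]] g G(2) by (simp add: D(7)[symmetric] D'(7)[symmetric] lin_smul[OF G(1)])
  qed
  then show ?thesis using g by blast
qed

text \<open>Conversely, a homomorphism from a module generated by the vectors on \<open>X\<close> lifts to a linear map, and the lifts of the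
  images of the generators can be prescribed. The prescription is used for lifts that preserve a filtration.\<close>

lemma presents_lift_basis:
  fixes \<pi> :: "'p::comm_ring_1 \<Rightarrow> 'r" and X :: "'i set"
  assumes R: "ring_cover R \<pi>" and P: "presents \<pi> M (vec X) N \<theta>" and P': "presents \<pi> M' Z' N' \<theta>'"
    and g: "g \<in> module_hom R M M'"
    and v: "\<And>i. i \<in> X \<Longrightarrow> v i \<in> Z'" "\<And>i. i \<in> X \<Longrightarrow> \<theta>' (v i) = g (\<theta> (bas i))"
    and x: "x \<in> vec X"
  shows "linext v x \<in> Z'" "\<theta>' (linext v x) = g (\<theta> x)"
proof -
  interpret ring_cover R \<pi> by fact
  interpret M': module R M' by (rule presents_module[OF R P'])
  note D = presentsD[OF P] and D' = presentsD[OF P']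
  let ?W = "{x \<in> vec X. linext v x \<in> Z' \<and> \<theta>' (linext v x) = g (\<theta> x)}"
  have GZ: "linext v x \<in> Z'" if "x \<in> vec X" for x
    by (rule lin_vec_submod[OF lin_linext D'(1) _ that]) (simp add: v(1))
  have hom: "g (u \<oplus>\<^bsub>M\<^esub> w) = g u \<oplus>\<^bsub>M'\<^esub> g w" "g (r \<odot>\<^bsub>M\<^esub> u) = r \<odot>\<^bsub>M'\<^esub> g u"
    if "u \<in> carrier M" "w \<in> carrier M" "r \<in> carrier R" for u w r
    using g that by (auto simp: module_hom_def)
  have sub: "submod ?W"
    unfolding submod_def
  proof (intro conjI ballI allI)
    have "g (\<theta> 0) = \<theta>' 0"
    proof -
      have "\<theta> (smul 0 0) = \<pi> 0 \<odot>\<^bsub>M\<^esub> \<theta> 0" by (rule D(7)[OF vec_zero])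
      moreover have "g (\<theta> 0) \<in> carrier M'" using g D(9)[OF vec_zero] by (auto simp: module_hom_def)
      ultimately have "g (\<theta> 0) = \<zero>\<^bsub>M'\<^esub>"
        using hom(2)[of "\<theta> 0" "\<theta> 0" "\<pi> 0"] D(9)[OF vec_zero] by (simp add: smul_simps zero)
      then show ?thesis using D'(5) by simp
    qed
    then show "0 \<in> ?W" using GZ[OF vec_zero] by (simp add: vec_zero lin_0[OF lin_linext])
    fix x assume x: "x \<in> ?W"
    then show "smul a x \<in> ?W" for a
      using hom(2)[of "\<theta> x" "\<theta> x" "\<pi> a"] D(9) GZ[of "smul a x"] vec_smul[of x X a]
      by (simp add: lin_smul[OF lin_linext] D(7) D'(7))
    fix y assume y: "y \<in> ?W"
    then show "x + y \<in> ?W"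
      using hom(1)[of "\<theta> x" "\<theta> y" "\<zero>\<^bsub>R\<^esub>"] D(9) GZ[of "x + y"] vec_add[of x X y] x
      by (simp add: lin_add[OF lin_linext] D(6) D'(6))
  qed
  have "x \<in> ?W"
    by (rule lin_vec_submod[OF lin_id sub _ x]) (simp add: bas_vec v)
  then show "linext v x \<in> Z'" "\<theta>' (linext v x) = g (\<theta> x)" by auto
qed

lemma presents_lift:
  fixes \<pi> :: "'p::comm_ring_1 \<Rightarrow> 'r" and X :: "'i set"
  assumes R: "ring_cover R \<pi>" and P: "presents \<pi> M (vec X) N \<theta>" and P': "presents \<pi> M' Z' N' \<theta>'"
    and g: "g \<in> module_hom R M M'"
  shows "\<exists>G. lin G \<and> (\<forall>x\<in>vec X. G x \<in> Z' \<and> \<theta>' (G x) = g (\<theta> x))"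
proof -
  have "\<exists>v. v \<in> Z' \<and> \<theta>' v = g (\<theta> (bas i))" if "i \<in> X" for i
  proof -
    have "g (\<theta> (bas i)) \<in> carrier M'"
      using g presentsD(9)[OF P] that by (auto simp: module_hom_def bas_vec)
    then show ?thesis using presents_carrier[OF P'] by metis
  qed
  then obtain v where v: "\<And>i. i \<in> X \<Longrightarrow> v i \<in> Z'" "\<And>i. i \<in> X \<Longrightarrow> \<theta>' (v i) = g (\<theta> (bas i))" by metis
  then show ?thesis using lin_linext presents_lift_basis[OF R P P' g v] by blast
qed

lemma presents_reindex:
  fixes \<pi> :: "'p::comm_ring_1 \<Rightarrow> 'r" and X :: "'i set" and Y :: "'j set"
  assumes P: "presents \<pi> M (vec X) (vec X \<inter> vmod J) \<theta>" and e: "bij_betw e Y X" and J: "is_ideal J"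
  shows "presents \<pi> M (vec Y) (vec Y \<inter> vmod J) (\<lambda>x. \<theta> (linext (\<lambda>j. bas (e j)) x))"
proof -
  let ?E = "linext (\<lambda>j. bas (e j)) :: ('j \<Rightarrow>\<^sub>0 'p) \<Rightarrow> _" and ?E' = "linext (\<lambda>i. bas (the_inv_into Y e i)) :: ('i \<Rightarrow>\<^sub>0 'p) \<Rightarrow> _"
  note D = presentsD[OF P]
  have E: "?E x \<in> vec X" if "x \<in> vec Y" for x
    by (rule lin_vec_submod[OF lin_linext submod_vec _ that]) (use e in \<open>auto simp: bas_vec bij_betw_def\<close>)
  have E': "?E' x \<in> vec Y" if "x \<in> vec X" for x
    by (rule lin_vec_submod[OF lin_linext submod_vec _ that])
      (use bij_betwE[OF bij_betw_the_inv_into[OF e]] in \<open>auto simp: bas_vec\<close>)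
  have EE': "?E (?E' x) = x" if "x \<in> vec X" for x
    by (rule lin_vec_eq[OF lin_comp[OF lin_linext lin_linext] lin_id _ that])
      (use e in \<open>simp add: f_the_inv_into_f_bij_betw\<close>)
  have E'E: "?E' (?E x) = x" if "x \<in> vec Y" for x
    by (rule lin_vec_eq[OF lin_comp[OF lin_linext lin_linext] lin_id _ that])
      (use e in \<open>simp add: bij_betw_def the_inv_into_f_f\<close>)
  show ?thesis
  proof (rule presentsI)
    show "submod (vec Y :: ('j \<Rightarrow>\<^sub>0 'p) set)" by (rule submod_vec)
    show "submod (vec Y \<inter> vmod J :: ('j \<Rightarrow>\<^sub>0 'p) set)" by (rule submod_Int[OF submod_vec submod_vmod[OF J]])
    have "?E ` vec Y = vec X" using E E' EE' by (metis (no_types, lifting) image_eqI image_subsetI subsetI subset_antisym)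
    then show "(\<lambda>x. \<theta> (?E x)) ` vec Y = carrier M" using D(4) by (metis image_image)
    show "\<theta> (?E 0) = \<zero>\<^bsub>M\<^esub>" using D(5) by (simp add: lin_0[OF lin_linext])
    fix x :: "'j \<Rightarrow>\<^sub>0 'p" assume x: "x \<in> vec Y"
    show "\<theta> (?E (smul a x)) = \<pi> a \<odot>\<^bsub>M\<^esub> \<theta> (?E x)" for a using D(7) E x by (simp add: lin_smul[OF lin_linext])
    fix y :: "'j \<Rightarrow>\<^sub>0 'p" assume y: "y \<in> vec Y"
    show "\<theta> (?E (x + y)) = \<theta> (?E x) \<oplus>\<^bsub>M\<^esub> \<theta> (?E y)" using D(6) E x y by (simp add: lin_add[OF lin_linext])
    have "\<theta> (?E x) = \<theta> (?E y) \<longleftrightarrow> ?E (x - y) \<in> vec X \<inter> vmod J"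
      using D(8) E x y by (simp add: lin_diff[OF lin_linext])
    also have "\<dots> \<longleftrightarrow> x - y \<in> vec Y \<inter> vmod J"
      using E[OF vec_diff[OF x y]] E'E[OF vec_diff[OF x y]] vec_diff[OF x y]
        lin_vmod[OF lin_linext J, of "x - y"] lin_vmod[OF lin_linext J, of "?E (x - y)"] by (metis IntD2 IntI)
    finally show "\<theta> (?E x) = \<theta> (?E y) \<longleftrightarrow> x - y \<in> vec Y \<inter> vmod J" .
  qed auto
qed

lemma presents_free_mod:
  fixes \<pi> :: "'p::comm_ring_1 \<Rightarrow> 'r" and X :: "'b set"
  assumes R: "ring_cover R \<pi>"
  shows "presents \<pi> (free_mod R X) (vec X) (vec X \<inter> vmod {a. \<pi> a = \<zero>\<^bsub>R\<^esub>}) (\<lambda>x j. \<pi> (lookup x j))"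
proof -
  interpret ring_cover R \<pi> by fact
  have id: "is_ideal {a. \<pi> a = \<zero>\<^bsub>R\<^esub>}"
    using is_ideal_pre[OF zeroideal] by (simp add: pre_def)
  show ?thesis
  proof (rule presentsI)
    show "submod (vec X :: ('b \<Rightarrow>\<^sub>0 'p) set)" by (rule submod_vec)
    show "submod (vec X \<inter> vmod {a. \<pi> a = \<zero>\<^bsub>R\<^esub>} :: ('b \<Rightarrow>\<^sub>0 'p) set)"
      by (rule submod_Int[OF submod_vec submod_vmod[OF id]])
    show "(\<lambda>x j. \<pi> (lookup x j)) ` vec X = carrier (free_mod R X)"
    proof (intro equalityI subsetI)
      fix u assume "u \<in> (\<lambda>x j. \<pi> (lookup x j)) ` vec X"
      then obtain x where x: "x \<in> vec X" "u = (\<lambda>j. \<pi> (lookup x j))" by blast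
      have "{j. u j \<noteq> \<zero>\<^bsub>R\<^esub>} \<subseteq> keys x" using x(2) by (auto simp: in_keys_iff zero)
      then show "u \<in> carrier (free_mod R X)"
        using x finite_subset[OF _ finite_keys[of x]] by (auto simp: free_mod_def vec_def)
    next
      fix u assume u: "u \<in> carrier (free_mod R X)"
      let ?A = "{j. u j \<noteq> \<zero>\<^bsub>R\<^esub>}"
      have fin: "finite ?A" "?A \<subseteq> X" using u by (auto simp: free_mod_def)
      have "\<exists>a. \<pi> a = u j" for j using u surj by (auto simp: free_mod_def)
      then obtain a where a: "\<And>j. \<pi> (a j) = u j" by metis
      define x where "x = (\<Sum>j\<in>?A. smul (a j) (bas j))"
      have l: "lookup x j = (if j \<in> ?A then a j else 0)" for j
        using fin by (simp add: x_def lookup_sum' lookup_bas if_distrib[where f = "(*) _"] sum.delta cong: if_cong)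
      have "x \<in> vec X" using fin(2) by (auto simp: vec_iff l)
      moreover have "u = (\<lambda>j. \<pi> (lookup x j))" by (auto simp: l a zero)
      ultimately show "u \<in> (\<lambda>x j. \<pi> (lookup x j)) ` vec X" by blast
    qed
    show "(\<lambda>j. \<pi> (lookup 0 j)) = \<zero>\<^bsub>free_mod R X\<^esub>" by (simp add: free_mod_def zero)
    fix x y :: "'b \<Rightarrow>\<^sub>0 'p" assume xy: "x \<in> vec X" "y \<in> vec X"
    show "(\<lambda>j. \<pi> (lookup (x + y) j)) = (\<lambda>j. \<pi> (lookup x j)) \<oplus>\<^bsub>free_mod R X\<^esub> (\<lambda>j. \<pi> (lookup y j))"
      by (simp add: free_mod_def lookup_add add)
    show "(\<lambda>j. \<pi> (lookup (smul a x) j)) = \<pi> a \<odot>\<^bsub>free_mod R X\<^esub> (\<lambda>j. \<pi> (lookup x j))" for a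
      by (simp add: free_mod_def mult)
    show "((\<lambda>j. \<pi> (lookup x j)) = (\<lambda>j. \<pi> (lookup y j))) \<longleftrightarrow> x - y \<in> vec X \<inter> vmod {a. \<pi> a = \<zero>\<^bsub>R\<^esub>}"
      using vec_diff[OF xy] by (auto simp: fun_eq_iff vmod_def lookup_minus eq_iff pre_def)
  qed auto
qed

lemma presents_submodule:
  assumes R: "ring_cover R \<pi>" and P: "presents \<pi> M Z N \<theta>" and W: "submod W" "W \<subseteq> Z"
  shows "submodule (\<theta> ` W) R M"
proof -
  interpret R: ring_cover R \<pi> by fact
  interpret module R M by (rule presents_module[OF R P])
  note D = presentsD[OF P]
  have WZ: "w \<in> W \<Longrightarrow> w \<in> Z" for w using W(2) by blast
  show ?thesis
  proof (intro submodule.intro subgroup.intro submodule_axioms.intro)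
    show "\<theta> ` W \<subseteq> carrier (add_monoid M)" using D(9) WZ by auto
    have "\<theta> 0 \<in> \<theta> ` W" using W(1) by (auto simp: submod_def)
    then show "\<one>\<^bsub>add_monoid M\<^esub> \<in> \<theta> ` W" using D(5) by simp
    fix u assume "u \<in> \<theta> ` W"
    then obtain w where w: "w \<in> W" "u = \<theta> w" by blast
    have "0 - w \<in> W" by (rule submod_diff[OF W(1)]) (use W(1) w in \<open>auto simp: submod_def\<close>)
    moreover have "\<theta> (0 - w) = \<ominus>\<^bsub>M\<^esub> u"
    proof -
      have "\<theta> 0 = \<theta> (0 - w) \<oplus>\<^bsub>M\<^esub> \<theta> w" using D(6)[of "0 - w" w] WZ calculation w by simp
      then show ?thesis using D(5) D(9) WZ w calculation M.minus_equality by metis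
    qed
    ultimately show "inv\<^bsub>add_monoid M\<^esub> u \<in> \<theta> ` W" by (metis a_inv_def imageI)
    fix v assume "v \<in> \<theta> ` W"
    then obtain x where x: "x \<in> W" "v = \<theta> x" by blast
    have "w + x \<in> W" using W(1) w x by (simp add: submod_def)
    moreover have "u \<oplus>\<^bsub>M\<^esub> v = \<theta> (w + x)" using D(6) WZ w x by simp
    ultimately show "u \<otimes>\<^bsub>add_monoid M\<^esub> v \<in> \<theta> ` W" by simp
  next
    fix r u assume "r \<in> carrier R" "u \<in> \<theta> ` W"
    then obtain a w where w: "w \<in> W" "u = \<theta> w" "r = \<pi> a" using R.surj by blast
    have "smul a w \<in> W" using W(1) w by (simp add: submod_def)
    moreover have "r \<odot>\<^bsub>M\<^esub> u = \<theta> (smul a w)" using D(7) WZ w by simp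
    ultimately show "r \<odot>\<^bsub>M\<^esub> u \<in> \<theta> ` W" by simp
  qed
qed

lemma presents_vimage:
  assumes R: "ring_cover R \<pi>" and P: "presents \<pi> M Z N \<theta>" and H: "submodule H R M"
  defines "W \<equiv> {x \<in> Z. \<theta> x \<in> H}"
  shows "submod W" "N \<subseteq> W" "W \<subseteq> Z" "\<theta> ` W = H"
proof -
  interpret R: ring_cover R \<pi> by fact
  interpret module R M by (rule presents_module[OF R P])
  interpret H: submodule H R M by fact
  note D = presentsD[OF P]
  have zeroH: "\<zero>\<^bsub>M\<^esub> \<in> H" using H.one_closed by simp
  have Hsub: "H \<subseteq> carrier M" using H.subset by simp
  show "submod W"
    unfolding submod_def W_def
    using D(1) D(5) D(6) D(7) zeroH H.m_closed H.smult_closed by (auto simp: submod_def)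
  show "N \<subseteq> W"
  proof
    fix x assume "x \<in> N"
    moreover from this have "x \<in> Z" by (rule subsetD[OF D(3)])
    moreover from this have "\<theta> x = \<zero>\<^bsub>M\<^esub>" using D(10)[of x] \<open>x \<in> N\<close> by simp
    ultimately show "x \<in> W" using zeroH by (simp add: W_def)
  qed
  show "W \<subseteq> Z" by (auto simp: W_def)
  show "\<theta> ` W = H"
  proof
    show "H \<subseteq> \<theta> ` W"
    proof
      fix u assume u: "u \<in> H"
      then obtain x where "x \<in> Z" "u = \<theta> x" using presents_carrier[OF P] Hsub by blast
      then show "u \<in> \<theta> ` W" using u by (auto simp: W_def)
    qed
  qed (auto simp: W_def)
qed

lemma mod_span_submodule:
  assumes M: "module R M" and G: "G \<subseteq> carrier M"
  shows "submodule (mod_span R M G) R M"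
proof -
  interpret module R M by fact
  have carr: "submodule (carrier M) R M"
    by (intro submodule.intro submodule_axioms.intro M.add.subgroup_self) auto
  have a_inv: "inv\<^bsub>add_monoid M\<^esub> u \<in> H" if "submodule H R M" "u \<in> H" for H u
    using that by (auto simp: submodule_def subgroup_def)
  show ?thesis
    unfolding mod_span_def
  proof (intro submodule.intro subgroup.intro submodule_axioms.intro)
    show "\<Inter> {H. submodule H R M \<and> G \<subseteq> H} \<subseteq> carrier (add_monoid M)" using carr G by auto
  qed (auto simp: a_inv submodule_def subgroup_def submodule_axioms_def)
qed

lemma mod_span_incl: "G \<subseteq> mod_span R M G"
  by (auto simp: mod_span_def)

lemma mod_span_least: "submodule H R M \<Longrightarrow> G \<subseteq> H \<Longrightarrow> mod_span R M G \<subseteq> H"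
  by (auto simp: mod_span_def)

text \<open>The multiples of basis vectors by elements of \<open>J\<close> generate \<open>vec X \<inter> vmod J\<close>.\<close>

lemma vec_vmod_induct:
  assumes "submod W" "\<And>i a. i \<in> X \<Longrightarrow> a \<in> J \<Longrightarrow> smul a (bas i) \<in> W" "x \<in> vec X" "x \<in> vmod J"
  shows "x \<in> W"
proof -
  have "(\<Sum>i\<in>keys x. smul (lookup x i) (bas i)) \<in> W"
    using assms(2-4) by (intro submod_sum[OF assms(1)]) (auto simp: vec_def vmod_def)
  then show ?thesis by (simp add: vec_expand[symmetric])
qed

section \<open>Extension of scalars along a surjection\<close>

text \<open>For a surjection \<open>\<phi>\<close> with kernel \<open>I\<close>, every element of \<open>K \<otimes> M\<close> has the form \<open>1 \<otimes> x\<close>, and \<open>K \<otimes> M = M/IM\<close>.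
  For a free module \<open>M\<close> this means that the vectors stay the same and only the ideal of relations grows, from
  \<open>ker_R\<close> to \<open>ker_K\<close>.\<close>

locale scalar_extension =
  R: ring_cover R \<pi> + K: ring_cover K \<kappa>
  for R :: "('r, 'x) ring_scheme" and \<pi> :: "'p::comm_ring_1 \<Rightarrow> 'r"
    and K :: "('k, 'z) ring_scheme" and \<kappa> :: "'p \<Rightarrow> 'k" +
  fixes \<phi> :: "'r \<Rightarrow> 'k"
  assumes \<phi>: "\<kappa> a = \<phi> (\<pi> a)"
begin

abbreviation ker_R :: "'p set" where "ker_R \<equiv> {a. \<pi> a = \<zero>\<^bsub>R\<^esub>}"
abbreviation ker_K :: "'p set" where "ker_K \<equiv> {a. \<kappa> a = \<zero>\<^bsub>K\<^esub>}"

lemma is_ideal_ker_K: "is_ideal ker_K"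
  using K.is_ideal_pre[OF K.zeroideal] by (simp add: K.pre_def)

lemma is_ideal_ker_R: "is_ideal ker_R"
  using R.is_ideal_pre[OF R.zeroideal] by (simp add: R.pre_def)

lemma ker_sub: "ker_R \<subseteq> ker_K"
  using \<phi> R.zero K.zero by (metis (mono_tags, lifting) Collect_mono)

context
  fixes M :: "('r, 'a, 'y) module_scheme" and X :: "'i set" and \<theta>
  assumes P: "presents \<pi> M (vec X) (vec X \<inter> vmod ker_R) \<theta>"
begin

text \<open>The free module on all pairs \<open>(k, v)\<close>, of which the tensor product is a quotient, is itself presented by vectors:
  \<open>\<tau>\<close> is its presentation, and \<open>\<omega>\<close> below is the resulting presentation of the tensor product.\<close>

abbreviation "pairs \<equiv> carrier (alg_mod K \<phi>) \<times> carrier M"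

abbreviation "\<tau> \<equiv> (\<lambda>(x :: ('k \<times> 'a) \<Rightarrow>\<^sub>0 'p) j. \<pi> (lookup x j))"

abbreviation "pure \<equiv> tensor_pure R (alg_mod K \<phi>) M"

abbreviation "T \<equiv> tensor R (alg_mod K \<phi>) M"

lemma free_pairs:
  "presents \<pi> (free_mod R pairs) (vec pairs) (vec pairs \<inter> vmod ker_R) \<tau>"
  by (rule presents_free_mod[OF R.ring_cover_axioms])

lemma \<tau>_bas: "\<tau> (bas (k, v)) = free_gen R (k, v)"
  by (auto simp: free_gen_def lookup_bas R.one R.zero)

lemma pair_bas: "k \<in> carrier K \<Longrightarrow> v \<in> carrier M \<Longrightarrow> bas (k, v) \<in> vec pairs"
  by (simp add: bas_vec alg_mod_def)

definition rel_add_left :: "'k \<Rightarrow> 'k \<Rightarrow> 'a \<Rightarrow> ('k \<times> 'a) \<Rightarrow>\<^sub>0 'p"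
  where "rel_add_left k k' v = bas (k \<oplus>\<^bsub>K\<^esub> k', v) - (bas (k, v) + bas (k', v))"

definition rel_add_right :: "'k \<Rightarrow> 'a \<Rightarrow> 'a \<Rightarrow> ('k \<times> 'a) \<Rightarrow>\<^sub>0 'p"
  where "rel_add_right k v v' = bas (k, v \<oplus>\<^bsub>M\<^esub> v') - (bas (k, v) + bas (k, v'))"

definition rel_smult_left :: "'p \<Rightarrow> 'k \<Rightarrow> 'a \<Rightarrow> ('k \<times> 'a) \<Rightarrow>\<^sub>0 'p"
  where "rel_smult_left a k v = bas (\<kappa> a \<otimes>\<^bsub>K\<^esub> k, v) - smul a (bas (k, v))"

definition rel_smult_right :: "'p \<Rightarrow> 'k \<Rightarrow> 'a \<Rightarrow> ('k \<times> 'a) \<Rightarrow>\<^sub>0 'p"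
  where "rel_smult_right a k v = bas (k, \<pi> a \<odot>\<^bsub>M\<^esub> v) - smul a (bas (k, v))"

lemma tensor_rels_eq:
  "tensor_rels R (alg_mod K \<phi>) M =
    {\<tau> (rel_add_left k k' v) | k k' v. k \<in> carrier K \<and> k' \<in> carrier K \<and> v \<in> carrier M} \<union>
    {\<tau> (rel_add_right k v v') | k v v'. k \<in> carrier K \<and> v \<in> carrier M \<and> v' \<in> carrier M} \<union>
    {\<tau> (rel_smult_left a k v) | a k v. k \<in> carrier K \<and> v \<in> carrier M} \<union>
    {\<tau> (rel_smult_right a k v) | a k v. k \<in> carrier K \<and> v \<in> carrier M}"
  (is "_ = ?A \<union> ?B \<union> ?C \<union> ?D")
proof -
  interpret M: module R M by (rule presents_module[OF R.ring_cover_axioms P])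
  let ?F = "free_mod R pairs"
  let ?e = "\<lambda>k v. free_gen R (k, v)"
  note D = presentsD[OF free_pairs]
  note diff = presents_diff[OF R.ring_cover_axioms free_pairs]
  have e: "\<tau> (bas (k, v)) = ?e k v" for k v by (rule \<tau>_bas)
  have pb: "k \<in> carrier K \<Longrightarrow> v \<in> carrier M \<Longrightarrow> bas (k, v) \<in> vec pairs" for k v by (rule pair_bas)
  have sum: "\<tau> (bas (k, v) - (bas (k', v') + bas (k'', v''))) = ?e k v \<ominus>\<^bsub>?F\<^esub> (?e k' v' \<oplus>\<^bsub>?F\<^esub> ?e k'' v'')"
    if "k \<in> carrier K" "k' \<in> carrier K" "k'' \<in> carrier K" "v \<in> carrier M" "v' \<in> carrier M" "v'' \<in> carrier M"
    for k k' k'' v v' v''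
    using diff[OF pb vec_add[OF pb pb]] D(6)[OF pb pb] that unfolding e by simp
  have scal: "\<tau> (bas (k, v) - smul a (bas (k', v'))) = ?e k v \<ominus>\<^bsub>?F\<^esub> (\<pi> a \<odot>\<^bsub>?F\<^esub> ?e k' v')"
    if "k \<in> carrier K" "k' \<in> carrier K" "v \<in> carrier M" "v' \<in> carrier M" for k k' v v' a
    using diff[OF pb vec_smul[OF pb]] D(7)[OF pb] that unfolding e by simp
  have A: "{?e (k \<oplus>\<^bsub>K\<^esub> k') v \<ominus>\<^bsub>?F\<^esub> (?e k v \<oplus>\<^bsub>?F\<^esub> ?e k' v) | k k' v.
      k \<in> carrier K \<and> k' \<in> carrier K \<and> v \<in> carrier M} = ?A"
    by (intro Collect_cong ex_cong1) (auto simp: rel_add_left_def sum)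
  have B: "{?e k (v \<oplus>\<^bsub>M\<^esub> v') \<ominus>\<^bsub>?F\<^esub> (?e k v \<oplus>\<^bsub>?F\<^esub> ?e k v') | k v v'.
      k \<in> carrier K \<and> v \<in> carrier M \<and> v' \<in> carrier M} = ?B"
    by (intro Collect_cong ex_cong1) (auto simp: rel_add_right_def sum)
  have C: "{?e (\<phi> r \<otimes>\<^bsub>K\<^esub> k) v \<ominus>\<^bsub>?F\<^esub> (r \<odot>\<^bsub>?F\<^esub> ?e k v) | r k v.
      r \<in> carrier R \<and> k \<in> carrier K \<and> v \<in> carrier M} = ?C" (is "?C' = _")
  proof (intro equalityI subsetI)
    fix u assume "u \<in> ?C'"
    then obtain r k v where u: "u = ?e (\<phi> r \<otimes>\<^bsub>K\<^esub> k) v \<ominus>\<^bsub>?F\<^esub> (r \<odot>\<^bsub>?F\<^esub> ?e k v)"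
      "r \<in> carrier R" "k \<in> carrier K" "v \<in> carrier M" by blast
    obtain a where "\<pi> a = r" using R.surj u(2) by blast
    then have "u = \<tau> (rel_smult_left a k v)" using u by (auto simp: rel_smult_left_def scal \<phi>[symmetric])
    then show "u \<in> ?C" using u by blast
  next
    fix u assume "u \<in> ?C"
    then obtain a k v where u: "u = \<tau> (rel_smult_left a k v)" "k \<in> carrier K" "v \<in> carrier M" by blast
    then have "u = ?e (\<phi> (\<pi> a) \<otimes>\<^bsub>K\<^esub> k) v \<ominus>\<^bsub>?F\<^esub> (\<pi> a \<odot>\<^bsub>?F\<^esub> ?e k v)"
      by (simp add: rel_smult_left_def scal \<phi>[symmetric])
    then show "u \<in> ?C'" using u R.closed by blast
  qed
  have D: "{?e k (r \<odot>\<^bsub>M\<^esub> v) \<ominus>\<^bsub>?F\<^esub> (r \<odot>\<^bsub>?F\<^esub> ?e k v) | r k v.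
      r \<in> carrier R \<and> k \<in> carrier K \<and> v \<in> carrier M} = ?D" (is "?D' = _")
  proof (intro equalityI subsetI)
    fix u assume "u \<in> ?D'"
    then obtain r k v where u: "u = ?e k (r \<odot>\<^bsub>M\<^esub> v) \<ominus>\<^bsub>?F\<^esub> (r \<odot>\<^bsub>?F\<^esub> ?e k v)"
      "r \<in> carrier R" "k \<in> carrier K" "v \<in> carrier M" by blast
    obtain a where "\<pi> a = r" using R.surj u(2) by blast
    then have "u = \<tau> (rel_smult_right a k v)" using u by (auto simp: rel_smult_right_def scal)
    then show "u \<in> ?D" using u by blast
  next
    fix u assume "u \<in> ?D"
    then obtain a k v where u: "u = \<tau> (rel_smult_right a k v)" "k \<in> carrier K" "v \<in> carrier M" by blast
    then have "u = ?e k (\<pi> a \<odot>\<^bsub>M\<^esub> v) \<ominus>\<^bsub>?F\<^esub> (\<pi> a \<odot>\<^bsub>?F\<^esub> ?e k v)"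
      by (simp add: rel_smult_right_def scal)
    then show "u \<in> ?D'" using u R.closed by blast
  qed
  have alg: "carrier (alg_mod K \<phi>) = carrier K" "add (alg_mod K \<phi>) = add K"
    "smult (alg_mod K \<phi>) = (\<lambda>r k. \<phi> r \<otimes>\<^bsub>K\<^esub> k)"
    by (simp_all add: alg_mod_def)
  show ?thesis
    unfolding A[symmetric] B[symmetric] C[symmetric] D[symmetric]
    by (simp only: tensor_rels_def Let_def alg)
qed

lemma rels_vec:
  "k \<in> carrier K \<Longrightarrow> k' \<in> carrier K \<Longrightarrow> v \<in> carrier M \<Longrightarrow> rel_add_left k k' v \<in> vec pairs"
  "k \<in> carrier K \<Longrightarrow> v \<in> carrier M \<Longrightarrow> v' \<in> carrier M \<Longrightarrow> rel_add_right k v v' \<in> vec pairs"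
  "k \<in> carrier K \<Longrightarrow> v \<in> carrier M \<Longrightarrow> rel_smult_left a k v \<in> vec pairs"
  "k \<in> carrier K \<Longrightarrow> v \<in> carrier M \<Longrightarrow> rel_smult_right a k v \<in> vec pairs"
proof -
  interpret M: module R M by (rule presents_module[OF R.ring_cover_axioms P])
  show "k \<in> carrier K \<Longrightarrow> k' \<in> carrier K \<Longrightarrow> v \<in> carrier M \<Longrightarrow> rel_add_left k k' v \<in> vec pairs"
    unfolding rel_add_left_def by (rule vec_diff[OF pair_bas vec_add[OF pair_bas pair_bas]]) simp_all
  show "k \<in> carrier K \<Longrightarrow> v \<in> carrier M \<Longrightarrow> v' \<in> carrier M \<Longrightarrow> rel_add_right k v v' \<in> vec pairs"
    unfolding rel_add_right_def by (rule vec_diff[OF pair_bas vec_add[OF pair_bas pair_bas]]) simp_all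
  show "k \<in> carrier K \<Longrightarrow> v \<in> carrier M \<Longrightarrow> rel_smult_left a k v \<in> vec pairs"
    unfolding rel_smult_left_def by (rule vec_diff[OF pair_bas vec_smul[OF pair_bas]]) simp_all
  show "k \<in> carrier K \<Longrightarrow> v \<in> carrier M \<Longrightarrow> rel_smult_right a k v \<in> vec pairs"
    unfolding rel_smult_right_def by (rule vec_diff[OF pair_bas vec_smul[OF pair_bas]]) simp_all
qed

lemma rel_cases:
  assumes "u \<in> tensor_rels R (alg_mod K \<phi>) M"
  obtains k k' v where "u = \<tau> (rel_add_left k k' v)" "k \<in> carrier K" "k' \<in> carrier K" "v \<in> carrier M"
  | k v v' where "u = \<tau> (rel_add_right k v v')" "k \<in> carrier K" "v \<in> carrier M" "v' \<in> carrier M"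
  | a k v where "u = \<tau> (rel_smult_left a k v)" "k \<in> carrier K" "v \<in> carrier M"
  | a k v where "u = \<tau> (rel_smult_right a k v)" "k \<in> carrier K" "v \<in> carrier M"
  using assms unfolding tensor_rels_eq by (elim UnE CollectE exE conjE) metis+

lemma rels_in_free: "tensor_rels R (alg_mod K \<phi>) M \<subseteq> carrier (free_mod R pairs)"
proof
  fix u assume "u \<in> tensor_rels R (alg_mod K \<phi>) M"
  then show "u \<in> carrier (free_mod R pairs)"
    by (cases rule: rel_cases) (simp_all only: presentsD(9)[OF free_pairs] rels_vec)
qed

lemma ker_submodule: "submodule (tensor_ker R (alg_mod K \<phi>) M) R (free_mod R pairs)"
  unfolding tensor_ker_def
  by (rule mod_span_submodule[OF presents_module[OF R.ring_cover_axioms free_pairs] rels_in_free])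

definition W :: "(('k \<times> 'a) \<Rightarrow>\<^sub>0 'p) set"
  where "W = {x \<in> vec pairs. \<tau> x \<in> tensor_ker R (alg_mod K \<phi>) M}"

definition \<omega> :: "(('k \<times> 'a) \<Rightarrow>\<^sub>0 'p) \<Rightarrow> ('k \<times> 'a \<Rightarrow> 'r) set"
  where "\<omega> x = tensor_ker R (alg_mod K \<phi>) M +>\<^bsub>free_mod R pairs\<^esub> \<tau> x"

lemma tensor_presents: "presents \<pi> T (vec pairs) W \<omega>"
proof -
  note V = presents_vimage[OF R.ring_cover_axioms free_pairs ker_submodule, folded W_def]
  show ?thesis
    using presents_quot[OF R.ring_cover_axioms free_pairs V(1,2,3)]
    by (simp add: V(4) tensor_def \<omega>_def[abs_def])
qed

lemma pure_eq: "pure k v = \<omega> (bas (k, v))"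
  by (simp add: tensor_pure_def \<omega>_def \<tau>_bas)

lemma W_rel: "\<tau> x \<in> tensor_rels R (alg_mod K \<phi>) M \<Longrightarrow> x \<in> vec pairs \<Longrightarrow> x \<in> W"
  by (simp add: W_def tensor_ker_def subsetD[OF mod_span_incl])

lemma pure_rules:
  assumes k: "k \<in> carrier K" and v: "v \<in> carrier M"
  shows "k' \<in> carrier K \<Longrightarrow> pure (k \<oplus>\<^bsub>K\<^esub> k') v = pure k v \<oplus>\<^bsub>T\<^esub> pure k' v"
    and "v' \<in> carrier M \<Longrightarrow> pure k (v \<oplus>\<^bsub>M\<^esub> v') = pure k v \<oplus>\<^bsub>T\<^esub> pure k v'"
    and "pure (\<kappa> a \<otimes>\<^bsub>K\<^esub> k) v = \<pi> a \<odot>\<^bsub>T\<^esub> pure k v"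
    and "pure k (\<pi> a \<odot>\<^bsub>M\<^esub> v) = \<pi> a \<odot>\<^bsub>T\<^esub> pure k v"
proof -
  interpret M: module R M by (rule presents_module[OF R.ring_cover_axioms P])
  note D = presentsD[OF tensor_presents]
  have pb: "k \<in> carrier K \<Longrightarrow> v \<in> carrier M \<Longrightarrow> bas (k, v) \<in> vec pairs" for k v by (rule pair_bas)
  have vd: "x \<in> vec pairs \<Longrightarrow> y \<in> vec pairs \<Longrightarrow> \<tau> (x - y) \<in> tensor_rels R (alg_mod K \<phi>) M \<Longrightarrow> \<omega> x = \<omega> y" for x y
    using W_rel vec_diff D(8) by blast
  show "pure (k \<oplus>\<^bsub>K\<^esub> k') v = pure k v \<oplus>\<^bsub>T\<^esub> pure k' v" if k': "k' \<in> carrier K"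
  proof -
    have "\<tau> (rel_add_left k k' v) \<in> tensor_rels R (alg_mod K \<phi>) M"
      unfolding tensor_rels_eq using k v k' by blast
    then have "\<omega> (bas (k \<oplus>\<^bsub>K\<^esub> k', v)) = \<omega> (bas (k, v) + bas (k', v))"
      unfolding rel_add_left_def using k k' v by (intro vd vec_add pb) auto
    then show ?thesis using D(6)[OF pb pb] k k' v by (simp add: pure_eq)
  qed
  show "pure k (v \<oplus>\<^bsub>M\<^esub> v') = pure k v \<oplus>\<^bsub>T\<^esub> pure k v'" if v': "v' \<in> carrier M"
  proof -
    have "\<tau> (rel_add_right k v v') \<in> tensor_rels R (alg_mod K \<phi>) M"
      unfolding tensor_rels_eq using k v v' by blast
    then have "\<omega> (bas (k, v \<oplus>\<^bsub>M\<^esub> v')) = \<omega> (bas (k, v) + bas (k, v'))"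
      unfolding rel_add_right_def using k v' v by (intro vd vec_add pb) auto
    then show ?thesis using D(6)[OF pb pb] k v' v by (simp add: pure_eq)
  qed
  show "pure (\<kappa> a \<otimes>\<^bsub>K\<^esub> k) v = \<pi> a \<odot>\<^bsub>T\<^esub> pure k v"
  proof -
    have "\<tau> (rel_smult_left a k v) \<in> tensor_rels R (alg_mod K \<phi>) M"
      unfolding tensor_rels_eq using k v by blast
    then have "\<omega> (bas (\<kappa> a \<otimes>\<^bsub>K\<^esub> k, v)) = \<omega> (smul a (bas (k, v)))"
      unfolding rel_smult_left_def using k v by (intro vd vec_smul pb) auto
    then show ?thesis using D(7)[OF pb] k v by (simp add: pure_eq)
  qed
  show "pure k (\<pi> a \<odot>\<^bsub>M\<^esub> v) = \<pi> a \<odot>\<^bsub>T\<^esub> pure k v"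
  proof -
    have "\<tau> (rel_smult_right a k v) \<in> tensor_rels R (alg_mod K \<phi>) M"
      unfolding tensor_rels_eq using k v by blast
    then have "\<omega> (bas (k, \<pi> a \<odot>\<^bsub>M\<^esub> v)) = \<omega> (smul a (bas (k, v)))"
      unfolding rel_smult_right_def using k v by (intro vd vec_smul pb) auto
    then show ?thesis using D(7)[OF pb] k v by (simp add: pure_eq)
  qed
qed

text \<open>Scalars move to the right factor; since \<open>\<kappa>\<close> is surjective, \<open>1 \<otimes> x\<close> is the general pure tensor.\<close>

lemma pure_shift:
  assumes x: "x \<in> vec X"
  shows "pure (\<kappa> a) (\<theta> x) = pure \<one>\<^bsub>K\<^esub> (\<theta> (smul a x))"
proof -
  note D = presentsD[OF P]
  have "pure (\<kappa> a \<otimes>\<^bsub>K\<^esub> \<one>\<^bsub>K\<^esub>) (\<theta> x) = pure \<one>\<^bsub>K\<^esub> (\<pi> a \<odot>\<^bsub>M\<^esub> \<theta> x)"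
    using pure_rules(3,4)[OF K.one_closed D(9)[OF x]] by simp
  then show ?thesis using D(7)[OF x] by simp
qed

lemma pure_one_add: "x \<in> vec X \<Longrightarrow> y \<in> vec X \<Longrightarrow>
    pure \<one>\<^bsub>K\<^esub> (\<theta> (x + y)) = pure \<one>\<^bsub>K\<^esub> (\<theta> x) \<oplus>\<^bsub>T\<^esub> pure \<one>\<^bsub>K\<^esub> (\<theta> y)"
  using presentsD(6,9)[OF P] pure_rules(2)[OF K.one_closed] by simp

lemma pure_one_smul: "x \<in> vec X \<Longrightarrow> pure \<one>\<^bsub>K\<^esub> (\<theta> (smul a x)) = \<pi> a \<odot>\<^bsub>T\<^esub> pure \<one>\<^bsub>K\<^esub> (\<theta> x)"
  using presentsD(7,9)[OF P] pure_rules(4)[OF K.one_closed] by simp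

lemma pure_one_zero: "pure \<one>\<^bsub>K\<^esub> (\<theta> 0) = \<zero>\<^bsub>T\<^esub>"
proof -
  interpret T: module R T by (rule presents_module[OF R.ring_cover_axioms tensor_presents])
  have "pure \<one>\<^bsub>K\<^esub> (\<theta> 0) \<in> carrier T"
    unfolding pure_eq by (rule presentsD(9)[OF tensor_presents])
      (auto intro!: pair_bas presentsD(9)[OF P] vec_zero)
  then show ?thesis using pure_one_smul[OF vec_zero, of 0] by (simp add: smul_simps R.zero)
qed

lemma pure_one_closed: "x \<in> vec X \<Longrightarrow> pure \<one>\<^bsub>K\<^esub> (\<theta> x) \<in> carrier T"
  unfolding pure_eq by (rule presentsD(9)[OF tensor_presents])
    (auto intro!: pair_bas presentsD(9)[OF P])

lemma pure_one_surj: "u \<in> carrier T \<Longrightarrow> \<exists>x\<in>vec X. u = pure \<one>\<^bsub>K\<^esub> (\<theta> x)"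
proof -
  assume "u \<in> carrier T"
  then obtain z where z: "z \<in> vec pairs" "u = \<omega> z" by (rule presents_carrier[OF tensor_presents])
  note D = presentsD[OF tensor_presents]
  let ?U = "{z \<in> vec pairs. \<exists>x\<in>vec X. \<omega> z = pure \<one>\<^bsub>K\<^esub> (\<theta> x)}"
  have "submod ?U"
    unfolding submod_def
  proof (intro conjI ballI allI)
    show "0 \<in> ?U" using D(5) pure_one_zero vec_zero[of X] vec_zero[of pairs] by force
    fix z assume "z \<in> ?U"
    then obtain x where x: "z \<in> vec pairs" "x \<in> vec X" "\<omega> z = pure \<one>\<^bsub>K\<^esub> (\<theta> x)" by blast
    have "\<omega> (smul a z) = pure \<one>\<^bsub>K\<^esub> (\<theta> (smul a x))" for a
      using D(7)[OF x(1)] pure_one_smul[OF x(2)] x(3) by simp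
    then show "smul a z \<in> ?U" for a using vec_smul[OF x(1), of a] vec_smul[OF x(2), of a] by blast
    fix z' assume "z' \<in> ?U"
    then obtain x' where x': "z' \<in> vec pairs" "x' \<in> vec X" "\<omega> z' = pure \<one>\<^bsub>K\<^esub> (\<theta> x')" by blast
    have "\<omega> (z + z') = pure \<one>\<^bsub>K\<^esub> (\<theta> (x + x'))"
      using D(6)[OF x(1) x'(1)] pure_one_add[OF x(2) x'(2)] x(3) x'(3) by simp
    then show "z + z' \<in> ?U" using vec_add[OF x(1) x'(1)] vec_add[OF x(2) x'(2)] by blast
  qed
  moreover have "bas i \<in> ?U" if i: "i \<in> pairs" for i
  proof -
    obtain k v where kv: "i = (k, v)" "k \<in> carrier K" "v \<in> carrier M" using i by (auto simp: alg_mod_def)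
    obtain a where a: "\<kappa> a = k" using K.surj kv by blast
    obtain x where x: "x \<in> vec X" "v = \<theta> x" using presents_carrier[OF P kv(3)] by blast
    have "\<omega> (bas i) = pure \<one>\<^bsub>K\<^esub> (\<theta> (smul a x))"
      using pure_shift[OF x(1), of a] a x(2) kv(1) by (simp add: pure_eq)
    then show ?thesis using vec_smul[OF x(1), of a] i by (auto simp: bas_vec)
  qed
  ultimately have "z \<in> ?U" by (rule lin_vec_submod[OF lin_id _ _ z(1)])
  then show ?thesis using z(2) by blast
qed

text \<open>The hard direction is that \<open>1 \<otimes> x = 0\<close> forces the coefficients of \<open>x\<close> into the kernel. A map out of the tensor product
  detects this: a pair \<open>(k, v)\<close> is sent to the product of a lift of \<open>k\<close> and a lift of \<open>v\<close>, which is well defined modulo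
  \<open>ker_K\<close> and sends the relations of the tensor product to zero.\<close>

lemma pure_one_eq_iff:
  assumes x: "x \<in> vec X" and y: "y \<in> vec X"
  shows "pure \<one>\<^bsub>K\<^esub> (\<theta> x) = pure \<one>\<^bsub>K\<^esub> (\<theta> y) \<longleftrightarrow> x - y \<in> vec X \<inter> vmod ker_K"
proof
  interpret T: module R T by (rule presents_module[OF R.ring_cover_axioms tensor_presents])
  interpret M: module R M by (rule presents_module[OF R.ring_cover_axioms P])
  note D = presentsD[OF P]
  assume xy: "x - y \<in> vec X \<inter> vmod ker_K"
  let ?U = "{z \<in> vec X. pure \<one>\<^bsub>K\<^esub> (\<theta> z) = \<zero>\<^bsub>T\<^esub>}"
  have "x - y \<in> ?U"
  proof (rule vec_vmod_induct)
    show "submod ?U"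
      unfolding submod_def
      using pure_one_add pure_one_smul pure_one_zero
      by (auto simp: vec_zero vec_add vec_smul)
    fix i a assume i: "i \<in> X" and a: "a \<in> ker_K"
    have b: "bas i \<in> vec X" using i by (simp add: bas_vec)
    have "pure \<one>\<^bsub>K\<^esub> (\<theta> (smul a (bas i))) = pure (\<kappa> 0) (\<theta> (bas i))"
      using pure_shift[OF b, of a] a by (simp add: K.zero)
    also have "\<dots> = \<zero>\<^bsub>T\<^esub>"
      using pure_shift[OF b, of 0] pure_one_zero by (simp add: smul_simps)
    finally show "smul a (bas i) \<in> ?U" using vec_smul[OF b] by simp
  qed (use xy in auto)
  then have "pure \<one>\<^bsub>K\<^esub> (\<theta> ((x - y) + y)) = pure \<one>\<^bsub>K\<^esub> (\<theta> y)"
    using pure_one_add[of "x - y" y] y pure_one_closed[OF y] by simp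
  then show "pure \<one>\<^bsub>K\<^esub> (\<theta> x) = pure \<one>\<^bsub>K\<^esub> (\<theta> y)" by simp
next
  interpret M: module R M by (rule presents_module[OF R.ring_cover_axioms P])
  note D = presentsD[OF P]
  \<comment> \<open>evaluate \<open>k \<otimes> v\<close> as the product of a lift of \<open>k\<close> with a lift of \<open>v\<close>\<close>
  have "\<exists>a. \<kappa> a = k" if "k \<in> carrier K" for k using K.surj that .
  then obtain a where a: "\<And>k. k \<in> carrier K \<Longrightarrow> \<kappa> (a k) = k" by metis
  have "\<exists>x. x \<in> vec X \<and> \<theta> x = v" if "v \<in> carrier M" for v using presents_carrier[OF P that] by metis
  then obtain l where l: "\<And>v. v \<in> carrier M \<Longrightarrow> l v \<in> vec X" "\<And>v. v \<in> carrier M \<Longrightarrow> \<theta> (l v) = v" by metis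
  define E where "E = linext (\<lambda>(k, v). smul (a k) (l v))"
  have linE: "lin E" by (simp add: E_def lin_linext)
  have Ebas: "E (bas (k, v)) = smul (a k) (l v)" for k v by (simp add: E_def)
  let ?U = "{z \<in> vec pairs. E z \<in> vmod ker_K}"
  have subU: "submod ?U"
    unfolding submod_def
    using linE is_ideal_ker_K
    by (auto simp: vec_zero vec_add vec_smul lin_0 lin_add lin_smul vmod_zero vmod_add vmod_smul)
  have pb: "k \<in> carrier K \<Longrightarrow> v \<in> carrier M \<Longrightarrow> bas (k, v) \<in> vec pairs" for k v by (rule pair_bas)
  have kerK: "b - b' \<in> ker_K \<longleftrightarrow> \<kappa> b = \<kappa> b'" for b b'
    using K.eq_iff[of b b'] by (simp add: K.pre_def)
  have scal: "smul b z \<in> vmod ker_K" if "b \<in> ker_K" for b and z :: "'i \<Rightarrow>\<^sub>0 'p"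
    using that is_ideal_ker_K unfolding vmod_def is_ideal_def by (simp add: K.mult)
  have kerR: "z - z' \<in> vmod ker_K" if "z \<in> vec X" "z' \<in> vec X" "\<theta> z = \<theta> z'" for z z'
    using D(8)[OF that(1,2)] that(3) vmod_mono[OF ker_sub] by blast
  have rels: "tensor_rels R (alg_mod K \<phi>) M \<subseteq> \<tau> ` ?U"
  proof -
    have U1: "rel_add_left k k' v \<in> ?U" if "k \<in> carrier K" "k' \<in> carrier K" "v \<in> carrier M" for k k' v
    proof -
      have "E (rel_add_left k k' v) = smul (a (k \<oplus>\<^bsub>K\<^esub> k') - (a k + a k')) (l v)"
        by (simp add: rel_add_left_def lin_diff[OF linE] lin_add[OF linE] Ebas smul_simps)
      moreover have "a (k \<oplus>\<^bsub>K\<^esub> k') - (a k + a k') \<in> ker_K"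
        unfolding kerK using that by (simp add: a K.add)
      ultimately have "E (rel_add_left k k' v) \<in> vmod ker_K" by (simp add: scal del: mem_Collect_eq)
      then show ?thesis using rels_vec(1)[OF that] by simp
    qed
    have U2: "rel_add_right k v v' \<in> ?U" if "k \<in> carrier K" "v \<in> carrier M" "v' \<in> carrier M" for k v v'
    proof -
      have "E (rel_add_right k v v') = smul (a k) (l (v \<oplus>\<^bsub>M\<^esub> v') - (l v + l v'))"
        by (simp add: rel_add_right_def lin_diff[OF linE] lin_add[OF linE] Ebas smul_simps)
      moreover have "l (v \<oplus>\<^bsub>M\<^esub> v') - (l v + l v') \<in> vmod ker_K"
        by (rule kerR) (use that l D(6) in \<open>auto simp: vec_add\<close>)
      ultimately have "E (rel_add_right k v v') \<in> vmod ker_K" using vmod_smul[OF is_ideal_ker_K] by simp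
      then show ?thesis using rels_vec(2)[OF that] by simp
    qed
    have U3: "rel_smult_left b k v \<in> ?U" if "k \<in> carrier K" "v \<in> carrier M" for b k v
    proof -
      have "E (rel_smult_left b k v) = smul (a (\<kappa> b \<otimes>\<^bsub>K\<^esub> k) - b * a k) (l v)"
        by (simp add: rel_smult_left_def lin_diff[OF linE] lin_smul[OF linE] Ebas smul_simps)
      moreover have "a (\<kappa> b \<otimes>\<^bsub>K\<^esub> k) - b * a k \<in> ker_K"
        unfolding kerK using that by (simp add: a K.mult)
      ultimately have "E (rel_smult_left b k v) \<in> vmod ker_K" by (simp add: scal del: mem_Collect_eq)
      then show ?thesis using rels_vec(3)[OF that] by simp
    qed
    have U4: "rel_smult_right b k v \<in> ?U" if "k \<in> carrier K" "v \<in> carrier M" for b k v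
    proof -
      have "E (rel_smult_right b k v) = smul (a k) (l (\<pi> b \<odot>\<^bsub>M\<^esub> v) - smul b (l v))"
        by (simp add: rel_smult_right_def lin_diff[OF linE] lin_smul[OF linE] Ebas smul_simps mult.commute)
      moreover have "l (\<pi> b \<odot>\<^bsub>M\<^esub> v) - smul b (l v) \<in> vmod ker_K"
        by (rule kerR) (use that l D(7) in \<open>auto simp: vec_smul\<close>)
      ultimately have "E (rel_smult_right b k v) \<in> vmod ker_K" using vmod_smul[OF is_ideal_ker_K] by simp
      then show ?thesis using rels_vec(4)[OF that] by simp
    qed
    show ?thesis
    proof
      fix u assume "u \<in> tensor_rels R (alg_mod K \<phi>) M"
      then show "u \<in> \<tau> ` ?U"
      proof (cases rule: rel_cases)
        case (1 k k' v)
        show ?thesis unfolding 1(1) by (rule imageI[OF U1[OF 1(2-4)]])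
      next
        case (2 k v v')
        show ?thesis unfolding 2(1) by (rule imageI[OF U2[OF 2(2-4)]])
      next
        case (3 a k v)
        show ?thesis unfolding 3(1) by (rule imageI[OF U3[OF 3(2-3)]])
      next
        case (4 a k v)
        show ?thesis unfolding 4(1) by (rule imageI[OF U4[OF 4(2-3)]])
      qed
    qed
  qed
  have "vec pairs \<inter> vmod ker_R \<subseteq> ?U"
    using lin_vmod[OF linE is_ideal_ker_K] vmod_mono[OF ker_sub] by blast
  then have U_iff: "\<tau> z \<in> \<tau> ` ?U \<longleftrightarrow> z \<in> ?U" if "z \<in> vec pairs" for z
    using presents_image_iff[OF free_pairs subU _ _ that] by blast
  have "submodule (\<tau> ` ?U) R (free_mod R pairs)"
    by (rule presents_submodule[OF R.ring_cover_axioms free_pairs subU]) auto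
  then have ker: "tensor_ker R (alg_mod K \<phi>) M \<subseteq> \<tau> ` ?U"
    unfolding tensor_ker_def using rels by (rule mod_span_least)
  assume "pure \<one>\<^bsub>K\<^esub> (\<theta> x) = pure \<one>\<^bsub>K\<^esub> (\<theta> y)"
  then have "bas (\<one>\<^bsub>K\<^esub>, \<theta> x) - bas (\<one>\<^bsub>K\<^esub>, \<theta> y) \<in> W"
    unfolding pure_eq using presentsD(8)[OF tensor_presents pb pb] D(9) x y by simp
  then have "bas (\<one>\<^bsub>K\<^esub>, \<theta> x) - bas (\<one>\<^bsub>K\<^esub>, \<theta> y) \<in> ?U"
    using ker U_iff unfolding W_def by blast
  then have "E (bas (\<one>\<^bsub>K\<^esub>, \<theta> x) - bas (\<one>\<^bsub>K\<^esub>, \<theta> y)) \<in> vmod ker_K" by blast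
  then have E1: "smul (a \<one>\<^bsub>K\<^esub>) (l (\<theta> x) - l (\<theta> y)) \<in> vmod ker_K"
    by (simp add: lin_diff[OF linE] Ebas smul_simps)
  have "1 - a \<one>\<^bsub>K\<^esub> \<in> ker_K" unfolding kerK by (simp add: a K.one)
  then have E2: "smul (1 - a \<one>\<^bsub>K\<^esub>) (l (\<theta> x) - l (\<theta> y)) \<in> vmod ker_K" by (rule scal)
  have ll: "l (\<theta> x) - l (\<theta> y) \<in> vmod ker_K"
    using vmod_add[OF is_ideal_ker_K E1 E2] by (simp add: smul_simps)
  have "x - l (\<theta> x) \<in> vmod ker_K" "l (\<theta> y) - y \<in> vmod ker_K"
    by (rule kerR; use x y l D(9) in simp)+
  then have "(x - l (\<theta> x)) + ((l (\<theta> x) - l (\<theta> y)) + (l (\<theta> y) - y)) \<in> vmod ker_K"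
    using ll by (intro vmod_add[OF is_ideal_ker_K])
  then show "x - y \<in> vec X \<inter> vmod ker_K" using vec_diff[OF x y] by simp
qed

lemma tensor_presents_vec: "presents \<pi> T (vec X) (vec X \<inter> vmod ker_K) (\<lambda>x. pure \<one>\<^bsub>K\<^esub> (\<theta> x))"
proof (rule presentsI)
  show "(\<lambda>x. pure \<one>\<^bsub>K\<^esub> (\<theta> x)) ` vec X = carrier T"
    using pure_one_closed pure_one_surj by blast
qed (simp_all add: submod_vec submod_Int submod_vmod[OF is_ideal_ker_K] pure_one_zero pure_one_add
    pure_one_smul pure_one_eq_iff)

end

text \<open>The value of the map selected by the definition. It is unique since the elements \<open>1 \<otimes> x\<close> exhaust the tensor product, and
  it exists since the map on vectors preserves the multiples of \<open>ker_K\<close>. The factor \<open>b\<close> covers both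
  the action of a scalar and, for \<open>b = 1\<close>, the extension of a homomorphism.\<close>

lemma tensor_map_eq:
  assumes P: "presents \<pi> M (vec X) (vec X \<inter> vmod ker_R) \<theta>"
    and P': "presents \<pi> M' (vec X') (vec X' \<inter> vmod ker_R) \<theta>'"
    and G: "lin G" "\<And>x. x \<in> vec X \<Longrightarrow> G x \<in> vec X'"
    and g: "\<And>x. x \<in> vec X \<Longrightarrow> g (\<theta> x) = \<theta>' (G x)"
    and m: "\<And>k. k \<in> carrier K \<Longrightarrow> m k = \<kappa> b \<otimes>\<^bsub>K\<^esub> k"
    and x: "x \<in> vec X"
  shows "tensor_map R (alg_mod K \<phi>) M (alg_mod K \<phi>) M' m g (tensor_pure R (alg_mod K \<phi>) M \<one>\<^bsub>K\<^esub> (\<theta> x))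
    = tensor_pure R (alg_mod K \<phi>) M' \<one>\<^bsub>K\<^esub> (\<theta>' (smul b (G x)))"
proof -
  let ?A = "alg_mod K \<phi>"
  let ?T = "tensor R ?A M" and ?T' = "tensor R ?A M'"
  let ?p = "tensor_pure R ?A M" and ?p' = "tensor_pure R ?A M'"
  note TP = tensor_presents_vec[OF P] and TP' = tensor_presents_vec[OF P']
  have "\<exists>t. t \<in> module_hom R ?T ?T' \<and>
    (\<forall>x\<in>vec X. t (?p \<one>\<^bsub>K\<^esub> (\<theta> x)) = ?p' \<one>\<^bsub>K\<^esub> (\<theta>' (smul b (G x))))"
  proof (rule presents_hom[OF R.ring_cover_axioms TP TP' lin_scale[OF G(1)]])
    show "smul b (G x) \<in> vec X'" if "x \<in> vec X" for x using G(2) that by (simp add: vec_smul)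
    show "smul b (G x) \<in> vec X' \<inter> vmod ker_K" if "x \<in> vec X \<inter> vmod ker_K" for x
      using that G vec_smul vmod_smul[OF is_ideal_ker_K] lin_vmod[OF G(1) is_ideal_ker_K] by blast
  qed
  then obtain t0 where t0: "t0 \<in> module_hom R ?T ?T'"
    "\<And>x. x \<in> vec X \<Longrightarrow> t0 (?p \<one>\<^bsub>K\<^esub> (\<theta> x)) = ?p' \<one>\<^bsub>K\<^esub> (\<theta>' (smul b (G x)))" by blast
  interpret T: module R ?T by (rule presents_module[OF R.ring_cover_axioms TP])
  let ?t = "restrict t0 (carrier ?T)"
  have "tensor_map R ?A M ?A M' m g = ?t"
    unfolding tensor_map_def
  proof (rule the_equality)
    have "?t \<in> module_hom R ?T ?T'"
      using t0(1) unfolding module_hom_def by auto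
    moreover have "?t (?p k v) = ?p' (m k) (g v)" if k: "k \<in> carrier ?A" and v: "v \<in> carrier M" for k v
    proof -
      have k: "k \<in> carrier K" using k by (simp add: alg_mod_def)
      obtain a where a: "\<kappa> a = k" using K.surj k by blast
      obtain z where z: "z \<in> vec X" "v = \<theta> z" using presents_carrier[OF P v] .
      have az: "smul a z \<in> vec X" using z(1) by (rule vec_smul)
      have "?p k v = ?p \<one>\<^bsub>K\<^esub> (\<theta> (smul a z))" using pure_shift[OF P z(1), of a] a z(2) by simp
      then have "?t (?p k v) = ?p' \<one>\<^bsub>K\<^esub> (\<theta>' (smul b (G (smul a z))))"
        using t0(2)[OF az] pure_one_closed[OF P az] by simp
      also have "\<dots> = ?p' \<one>\<^bsub>K\<^esub> (\<theta>' (smul (b * a) (G z)))"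
        by (simp add: lin_smul[OF G(1)] smul_simps)
      also have "\<dots> = ?p' (\<kappa> (b * a)) (\<theta>' (G z))"
        using pure_shift[OF P' G(2)[OF z(1)]] by simp
      also have "\<dots> = ?p' (m k) (g v)" using m[OF k] g[OF z(1)] a z(2) by (simp add: K.mult)
      finally show ?thesis .
    qed
    ultimately show "?t \<in> module_hom R ?T ?T' \<and> ?t \<in> extensional (carrier ?T) \<and>
      (\<forall>k\<in>carrier ?A. \<forall>v\<in>carrier M. ?t (?p k v) = ?p' (m k) (g v))" by simp
  next
    fix t assume t: "t \<in> module_hom R ?T ?T' \<and> t \<in> extensional (carrier ?T) \<and>
      (\<forall>k\<in>carrier ?A. \<forall>v\<in>carrier M. t (?p k v) = ?p' (m k) (g v))"
    show "t = ?t"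
    proof (rule extensionalityI)
      show "t \<in> extensional (carrier ?T)" using t by blast
      show "?t \<in> extensional (carrier ?T)" by simp
      fix u assume u: "u \<in> carrier ?T"
      then obtain z where z: "z \<in> vec X" "u = ?p \<one>\<^bsub>K\<^esub> (\<theta> z)" using pure_one_surj[OF P] by blast
      have "t u = ?p' (m \<one>\<^bsub>K\<^esub>) (g (\<theta> z))"
        using t z presentsD(9)[OF P] by (simp add: alg_mod_def)
      also have "\<dots> = ?p' (\<kappa> b) (\<theta>' (G z))" using m g z by simp
      also have "\<dots> = ?p' \<one>\<^bsub>K\<^esub> (\<theta>' (smul b (G z)))" using pure_shift[OF P' G(2)[OF z(1)]] by simp
      also have "\<dots> = ?t u" using t0(2) z u by simp
      finally show "t u = ?t u" .
    qed
  qed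
  then show ?thesis using t0(2)[OF x] pure_one_closed[OF P x] by simp
qed

lemma base_change_presents:
  assumes P: "presents \<pi> M (vec X) (vec X \<inter> vmod ker_R) \<theta>"
  shows "presents \<kappa> (base_change R K \<phi> M) (vec X) (vec X \<inter> vmod ker_K)
    (\<lambda>x. tensor_pure R (alg_mod K \<phi>) M \<one>\<^bsub>K\<^esub> (\<theta> x))"
proof -
  note D = presentsD[OF tensor_presents_vec[OF P]]
  have "tensor_map R (alg_mod K \<phi>) M (alg_mod K \<phi>) M (\<lambda>k. \<kappa> a \<otimes>\<^bsub>K\<^esub> k) (\<lambda>y. y)
      (tensor_pure R (alg_mod K \<phi>) M \<one>\<^bsub>K\<^esub> (\<theta> x)) = tensor_pure R (alg_mod K \<phi>) M \<one>\<^bsub>K\<^esub> (\<theta> (smul a x))"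
    if "x \<in> vec X" for a x
    using tensor_map_eq[OF P P lin_id, of "\<lambda>y. y" "\<lambda>k. \<kappa> a \<otimes>\<^bsub>K\<^esub> k" a x] that by simp
  then show ?thesis
    by (intro presentsI) (use D in \<open>simp_all add: base_change_def Let_def\<close>)
qed

lemma base_change_map_eq:
  assumes P: "presents \<pi> M (vec X) (vec X \<inter> vmod ker_R) \<theta>"
    and P': "presents \<pi> M' (vec X') (vec X' \<inter> vmod ker_R) \<theta>'"
    and G: "lin G" "\<And>x. x \<in> vec X \<Longrightarrow> G x \<in> vec X'"
    and g: "\<And>x. x \<in> vec X \<Longrightarrow> g (\<theta> x) = \<theta>' (G x)"
    and x: "x \<in> vec X"
  shows "base_change_map R K \<phi> M M' g (tensor_pure R (alg_mod K \<phi>) M \<one>\<^bsub>K\<^esub> (\<theta> x))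
    = tensor_pure R (alg_mod K \<phi>) M' \<one>\<^bsub>K\<^esub> (\<theta>' (G x))"
  using tensor_map_eq[OF P P' G g, of "\<lambda>k. k" 1 x] x
  by (simp add: base_change_map_def K.one smul_simps)

end

section \<open>Coordinates on filtered free modules\<close>

text \<open>Every module is a quotient of the free module on its own elements, so facts about presented modules
  hold for all modules.\<close>

lemma presents_exists:
  fixes \<pi> :: "'b::comm_ring_1 \<Rightarrow> 'r" and M :: "('r, 'c, 'y) module_scheme"
  assumes R: "ring_cover R \<pi>" and M: "module R M"
  shows "\<exists>N \<theta>. presents \<pi> M (vec (carrier M)) N \<theta>"
proof -
  interpret R: ring_cover R \<pi> by fact
  interpret module R M by fact
  define \<theta> where "\<theta> x = (\<Oplus>\<^bsub>M\<^esub>v\<in>keys x. \<pi> (lookup x v) \<odot>\<^bsub>M\<^esub> v)" for x :: "'c \<Rightarrow>\<^sub>0 'b"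
  let ?V = "vec (carrier M) :: ('c \<Rightarrow>\<^sub>0 'b) set"
  have super: "\<theta> x = (\<Oplus>\<^bsub>M\<^esub>v\<in>A. \<pi> (lookup x v) \<odot>\<^bsub>M\<^esub> v)"
    if "finite A" "keys x \<subseteq> A" "A \<subseteq> carrier M" for x A
    unfolding \<theta>_def using that
    by (intro M.add.finprod_mono_neutral_cong_left) (auto simp: in_keys_iff R.zero)
  have V: "keys x \<subseteq> carrier M" if "x \<in> ?V" for x using that by (simp add: vec_def)
  have closed: "\<theta> x \<in> carrier M" if "x \<in> ?V" for x
    unfolding \<theta>_def using V[OF that] by (intro M.finsum_closed) auto
  have add: "\<theta> (x + y) = \<theta> x \<oplus>\<^bsub>M\<^esub> \<theta> y" if "x \<in> ?V" "y \<in> ?V" for x y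
  proof -
    let ?A = "keys x \<union> keys y"
    have A: "finite ?A" "?A \<subseteq> carrier M" using V that by auto
    have "\<theta> (x + y) = (\<Oplus>\<^bsub>M\<^esub>v\<in>?A. \<pi> (lookup (x + y) v) \<odot>\<^bsub>M\<^esub> v)"
      by (rule super[OF A(1) keys_add A(2)])
    also have "\<dots> = (\<Oplus>\<^bsub>M\<^esub>v\<in>?A. \<pi> (lookup x v) \<odot>\<^bsub>M\<^esub> v \<oplus>\<^bsub>M\<^esub> \<pi> (lookup y v) \<odot>\<^bsub>M\<^esub> v)"
      by (rule M.finsum_cong') (use A(2) in \<open>auto simp: lookup_add R.add smult_l_distr\<close>)
    also have "\<dots> = (\<Oplus>\<^bsub>M\<^esub>v\<in>?A. \<pi> (lookup x v) \<odot>\<^bsub>M\<^esub> v) \<oplus>\<^bsub>M\<^esub> (\<Oplus>\<^bsub>M\<^esub>v\<in>?A. \<pi> (lookup y v) \<odot>\<^bsub>M\<^esub> v)"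
      by (rule M.finsum_addf) (use A(2) in auto)
    also have "\<dots> = \<theta> x \<oplus>\<^bsub>M\<^esub> \<theta> y"
      using super[OF A(1) Un_upper1 A(2)] super[OF A(1) Un_upper2 A(2)] by simp
    finally show ?thesis .
  qed
  have smul: "\<theta> (smul a x) = \<pi> a \<odot>\<^bsub>M\<^esub> \<theta> x" if "x \<in> ?V" for a x
  proof -
    have "keys (smul a x) \<subseteq> keys x" by (auto simp: in_keys_iff)
    then have "\<theta> (smul a x) = (\<Oplus>\<^bsub>M\<^esub>v\<in>keys x. \<pi> (lookup (smul a x) v) \<odot>\<^bsub>M\<^esub> v)"
      by (rule super[OF finite_keys _ V[OF that]])
    also have "\<dots> = (\<Oplus>\<^bsub>M\<^esub>v\<in>keys x. \<pi> a \<odot>\<^bsub>M\<^esub> (\<pi> (lookup x v) \<odot>\<^bsub>M\<^esub> v))"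
      by (rule M.finsum_cong') (use V[OF that] in \<open>auto simp: R.mult smult_assoc1\<close>)
    also have "\<dots> = \<pi> a \<odot>\<^bsub>M\<^esub> \<theta> x"
      unfolding \<theta>_def by (rule finsum_smult_ldistr[symmetric]) (use V[OF that] in auto)
    finally show ?thesis .
  qed
  have zero: "\<theta> 0 = \<zero>\<^bsub>M\<^esub>" by (simp add: \<theta>_def)
  have bas: "\<theta> (bas v) = v" if "v \<in> carrier M" for v
    using that by (simp add: \<theta>_def lookup_bas R.one)
  let ?N = "{x \<in> ?V. \<theta> x = \<zero>\<^bsub>M\<^esub>}"
  have N: "submod ?N"
    unfolding submod_def using zero add smul by (auto simp: vec_zero vec_add vec_smul)
  have "presents \<pi> M ?V ?N \<theta>"
  proof (rule presentsI[OF submod_vec N _ _ zero add smul])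
    show "\<theta> ` ?V = carrier M"
    proof
      show "carrier M \<subseteq> \<theta> ` ?V"
      proof
        fix v assume "v \<in> carrier M"
        then show "v \<in> \<theta> ` ?V" using bas[of v] by (intro image_eqI[of _ _ "bas v"]) (auto simp: bas_vec)
      qed
    qed (use closed in blast)
    fix x y assume x: "x \<in> ?V" and y: "y \<in> ?V"
    have "\<theta> ((x - y) + y) = \<theta> (x - y) \<oplus>\<^bsub>M\<^esub> \<theta> y" by (rule add[OF vec_diff[OF x y] y])
    then have "\<theta> x = \<theta> (x - y) \<oplus>\<^bsub>M\<^esub> \<theta> y" by simp
    then show "\<theta> x = \<theta> y \<longleftrightarrow> x - y \<in> ?N"
      using closed[OF vec_diff[OF x y]] closed[OF y] vec_diff[OF x y] by simp
  qed auto
  then show ?thesis by blast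
qed

lemma quot_mod_coset:
  assumes R: "ring_cover R \<pi>" and M: "module R M" and H: "submodule H R M"
  shows "\<lbrakk>v \<in> carrier M; w \<in> carrier M\<rbrakk> \<Longrightarrow>
      H +>\<^bsub>M\<^esub> (v \<oplus>\<^bsub>M\<^esub> w) = (H +>\<^bsub>M\<^esub> v) \<oplus>\<^bsub>quot_mod M H\<^esub> (H +>\<^bsub>M\<^esub> w)"
    and "\<lbrakk>r \<in> carrier R; v \<in> carrier M\<rbrakk> \<Longrightarrow> H +>\<^bsub>M\<^esub> (r \<odot>\<^bsub>M\<^esub> v) = r \<odot>\<^bsub>quot_mod M H\<^esub> (H +>\<^bsub>M\<^esub> v)"
    and "\<lbrakk>v \<in> carrier M; w \<in> carrier M\<rbrakk> \<Longrightarrow> H +>\<^bsub>M\<^esub> v = H +>\<^bsub>M\<^esub> w \<longleftrightarrow> v \<ominus>\<^bsub>M\<^esub> w \<in> H"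
    and "v \<in> carrier M \<Longrightarrow> H +>\<^bsub>M\<^esub> v = \<zero>\<^bsub>quot_mod M H\<^esub> \<longleftrightarrow> v \<in> H"
    and "carrier (quot_mod M H) = (\<lambda>v. H +>\<^bsub>M\<^esub> v) ` carrier M"
proof -
  interpret R: ring_cover R \<pi> by fact
  obtain N \<theta> where P: "presents \<pi> M (vec (carrier M)) N \<theta>" using presents_exists[OF R M] by blast
  note V = presents_vimage[OF R P H]
  note Q = presents_quot[OF R P V(1,2,3), unfolded V(4)]
  note D = presentsD[OF P] and DQ = presentsD[OF Q]
  show "H +>\<^bsub>M\<^esub> (v \<oplus>\<^bsub>M\<^esub> w) = (H +>\<^bsub>M\<^esub> v) \<oplus>\<^bsub>quot_mod M H\<^esub> (H +>\<^bsub>M\<^esub> w)"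
    "H +>\<^bsub>M\<^esub> v = H +>\<^bsub>M\<^esub> w \<longleftrightarrow> v \<ominus>\<^bsub>M\<^esub> w \<in> H" if vw: "v \<in> carrier M" "w \<in> carrier M"
  proof -
    obtain x where x: "x \<in> vec (carrier M)" "v = \<theta> x" using vw(1) by (rule presents_carrier[OF P])
    obtain y where y: "y \<in> vec (carrier M)" "w = \<theta> y" using vw(2) by (rule presents_carrier[OF P])
    note xy = x y
    show "H +>\<^bsub>M\<^esub> (v \<oplus>\<^bsub>M\<^esub> w) = (H +>\<^bsub>M\<^esub> v) \<oplus>\<^bsub>quot_mod M H\<^esub> (H +>\<^bsub>M\<^esub> w)"
      using D(6)[OF xy(1,3)] DQ(6)[OF xy(1,3)] xy(2,4) by simp
    show "H +>\<^bsub>M\<^esub> v = H +>\<^bsub>M\<^esub> w \<longleftrightarrow> v \<ominus>\<^bsub>M\<^esub> w \<in> H"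
      using DQ(8)[OF xy(1,3)] presents_diff[OF R P xy(1,3)] vec_diff[OF xy(1,3)] xy(2,4) by simp
  qed
  show "H +>\<^bsub>M\<^esub> (r \<odot>\<^bsub>M\<^esub> v) = r \<odot>\<^bsub>quot_mod M H\<^esub> (H +>\<^bsub>M\<^esub> v)" if rv: "r \<in> carrier R" "v \<in> carrier M"
  proof -
    obtain x where x: "x \<in> vec (carrier M)" "v = \<theta> x" using rv(2) by (rule presents_carrier[OF P])
    obtain a where a: "\<pi> a = r" using R.surj[OF rv(1)] by blast
    show ?thesis using D(7)[OF x(1), of a] DQ(7)[OF x(1), of a] x(2) a by simp
  qed
  show "H +>\<^bsub>M\<^esub> v = \<zero>\<^bsub>quot_mod M H\<^esub> \<longleftrightarrow> v \<in> H" if v: "v \<in> carrier M"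
  proof -
    obtain x where x: "x \<in> vec (carrier M)" "v = \<theta> x" using v by (rule presents_carrier[OF P])
    show ?thesis using DQ(10)[OF x(1)] x by simp
  qed
  show "carrier (quot_mod M H) = (\<lambda>v. H +>\<^bsub>M\<^esub> v) ` carrier M"
  proof -
    have "(\<lambda>v. H +>\<^bsub>M\<^esub> v) ` (\<theta> ` vec (carrier M)) = carrier (quot_mod M H)"
      by (simp only: image_image DQ(4))
    then show ?thesis by (simp only: D(4))
  qed
qed

lemma basis_presents:
  fixes \<pi> :: "'p::comm_ring_1 \<Rightarrow> 'r" and M :: "('r, 'a, 'y) module_scheme"
  assumes R: "ring_cover R \<pi>" and M: "module R M" and B: "mod_basis R M B"
  defines "\<theta> \<equiv> \<lambda>x. \<Oplus>\<^bsub>M\<^esub>b\<in>B. \<pi> (lookup x b) \<odot>\<^bsub>M\<^esub> b"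
  shows "presents \<pi> M (vec B) (vec B \<inter> vmod {a. \<pi> a = \<zero>\<^bsub>R\<^esub>}) \<theta>"
    and "b \<in> B \<Longrightarrow> \<theta> (bas b) = b"
proof -
  interpret R: ring_cover R \<pi> by fact
  interpret module R M by fact
  have fin: "finite B" and sub: "B \<subseteq> carrier M"
    and ex1: "\<And>v. v \<in> carrier M \<Longrightarrow> \<exists>!a. a \<in> B \<rightarrow>\<^sub>E carrier R \<and> v = (\<Oplus>\<^bsub>M\<^esub>b\<in>B. a b \<odot>\<^bsub>M\<^esub> b)"
    using B by (auto simp: mod_basis_def)
  have id: "is_ideal {a. \<pi> a = \<zero>\<^bsub>R\<^esub>}" using R.is_ideal_pre[OF R.zeroideal] by (simp add: R.pre_def)
  have closed: "\<theta> x \<in> carrier M" for x unfolding \<theta>_def using sub by (intro M.finsum_closed) auto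
  show "\<theta> (bas b) = b" if b: "b \<in> B"
  proof -
    have "\<theta> (bas b) = (\<Oplus>\<^bsub>M\<^esub>i\<in>B. if b = i then i else \<zero>\<^bsub>M\<^esub>)"
      unfolding \<theta>_def using sub
      by (intro M.finsum_cong') (auto simp: lookup_bas R.one R.zero)
    also have "\<dots> = b" using M.add.finprod_singleton[OF b fin, of "\<lambda>i. i"] sub by (simp add: Pi_def subset_iff)
    finally show ?thesis .
  qed
  show "presents \<pi> M (vec B) (vec B \<inter> vmod {a. \<pi> a = \<zero>\<^bsub>R\<^esub>}) \<theta>"
  proof (rule presentsI)
    show "submod (vec B :: ('a \<Rightarrow>\<^sub>0 'p) set)" by (rule submod_vec)
    show "submod (vec B \<inter> vmod {a. \<pi> a = \<zero>\<^bsub>R\<^esub>} :: ('a \<Rightarrow>\<^sub>0 'p) set)"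
      by (rule submod_Int[OF submod_vec submod_vmod[OF id]])
    show "\<theta> ` vec B = carrier M"
    proof
      show "carrier M \<subseteq> \<theta> ` vec B"
      proof
        fix v assume "v \<in> carrier M"
        then obtain a where a: "a \<in> B \<rightarrow>\<^sub>E carrier R" "v = (\<Oplus>\<^bsub>M\<^esub>b\<in>B. a b \<odot>\<^bsub>M\<^esub> b)" using ex1 by blast
        have "\<exists>p. \<pi> p = a b" if "b \<in> B" for b using a(1) that R.surj by (auto simp: PiE_def)
        then obtain p where p: "\<And>b. b \<in> B \<Longrightarrow> \<pi> (p b) = a b" by metis
        define x where "x = (\<Sum>b\<in>B. smul (p b) (bas b))"
        have l: "lookup x b = (if b \<in> B then p b else 0)" for b
          using fin by (simp add: x_def lookup_sum' lookup_bas if_distrib[where f = "(*) _"] sum.delta cong: if_cong)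
        have "\<theta> x = v"
          unfolding \<theta>_def a(2) using sub a(1) by (intro M.finsum_cong') (auto simp: l p PiE_def)
        moreover have "x \<in> vec B" by (auto simp: vec_iff l)
        ultimately show "v \<in> \<theta> ` vec B" by blast
      qed
    qed (use closed in blast)
    show "\<theta> 0 = \<zero>\<^bsub>M\<^esub>"
      unfolding \<theta>_def using sub by (intro M.add.finprod_one_eqI) (auto simp: R.zero)
    fix x y :: "'a \<Rightarrow>\<^sub>0 'p" assume x: "x \<in> vec B" and y: "y \<in> vec B"
    show "\<theta> (x + y) = \<theta> x \<oplus>\<^bsub>M\<^esub> \<theta> y"
    proof -
      have "\<theta> (x + y) = (\<Oplus>\<^bsub>M\<^esub>b\<in>B. \<pi> (lookup x b) \<odot>\<^bsub>M\<^esub> b \<oplus>\<^bsub>M\<^esub> \<pi> (lookup y b) \<odot>\<^bsub>M\<^esub> b)"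
        unfolding \<theta>_def using sub
        by (intro M.finsum_cong') (auto simp: lookup_add R.add smult_l_distr)
      also have "\<dots> = \<theta> x \<oplus>\<^bsub>M\<^esub> \<theta> y"
        unfolding \<theta>_def using sub by (intro M.finsum_addf) auto
      finally show ?thesis .
    qed
    show "\<theta> (smul a x) = \<pi> a \<odot>\<^bsub>M\<^esub> \<theta> x" for a
    proof -
      have "\<theta> (smul a x) = (\<Oplus>\<^bsub>M\<^esub>b\<in>B. \<pi> a \<odot>\<^bsub>M\<^esub> (\<pi> (lookup x b) \<odot>\<^bsub>M\<^esub> b))"
        unfolding \<theta>_def using sub
        by (intro M.finsum_cong') (auto simp: R.mult smult_assoc1)
      also have "\<dots> = \<pi> a \<odot>\<^bsub>M\<^esub> \<theta> x"
        unfolding \<theta>_def using sub fin by (intro finsum_smult_ldistr[symmetric]) auto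
      finally show ?thesis .
    qed
    show "\<theta> x = \<theta> y \<longleftrightarrow> x - y \<in> vec B \<inter> vmod {a. \<pi> a = \<zero>\<^bsub>R\<^esub>}"
    proof
      assume eq: "\<theta> x = \<theta> y"
      let ?r = "\<lambda>x. restrict (\<lambda>b. \<pi> (lookup x b)) B"
      have r: "?r x \<in> B \<rightarrow>\<^sub>E carrier R \<and> \<theta> x = (\<Oplus>\<^bsub>M\<^esub>b\<in>B. ?r x b \<odot>\<^bsub>M\<^esub> b)" for x
        unfolding \<theta>_def using sub by (auto intro!: M.finsum_cong')
      have "?r x = ?r y" using ex1[OF closed[of x]] r[of x] r[of y] eq by metis
      then have "\<pi> (lookup x b) = \<pi> (lookup y b)" if "b \<in> B" for b using that by (metis restrict_apply')
      then have "lookup x b - lookup y b \<in> {a. \<pi> a = \<zero>\<^bsub>R\<^esub>}" if "b \<in> B" for b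
        using that R.eq_iff by (simp add: R.pre_def)
      then have "lookup x b - lookup y b \<in> {a. \<pi> a = \<zero>\<^bsub>R\<^esub>}" for b
        using x y by (cases "b \<in> B") (auto simp: vec_iff R.zero)
      then show "x - y \<in> vec B \<inter> vmod {a. \<pi> a = \<zero>\<^bsub>R\<^esub>}"
        using vec_diff[OF x y] by (simp add: vmod_def lookup_minus)
    next
      assume "x - y \<in> vec B \<inter> vmod {a. \<pi> a = \<zero>\<^bsub>R\<^esub>}"
      then have "\<pi> (lookup x b) = \<pi> (lookup y b)" for b
        using R.eq_iff by (simp add: R.pre_def vmod_def lookup_minus)
      then show "\<theta> x = \<theta> y" by (simp add: \<theta>_def)
    qed
  qed auto
qed

text \<open>On a free module, the submodule \<open>IM\<close> consists of the vectors with coefficients in \<open>I\<close>, because these form a submodule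
  that contains all products \<open>a x\<close>.\<close>

lemma ideal_smult_presented:
  assumes R: "ring_cover R \<pi>" and P: "presents \<pi> M (vec X) (vec X \<inter> vmod {a. \<pi> a = \<zero>\<^bsub>R\<^esub>}) \<theta>"
    and I: "ideal I R" and x: "x \<in> vec X" "\<theta> x \<in> ideal_smult R I M"
  shows "x \<in> vmod {a. \<pi> a \<in> I}"
proof -
  interpret R: ring_cover R \<pi> by fact
  interpret I: ideal I R by fact
  note D = presentsD[OF P]
  have id: "is_ideal {a. \<pi> a \<in> I}" using R.is_ideal_pre[OF I] by (simp add: R.pre_def)
  let ?W = "vec X \<inter> vmod {a. \<pi> a \<in> I}"
  have W: "submod ?W" by (rule submod_Int[OF submod_vec submod_vmod[OF id]])
  have "ideal_smult R I M \<subseteq> \<theta> ` ?W"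
    unfolding ideal_smult_def
  proof (rule mod_span_least[OF presents_submodule[OF R P W]])
    show "{a \<odot>\<^bsub>M\<^esub> x |a x. a \<in> I \<and> x \<in> carrier M} \<subseteq> \<theta> ` ?W"
    proof safe
      fix r v assume r: "r \<in> I" and v: "v \<in> carrier M"
      obtain a where a: "\<pi> a = r" using R.surj r I.a_subset by blast
      obtain z where z: "z \<in> vec X" "v = \<theta> z" using v by (rule presents_carrier[OF P])
      have "smul a z \<in> ?W"
        using z a r I.I_r_closed by (auto simp: vec_smul vmod_def R.mult)
      moreover have "r \<odot>\<^bsub>M\<^esub> v = \<theta> (smul a z)" using D(7) z a by simp
      ultimately show "r \<odot>\<^bsub>M\<^esub> v \<in> \<theta> ` ?W" by blast
    qed
  qed auto
  moreover have "vec X \<inter> vmod {a. \<pi> a = \<zero>\<^bsub>R\<^esub>} \<subseteq> ?W"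
    using I.zero_closed by (auto simp: vmod_def)
  ultimately show ?thesis using presents_image_iff[OF P W _ _ x(1)] x(2) by blast
qed

locale covered_filtration = filtered_free_module S c A F + ring_cover S \<pi>
  for S :: "('s, 'x) ring_scheme" and c :: nat and A :: "('s, 'a) module" and F :: "nat \<Rightarrow> 'a set"
    and \<pi> :: "'p::comm_ring_1 \<Rightarrow> 's"
begin

lemma module_A: "module S A"
  using fg_free by (simp add: fg_free_def)

sublocale A: module S A by (rule module_A)

abbreviation ker :: "'p set" where "ker \<equiv> {a. \<pi> a = \<zero>\<^bsub>S\<^esub>}"

lemma is_ideal_ker: "is_ideal ker"
  using is_ideal_pre[OF zeroideal] by (simp add: pre_def)

lemma F_sub: "p \<le> c \<Longrightarrow> F p \<subseteq> carrier A"
  using filt_submodule[of p] by (auto simp: submodule_def subgroup_def)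

lemma F_closed: "p \<le> c \<Longrightarrow> v \<in> F p \<Longrightarrow> w \<in> F p \<Longrightarrow> v \<oplus>\<^bsub>A\<^esub> w \<in> F p"
  "p \<le> c \<Longrightarrow> v \<in> F p \<Longrightarrow> r \<in> carrier S \<Longrightarrow> r \<odot>\<^bsub>A\<^esub> v \<in> F p"
  "p \<le> c \<Longrightarrow> \<zero>\<^bsub>A\<^esub> \<in> F p"
  using filt_submodule[of p] by (auto simp: submodule_def subgroup_def submodule_axioms_def)

lemma module_filt: "p \<le> c \<Longrightarrow> module S (filt_mod A F p)"
  using filt_free by (simp add: fg_free_def)

lemma sub_filt: "p < c \<Longrightarrow> submodule (F p) S (filt_mod A F (Suc p))"
  using filt_summand[of "Suc p"] by (simp add: direct_summand_def)

lemma F_Suc: "p < c \<Longrightarrow> F p \<subseteq> F (Suc p)"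
  using sub_filt[of p] by (auto simp: submodule_def subgroup_def filt_mod_def)

lemma F_mono: "p \<le> q \<Longrightarrow> q \<le> c \<Longrightarrow> F p \<subseteq> F q"
proof (induction q)
  case (Suc q)
  show ?case
  proof (cases "p = Suc q")
    case False
    then have "F p \<subseteq> F q" using Suc by simp
    then show ?thesis using F_Suc[of q] Suc.prems by auto
  qed simp
qed simp

text \<open>The basis of the subquotient is the one that \<open>mod_rank\<close> selects, so that its cardinality is the rank by
  definition.\<close>

definition qbasis :: "nat \<Rightarrow> 'a set set"
  where "qbasis q = (SOME B. mod_basis S (filt_quot A F q) B)"

lemma qbasis: "q \<in> {1..c} \<Longrightarrow> mod_basis S (filt_quot A F q) (qbasis q)"
  using filt_quot_free[of q] someI_ex[of "mod_basis S (filt_quot A F q)"] by (simp add: fg_free_def qbasis_def)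

lemma card_qbasis: "card (qbasis q) = mod_rank S (filt_quot A F q)"
  by (simp add: qbasis_def mod_rank_def)

lemma finite_qbasis: "q \<in> {1..c} \<Longrightarrow> finite (qbasis q)"
  using qbasis by (auto simp: mod_basis_def)

text \<open>A lift to the filtration of a basis element of a subquotient.\<close>

definition gen :: "nat \<times> 'a set \<Rightarrow> 'a"
  where "gen i = (SOME v. v \<in> F (fst i) \<and> filt_proj A F (fst i) v = snd i)"

definition idx :: "nat \<Rightarrow> (nat \<times> 'a set) set"
  where "idx p = (SIGMA q:{1..p}. qbasis q)"

lemma proj_rules:
  assumes "p < c"
  shows "\<lbrakk>v \<in> F (Suc p); w \<in> F (Suc p)\<rbrakk> \<Longrightarrow> filt_proj A F (Suc p) (v \<oplus>\<^bsub>A\<^esub> w) =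
      filt_proj A F (Suc p) v \<oplus>\<^bsub>filt_quot A F (Suc p)\<^esub> filt_proj A F (Suc p) w"
    and "\<lbrakk>r \<in> carrier S; v \<in> F (Suc p)\<rbrakk> \<Longrightarrow>
      filt_proj A F (Suc p) (r \<odot>\<^bsub>A\<^esub> v) = r \<odot>\<^bsub>filt_quot A F (Suc p)\<^esub> filt_proj A F (Suc p) v"
    and "\<lbrakk>v \<in> F (Suc p); w \<in> F (Suc p)\<rbrakk> \<Longrightarrow>
      filt_proj A F (Suc p) v = filt_proj A F (Suc p) w \<longleftrightarrow> v \<ominus>\<^bsub>filt_mod A F (Suc p)\<^esub> w \<in> F p"
    and "v \<in> F (Suc p) \<Longrightarrow> filt_proj A F (Suc p) v = \<zero>\<^bsub>filt_quot A F (Suc p)\<^esub> \<longleftrightarrow> v \<in> F p"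
    and "carrier (filt_quot A F (Suc p)) = filt_proj A F (Suc p) ` F (Suc p)"
  using quot_mod_coset[OF ring_cover_axioms module_filt sub_filt[OF assms]] assms
  by (simp_all add: filt_proj_def[abs_def] filt_quot_def filt_mod_def)

lemma gen:
  assumes "(q, u) \<in> idx p" "p \<le> c"
  shows "gen (q, u) \<in> F q" "filt_proj A F q (gen (q, u)) = u"
proof -
  obtain q' where q: "q = Suc q'" "q' < c" "q \<in> {1..c}" using assms by (cases q) (auto simp: idx_def)
  have "u \<in> carrier (filt_quot A F q)"
    using assms qbasis[OF q(3)] by (auto simp: idx_def mod_basis_def)
  then have "\<exists>v. v \<in> F q \<and> filt_proj A F q v = u" using proj_rules(5)[OF q(2)] q(1) by auto
  then show "gen (q, u) \<in> F q" "filt_proj A F q (gen (q, u)) = u"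
    unfolding gen_def using someI_ex[of "\<lambda>v. v \<in> F q \<and> filt_proj A F q v = u"] by auto
qed

lemma finite_idx: "finite (idx c)"
  unfolding idx_def using finite_qbasis by auto

lemma idx_mono: "p \<le> q \<Longrightarrow> idx p \<subseteq> idx q"
  by (auto simp: idx_def)

lemma gen_closed: "i \<in> idx c \<Longrightarrow> gen i \<in> carrier A"
  using gen(1)[of "fst i" "snd i" c] F_sub[of "fst i"] by (auto simp: idx_def)

definition \<Phi> :: "((nat \<times> 'a set) \<Rightarrow>\<^sub>0 'p) \<Rightarrow> 'a"
  where "\<Phi> x = (\<Oplus>\<^bsub>A\<^esub>i\<in>idx c. \<pi> (lookup x i) \<odot>\<^bsub>A\<^esub> gen i)"

lemma \<Phi>_closed: "\<Phi> x \<in> carrier A"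
  unfolding \<Phi>_def by (intro A.M.finsum_closed) (auto intro: gen_closed)

lemma \<Phi>_add: "\<Phi> (x + y) = \<Phi> x \<oplus>\<^bsub>A\<^esub> \<Phi> y"
proof -
  have "\<Phi> (x + y) = (\<Oplus>\<^bsub>A\<^esub>i\<in>idx c. \<pi> (lookup x i) \<odot>\<^bsub>A\<^esub> gen i \<oplus>\<^bsub>A\<^esub> \<pi> (lookup y i) \<odot>\<^bsub>A\<^esub> gen i)"
    unfolding \<Phi>_def by (intro A.M.finsum_cong') (auto simp: gen_closed lookup_add add A.smult_l_distr)
  also have "\<dots> = \<Phi> x \<oplus>\<^bsub>A\<^esub> \<Phi> y"
    unfolding \<Phi>_def by (intro A.M.finsum_addf) (auto simp: gen_closed)
  finally show ?thesis .
qed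

lemma \<Phi>_smul: "\<Phi> (smul a x) = \<pi> a \<odot>\<^bsub>A\<^esub> \<Phi> x"
proof -
  have "\<Phi> (smul a x) = (\<Oplus>\<^bsub>A\<^esub>i\<in>idx c. \<pi> a \<odot>\<^bsub>A\<^esub> (\<pi> (lookup x i) \<odot>\<^bsub>A\<^esub> gen i))"
    unfolding \<Phi>_def by (intro A.M.finsum_cong') (auto simp: gen_closed mult A.smult_assoc1)
  also have "\<dots> = \<pi> a \<odot>\<^bsub>A\<^esub> \<Phi> x"
    unfolding \<Phi>_def by (intro A.finsum_smult_ldistr[symmetric]) (auto simp: gen_closed finite_idx)
  finally show ?thesis .
qed

lemma \<Phi>_bas: "i \<in> idx c \<Longrightarrow> \<Phi> (bas i) = gen i"
proof -
  assume i: "i \<in> idx c"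
  have "\<Phi> (bas i) = (\<Oplus>\<^bsub>A\<^esub>j\<in>idx c. if i = j then gen j else \<zero>\<^bsub>A\<^esub>)"
    unfolding \<Phi>_def by (intro A.M.finsum_cong') (auto simp: gen_closed lookup_bas one zero)
  also have "\<dots> = gen i"
    using A.M.add.finprod_singleton[OF i finite_idx, of gen] gen_closed by (simp add: Pi_def)
  finally show ?thesis .
qed

lemma \<Phi>_ker: "x \<in> vmod ker \<Longrightarrow> \<Phi> x = \<zero>\<^bsub>A\<^esub>"
  unfolding \<Phi>_def by (intro A.M.add.finprod_one_eqI) (auto simp: vmod_def gen_closed)

lemma \<Phi>_zero: "\<Phi> 0 = \<zero>\<^bsub>A\<^esub>"
  by (rule \<Phi>_ker) (rule vmod_zero[OF is_ideal_ker])

lemma \<Phi>_F: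
  assumes "p \<le> c" "x \<in> vec (idx p)"
  shows "\<Phi> x \<in> F p"
proof -
  have "x \<in> {x. \<Phi> x \<in> F p}"
  proof (rule lin_vec_submod[OF lin_id _ _ assms(2)])
    show "submod {x. \<Phi> x \<in> F p}"
      using F_closed[OF assms(1)] by (auto simp: submod_def \<Phi>_zero \<Phi>_add \<Phi>_smul)
    fix i assume i: "i \<in> idx p"
    then have "gen i \<in> F (fst i)" "fst i \<le> p"
      using gen(1)[of "fst i" "snd i" p] assms(1) by (auto simp: idx_def)
    then have "gen i \<in> F p" using F_mono[of "fst i" p] assms(1) by blast
    moreover have "i \<in> idx c" using idx_mono[OF assms(1)] i by blast
    ultimately show "bas i \<in> {x. \<Phi> x \<in> F p}" using \<Phi>_bas[of i] by simp
  qed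
  then show ?thesis by simp
qed

text \<open>The component of a vector in the subquotient of level \<open>q\<close>.\<close>

definition top :: "nat \<Rightarrow> ((nat \<times> 'a set) \<Rightarrow>\<^sub>0 'p) \<Rightarrow> ('a set \<Rightarrow>\<^sub>0 'p)"
  where "top q = linext (\<lambda>i. if fst i = q then bas (snd i) else 0)"

definition lift_top :: "nat \<Rightarrow> ('a set \<Rightarrow>\<^sub>0 'p) \<Rightarrow> ((nat \<times> 'a set) \<Rightarrow>\<^sub>0 'p)"
  where "lift_top q = linext (\<lambda>u. bas (q, u))"

definition \<Psi> :: "nat \<Rightarrow> ('a set \<Rightarrow>\<^sub>0 'p) \<Rightarrow> 'a set"
  where "\<Psi> q x = (\<Oplus>\<^bsub>filt_quot A F q\<^esub>u\<in>qbasis q. \<pi> (lookup x u) \<odot>\<^bsub>filt_quot A F q\<^esub> u)"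

lemma \<Psi>_presents:
  assumes "q \<in> {1..c}"
  shows "presents \<pi> (filt_quot A F q) (vec (qbasis q)) (vec (qbasis q) \<inter> vmod ker) (\<Psi> q)"
    and "u \<in> qbasis q \<Longrightarrow> \<Psi> q (bas u) = u"
  using basis_presents[OF ring_cover_axioms _ qbasis[OF assms]] filt_quot_free[OF assms]
  by (simp_all add: \<Psi>_def[abs_def] fg_free_def)

lemma lin_top: "lin (top q)" and lin_lift_top: "lin (lift_top q)"
  by (simp_all add: top_def lift_top_def lin_linext)

lemma top_vec: "x \<in> vec (idx p) \<Longrightarrow> top q x \<in> vec (qbasis q)"
  by (erule lin_vec_submod[OF lin_top submod_vec, rotated]) (auto simp: top_def idx_def bas_vec vec_zero)

lemma lift_top_vec: "q \<in> {1..p} \<Longrightarrow> z \<in> vec (qbasis q) \<Longrightarrow> lift_top q z \<in> vec (idx p)"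
  by (erule lin_vec_submod[OF lin_lift_top submod_vec, rotated]) (auto simp: lift_top_def idx_def bas_vec)

lemma top_lift_top: "top q (lift_top q z) = z"
  using lin_eq[OF lin_comp[OF lin_top lin_lift_top] lin_id, of q q z]
  by (simp add: top_def lift_top_def)

lemma lookup_top: "lookup (top q x) u = lookup x (q, u)"
proof -
  have "lookup (top q x) u = (\<Sum>i\<in>keys x. lookup x i * lookup (if fst i = q then bas (snd i) else 0) u)"
    by (simp only: top_def linext_def lookup_sum' lookup_smul)
  also have "\<dots> = (\<Sum>i\<in>keys x. if (q, u) = i then lookup x i else 0)"
    by (rule sum.cong) (auto simp: lookup_bas)
  also have "\<dots> = lookup x (q, u)"
    by (subst sum.delta') (auto simp: in_keys_iff)
  finally show ?thesis .
qed

lemma top_removed: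
  assumes "x \<in> vec (idx (Suc p))"
  shows "x - lift_top (Suc p) (top (Suc p) x) \<in> vec (idx p)"
  by (rule lin_vec_submod[OF lin_sub[OF lin_id lin_comp[OF lin_lift_top lin_top]] submod_vec _ assms])
    (auto simp: top_def lift_top_def idx_def bas_vec vec_zero lin_0[OF lin_linext])

lemma proj_\<Phi>:
  assumes p: "p < c" and x: "x \<in> vec (idx (Suc p))"
  shows "filt_proj A F (Suc p) (\<Phi> x) = \<Psi> (Suc p) (top (Suc p) x)"
proof -
  let ?q = "Suc p"
  note D = presentsD[OF \<Psi>_presents(1)[of ?q]]
  let ?U = "{x \<in> vec (idx ?q). filt_proj A F ?q (\<Phi> x) = \<Psi> ?q (top ?q x)}"
  have q: "?q \<in> {1..c}" using p by simp
  have \<Phi>: "x \<in> vec (idx ?q) \<Longrightarrow> \<Phi> x \<in> F ?q" for x using \<Phi>_F[of ?q x] p by simp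
  have "x \<in> ?U"
  proof (rule lin_vec_submod[OF lin_id _ _ x])
    have "filt_proj A F ?q (\<Phi> 0) = \<zero>\<^bsub>filt_quot A F ?q\<^esub>"
      using proj_rules(4)[OF p, of "\<Phi> 0"] F_closed(3) p by (simp add: \<Phi>_zero)
    then show "submod ?U"
      using D(5)[OF q] D(6)[OF q top_vec top_vec] D(7)[OF q top_vec] proj_rules(1,2)[OF p] \<Phi>
      by (auto simp: submod_def vec_zero vec_add vec_smul \<Phi>_add \<Phi>_smul lin_0[OF lin_top] lin_add[OF lin_top] lin_smul[OF lin_top])
    fix i assume i: "i \<in> idx ?q"
    obtain q u where iq: "i = (q, u)" by force
    have ic: "i \<in> idx c" using idx_mono[of ?q c] p i by auto
    have "filt_proj A F ?q (gen i) = \<Psi> ?q (top ?q (bas i))"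
    proof (cases "q = ?q")
      case True
      then show ?thesis using gen(2)[of q u ?q] \<Psi>_presents(2)[OF q, of u] i iq p by (simp add: top_def idx_def)
    next
      case False
      then have qp: "q \<le> p" using i iq by (auto simp: idx_def)
      have "gen i \<in> F q" using gen(1)[of q u ?q] i iq p by simp
      then have "gen i \<in> F p" using F_mono[OF qp] p by auto
      then have "filt_proj A F ?q (gen i) = \<zero>\<^bsub>filt_quot A F ?q\<^esub>"
        using proj_rules(4)[OF p, of "gen i"] F_Suc[OF p] by blast
      then show ?thesis using False iq D(5)[OF q] by (simp add: top_def)
    qed
    then show "bas i \<in> ?U" using i \<Phi>_bas[OF ic] by (simp add: bas_vec)
  qed
  then show ?thesis by simp
qed

text \<open>Lifts of bases of the subquotients form a basis adapted to the filtration. An element of \<open>F (p + 1)\<close> is first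
  matched in the top subquotient and corrected by an element of \<open>F p\<close>; a relation has zero top component, hence lies in
  level \<open>p\<close> up to the kernel of \<open>\<pi>\<close>.\<close>

lemma filt_presents:
  "p \<le> c \<Longrightarrow> presents \<pi> (filt_mod A F p) (vec (idx p)) (vec (idx p) \<inter> vmod ker) \<Phi>"
proof (induction p)
  case 0
  have "idx 0 = {}" by (auto simp: idx_def)
  then have v0: "vec (idx 0) = {0 :: (nat \<times> 'a set) \<Rightarrow>\<^sub>0 'p}" by (auto simp: vec_def)
  have "0 \<in> vmod ker" by (rule vmod_zero[OF is_ideal_ker])
  then show ?case
    unfolding v0
    by (intro presentsI) (auto simp: submod_def smul_simps filt_mod_def filt_bot \<Phi>_zero \<Phi>_add[symmetric] \<Phi>_smul[symmetric])
next
  case (Suc p)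
  let ?q = "Suc p"
  have p: "p < c" and q: "?q \<in> {1..c}" using Suc by auto
  have IH: "presents \<pi> (filt_mod A F p) (vec (idx p)) (vec (idx p) \<inter> vmod ker) \<Phi>" using Suc by simp
  note D = presentsD[OF \<Psi>_presents(1)[OF q]] and DI = presentsD[OF IH]
  have sub: "z \<in> vec (idx p) \<Longrightarrow> z \<in> vec (idx ?q)" for z using vec_mono[OF idx_mono[of p ?q]] by auto
  have \<Phi>: "x \<in> vec (idx ?q) \<Longrightarrow> \<Phi> x \<in> F ?q" for x using \<Phi>_F[of ?q x] Suc.prems by simp
  have \<Phi>diff: "\<Phi> (x - y) = \<Phi> x \<ominus>\<^bsub>A\<^esub> \<Phi> y" for x y
  proof -
    have "\<Phi> x = \<Phi> (x - y) \<oplus>\<^bsub>A\<^esub> \<Phi> y" by (simp add: \<Phi>_add[symmetric])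
    then show ?thesis using \<Phi>_closed by (simp add: A.M.minus_eq A.M.a_assoc A.M.r_neg)
  qed
  show ?case
  proof (rule presentsI)
    show "submod (vec (idx ?q) :: ((nat \<times> 'a set) \<Rightarrow>\<^sub>0 'p) set)" by (rule submod_vec)
    show "submod (vec (idx ?q) \<inter> vmod ker :: ((nat \<times> 'a set) \<Rightarrow>\<^sub>0 'p) set)"
      by (rule submod_Int[OF submod_vec submod_vmod[OF is_ideal_ker]])
    show "\<Phi> ` vec (idx ?q) = carrier (filt_mod A F ?q)"
    proof
      show "\<Phi> ` vec (idx ?q) \<subseteq> carrier (filt_mod A F ?q)" using \<Phi> by (auto simp: filt_mod_def)
      show "carrier (filt_mod A F ?q) \<subseteq> \<Phi> ` vec (idx ?q)"
      proof
        fix v assume "v \<in> carrier (filt_mod A F ?q)"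
        then have v: "v \<in> F ?q" by (simp add: filt_mod_def)
        then have "filt_proj A F ?q v \<in> carrier (filt_quot A F ?q)" using proj_rules(5)[OF p] by blast
        then obtain z where z: "z \<in> vec (qbasis ?q)" "filt_proj A F ?q v = \<Psi> ?q z"
          by (rule presents_carrier[OF \<Psi>_presents(1)[OF q]])
        \<comment> \<open>\<open>?y\<close> matches \<open>v\<close> in the top subquotient; the correction \<open>x\<close> below comes from the level \<open>p\<close>.\<close>
        let ?y = "lift_top ?q z"
        have y: "?y \<in> vec (idx ?q)" by (rule lift_top_vec[OF _ z(1)]) simp
        have "filt_proj A F ?q v = filt_proj A F ?q (\<Phi> ?y)"
          using proj_\<Phi>[OF p y] z(2) by (simp add: top_lift_top)
        then have "v \<ominus>\<^bsub>filt_mod A F ?q\<^esub> \<Phi> ?y \<in> F p" using proj_rules(3)[OF p v \<Phi>[OF y]] by blast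
        then obtain x where x: "x \<in> vec (idx p)" "v \<ominus>\<^bsub>filt_mod A F ?q\<^esub> \<Phi> ?y = \<Phi> x"
          using DI(4) by (auto simp: filt_mod_def)
        interpret Fq: module S "filt_mod A F ?q" using module_filt p by simp
        have "v = (v \<ominus>\<^bsub>filt_mod A F ?q\<^esub> \<Phi> ?y) \<oplus>\<^bsub>filt_mod A F ?q\<^esub> \<Phi> ?y"
        proof -
          have "v \<in> carrier (filt_mod A F ?q)" "\<Phi> ?y \<in> carrier (filt_mod A F ?q)"
            using v \<Phi>[OF y] by (auto simp: filt_mod_def)
          then show ?thesis by (simp add: Fq.M.minus_eq Fq.M.a_assoc Fq.M.l_neg)
        qed
        then have "v = \<Phi> (x + ?y)" using x(2) by (simp add: \<Phi>_add filt_mod_def)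
        then show "v \<in> \<Phi> ` vec (idx ?q)" using vec_add[OF sub[OF x(1)] y] by blast
      qed
    qed
    fix x y :: "(nat \<times> 'a set) \<Rightarrow>\<^sub>0 'p" assume x: "x \<in> vec (idx ?q)" and y: "y \<in> vec (idx ?q)"
    have zero_iff: "\<Phi> x = \<zero>\<^bsub>A\<^esub> \<longleftrightarrow> x \<in> vmod ker" if x: "x \<in> vec (idx ?q)" for x
    proof
      assume eq: "\<Phi> x = \<zero>\<^bsub>A\<^esub>"
      have "\<Psi> ?q (top ?q x) = \<zero>\<^bsub>filt_quot A F ?q\<^esub>"
        using proj_\<Phi>[OF p x] proj_rules(4)[OF p \<Phi>[OF x]] F_closed(3)[of p] p eq by simp
      then have "top ?q x \<in> vmod ker" using D(10)[OF top_vec[OF x]] by blast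
      then have k: "lift_top ?q (top ?q x) \<in> vmod ker" by (rule lin_vmod[OF lin_lift_top is_ideal_ker])
      have "\<Phi> (x - lift_top ?q (top ?q x)) = \<zero>\<^bsub>A\<^esub>"
        using \<Phi>diff \<Phi>_ker[OF k] eq by (simp add: A.M.minus_eq)
      then have "x - lift_top ?q (top ?q x) \<in> vmod ker"
        using DI(10)[OF top_removed[OF x]] by (simp add: filt_mod_def)
      then show "x \<in> vmod ker" using vmod_add[OF is_ideal_ker _ k] by fastforce
    qed (rule \<Phi>_ker)
    have "\<Phi> x = \<Phi> y \<longleftrightarrow> \<Phi> (x - y) = \<zero>\<^bsub>A\<^esub>"
      using \<Phi>_add[of "x - y" y] \<Phi>_closed by simp
    then show "\<Phi> x = \<Phi> y \<longleftrightarrow> x - y \<in> vec (idx ?q) \<inter> vmod ker"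
      using zero_iff[OF vec_diff[OF x y]] vec_diff[OF x y] by simp
  qed (auto simp: filt_mod_def \<Phi>_zero \<Phi>_add \<Phi>_smul)
qed

end

section \<open>The coordinates of a higher matrix factorization\<close>

lemma lookup_reindex:
  assumes "inj e"
  shows "lookup (linext (\<lambda>i. bas (e i)) x) (e i) = lookup x i"
proof -
  have "lookup (linext (\<lambda>i. bas (e i)) x) (e i) = (\<Sum>j\<in>keys x. lookup x j * lookup (bas (e j)) (e i))"
    by (simp only: linext_def lookup_sum' lookup_smul)
  also have "\<dots> = (\<Sum>j\<in>keys x. if i = j then lookup x j else 0)"
    by (rule sum.cong) (use assms in \<open>auto simp: lookup_bas inj_eq\<close>)
  also have "\<dots> = lookup x i"
    by (subst sum.delta') (auto simp: in_keys_iff)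
  finally show ?thesis .
qed

locale hmf_cover =
  higher_matrix_factorization S c A0 F0 A1 F1 f d h + ring_cover S \<pi>
  for S :: "('s, 'x) ring_scheme" and c :: nat
    and A0 :: "('s, 'a) module" and F0 :: "nat \<Rightarrow> 'a set"
    and A1 :: "('s, 'b) module" and F1 :: "nat \<Rightarrow> 'b set"
    and f :: "nat \<Rightarrow> 's" and d :: "'b \<Rightarrow> 'a" and h :: "(nat \<Rightarrow> 'a) \<Rightarrow> 'b"
    and \<pi> :: "'p::comm_ring_1 \<Rightarrow> 's" +
  assumes regular: "regular_sequence S c f"
begin

sublocale C0: covered_filtration S c A0 F0 \<pi> by unfold_locales
sublocale C1: covered_filtration S c A1 F1 \<pi> by unfold_locales

abbreviation ker :: "'p set" where "ker \<equiv> {a. \<pi> a = \<zero>\<^bsub>S\<^esub>}"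

definition gens_all :: "((nat \<times> 'a set) + (nat \<times> 'b set)) set"
  where "gens_all = C0.idx c <+> C1.idx c"

definition lev :: "(nat \<times> 'a set) + (nat \<times> 'b set) \<Rightarrow> nat" where "lev = case_sum fst fst"

definition par :: "(nat \<times> 'a set) + (nat \<times> 'b set) \<Rightarrow> nat" where "par = case_sum (\<lambda>_. 0) (\<lambda>_. 1)"

definition J :: "nat \<Rightarrow> 'p set" where "J p = {a. \<pi> a \<in> seq_ideal S f p}"

abbreviation X where "X \<equiv> gens gens_all lev par"

lemma X_0: "p \<le> c \<Longrightarrow> X p 0 = (\<lambda>i. ({#}, Inl i)) ` C0.idx p"
  and X_1: "p \<le> c \<Longrightarrow> X p 1 = (\<lambda>i. ({#}, Inr i)) ` C1.idx p"
proof -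
  have "X p 0 = (\<lambda>i. ({#}, Inl i)) ` {i \<in> C0.idx c. fst i \<le> p}"
    by (auto simp: gens_def gens_all_def lev_def par_def)
  moreover have "X p 1 = (\<lambda>i. ({#}, Inr i)) ` {i \<in> C1.idx c. fst i \<le> p}"
  proof -
    have "e = {#}" if "2 * size e + par b = 1" for e :: "nat multiset" and b using that by (cases e) auto
    then show ?thesis by (fastforce simp: gens_def gens_all_def lev_def par_def)
  qed
  moreover have "{i \<in> C0.idx c. fst i \<le> p} = C0.idx p" "{i \<in> C1.idx c. fst i \<le> p} = C1.idx p" if "p \<le> c"
    using that by (auto simp: C0.idx_def C1.idx_def)
  ultimately show "p \<le> c \<Longrightarrow> X p 0 = (\<lambda>i. ({#}, Inl i)) ` C0.idx p"
    "p \<le> c \<Longrightarrow> X p 1 = (\<lambda>i. ({#}, Inr i)) ` C1.idx p" by simp_all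
qed

text \<open>In degrees zero and one no variable occurs, and the generators are those of \<open>A\<^sub>0\<close> and \<open>A\<^sub>1\<close>.\<close>

definition strip0 :: "((nat \<times> 'a set) + (nat \<times> 'b set), 'p) hvec \<Rightarrow> ((nat \<times> 'a set) \<Rightarrow>\<^sub>0 'p)"
  where "strip0 = linext (\<lambda>j. bas (projl (snd j)))"

definition strip1 :: "((nat \<times> 'a set) + (nat \<times> 'b set), 'p) hvec \<Rightarrow> ((nat \<times> 'b set) \<Rightarrow>\<^sub>0 'p)"
  where "strip1 = linext (\<lambda>j. bas (projr (snd j)))"

definition "\<Theta>0 x = C0.\<Phi> (strip0 x)"
definition "\<Theta>1 x = C1.\<Phi> (strip1 x)"

lemma presents0: "p \<le> c \<Longrightarrow> presents \<pi> (filt_mod A0 F0 p) (vec (X p 0)) (vec (X p 0) \<inter> vmod ker) \<Theta>0"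
  and presents1: "p \<le> c \<Longrightarrow> presents \<pi> (filt_mod A1 F1 p) (vec (X p 1)) (vec (X p 1) \<inter> vmod ker) \<Theta>1"
proof -
  assume p: "p \<le> c"
  have "bij_betw (\<lambda>j. projl (snd j)) (X p 0) (C0.idx p)"
    unfolding X_0[OF p] by (intro bij_betwI[where g = "\<lambda>i. ({#}, Inl i)"]) auto
  from presents_reindex[OF C0.filt_presents[OF p] this C0.is_ideal_ker]
  show "presents \<pi> (filt_mod A0 F0 p) (vec (X p 0)) (vec (X p 0) \<inter> vmod ker) \<Theta>0"
    by (simp add: \<Theta>0_def[abs_def] strip0_def)
  have "bij_betw (\<lambda>j. projr (snd j)) (X p 1) (C1.idx p)"
    unfolding X_1[OF p] by (intro bij_betwI[where g = "\<lambda>i. ({#}, Inr i)"]) auto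
  from presents_reindex[OF C1.filt_presents[OF p] this C1.is_ideal_ker]
  show "presents \<pi> (filt_mod A1 F1 p) (vec (X p 1)) (vec (X p 1) \<inter> vmod ker) \<Theta>1"
    by (simp add: \<Theta>1_def[abs_def] strip1_def)
qed

lemma filt_mod_top: "filt_mod A0 F0 c = A0" "filt_mod A1 F1 c = A1"
  by (simp_all add: filt_mod_def A0.filt_top A1.filt_top)

lemma seq_ideal_ideal: "p \<le> c \<Longrightarrow> ideal (seq_ideal S f p) S"
  unfolding seq_ideal_def using f_closed by (intro genideal_ideal) auto

lemma is_ideal_J: "p \<le> c \<Longrightarrow> is_ideal (J p)"
  using is_ideal_pre[OF seq_ideal_ideal] by (simp add: J_def pre_def)

lemma ker_J: "p \<le> c \<Longrightarrow> ker \<subseteq> J p"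
  using additive_subgroup.zero_closed[OF ideal.axioms(1)[OF seq_ideal_ideal]] by (auto simp: J_def)

text \<open>The right-hand side is an ideal that contains the kernel, so its image in \<open>S\<close> is an ideal; this ideal contains the
  generators \<open>f\<^sub>1, \<dots>, f\<^sub>p\<^sub>+\<^sub>1\<close>.\<close>

lemma J_Suc:
  assumes p: "p < c" and r: "\<pi> r = f (Suc p)"
  shows "J (Suc p) = {j + r * a | j a. j \<in> J p}"
proof -
  let ?L = "{j + r * a | j a. j \<in> J p}"
  have Jp: "is_ideal (J p)" and JS: "is_ideal (J (Suc p))" using is_ideal_J p by auto
  have fc: "f ` {1..Suc p} \<subseteq> carrier S" using f_closed p by auto
  have L: "is_ideal ?L"
    unfolding is_ideal_def
  proof safe
    show "\<exists>j a. 0 = j + r * a \<and> j \<in> J p" using Jp by (intro exI[of _ 0]) (simp add: is_ideal_def)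
    fix x b x' b' assume "x \<in> J p" "x' \<in> J p"
    then show "\<exists>z e. (x + r * b) + (x' + r * b') = z + r * e \<and> z \<in> J p" using Jp
      by (intro exI[of _ "x + x'"] exI[of _ "b + b'"]) (simp add: is_ideal_def algebra_simps)
  next
    fix s x b assume "x \<in> J p"
    then show "\<exists>z e. s * (x + r * b) = z + r * e \<and> z \<in> J p" using Jp
      by (intro exI[of _ "s * x"] exI[of _ "s * b"]) (simp add: is_ideal_def algebra_simps)
  qed
  have JpL: "J p \<subseteq> ?L" by (force intro: exI[of _ 0])
  then have kL: "pre {\<zero>\<^bsub>S\<^esub>} \<subseteq> ?L" using ker_J[of p] p by (auto simp: pre_def)
  note im = ideal_image[OF L kL]
  have "f ` {1..Suc p} \<subseteq> \<pi> ` ?L"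
  proof safe
    fix i assume i: "i \<in> {1..Suc p}"
    show "f i \<in> \<pi> ` ?L"
    proof (cases "i = Suc p")
      case True
      have "r \<in> ?L" using Jp by (intro CollectI exI[of _ 0] exI[of _ 1]) (simp add: is_ideal_def)
      then show ?thesis using r True by (intro image_eqI[of _ _ r]) auto
    next
      case False
      then have ip: "i \<in> {1..p}" using i by auto
      obtain a where a: "\<pi> a = f i" using surj fc i by blast
      have "f ` {1..p} \<subseteq> seq_ideal S f p"
        unfolding seq_ideal_def using fc by (intro genideal_self) auto
      then have "a \<in> J p" using a ip by (auto simp: J_def)
      then show ?thesis using a JpL by (intro image_eqI[of _ _ a]) auto
    qed
  qed
  then have "seq_ideal S f (Suc p) \<subseteq> \<pi> ` ?L"
    unfolding seq_ideal_def by (rule genideal_minimal[OF im(1)])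
  then have "J (Suc p) \<subseteq> pre (\<pi> ` ?L)" unfolding J_def pre_def by blast
  then have "J (Suc p) \<subseteq> ?L" by (simp only: im(2))
  moreover have "?L \<subseteq> J (Suc p)"
  proof safe
    fix j a assume j: "j \<in> J p"
    have gen: "f ` {1..Suc p} \<subseteq> seq_ideal S f (Suc p)"
      unfolding seq_ideal_def using fc by (intro genideal_self)
    have "seq_ideal S f p \<subseteq> seq_ideal S f (Suc p)"
    proof -
      have "f ` {1..p} \<subseteq> seq_ideal S f (Suc p)" using gen by auto
      then show ?thesis
        unfolding seq_ideal_def[of S f p] by (rule genideal_minimal[OF seq_ideal_ideal[OF Suc_leI[OF p]]])
    qed
    then have "j \<in> J (Suc p)" using j by (auto simp: J_def)
    moreover have "r \<in> J (Suc p)" using gen r by (auto simp: J_def)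
    ultimately show "j + r * a \<in> J (Suc p)" using JS unfolding is_ideal_def by (metis mult.commute)
  qed
  ultimately show ?thesis by blast
qed

lemma regular_J:
  assumes p: "p < c" and r: "\<pi> r = f (Suc p)" and a: "r * a \<in> J p"
  shows "a \<in> J p"
proof -
  have "Suc p \<in> {1..c}" using p by simp
  then have "f (Suc p) \<otimes>\<^bsub>S\<^esub> \<pi> a \<in> seq_ideal S f (Suc p - 1) \<longrightarrow> \<pi> a \<in> seq_ideal S f (Suc p - 1)"
    using regular closed unfolding regular_sequence_def by blast
  then show ?thesis using a r by (simp add: J_def mult)
qed

lemma d_hom_filt: "p \<le> c \<Longrightarrow> d \<in> module_hom S (filt_mod A1 F1 p) (filt_mod A0 F0 p)"
  using d_hom d_filt[of p] C1.F_sub[of p]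
  by (auto simp: module_hom_def filt_mod_def image_subset_iff subset_iff)

text \<open>Each generator is sent to a lift at its own level, so that one linear map lifts \<open>d\<close> on every step of the filtration.\<close>

lemma d_lift_exists:
  "\<exists>D. lin D \<and> (\<forall>p\<le>c. \<forall>x\<in>vec (X p 1). D x \<in> vec (X p 0) \<and> \<Theta>0 (D x) = d (\<Theta>1 x))"
proof -
  have "\<exists>v. v \<in> vec (X (lev (snd i)) 0) \<and> \<Theta>0 v = d (\<Theta>1 (bas i))" if i: "i \<in> X c 1" for i
  proof -
    obtain e b where eb: "i = (e, b)" by force
    have l: "lev b \<le> c" using i eb by (auto simp: gens_def)
    have "e = {#}" using i eb by (cases e) (auto simp: gens_def)
    then have "i \<in> X (lev b) 1" using i eb by (auto simp: gens_def)
    then have "\<Theta>1 (bas i) \<in> carrier (filt_mod A1 F1 (lev b))"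
      by (intro presentsD(9)[OF presents1[OF l]]) (simp add: bas_vec)
    then have "d (\<Theta>1 (bas i)) \<in> carrier (filt_mod A0 F0 (lev b))"
      using d_hom_filt[OF l] by (auto simp: module_hom_def)
    then obtain v where "v \<in> vec (X (lev b) 0)" "d (\<Theta>1 (bas i)) = \<Theta>0 v"
      by (rule presents_carrier[OF presents0[OF l]])
    then show ?thesis using eb by auto
  qed
  then obtain v where v: "\<And>i. i \<in> X c 1 \<Longrightarrow> v i \<in> vec (X (lev (snd i)) 0)"
      "\<And>i. i \<in> X c 1 \<Longrightarrow> \<Theta>0 (v i) = d (\<Theta>1 (bas i))" by metis
  have "linext v x \<in> vec (X p 0) \<and> \<Theta>0 (linext v x) = d (\<Theta>1 x)" if p: "p \<le> c" and x: "x \<in> vec (X p 1)" for p x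
  proof -
    have vi: "v i \<in> vec (X p 0) \<and> \<Theta>0 (v i) = d (\<Theta>1 (bas i))" if i: "i \<in> X p 1" for i
    proof -
      have ic: "i \<in> X c 1" and "X (lev (snd i)) 0 \<subseteq> X p 0" using i p by (auto simp: gens_def)
      then show ?thesis using v[OF ic] vec_mono by blast
    qed
    then show ?thesis
      using presents_lift_basis[OF ring_cover_axioms presents1[OF p] presents0[OF p] d_hom_filt[OF p] _ _ x] by simp
  qed
  then show ?thesis using lin_linext by blast
qed

lemma hmf_part_source:
  assumes p: "p \<in> {1..c}" and v: "v \<in> F0 p"
  shows "direct_sum_incl {1..c} (filt_mod A0 F0) p v \<in> carrier (hmf_source c A0 F0)"
    and "direct_sum_incl {1..c} (filt_mod A0 F0) p v \<in> hmf_source_filt c A0 F0 p"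
proof -
  show 1: "direct_sum_incl {1..c} (filt_mod A0 F0) p v \<in> carrier (hmf_source c A0 F0)"
    using assms C0.F_closed(3) by (auto simp: hmf_source_def direct_sum_mod_def direct_sum_incl_def filt_mod_def)
  show "direct_sum_incl {1..c} (filt_mod A0 F0) p v \<in> hmf_source_filt c A0 F0 p"
    using 1 by (auto simp: hmf_source_filt_def direct_sum_incl_def filt_mod_def)
qed

lemma hmf_part_hom:
  assumes p: "p \<in> {1..c}"
  shows "hmf_part c A0 F0 h p \<in> module_hom S (filt_mod A0 F0 p) (filt_mod A1 F1 p)"
proof -
  let ?i = "direct_sum_incl {1..c} (filt_mod A0 F0) p"
  have pc: "p \<le> c" using p by simp
  have zero: "\<zero>\<^bsub>A0\<^esub> \<in> carrier A0" by simp
  have add: "?i (v \<oplus>\<^bsub>A0\<^esub> w) = ?i v \<oplus>\<^bsub>hmf_source c A0 F0\<^esub> ?i w" for v w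
    by (auto simp: hmf_source_def direct_sum_mod_def direct_sum_incl_def filt_mod_def)
  have smul: "?i (r \<odot>\<^bsub>A0\<^esub> v) = r \<odot>\<^bsub>hmf_source c A0 F0\<^esub> ?i v" if "r \<in> carrier S" for r v
    using that by (auto simp: hmf_source_def direct_sum_mod_def direct_sum_incl_def filt_mod_def)
  show ?thesis
    unfolding module_hom_def
  proof (intro CollectI conjI ballI Pi_I)
    fix v assume "v \<in> carrier (filt_mod A0 F0 p)"
    then have v: "v \<in> F0 p" by (simp add: filt_mod_def)
    note iv = hmf_part_source[OF p v]
    show "hmf_part c A0 F0 h p v \<in> carrier (filt_mod A1 F1 p)"
      using h_filt[OF pc] iv(2) by (auto simp: hmf_part_def filt_mod_def)
    show "hmf_part c A0 F0 h p (r \<odot>\<^bsub>filt_mod A0 F0 p\<^esub> v) = r \<odot>\<^bsub>filt_mod A1 F1 p\<^esub> hmf_part c A0 F0 h p v"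
      if r: "r \<in> carrier S" for r
      using h_hom iv(1) r smul[OF r, of v] by (simp add: hmf_part_def filt_mod_def module_hom_def)
    fix w assume "w \<in> carrier (filt_mod A0 F0 p)"
    then have w: "w \<in> F0 p" by (simp add: filt_mod_def)
    show "hmf_part c A0 F0 h p (v \<oplus>\<^bsub>filt_mod A0 F0 p\<^esub> w) =
        hmf_part c A0 F0 h p v \<oplus>\<^bsub>filt_mod A1 F1 p\<^esub> hmf_part c A0 F0 h p w"
      using h_hom iv(1) hmf_part_source(1)[OF p w] add[of v w]
      by (simp add: hmf_part_def filt_mod_def module_hom_def)
  qed
qed

lemma h_lift_exists:
  "\<exists>H. \<forall>p. lin (H p) \<and> (p \<in> {1..c} \<longrightarrow>
    (\<forall>x\<in>vec (X p 0). H p x \<in> vec (X p 1) \<and> \<Theta>1 (H p x) = hmf_part c A0 F0 h p (\<Theta>0 x)))"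
proof (rule choice, intro allI)
  fix p
  show "\<exists>H. lin H \<and> (p \<in> {1..c} \<longrightarrow>
    (\<forall>x\<in>vec (X p 0). H x \<in> vec (X p 1) \<and> \<Theta>1 (H x) = hmf_part c A0 F0 h p (\<Theta>0 x)))"
  proof (cases "p \<in> {1..c}")
    case True
    then have pc: "p \<le> c" by simp
    show ?thesis
      using presents_lift[OF ring_cover_axioms presents0[OF pc] presents1[OF pc] hmf_part_hom[OF True]] by blast
  qed (use lin_zero in blast)
qed

lemma core_dh:
  assumes p: "p < c" and x: "x \<in> vec (X (Suc p) 0)" and r: "\<pi> r = f (Suc p)"
    and D: "lin D" "\<And>p x. p \<le> c \<Longrightarrow> x \<in> vec (X p 1) \<Longrightarrow> D x \<in> vec (X p 0) \<and> \<Theta>0 (D x) = d (\<Theta>1 x)"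
    and H: "H x \<in> vec (X (Suc p) 1)" "\<Theta>1 (H x) = hmf_part c A0 F0 h (Suc p) (\<Theta>0 x)"
  shows "D (H x) - smul r x \<in> vmod (J p)"
proof -
  have q: "Suc p \<le> c" "Suc p \<in> {1..c}" using p by auto
  note P0 = presents0[OF q(1)] and P = presentsD[OF presents0[OF q(1)]]
  have DH: "D (H x) \<in> vec (X (Suc p) 0)" "\<Theta>0 (D (H x)) = d (\<Theta>1 (H x))" using D(2)[OF q(1) H(1)] by auto
  have \<Theta>x: "\<Theta>0 x \<in> F0 (Suc p)" using P(9)[OF x] by (simp add: filt_mod_def)
  have "\<Theta>0 (D (H x) - smul r x) = \<Theta>0 (D (H x)) \<ominus>\<^bsub>filt_mod A0 F0 (Suc p)\<^esub> \<Theta>0 (smul r x)"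
    by (rule presents_diff[OF ring_cover_axioms P0 DH(1) vec_smul[OF x]])
  also have "\<dots> \<in> ideal_smult S (seq_ideal S f p) (filt_mod A0 F0 (Suc p))"
    using dh[OF q(2) \<Theta>x] P(7)[OF x, of r] r DH(2) H(2) by simp
  finally have mem: "\<Theta>0 (D (H x) - smul r x) \<in> ideal_smult S (seq_ideal S f p) (filt_mod A0 F0 (Suc p))" .
  have I: "ideal (seq_ideal S f p) S" using seq_ideal_ideal p by simp
  show ?thesis
    using ideal_smult_presented[OF ring_cover_axioms P0 I vec_diff[OF DH(1) vec_smul[OF x]] mem]
    by (simp add: J_def)
qed

lemma lin_strip1: "lin strip1"
  by (simp add: strip1_def lin_linext)

lemma strip1_vec: "p \<le> c \<Longrightarrow> x \<in> vec (X p 1) \<Longrightarrow> strip1 x \<in> vec (C1.idx p)"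
  by (rule lin_vec_submod[OF lin_strip1 submod_vec, of "X p 1"])
    (auto simp: X_1[simplified] strip1_def bas_vec)

lemma lookup_strip1:
  assumes p: "p \<le> c" and x: "x \<in> vec (X p 1)"
  shows "lookup (strip1 x) i = lookup x ({#}, Inr i)"
proof -
  let ?s = "linext (\<lambda>i. bas ({#}, Inr i)) :: _ \<Rightarrow> ((nat \<times> 'a set) + (nat \<times> 'b set), 'p) hvec"
  have "?s (strip1 x) = x"
    by (rule lin_vec_eq[OF lin_comp[OF lin_linext lin_strip1] lin_id _ x])
      (use X_1[OF p] in \<open>auto simp: strip1_def\<close>)
  moreover have "lookup (?s (strip1 x)) ({#}, Inr i) = lookup (strip1 x) i"
    by (rule lookup_reindex) (auto simp: inj_on_def)
  ultimately show ?thesis by simp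
qed

text \<open>Condition (b) is an equation in the subquotient of level \<open>p + 1\<close>, hence a congruence for the coefficients at the
  generators of exactly that level.\<close>

lemma core_hd:
  assumes p: "p < c" and x: "x \<in> vec (X (Suc p) 1)" and r: "\<pi> r = f (Suc p)"
    and D: "D x \<in> vec (X (Suc p) 0)" "\<Theta>0 (D x) = d (\<Theta>1 x)"
    and H: "H (D x) \<in> vec (X (Suc p) 1)" "\<Theta>1 (H (D x)) = hmf_part c A0 F0 h (Suc p) (\<Theta>0 (D x))"
    and b: "lev b = Suc p"
  shows "lookup (H (D x) - smul r x) ({#}, b) \<in> J p"
proof -
  let ?q = "Suc p" and ?z = "H (D x) - smul r x"
  have q: "?q \<le> c" "?q \<in> {1..c}" using p by auto
  note PQ = C1.\<Psi>_presents(1)[OF q(2)]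
  note Q = presentsD[OF PQ]
  have z: "?z \<in> vec (X ?q 1)" by (rule vec_diff[OF H(1) vec_smul[OF x]])
  have sx: "strip1 x \<in> vec (C1.idx ?q)" and sH: "strip1 (H (D x)) \<in> vec (C1.idx ?q)" and sz: "strip1 ?z \<in> vec (C1.idx ?q)"
    using strip1_vec[OF q(1)] x H(1) z by auto
  have \<Theta>x: "\<Theta>1 x \<in> F1 ?q" using presentsD(9)[OF presents1[OF q(1)] x] by (simp add: filt_mod_def)
  have 1: "filt_proj A1 F1 ?q (\<Theta>1 x) = C1.\<Psi> ?q (C1.top ?q (strip1 x))"
    using C1.proj_\<Phi>[OF p sx] by (simp add: \<Theta>1_def)
  have 2: "filt_proj A1 F1 ?q (hmf_part c A0 F0 h ?q (d (\<Theta>1 x))) = C1.\<Psi> ?q (C1.top ?q (strip1 (H (D x))))"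
    using C1.proj_\<Phi>[OF p sH] H(2) D(2) by (simp add: \<Theta>1_def)
  have tx: "C1.top ?q (strip1 x) \<in> vec (C1.qbasis ?q)" "C1.top ?q (strip1 (H (D x))) \<in> vec (C1.qbasis ?q)"
    using C1.top_vec[OF sx] C1.top_vec[OF sH] by auto
  have tz: "C1.top ?q (strip1 ?z) = C1.top ?q (strip1 (H (D x))) - smul r (C1.top ?q (strip1 x))"
    by (simp add: lin_diff[OF lin_strip1] lin_smul[OF lin_strip1] lin_diff[OF C1.lin_top] lin_smul[OF C1.lin_top])
  have "C1.\<Psi> ?q (C1.top ?q (strip1 ?z)) =
      C1.\<Psi> ?q (C1.top ?q (strip1 (H (D x)))) \<ominus>\<^bsub>filt_quot A1 F1 ?q\<^esub> C1.\<Psi> ?q (smul r (C1.top ?q (strip1 x)))"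
    unfolding tz by (rule presents_diff[OF ring_cover_axioms PQ tx(2) vec_smul[OF tx(1)]])
  also have "\<dots> \<in> ideal_smult S (seq_ideal S f p) (filt_quot A1 F1 ?q)"
    using hd[OF q(2) \<Theta>x] Q(7)[OF tx(1), of r] 1 2 r by simp
  finally have mem: "C1.\<Psi> ?q (C1.top ?q (strip1 ?z)) \<in> ideal_smult S (seq_ideal S f p) (filt_quot A1 F1 ?q)" .
  have I: "ideal (seq_ideal S f p) S" using seq_ideal_ideal p by simp
  have top: "C1.top ?q (strip1 ?z) \<in> vmod (J p)"
    using ideal_smult_presented[OF ring_cover_axioms PQ I C1.top_vec[OF sz] mem] by (simp add: J_def)
  show ?thesis
  proof (cases b)
    case (Inl i)
    then have "({#}, b) \<notin> X ?q 1" by (simp add: gens_def par_def)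
    then have "lookup ?z ({#}, b) = 0" using z unfolding vec_iff by blast
    then show ?thesis using is_ideal_J[of p] p by (simp add: is_ideal_def)
  next
    case (Inr i)
    then have i: "i = (?q, snd i)" using b by (simp add: lev_def prod_eq_iff)
    have "lookup ?z ({#}, b) = lookup (strip1 ?z) i" using lookup_strip1[OF q(1) z] Inr by simp
    also have "\<dots> = lookup (C1.top ?q (strip1 ?z)) (snd i)" using C1.lookup_top i by metis
    finally show ?thesis using top by (simp add: vmod_def)
  qed
qed

lemma core_exists:
  "\<exists>ff D H. hmf_core c J ff gens_all lev par D H \<and>
    (\<forall>p\<in>{1..c}. \<pi> (ff p) = f p) \<and>
    (\<forall>p\<le>c. \<forall>x\<in>vec (X p 1). D x \<in> vec (X p 0) \<and> \<Theta>0 (D x) = d (\<Theta>1 x)) \<and>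
    (\<forall>p\<in>{1..c}. \<forall>x\<in>vec (X p 0). H p x \<in> vec (X p 1) \<and> \<Theta>1 (H p x) = hmf_part c A0 F0 h p (\<Theta>0 x))"
proof -
  have "\<exists>a. \<pi> a = f p" if "p \<in> {1..c}" for p using surj f_closed that by blast
  then obtain ff where ff: "\<And>p. p \<in> {1..c} \<Longrightarrow> \<pi> (ff p) = f p" by metis
  obtain D where D: "lin D" "\<And>p x. p \<le> c \<Longrightarrow> x \<in> vec (X p 1) \<Longrightarrow> D x \<in> vec (X p 0) \<and> \<Theta>0 (D x) = d (\<Theta>1 x)"
    using d_lift_exists by blast
  obtain H where H: "\<And>p. lin (H p)" "\<And>p x. p \<in> {1..c} \<Longrightarrow> x \<in> vec (X p 0) \<Longrightarrow>
      H p x \<in> vec (X p 1) \<and> \<Theta>1 (H p x) = hmf_part c A0 F0 h p (\<Theta>0 x)"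
    using h_lift_exists by blast
  have ffS: "\<pi> (ff (Suc p)) = f (Suc p)" if "p < c" for p using ff that by simp
  have "hmf_core c J ff gens_all lev par D H"
  proof
    show "is_ideal (J p)" if "p \<le> c" for p using is_ideal_J that .
    show "J (Suc p) = {j + ff (Suc p) * r |j r. j \<in> J p}" if "p < c" for p using J_Suc[OF that ffS[OF that]] .
    show "a \<in> J p" if "p < c" "ff (Suc p) * a \<in> J p" for p a using regular_J[OF that(1) ffS[OF that(1)] that(2)] .
    show "1 \<le> lev b" "lev b \<le> c" if "b \<in> gens_all" for b
      using that by (auto simp: gens_all_def lev_def C0.idx_def C1.idx_def)
    show "par b \<le> 1" for b by (auto simp: par_def split: sum.splits)
    show "lin D" by (rule D(1))
    show "lin (H p)" for p by (rule H(1))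
    show "D x \<in> vec (X p 0)" if "p \<le> c" "x \<in> vec (X p 1)" for p x using D(2) that by blast
    show "H (Suc p) x \<in> vec (X (Suc p) 1)" if "p < c" "x \<in> vec (X (Suc p) 0)" for p x
      using H(2)[of "Suc p" x] that by simp
    show "D (H (Suc p) x) - smul (ff (Suc p)) x \<in> vmod (J p)" if "p < c" "x \<in> vec (X (Suc p) 0)" for p x
      by (rule core_dh[where H = "H (Suc p)" and D = D, OF that ffS[OF that(1)] D]) (use H(2)[of "Suc p" x] that in auto)
    show "lookup (H (Suc p) (D x) - smul (ff (Suc p)) x) ({#}, b) \<in> J p"
      if "p < c" "x \<in> vec (X (Suc p) 1)" "b \<in> gens_all" "lev b = Suc p" for p x b
    proof -
      have Dx: "D x \<in> vec (X (Suc p) 0)" "\<Theta>0 (D x) = d (\<Theta>1 x)" using D(2)[of "Suc p" x] that by auto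
      show ?thesis
        by (rule core_hd[where H = "H (Suc p)" and D = D, OF that(1,2) ffS[OF that(1)] Dx _ _ that(4)])
          (use H(2)[of "Suc p", OF _ Dx(1)] that(1) in auto)
    qed
  qed
  then show ?thesis using ff D(2) H(2) by blast
qed

end

section \<open>Comparison of resolutions\<close>

text \<open>A free resolution of \<open>M\<close> over the quotient by \<open>J\<close>, written with vectors over the covering ring: all equations
  hold modulo \<open>J\<close>, and \<open>\<theta>\<close> presents \<open>M\<close> as the cokernel of \<open>D 0\<close>.\<close>

definition vec_resolution ::
  "('p::comm_ring_1 \<Rightarrow> 'r) \<Rightarrow> ('r, 'a, 'y) module_scheme \<Rightarrow> 'p set \<Rightarrow> (nat \<Rightarrow> 'i set) \<Rightarrow>
    (nat \<Rightarrow> ('i \<Rightarrow>\<^sub>0 'p) \<Rightarrow> ('i \<Rightarrow>\<^sub>0 'p)) \<Rightarrow> (('i \<Rightarrow>\<^sub>0 'p) \<Rightarrow> 'a) \<Rightarrow> bool"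
  where "vec_resolution \<rho> M J X D \<theta> \<longleftrightarrow> (\<forall>i. lin (D i)) \<and> (\<forall>i. \<forall>x\<in>vec (X (Suc i)). D i x \<in> vec (X i)) \<and>
    (\<forall>i. \<forall>x\<in>vec (X (Suc (Suc i))). D i (D (Suc i) x) \<in> vmod J) \<and>
    (\<forall>i. \<forall>x\<in>vec (X (Suc i)). D i x \<in> vmod J \<longrightarrow> (\<exists>z\<in>vec (X (Suc (Suc i))). x - D (Suc i) z \<in> vmod J)) \<and>
    presents \<rho> M (vec (X 0)) {x \<in> vec (X 0). \<exists>z\<in>vec (X (Suc 0)). x - D 0 z \<in> vmod J} \<theta>"

lemma vec_resolutionD:
  assumes "vec_resolution \<rho> M J X D \<theta>"
  shows "lin (D i)" "x \<in> vec (X (Suc i)) \<Longrightarrow> D i x \<in> vec (X i)"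
    "x \<in> vec (X (Suc (Suc i))) \<Longrightarrow> D i (D (Suc i) x) \<in> vmod J"
    "x \<in> vec (X (Suc i)) \<Longrightarrow> D i x \<in> vmod J \<Longrightarrow> \<exists>z\<in>vec (X (Suc (Suc i))). x - D (Suc i) z \<in> vmod J"
    "presents \<rho> M (vec (X 0)) {x \<in> vec (X 0). \<exists>z\<in>vec (X (Suc 0)). x - D 0 z \<in> vmod J} \<theta>"
  using assms unfolding vec_resolution_def by blast+

text \<open>The inductive step of all lifting constructions: projectivity of the free module on \<open>X\<close>.\<close>

lemma factor_through:
  assumes L: "lin L" and D: "lin D" and J: "is_ideal J"
    and ex: "\<forall>x\<in>vec X. \<exists>z\<in>vec Z. L x - D z \<in> vmod J"
  shows "\<exists>s. lin s \<and> (\<forall>x\<in>vec X. s x \<in> vec Z \<and> L x - D (s x) \<in> vmod J)"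
proof -
  have "\<exists>z. z \<in> vec Z \<and> L (bas i) - D z \<in> vmod J" if "i \<in> X" for i
    using ex that by (metis bas_vec)
  then obtain z where z: "\<And>i. i \<in> X \<Longrightarrow> z i \<in> vec Z" "\<And>i. i \<in> X \<Longrightarrow> L (bas i) - D (z i) \<in> vmod J" by metis
  have "linext z x \<in> vec Z" if "x \<in> vec X" for x
    by (rule lin_vec_submod[OF lin_linext submod_vec _ that]) (simp add: z)
  moreover have "L x - D (linext z x) \<in> vmod J" if "x \<in> vec X" for x
    by (rule lin_vec_submod[OF lin_sub[OF L lin_comp[OF D lin_linext]] submod_vmod[OF J] _ that]) (simp add: z)
  ultimately show ?thesis using lin_linext by blast
qed

text \<open>A chain map, modulo \<open>J\<close>, over the identity of the resolved module.\<close>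

definition comparison ::
  "'p::comm_ring_1 set \<Rightarrow> (nat \<Rightarrow> 'i set) \<Rightarrow> (nat \<Rightarrow> ('i \<Rightarrow>\<^sub>0 'p) \<Rightarrow> ('i \<Rightarrow>\<^sub>0 'p)) \<Rightarrow> (('i \<Rightarrow>\<^sub>0 'p) \<Rightarrow> 'a) \<Rightarrow>
    (nat \<Rightarrow> 'j set) \<Rightarrow> (nat \<Rightarrow> ('j \<Rightarrow>\<^sub>0 'p) \<Rightarrow> ('j \<Rightarrow>\<^sub>0 'p)) \<Rightarrow> (('j \<Rightarrow>\<^sub>0 'p) \<Rightarrow> 'a) \<Rightarrow>
    (nat \<Rightarrow> ('i \<Rightarrow>\<^sub>0 'p) \<Rightarrow> ('j \<Rightarrow>\<^sub>0 'p)) \<Rightarrow> bool"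
  where "comparison J X D \<theta> X' D' \<theta>' \<alpha> \<longleftrightarrow>
    (\<forall>i. lin (\<alpha> i)) \<and> (\<forall>i. \<forall>x\<in>vec (X i). \<alpha> i x \<in> vec (X' i)) \<and>
    (\<forall>x\<in>vec (X 0). \<theta>' (\<alpha> 0 x) = \<theta> x) \<and>
    (\<forall>i. \<forall>x\<in>vec (X (Suc i)). \<alpha> i (D i x) - D' i (\<alpha> (Suc i) x) \<in> vmod J)"

lemma comparisonD:
  assumes "comparison J X D \<theta> X' D' \<theta>' \<alpha>"
  shows "lin (\<alpha> i)" "x \<in> vec (X i) \<Longrightarrow> \<alpha> i x \<in> vec (X' i)" "x \<in> vec (X 0) \<Longrightarrow> \<theta>' (\<alpha> 0 x) = \<theta> x"
    "x \<in> vec (X (Suc i)) \<Longrightarrow> \<alpha> i (D i x) - D' i (\<alpha> (Suc i) x) \<in> vmod J"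
  using assms by (simp_all add: comparison_def)

lemma chain_lift:
  fixes X :: "nat \<Rightarrow> 'i set" and X' :: "nat \<Rightarrow> 'j set" and J :: "'p::comm_ring_1 set"
  assumes R: "ring_cover R \<rho>" and J: "is_ideal J"
    and A: "vec_resolution \<rho> M J X D \<theta>" and A': "vec_resolution \<rho> M J X' D' \<theta>'"
  shows "\<exists>\<alpha>. comparison J X D \<theta> X' D' \<theta>' \<alpha>"
proof -
  interpret R: ring_cover R \<rho> by fact
  note d = vec_resolutionD[OF A] and d' = vec_resolutionD[OF A']
  note P = presentsD[OF d(5)] and P' = presentsD[OF d'(5)]
  let ?P = "\<lambda>i a. lin a \<and> (\<forall>x\<in>vec (X i). a x \<in> vec (X' i)) \<and>
    (\<forall>x\<in>vec (X (Suc i)). \<exists>z\<in>vec (X' (Suc i)). a (D i x) - D' i z \<in> vmod J) \<and>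
    (i = 0 \<longrightarrow> (\<forall>x\<in>vec (X 0). \<theta>' (a x) = \<theta> x))"
  let ?Q = "\<lambda>i a b. \<forall>x\<in>vec (X (Suc i)). a (D i x) - D' i (b x) \<in> vmod J"
  have "\<exists>\<alpha>. \<forall>i. ?P i (\<alpha> i) \<and> ?Q i (\<alpha> i) (\<alpha> (Suc i))"
  proof (rule dependent_nat_choice)
    have "(\<lambda>u. u) \<in> module_hom R M M" by (auto simp: module_hom_def)
    from presents_lift[OF R d(5) d'(5) this]
    obtain a where a: "lin a" "\<forall>x\<in>vec (X 0). a x \<in> vec (X' 0) \<and> \<theta>' (a x) = \<theta> x" by (elim exE conjE)
    have "\<exists>z\<in>vec (X' (Suc 0)). a (D 0 x) - D' 0 z \<in> vmod J" if x: "x \<in> vec (X (Suc 0))" for x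
    proof -
      have Dx: "D 0 x \<in> vec (X 0)" using d(2)[OF x] .
      have "D 0 x - D 0 x \<in> vmod J" using vmod_zero[OF J] by simp
      then have "D 0 x \<in> {x \<in> vec (X 0). \<exists>z\<in>vec (X (Suc 0)). x - D 0 z \<in> vmod J}" using x Dx by blast
      then have z: "\<theta>' (a (D 0 x)) = \<zero>\<^bsub>M\<^esub>" using P(10)[OF Dx] a(2) Dx by simp
      have "a (D 0 x) \<in> vec (X' 0)" using a(2) Dx by simp
      from P'(10)[OF this] z show ?thesis by simp
    qed
    then show "\<exists>a. ?P 0 a" using a by (intro exI[of _ a]) simp
  next
    fix a i assume a: "?P i a"
    have la: "lin a" using a by simp
    have ex: "\<forall>x\<in>vec (X (Suc i)). \<exists>z\<in>vec (X' (Suc i)). a (D i x) - D' i z \<in> vmod J" using a by simp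
    from factor_through[OF lin_comp[OF la d(1)] d'(1) J ex]
    obtain b where b: "lin b" "\<forall>x\<in>vec (X (Suc i)). b x \<in> vec (X' (Suc i)) \<and> a (D i x) - D' i (b x) \<in> vmod J"
      by (elim exE conjE)
    have "\<exists>z\<in>vec (X' (Suc (Suc i))). b (D (Suc i) x) - D' (Suc i) z \<in> vmod J" if x: "x \<in> vec (X (Suc (Suc i)))" for x
    proof -
      have Dx: "D (Suc i) x \<in> vec (X (Suc i))" using d(2)[OF x] .
      have aD: "a (D i (D (Suc i) x)) \<in> vmod J" by (rule lin_vmod[OF la J d(3)[OF x]])
      have bD: "b (D (Suc i) x) \<in> vec (X' (Suc i))" "a (D i (D (Suc i) x)) - D' i (b (D (Suc i) x)) \<in> vmod J"
        using b(2) Dx by auto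
      have "D' i (b (D (Suc i) x)) \<in> vmod J" using vmod_diff[OF J aD bD(2)] by simp
      then show ?thesis by (rule d'(4)[OF bD(1)])
    qed
    then show "\<exists>b. ?P (Suc i) b \<and> ?Q i a b" using b by (intro exI[of _ b]) simp
  qed
  then obtain \<alpha> where "\<forall>i. ?P i (\<alpha> i) \<and> ?Q i (\<alpha> i) (\<alpha> (Suc i))" by (elim exE)
  then show ?thesis unfolding comparison_def by (intro exI[of _ \<alpha>]) simp
qed

text \<open>The usual construction, with \<open>g i - D' s i - s (i - 1) D\<close> a cycle in each degree; the invariant for the choice of
  \<open>s i\<close> is stated on boundaries \<open>D x\<close>, where the last term vanishes.\<close>

lemma null_homotopy:
  fixes X :: "nat \<Rightarrow> 'i set" and X' :: "nat \<Rightarrow> 'j set" and J :: "'p::comm_ring_1 set"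
  assumes J: "is_ideal J" and A: "vec_resolution \<rho> M J X D \<theta>" and A': "vec_resolution \<rho> M J X' D' \<theta>'"
    and g: "\<And>i. lin (g i)" "\<And>i x. x \<in> vec (X i) \<Longrightarrow> g i x \<in> vec (X' i)"
    and chain: "\<And>i x. x \<in> vec (X (Suc i)) \<Longrightarrow> g i (D i x) - D' i (g (Suc i) x) \<in> vmod J"
    and null: "\<And>x. x \<in> vec (X 0) \<Longrightarrow> \<exists>z\<in>vec (X' (Suc 0)). g 0 x - D' 0 z \<in> vmod J"
  shows "\<exists>s. (\<forall>i. lin (s i)) \<and> (\<forall>i. \<forall>x\<in>vec (X i). s i x \<in> vec (X' (Suc i))) \<and>
    (\<forall>x\<in>vec (X 0). g 0 x - D' 0 (s 0 x) \<in> vmod J) \<and>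
    (\<forall>i. \<forall>x\<in>vec (X (Suc i)). g (Suc i) x - s i (D i x) - D' (Suc i) (s (Suc i) x) \<in> vmod J)"
proof -
  note d = vec_resolutionD[OF A] and d' = vec_resolutionD[OF A']
  let ?P = "\<lambda>i a. lin a \<and> (\<forall>x\<in>vec (X i). a x \<in> vec (X' (Suc i))) \<and>
    (\<forall>x\<in>vec (X (Suc i)). g i (D i x) - D' i (a (D i x)) \<in> vmod J) \<and>
    (i = 0 \<longrightarrow> (\<forall>x\<in>vec (X 0). g 0 x - D' 0 (a x) \<in> vmod J))"
  let ?Q = "\<lambda>i a b. \<forall>x\<in>vec (X (Suc i)). g (Suc i) x - a (D i x) - D' (Suc i) (b x) \<in> vmod J"
  have "\<exists>s. \<forall>i. ?P i (s i) \<and> ?Q i (s i) (s (Suc i))"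
  proof (rule dependent_nat_choice)
    have "\<forall>x\<in>vec (X 0). \<exists>z\<in>vec (X' (Suc 0)). g 0 x - D' 0 z \<in> vmod J" using null by simp
    from factor_through[OF g(1) d'(1) J this]
    obtain a where "lin a" "\<forall>x\<in>vec (X 0). a x \<in> vec (X' (Suc 0)) \<and> g 0 x - D' 0 (a x) \<in> vmod J"
      by (elim exE conjE)
    then show "\<exists>a. ?P 0 a" using d(2) by (intro exI[of _ a]) simp
  next
    fix a i assume a: "?P i a"
    have la: "lin a" using a by simp
    have L: "lin (\<lambda>x. g (Suc i) x - a (D i x))" by (rule lin_sub[OF g(1) lin_comp[OF la d(1)]])
    have "\<exists>z\<in>vec (X' (Suc (Suc i))). (g (Suc i) x - a (D i x)) - D' (Suc i) z \<in> vmod J"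
      if x: "x \<in> vec (X (Suc i))" for x
    proof -
      have "a (D i x) \<in> vec (X' (Suc i))" using a d(2)[OF x] by simp
      then have mem: "g (Suc i) x - a (D i x) \<in> vec (X' (Suc i))" by (rule vec_diff[OF g(2)[OF x]])
      have eq: "D' i (g (Suc i) x - a (D i x)) =
          (g i (D i x) - D' i (a (D i x))) - (g i (D i x) - D' i (g (Suc i) x))"
        by (simp add: lin_diff[OF d'(1)])
      have "D' i (g (Suc i) x - a (D i x)) \<in> vmod J"
        unfolding eq by (rule vmod_diff[OF J _ chain[OF x]]) (use a x in simp)
      then show ?thesis by (rule d'(4)[OF mem])
    qed
    then have "\<forall>x\<in>vec (X (Suc i)). \<exists>z\<in>vec (X' (Suc (Suc i))). (g (Suc i) x - a (D i x)) - D' (Suc i) z \<in> vmod J"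
      by simp
    from factor_through[OF L d'(1) J this]
    obtain b where b: "lin b" "\<forall>x\<in>vec (X (Suc i)).
        b x \<in> vec (X' (Suc (Suc i))) \<and> (g (Suc i) x - a (D i x)) - D' (Suc i) (b x) \<in> vmod J"
      by (elim exE conjE)
    have "g (Suc i) (D (Suc i) x) - D' (Suc i) (b (D (Suc i) x)) \<in> vmod J" if x: "x \<in> vec (X (Suc (Suc i)))" for x
    proof -
      have Dx: "D (Suc i) x \<in> vec (X (Suc i))" using d(2)[OF x] .
      have aD: "a (D i (D (Suc i) x)) \<in> vmod J" by (rule lin_vmod[OF la J d(3)[OF x]])
      have "(g (Suc i) (D (Suc i) x) - a (D i (D (Suc i) x))) - D' (Suc i) (b (D (Suc i) x)) \<in> vmod J"
        using b(2) Dx by simp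
      from vmod_add[OF J this aD] show ?thesis by (simp add: algebra_simps)
    qed
    then show "\<exists>b. ?P (Suc i) b \<and> ?Q i a b" using b by (intro exI[of _ b]) simp
  qed
  then obtain s where "\<forall>i. ?P i (s i) \<and> ?Q i (s i) (s (Suc i))" by (elim exE)
  then show ?thesis by (intro exI[of _ s]) simp
qed

lemma homotopy_inverse:
  fixes X :: "nat \<Rightarrow> 'i set" and X' :: "nat \<Rightarrow> 'j set" and J :: "'p::comm_ring_1 set"
  assumes R: "ring_cover R \<rho>" and J: "is_ideal J"
    and A: "vec_resolution \<rho> M J X D \<theta>" and A': "vec_resolution \<rho> M J X' D' \<theta>'"
    and \<alpha>: "comparison J X D \<theta> X' D' \<theta>' \<alpha>" and \<beta>: "comparison J X' D' \<theta>' X D \<theta> \<beta>"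
  shows "\<exists>s. (\<forall>i. lin (s i)) \<and> (\<forall>i. \<forall>x\<in>vec (X i). s i x \<in> vec (X (Suc i))) \<and>
    (\<forall>x\<in>vec (X 0). \<beta> 0 (\<alpha> 0 x) - x - D 0 (s 0 x) \<in> vmod J) \<and>
    (\<forall>i. \<forall>x\<in>vec (X (Suc i)). \<beta> (Suc i) (\<alpha> (Suc i) x) - x - s i (D i x) - D (Suc i) (s (Suc i) x) \<in> vmod J)"
proof -
  note d = vec_resolutionD[OF A] and a = comparisonD[OF \<alpha>] and b = comparisonD[OF \<beta>]
  show ?thesis
  proof (rule null_homotopy[OF J A A, where g = "\<lambda>i x. \<beta> i (\<alpha> i x) - x"])
    show "lin (\<lambda>x. \<beta> i (\<alpha> i x) - x)" for i by (rule lin_sub[OF lin_comp[OF b(1) a(1)] lin_id])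
    show "\<beta> i (\<alpha> i x) - x \<in> vec (X i)" if "x \<in> vec (X i)" for i x
      using vec_diff[OF b(2)[OF a(2)[OF that]] that] .
    fix i and x :: "'i \<Rightarrow>\<^sub>0 'p" assume x: "x \<in> vec (X (Suc i))"
    have "\<beta> i (\<alpha> i (D i x) - D' i (\<alpha> (Suc i) x)) + (\<beta> i (D' i (\<alpha> (Suc i) x)) - D i (\<beta> (Suc i) (\<alpha> (Suc i) x))) \<in> vmod J"
      by (rule vmod_add[OF J lin_vmod[OF b(1) J a(4)[OF x]] b(4)[OF a(2)[OF x]]])
    then show "(\<beta> i (\<alpha> i (D i x)) - D i x) - D i (\<beta> (Suc i) (\<alpha> (Suc i) x) - x) \<in> vmod J"
      by (simp add: lin_diff[OF b(1)] lin_diff[OF d(1)] algebra_simps)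
  next
    fix x :: "'i \<Rightarrow>\<^sub>0 'p" assume x: "x \<in> vec (X 0)"
    have "\<theta> (\<beta> 0 (\<alpha> 0 x)) = \<theta> x" using a(3)[OF x] b(3)[OF a(2)[OF x]] by simp
    then show "\<exists>z\<in>vec (X (Suc 0)). (\<beta> 0 (\<alpha> 0 x) - x) - D 0 z \<in> vmod J"
      using presentsD(8)[OF d(5) b(2)[OF a(2)[OF x]] x] by simp
  qed
qed

section \<open>Dimension over the residue field\<close>

text \<open>Elimination modulo \<open>m\<close>: if some basis vector has an image with a coefficient at \<open>b\<close> outside \<open>m\<close>, this coefficient is
  invertible modulo \<open>m\<close>, and a multiple of the basis vector clears the coefficient at \<open>b\<close> of all other images.\<close>

lemma injective_card_le:
  fixes G :: "('i \<Rightarrow>\<^sub>0 'p::comm_ring_1) \<Rightarrow> ('j \<Rightarrow>\<^sub>0 'p)"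
  assumes m: "is_maximal m" and B: "finite B" and Y: "finite Y"
    and G: "lin G" "\<And>x. x \<in> vec Y \<Longrightarrow> G x \<in> vec B"
    and inj: "\<And>x. x \<in> vec Y \<Longrightarrow> G x \<in> vmod m \<Longrightarrow> x \<in> vmod m"
  shows "card Y \<le> card B"
  using B Y G inj
proof (induction B arbitrary: Y G rule: finite_induct)
  case empty
  have I: "is_ideal m" and 1: "1 \<notin> m" using m by (auto simp: is_maximal_def)
  have "Y = {}"
  proof (rule ccontr)
    assume "Y \<noteq> {}"
    then obtain i where i: "i \<in> Y" by blast
    then have "G (bas i) \<in> vec {}" using empty.prems(3) by (simp add: bas_vec)
    then have "G (bas i) \<in> vmod m" using I by (auto simp: vec_iff vmod_def is_ideal_def)
    then have "bas i \<in> vmod m" using empty.prems(4) i by (simp add: bas_vec)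
    then have "lookup (bas i) i \<in> m" by (simp add: vmod_def)
    then show False using 1 by (simp add: lookup_bas)
  qed
  then show ?case by simp
next
  case (insert b B)
  have I: "is_ideal m" using m by (simp add: is_maximal_def)
  define drop where "drop x = x - smul (lookup x b) (bas b)" for x :: "'j \<Rightarrow>\<^sub>0 'p"
  have lin_drop: "lin drop"
    by (rule linI; rule poly_mapping_eqI) (auto simp: drop_def lookup_minus lookup_add lookup_bas algebra_simps)
  have drop_vec: "drop x \<in> vec B" if "x \<in> vec (insert b B)" for x
    using that by (auto simp: drop_def vec_iff lookup_minus lookup_bas)
  have drop_inj: "x \<in> vmod m" if "drop x \<in> vmod m" "lookup x b \<in> m" for x
    unfolding vmod_def
  proof safe
    fix j show "lookup x j \<in> m"
    proof (cases "j = b")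
      case False
      then have "lookup (drop x) j = lookup x j" by (simp add: drop_def lookup_minus lookup_bas)
      moreover have "lookup (drop x) j \<in> m" using that(1) unfolding vmod_def by blast
      ultimately show ?thesis by simp
    qed (use that in simp)
  qed
  show ?case
  proof (cases "\<forall>i\<in>Y. lookup (G (bas i)) b \<in> m")
    case True
    have coeff: "lookup (G x) b \<in> m" if "x \<in> vec Y" for x
    proof -
      have "G x \<in> {u. lookup u b \<in> m}"
        by (rule lin_vec_submod[OF insert.prems(2) _ _ that])
          (use I True in \<open>auto simp: submod_def is_ideal_def lookup_add\<close>)
      then show ?thesis by simp
    qed
    have "card Y \<le> card B"
    proof (rule insert.IH[OF insert.prems(1) lin_comp[OF lin_drop insert.prems(2)]])
      show "drop (G x) \<in> vec B" if "x \<in> vec Y" for x using drop_vec insert.prems(3) that .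
      show "x \<in> vmod m" if "x \<in> vec Y" "drop (G x) \<in> vmod m" for x
        using insert.prems(4)[OF that(1)] drop_inj[OF that(2) coeff[OF that(1)]] by simp
    qed
    then show ?thesis using insert.hyps by simp
  next
    case False
    then obtain i where i: "i \<in> Y" "lookup (G (bas i)) b \<notin> m" by blast
    obtain r where r: "1 - lookup (G (bas i)) b * r \<in> m" using is_maximal_inverse[OF m i(2)] by blast
    \<comment> \<open>The elimination step: \<open>G (E x)\<close> has its coefficient at \<open>b\<close> in \<open>m\<close>, so \<open>b\<close> and \<open>i\<close> can be dropped.\<close>
    define E where "E x = x - smul (r * lookup (G x) b) (bas i)" for x
    have linE: "lin E"
      by (rule linI; rule poly_mapping_eqI)
        (auto simp: E_def lookup_minus lookup_add lookup_bas lin_add[OF insert.prems(2)] lin_smul[OF insert.prems(2)] algebra_simps)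
    have E_vec: "E x \<in> vec Y" if "x \<in> vec (Y - {i})" for x
    proof -
      have "x \<in> vec Y" using that vec_mono[of "Y - {i}" Y] by blast
      then show ?thesis unfolding E_def by (rule vec_diff[OF _ vec_smul]) (simp add: bas_vec i)
    qed
    have coeff: "lookup (G (E x)) b \<in> m" for x
    proof -
      have "lookup (G (E x)) b = lookup (G x) b * (1 - lookup (G (bas i)) b * r)"
        by (simp add: E_def lin_diff[OF insert.prems(2)] lin_smul[OF insert.prems(2)] lookup_minus algebra_simps)
      then show ?thesis using r I by (simp add: is_ideal_def)
    qed
    have "card (Y - {i}) \<le> card B"
    proof (rule insert.IH)
      show "finite (Y - {i})" using insert.prems(1) by simp
      show "lin (\<lambda>x. drop (G (E x)))" by (rule lin_comp[OF lin_drop lin_comp[OF insert.prems(2) linE]])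
      show "drop (G (E x)) \<in> vec B" if "x \<in> vec (Y - {i})" for x
        using drop_vec insert.prems(3) E_vec that by blast
      show "x \<in> vmod m" if x: "x \<in> vec (Y - {i})" "drop (G (E x)) \<in> vmod m" for x
      proof -
        have Ex: "E x \<in> vmod m"
          using insert.prems(4)[OF E_vec[OF x(1)]] drop_inj[OF x(2) coeff] by simp
        show ?thesis
          unfolding vmod_def
        proof safe
          fix j show "lookup x j \<in> m"
          proof (cases "j = i")
            case True
            then have "lookup x j = 0" using x(1) by (simp add: vec_iff)
            then show ?thesis using I by (simp add: is_ideal_def)
          next
            case False
            then have "lookup (E x) j = lookup x j" by (simp add: E_def lookup_minus lookup_bas)
            moreover have "lookup (E x) j \<in> m" using Ex unfolding vmod_def by blast
            ultimately show ?thesis by simp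
          qed
        qed
      qed
    qed
    moreover have "card Y = Suc (card (Y - {i}))" using i(1) insert.prems(1) by (metis card_Suc_Diff1)
    ultimately show ?thesis using insert.hyps by simp
  qed
qed

lemma presents_card_le:
  assumes K: "ring_cover K \<kappa>" and m: "is_maximal m" and fin: "finite Y" "finite B"
    and P: "presents \<kappa> Q (vec Y) (vec Y \<inter> vmod m) \<theta>" and P': "presents \<kappa> Q (vec B) (vec B \<inter> vmod m) \<theta>'"
  shows "card Y \<le> card B"
proof -
  have "(\<lambda>u. u) \<in> module_hom K Q Q" by (auto simp: module_hom_def)
  then obtain G where G: "lin G" "\<And>x. x \<in> vec Y \<Longrightarrow> G x \<in> vec B" "\<And>x. x \<in> vec Y \<Longrightarrow> \<theta>' (G x) = \<theta> x"
    using presents_lift[OF K P P', of "\<lambda>u. u"] by blast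
  show ?thesis
  proof (rule injective_card_le[OF m fin(2,1) G(1,2)])
    fix x assume x: "x \<in> vec Y" and Gx: "G x \<in> vmod m"
    have "\<theta>' (G x) = \<zero>\<^bsub>Q\<^esub>" using presentsD(10)[OF P' G(2)[OF x]] G(2)[OF x] Gx by blast
    then show "x \<in> vmod m" using presentsD(10)[OF P x] G(3)[OF x] by simp
  qed
qed

text \<open>A presentation without relations modulo \<open>m\<close> yields a basis, which makes the choice in \<open>mod_rank\<close> meaningful.\<close>

lemma presents_basis:
  assumes K: "ring_cover K \<kappa>" and m: "m = {a. \<kappa> a = \<zero>\<^bsub>K\<^esub>}" "1 \<notin> m" and Y: "finite Y"
    and P: "presents \<kappa> Q (vec Y) (vec Y \<inter> vmod m) \<theta>"
  shows "mod_basis K Q ((\<lambda>i. \<theta> (bas i)) ` Y)" (is "mod_basis K Q (?b ` Y)")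
proof -
  interpret K: ring_cover K \<kappa> by fact
  interpret module K Q by (rule presents_module[OF K P])
  note D = presentsD[OF P]
  have bY: "bas i \<in> vec Y" if "i \<in> Y" for i using that by (simp add: bas_vec)
  have inj: "inj_on ?b Y"
  proof (rule inj_onI, rule ccontr)
    fix i j assume ij: "i \<in> Y" "j \<in> Y" "?b i = ?b j" "i \<noteq> j"
    then have "bas i - bas j \<in> vmod m" using D(8)[OF bY[OF ij(1)] bY[OF ij(2)]] by simp
    then have "lookup (bas i - bas j) i \<in> m" by (simp add: vmod_def)
    then show False using m(2) ij(4) by (simp add: lookup_minus lookup_bas)
  qed
  have carr: "?b i \<in> carrier Q" if "i \<in> Y" for i using D(9) bY that by blast
  have expand: "\<theta> x = (\<Oplus>\<^bsub>Q\<^esub>u\<in>?b ` Y. a u \<odot>\<^bsub>Q\<^esub> u)"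
    if x: "x \<in> vec Y" and a: "\<And>i. i \<in> Y \<Longrightarrow> a (?b i) = \<kappa> (lookup x i)" for x a
  proof -
    have "x = (\<Sum>i\<in>Y. smul (lookup x i) (bas i))"
      using x Y by (subst vec_expand, intro sum.mono_neutral_left) (auto simp: vec_def in_keys_iff smul_simps)
    then have "\<theta> x = \<theta> (\<Sum>i\<in>Y. smul (lookup x i) (bas i))" by simp
    also have "\<dots> = (\<Oplus>\<^bsub>Q\<^esub>i\<in>Y. \<theta> (smul (lookup x i) (bas i)))"
      by (rule presents_sum[OF K P Y]) (simp add: vec_smul bY)
    also have "\<dots> = (\<Oplus>\<^bsub>Q\<^esub>i\<in>Y. a (?b i) \<odot>\<^bsub>Q\<^esub> ?b i)"
      by (rule M.finsum_cong') (use carr a D(7)[OF bY] in auto)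
    also have "\<dots> = (\<Oplus>\<^bsub>Q\<^esub>u\<in>?b ` Y. a u \<odot>\<^bsub>Q\<^esub> u)"
      by (rule M.finsum_reindex[symmetric]) (use inj carr a in auto)
    finally show ?thesis .
  qed
  show ?thesis
    unfolding mod_basis_def
  proof (intro conjI ballI)
    show "finite (?b ` Y)" using Y by simp
    show "?b ` Y \<subseteq> carrier Q" using carr by blast
    fix v assume "v \<in> carrier Q"
    then obtain x where x: "x \<in> vec Y" "v = \<theta> x" by (rule presents_carrier[OF P])
    define a where "a = restrict (\<lambda>u. \<kappa> (lookup x (the_inv_into Y ?b u))) (?b ` Y)"
    have a: "a (?b i) = \<kappa> (lookup x i)" if "i \<in> Y" for i
      using that the_inv_into_f_f[OF inj that] by (simp add: a_def)
    show "\<exists>!a. a \<in> ?b ` Y \<rightarrow>\<^sub>E carrier K \<and> v = (\<Oplus>\<^bsub>Q\<^esub>u\<in>?b ` Y. a u \<odot>\<^bsub>Q\<^esub> u)"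
    proof (rule ex1I[of _ a])
      show "a \<in> ?b ` Y \<rightarrow>\<^sub>E carrier K \<and> v = (\<Oplus>\<^bsub>Q\<^esub>u\<in>?b ` Y. a u \<odot>\<^bsub>Q\<^esub> u)"
        using expand[OF x(1) a] x(2) by (auto simp: a_def)
      fix a' assume a': "a' \<in> ?b ` Y \<rightarrow>\<^sub>E carrier K \<and> v = (\<Oplus>\<^bsub>Q\<^esub>u\<in>?b ` Y. a' u \<odot>\<^bsub>Q\<^esub> u)"
      have "\<exists>p. \<kappa> p = a' (?b i)" if "i \<in> Y" for i using a' that K.surj by (auto simp: PiE_def)
      then obtain p where p: "\<And>i. i \<in> Y \<Longrightarrow> \<kappa> (p i) = a' (?b i)" by metis
      define x' where "x' = (\<Sum>i\<in>Y. smul (p i) (bas i))"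
      have l: "lookup x' i = (if i \<in> Y then p i else 0)" for i
        using Y by (simp add: x'_def lookup_sum' lookup_bas if_distrib[where f = "(*) _"] sum.delta cong: if_cong)
      have x': "x' \<in> vec Y" by (auto simp: vec_iff l)
      have "\<theta> x' = v" using expand[OF x', of a'] a' p l by simp
      then have "x' - x \<in> vmod m" using D(8)[OF x' x(1)] x(2) by simp
      then have "lookup x' i - lookup x i \<in> m" for i by (simp add: vmod_def lookup_minus)
      then have "\<kappa> (lookup x' i) = \<kappa> (lookup x i)" for i
        using K.eq_iff by (simp add: m(1) K.pre_def)
      then have "a' (?b i) = a (?b i)" if "i \<in> Y" for i using that p[OF that] l a[OF that] by metis
      then show "a' = a" using a' by (intro extensionalityI[of _ "?b ` Y"]) (auto simp: PiE_def a_def)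
    qed
  qed
qed

lemma presents_rank:
  assumes K: "ring_cover K \<kappa>" and m: "m = {a. \<kappa> a = \<zero>\<^bsub>K\<^esub>}" "is_maximal m" and Y: "finite Y"
    and P: "presents \<kappa> Q (vec Y) (vec Y \<inter> vmod m) \<theta>"
  shows "mod_rank K Q = card Y"
proof -
  have 1: "1 \<notin> m" using m(2) by (simp add: is_maximal_def)
  define B where "B = (SOME B. mod_basis K Q B)"
  have B: "mod_basis K Q B"
    unfolding B_def using presents_basis[OF K m(1) 1 Y P] by (rule someI)
  have PB: "presents \<kappa> Q (vec B) (vec B \<inter> vmod m) (\<lambda>x. \<Oplus>\<^bsub>Q\<^esub>b\<in>B. \<kappa> (lookup x b) \<odot>\<^bsub>Q\<^esub> b)"
    unfolding m(1) by (rule basis_presents(1)[OF K presents_module[OF K P] B])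
  have finB: "finite B" using B by (simp add: mod_basis_def)
  have "card Y = card B"
    using presents_card_le[OF K m(2) Y finB P PB] presents_card_le[OF K m(2) finB Y PB P] by simp
  then show ?thesis by (simp add: mod_rank_def B_def)
qed

section \<open>Betti numbers from a minimal resolution\<close>

lemma submod_boundaries:
  assumes "lin D" "is_ideal J"
  shows "submod {x \<in> vec X. \<exists>z\<in>vec Z. x - D z \<in> vmod J}"
  unfolding submod_def
proof (intro conjI ballI allI)
  have "0 - D 0 \<in> vmod J" using assms by (simp add: lin_0 vmod_zero)
  then show "0 \<in> {x \<in> vec X. \<exists>z\<in>vec Z. x - D z \<in> vmod J}"
    by (intro CollectI conjI bexI[of _ 0] vec_zero)
  fix x assume "x \<in> {x \<in> vec X. \<exists>z\<in>vec Z. x - D z \<in> vmod J}"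
  then obtain z where z: "x \<in> vec X" "z \<in> vec Z" "x - D z \<in> vmod J" by blast
  have "smul a x - D (smul a z) \<in> vmod J" for a
    using vmod_smul[OF assms(2) z(3), of a] by (simp add: lin_smul[OF assms(1)] smul_simps)
  then show "smul a x \<in> {x \<in> vec X. \<exists>z\<in>vec Z. x - D z \<in> vmod J}" for a
    using vec_smul[OF z(1)] vec_smul[OF z(2)] by blast
  fix x' assume "x' \<in> {x \<in> vec X. \<exists>z\<in>vec Z. x - D z \<in> vmod J}"
  then obtain z' where z': "x' \<in> vec X" "z' \<in> vec Z" "x' - D z' \<in> vmod J" by blast
  have "(x + x') - D (z + z') \<in> vmod J"
    using vmod_add[OF assms(2) z(3) z'(3)] by (simp add: lin_add[OF assms(1)] algebra_simps)
  then show "x + x' \<in> {x \<in> vec X. \<exists>z\<in>vec Z. x - D z \<in> vmod J}"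
    using vec_add[OF z(1) z'(1)] vec_add[OF z(2) z'(2)] by blast
qed

text \<open>A free resolution lifts to vectors; its exactness becomes exactness modulo the kernel of \<open>\<rho>\<close>.\<close>

lemma free_resolution_vec:
  fixes \<rho> :: "'p::comm_ring_1 \<Rightarrow> 'r"
  assumes R: "ring_cover R \<rho>" and M: "module R M" and F: "free_resolution R M n \<delta> \<epsilon>"
  defines "\<tau> \<equiv> \<lambda>x j. \<rho> (lookup x j)" and "J \<equiv> {a. \<rho> a = \<zero>\<^bsub>R\<^esub>}"
  shows "\<exists>D. vec_resolution \<rho> M J (\<lambda>i. {..<n i :: nat}) D (\<lambda>x. \<epsilon> (\<tau> x)) \<and>
    (\<forall>i. \<forall>x\<in>vec {..<n (Suc i)}. \<delta> i (\<tau> x) = \<tau> (D i x))"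
proof -
  interpret R: ring_cover R \<rho> by fact
  interpret module R M by fact
  have J: "is_ideal J" using R.is_ideal_pre[OF R.zeroideal] by (simp add: R.pre_def J_def)
  let ?F = "\<lambda>i. free_mod R {..<n i}"
  have F1: "\<And>i. \<delta> i \<in> module_hom R (?F (Suc i)) (?F i)" and F2: "\<epsilon> \<in> module_hom R (?F 0) M"
    and F3: "\<epsilon> ` carrier (?F 0) = carrier M" and F4: "\<delta> 0 ` carrier (?F (Suc 0)) = mod_kernel (?F 0) M \<epsilon>"
    and F5: "\<And>i. \<delta> (Suc i) ` carrier (?F (Suc (Suc i))) = mod_kernel (?F (Suc i)) (?F i) (\<delta> i)"
    using F by (auto simp: free_resolution_def Let_def)
  have P: "presents \<rho> (?F i) (vec {..<n i}) (vec {..<n i} \<inter> vmod J) \<tau>" for i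
    unfolding \<tau>_def J_def by (rule presents_free_mod[OF R])
  note PD = presentsD[OF P]
  have "\<forall>i. \<exists>G. lin G \<and> (\<forall>x\<in>vec {..<n (Suc i)}. G x \<in> vec {..<n i} \<and> \<tau> (G x) = \<delta> i (\<tau> x))"
    using presents_lift[OF R P P F1] by blast
  then obtain D where D0: "\<forall>i. lin (D i) \<and> (\<forall>x\<in>vec {..<n (Suc i)}. D i x \<in> vec {..<n i} \<and> \<tau> (D i x) = \<delta> i (\<tau> x))"
    using choice[of "\<lambda>i G. lin G \<and> (\<forall>x\<in>vec {..<n (Suc i)}. G x \<in> vec {..<n i} \<and> \<tau> (G x) = \<delta> i (\<tau> x))"] by blast
  then have D: "lin (D i)" "x \<in> vec {..<n (Suc i)} \<Longrightarrow> D i x \<in> vec {..<n i}"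
    "x \<in> vec {..<n (Suc i)} \<Longrightarrow> \<tau> (D i x) = \<delta> i (\<tau> x)" for i x by auto
  have sq: "D i (D (Suc i) x) \<in> vmod J" if x: "x \<in> vec {..<n (Suc (Suc i))}" for i x
  proof -
    have "\<delta> (Suc i) (\<tau> x) \<in> mod_kernel (?F (Suc i)) (?F i) (\<delta> i)" using F5[of i] PD(9)[OF x] by blast
    then have "\<tau> (D i (D (Suc i) x)) = \<zero>\<^bsub>?F i\<^esub>" using D(3)[OF D(2)[OF x]] D(3)[OF x] by (simp add: mod_kernel_def)
    then show ?thesis using PD(10)[OF D(2)[OF D(2)[OF x]]] by simp
  qed
  have eqI: "x - z \<in> vmod J" if "x \<in> vec {..<n i}" "z \<in> vec {..<n i}" "\<tau> x = \<tau> z" for i x z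
    using PD(8)[OF that(1,2)] that(3) by simp
  have exact: "\<exists>z\<in>vec {..<n (Suc (Suc i))}. x - D (Suc i) z \<in> vmod J"
    if x: "x \<in> vec {..<n (Suc i)}" and Dx: "D i x \<in> vmod J" for i x
  proof -
    have "\<tau> (D i x) = \<zero>\<^bsub>?F i\<^esub>" using PD(10)[OF D(2)[OF x]] D(2)[OF x] Dx by simp
    then have "\<tau> x \<in> mod_kernel (?F (Suc i)) (?F i) (\<delta> i)" using D(3)[OF x] PD(9)[OF x] by (simp add: mod_kernel_def)
    then obtain u where u: "u \<in> carrier (?F (Suc (Suc i)))" "\<tau> x = \<delta> (Suc i) u" using F5[of i] by blast
    obtain z where z: "z \<in> vec {..<n (Suc (Suc i))}" "u = \<tau> z" using u(1) by (rule presents_carrier[OF P])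
    have "\<tau> x = \<tau> (D (Suc i) z)" using D(3)[OF z(1)] u(2) z(2) by simp
    then show ?thesis using eqI[OF x D(2)[OF z(1)]] z(1) by blast
  qed
  let ?N = "{x \<in> vec {..<n 0}. \<exists>z\<in>vec {..<n (Suc 0)}. x - D 0 z \<in> vmod J}"
  have \<epsilon>: "\<epsilon> (u \<oplus>\<^bsub>?F 0\<^esub> v) = \<epsilon> u \<oplus>\<^bsub>M\<^esub> \<epsilon> v" "\<epsilon> u \<in> carrier M"
    if "u \<in> carrier (?F 0)" "v \<in> carrier (?F 0)" for u v
    using F2 that by (auto simp: module_hom_def)
  have closed: "\<epsilon> (\<tau> x) \<in> carrier M" if "x \<in> vec {..<n 0}" for x using \<epsilon>(2) PD(9)[OF that] by blast
  have \<theta>add: "\<epsilon> (\<tau> (x + y)) = \<epsilon> (\<tau> x) \<oplus>\<^bsub>M\<^esub> \<epsilon> (\<tau> y)" if "x \<in> vec {..<n 0}" "y \<in> vec {..<n 0}" for x y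
    using PD(6)[OF that] \<epsilon>(1) PD(9)[OF that(1)] PD(9)[OF that(2)] by simp
  have zero_iff: "\<epsilon> (\<tau> x) = \<zero>\<^bsub>M\<^esub> \<longleftrightarrow> x \<in> ?N" if x: "x \<in> vec {..<n 0}" for x
  proof
    assume "\<epsilon> (\<tau> x) = \<zero>\<^bsub>M\<^esub>"
    then have "\<tau> x \<in> mod_kernel (?F 0) M \<epsilon>" using PD(9)[OF x] by (simp add: mod_kernel_def)
    then obtain u where u: "u \<in> carrier (?F (Suc 0))" "\<tau> x = \<delta> 0 u" using F4 by blast
    obtain z where z: "z \<in> vec {..<n (Suc 0)}" "u = \<tau> z" using u(1) by (rule presents_carrier[OF P])
    have "\<tau> x = \<tau> (D 0 z)" using D(3)[OF z(1)] u(2) z(2) by simp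
    then show "x \<in> ?N" using eqI[OF x D(2)[OF z(1)]] z(1) x by blast
  next
    assume "x \<in> ?N"
    then obtain z where z: "z \<in> vec {..<n (Suc 0)}" "x - D 0 z \<in> vmod J" by blast
    have "\<tau> x = \<tau> (D 0 z)" using PD(8)[OF x D(2)[OF z(1)]] z(2) vec_diff[OF x D(2)[OF z(1)]] by simp
    then have "\<tau> x = \<delta> 0 (\<tau> z)" using D(3)[OF z(1)] by simp
    then have "\<tau> x \<in> mod_kernel (?F 0) M \<epsilon>" using F4 PD(9)[OF z(1)] by blast
    then show "\<epsilon> (\<tau> x) = \<zero>\<^bsub>M\<^esub>" by (simp add: mod_kernel_def)
  qed
  have "presents \<rho> M (vec {..<n 0}) ?N (\<lambda>x. \<epsilon> (\<tau> x))"
  proof (rule presentsI[OF submod_vec submod_boundaries[OF D(1) J]])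
    show "(\<lambda>x. \<epsilon> (\<tau> x)) ` vec {..<n 0} = carrier M" using PD(4)[of 0] F3 by (metis image_image)
    have "0 \<in> ?N" using submod_boundaries[OF D(1) J] by (auto simp: submod_def)
    then show "\<epsilon> (\<tau> 0) = \<zero>\<^bsub>M\<^esub>" using zero_iff[OF vec_zero] by blast
    fix x y :: "nat \<Rightarrow>\<^sub>0 'p" assume x: "x \<in> vec {..<n 0}" and y: "y \<in> vec {..<n 0}"
    show "\<epsilon> (\<tau> (x + y)) = \<epsilon> (\<tau> x) \<oplus>\<^bsub>M\<^esub> \<epsilon> (\<tau> y)" by (rule \<theta>add[OF x y])
    have "\<epsilon> (\<tau> ((x - y) + y)) = \<epsilon> (\<tau> (x - y)) \<oplus>\<^bsub>M\<^esub> \<epsilon> (\<tau> y)" by (rule \<theta>add[OF vec_diff[OF x y] y])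
    then have "\<epsilon> (\<tau> x) = \<epsilon> (\<tau> y) \<longleftrightarrow> \<epsilon> (\<tau> (x - y)) = \<zero>\<^bsub>M\<^esub>"
      using closed[OF vec_diff[OF x y]] closed[OF y] by simp
    then show "\<epsilon> (\<tau> x) = \<epsilon> (\<tau> y) \<longleftrightarrow> x - y \<in> ?N" using zero_iff[OF vec_diff[OF x y]] by simp
  next
    fix a and x :: "nat \<Rightarrow>\<^sub>0 'p" assume x: "x \<in> vec {..<n 0}"
    show "\<epsilon> (\<tau> (smul a x)) = \<rho> a \<odot>\<^bsub>M\<^esub> \<epsilon> (\<tau> x)"
      using PD(7)[OF x] F2 PD(9)[OF x] by (simp add: module_hom_def)
  qed auto
  then have "vec_resolution \<rho> M J (\<lambda>i. {..<n i}) D (\<lambda>x. \<epsilon> (\<tau> x))"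
    unfolding vec_resolution_def using D(1,2) sq exact by simp
  then show ?thesis using D(3) by (intro exI[of _ D]) simp
qed

text \<open>Enumerating the generators in each degree turns a resolution by vectors into one by the modules \<open>R\<^sup>n\<close>, so that the
  choice of a free resolution in \<open>tor\<close> is not void.\<close>

lemma vec_resolution_free:
  assumes R: "ring_cover R \<rho>" and A: "vec_resolution \<rho> M J X D \<theta>" and J: "J = {a. \<rho> a = \<zero>\<^bsub>R\<^esub>}"
    and fin: "\<And>i. finite (X i)"
  shows "\<exists>\<delta> \<epsilon>. free_resolution R M (\<lambda>i. card (X i)) \<delta> \<epsilon>"
proof -
  interpret R: ring_cover R \<rho> by fact
  note d = vec_resolutionD[OF A] and P = presentsD[OF vec_resolutionD(5)[OF A]]
  have idJ: "is_ideal J" using R.is_ideal_pre[OF R.zeroideal] by (simp add: R.pre_def J)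
  let ?F = "\<lambda>i. free_mod R {..<card (X i)}"
  have "\<exists>e. bij_betw e (X i) {..<card (X i)}" for i
    using ex_bij_betw_finite_nat[OF fin[of i]] by (simp add: atLeast0LessThan)
  then obtain e where e: "\<And>i. bij_betw (e i) (X i) {..<card (X i)}" by metis
  define \<eta> where "\<eta> i x = (\<lambda>j. \<rho> (lookup (linext (\<lambda>j. bas (e i j)) x) j))" for i x
  have PF: "presents \<rho> (?F i) (vec (X i)) (vec (X i) \<inter> vmod J) (\<eta> i)" for i
    using presents_reindex[OF presents_free_mod[OF R, folded J] e idJ, of i] by (simp add: \<eta>_def[abs_def])
  note PD = presentsD[OF PF]
  have "\<exists>g. g \<in> module_hom R (?F (Suc i)) (?F i) \<and> (\<forall>x\<in>vec (X (Suc i)). g (\<eta> (Suc i) x) = \<eta> i (D i x))" for i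
  proof (rule presents_hom[OF R PF PF d(1)])
    show "D i x \<in> vec (X i)" if "x \<in> vec (X (Suc i))" for x using d(2) that .
    show "D i x \<in> vec (X i) \<inter> vmod J" if "x \<in> vec (X (Suc i)) \<inter> vmod J" for x
      using d(2)[of x i] lin_vmod[OF d(1) idJ] that by blast
  qed
  then have "\<forall>i. \<exists>g. g \<in> module_hom R (?F (Suc i)) (?F i) \<and> (\<forall>x\<in>vec (X (Suc i)). g (\<eta> (Suc i) x) = \<eta> i (D i x))"
    by blast
  from choice[OF this] obtain \<delta> where \<delta>: "\<forall>i. \<delta> i \<in> module_hom R (?F (Suc i)) (?F i) \<and>
      (\<forall>x\<in>vec (X (Suc i)). \<delta> i (\<eta> (Suc i) x) = \<eta> i (D i x))" ..
  then have \<delta>eq: "x \<in> vec (X (Suc i)) \<Longrightarrow> \<delta> i (\<eta> (Suc i) x) = \<eta> i (D i x)" for x i by blast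
  have "\<exists>g. g \<in> module_hom R (?F 0) M \<and> (\<forall>x\<in>vec (X 0). g (\<eta> 0 x) = \<theta> x)"
  proof (rule presents_hom[OF R PF d(5) lin_id])
    fix x assume x: "x \<in> vec (X 0) \<inter> vmod J"
    then have "x - D 0 0 \<in> vmod J" by (simp add: lin_0[OF d(1)])
    then show "x \<in> {x \<in> vec (X 0). \<exists>z\<in>vec (X (Suc 0)). x - D 0 z \<in> vmod J}" using x vec_zero by blast
  qed
  then obtain \<epsilon> where \<epsilon>: "\<epsilon> \<in> module_hom R (?F 0) M" "\<And>x. x \<in> vec (X 0) \<Longrightarrow> \<epsilon> (\<eta> 0 x) = \<theta> x" by blast
  have eq_iff: "\<eta> i x = \<eta> i z \<longleftrightarrow> x - z \<in> vmod J" if "x \<in> vec (X i)" "z \<in> vec (X i)" for i x z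
    using PD(8)[OF that] vec_diff[OF that] by simp
  have image: "\<delta> i ` carrier (?F (Suc i)) = {\<eta> i x | x. x \<in> vec (X i) \<and> (\<exists>z\<in>vec (X (Suc i)). x - D i z \<in> vmod J)}" for i
  proof (intro equalityI subsetI)
    fix u assume "u \<in> \<delta> i ` carrier (?F (Suc i))"
    then obtain v where v: "v \<in> carrier (?F (Suc i))" "u = \<delta> i v" by blast
    obtain z where z: "z \<in> vec (X (Suc i))" "v = \<eta> (Suc i) z" using v(1) by (rule presents_carrier[OF PF])
    have "u = \<eta> i (D i z)" using v z \<delta>eq by simp
    moreover have "D i z - D i z \<in> vmod J" using vmod_zero[OF idJ] by simp
    ultimately show "u \<in> {\<eta> i x | x. x \<in> vec (X i) \<and> (\<exists>z\<in>vec (X (Suc i)). x - D i z \<in> vmod J)}"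
      using d(2)[OF z(1)] z(1) by blast
  next
    fix u assume "u \<in> {\<eta> i x | x. x \<in> vec (X i) \<and> (\<exists>z\<in>vec (X (Suc i)). x - D i z \<in> vmod J)}"
    then obtain x z where x: "u = \<eta> i x" "x \<in> vec (X i)" "z \<in> vec (X (Suc i))" "x - D i z \<in> vmod J" by blast
    then have "u = \<delta> i (\<eta> (Suc i) z)" using eq_iff[OF x(2) d(2)[OF x(3)]] \<delta>eq[OF x(3)] by simp
    then show "u \<in> \<delta> i ` carrier (?F (Suc i))" using PD(9)[OF x(3)] by blast
  qed
  have "free_resolution R M (\<lambda>i. card (X i)) \<delta> \<epsilon>"
    unfolding free_resolution_def Let_def
  proof (intro conjI allI)
    show "\<delta> i \<in> module_hom R (?F (Suc i)) (?F i)" for i using \<delta> by blast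
    show "\<epsilon> \<in> module_hom R (?F 0) M" by (rule \<epsilon>(1))
    have "\<epsilon> ` (\<eta> 0 ` vec (X 0)) = carrier M" using P(4) \<epsilon>(2) by (simp add: image_image)
    then show "\<epsilon> ` carrier (?F 0) = carrier M" by (simp only: PD(4))
    show "\<delta> 0 ` carrier (?F 1) = mod_kernel (?F 0) M \<epsilon>"
    proof -
      have "mod_kernel (?F 0) M \<epsilon> = {\<eta> 0 x | x. x \<in> vec (X 0) \<and> \<theta> x = \<zero>\<^bsub>M\<^esub>}"
        unfolding mod_kernel_def PD(4)[symmetric] using \<epsilon>(2) by auto
      then show ?thesis using image[of 0] P(10) by auto
    qed
    show "\<delta> (Suc i) ` carrier (?F (Suc (Suc i))) = mod_kernel (?F (Suc i)) (?F i) (\<delta> i)" for i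
    proof -
      have "mod_kernel (?F (Suc i)) (?F i) (\<delta> i) = {\<eta> (Suc i) x | x. x \<in> vec (X (Suc i)) \<and> \<eta> i (D i x) = \<zero>\<^bsub>?F i\<^esub>}"
        unfolding mod_kernel_def PD(4)[symmetric] using \<delta>eq by auto
      moreover have "\<eta> i (D i x) = \<zero>\<^bsub>?F i\<^esub> \<longleftrightarrow> (\<exists>z\<in>vec (X (Suc (Suc i))). x - D (Suc i) z \<in> vmod J)"
        if x: "x \<in> vec (X (Suc i))" for x
      proof
        assume "\<eta> i (D i x) = \<zero>\<^bsub>?F i\<^esub>"
        then have "D i x \<in> vmod J" using PD(10)[OF d(2)[OF x]] by blast
        then show "\<exists>z\<in>vec (X (Suc (Suc i))). x - D (Suc i) z \<in> vmod J" by (rule d(4)[OF x])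
      next
        assume "\<exists>z\<in>vec (X (Suc (Suc i))). x - D (Suc i) z \<in> vmod J"
        then obtain z where z: "z \<in> vec (X (Suc (Suc i)))" "x - D (Suc i) z \<in> vmod J" by blast
        have "D i (x - D (Suc i) z) + D i (D (Suc i) z) \<in> vmod J"
          by (rule vmod_add[OF idJ lin_vmod[OF d(1) idJ z(2)] d(3)[OF z(1)]])
        then have "D i x \<in> vmod J" by (simp add: lin_diff[OF d(1)])
        then show "\<eta> i (D i x) = \<zero>\<^bsub>?F i\<^esub>" using PD(10)[OF d(2)[OF x]] d(2)[OF x] by blast
      qed
      ultimately show ?thesis using image[of "Suc i"] by auto
    qed
  qed
  then show ?thesis by blast
qed

text \<open>Reduced modulo \<open>m\<close>, the homology of any resolution is the free module on the generators of a minimal one: the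
  comparison maps are inverse to each other on homology, and the minimal resolution has zero differential modulo
  \<open>m\<close>.\<close>

lemma homology_presented:
  fixes X :: "nat \<Rightarrow> 'i set" and X' :: "nat \<Rightarrow> 'j set" and J m :: "'p::comm_ring_1 set"
  assumes R: "ring_cover R \<rho>" and J: "is_ideal J" and m: "is_ideal m" "J \<subseteq> m"
    and A: "vec_resolution \<rho> M J X D \<theta>" and A': "vec_resolution \<rho> M J X' D' \<theta>'"
    and min: "\<And>i x. x \<in> vec (X (Suc i)) \<Longrightarrow> D i x \<in> vmod m"
    and Q: "presents \<kappa> Q {x \<in> vec (X' i). \<forall>k. i = Suc k \<longrightarrow> D' k x \<in> vmod m}
      {x \<in> vec (X' i). \<exists>z\<in>vec (X' (Suc i)). x - D' i z \<in> vmod m} \<eta>"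
  shows "\<exists>\<zeta>. presents \<kappa> Q (vec (X i)) (vec (X i) \<inter> vmod m) \<zeta>"
proof -
  note d = vec_resolutionD[OF A] and d' = vec_resolutionD[OF A'] and q = presentsD[OF Q]
  let ?Z = "{x \<in> vec (X' i). \<forall>k. i = Suc k \<longrightarrow> D' k x \<in> vmod m}"
  let ?W = "{x \<in> vec (X' i). \<exists>z\<in>vec (X' (Suc i)). x - D' i z \<in> vmod m}"
  obtain \<alpha> where \<alpha>: "comparison J X D \<theta> X' D' \<theta>' \<alpha>" using chain_lift[OF R J A A'] ..
  obtain \<beta> where \<beta>: "comparison J X' D' \<theta>' X D \<theta> \<beta>" using chain_lift[OF R J A' A] ..
  note a = comparisonD[OF \<alpha>] and b = comparisonD[OF \<beta>]
  note Jm = subsetD[OF vmod_mono[OF m(2)]]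
  \<comment> \<open>\<open>\<beta> \<circ> \<alpha>\<close> is the identity modulo \<open>m\<close>, since the resolution \<open>D\<close> is minimal\<close>
  have ba: "\<beta> i (\<alpha> i x) - x \<in> vmod m" if x: "x \<in> vec (X i)" for x
  proof -
    obtain s where s0: "(\<forall>i. lin (s i)) \<and> (\<forall>i. \<forall>x\<in>vec (X i). s i x \<in> vec (X (Suc i))) \<and>
      (\<forall>x\<in>vec (X 0). \<beta> 0 (\<alpha> 0 x) - x - D 0 (s 0 x) \<in> vmod J) \<and>
      (\<forall>i. \<forall>x\<in>vec (X (Suc i)). \<beta> (Suc i) (\<alpha> (Suc i) x) - x - s i (D i x) - D (Suc i) (s (Suc i) x) \<in> vmod J)"
      using homotopy_inverse[OF R J A A' \<alpha> \<beta>] by (elim exE)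
    have sx: "s i x \<in> vec (X (Suc i))" using s0 x by simp
    have Ds: "D i (s i x) \<in> vmod m" by (rule min[OF sx])
    show ?thesis
    proof (cases i)
      case 0
      then have "\<beta> i (\<alpha> i x) - x - D i (s i x) \<in> vmod m" by (intro Jm) (use s0 x in simp)
      from vmod_add[OF m(1) this Ds] show ?thesis by simp
    next
      case (Suc k)
      have "\<beta> i (\<alpha> i x) - x - s k (D k x) - D i (s i x) \<in> vmod m" by (rule Jm) (use s0 x Suc in simp)
      from vmod_add[OF m(1) this Ds] have "\<beta> i (\<alpha> i x) - x - s k (D k x) \<in> vmod m" by simp
      moreover have "s k (D k x) \<in> vmod m"
        by (rule lin_vmod[OF _ m(1)]) (use min[of x k] x Suc s0 in simp_all)
      ultimately have "(\<beta> i (\<alpha> i x) - x - s k (D k x)) + s k (D k x) \<in> vmod m" by (rule vmod_add[OF m(1)])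
      then show ?thesis by simp
    qed
  qed
  \<comment> \<open>\<open>\<alpha> \<circ> \<beta>\<close> is the identity on homology\<close>
  have ab: "\<alpha> i (\<beta> i z) - z \<in> ?W" if z: "z \<in> ?Z" for z
  proof -
    obtain s where s0: "(\<forall>i. lin (s i)) \<and> (\<forall>i. \<forall>x\<in>vec (X' i). s i x \<in> vec (X' (Suc i))) \<and>
      (\<forall>x\<in>vec (X' 0). \<alpha> 0 (\<beta> 0 x) - x - D' 0 (s 0 x) \<in> vmod J) \<and>
      (\<forall>i. \<forall>x\<in>vec (X' (Suc i)). \<alpha> (Suc i) (\<beta> (Suc i) x) - x - s i (D' i x) - D' (Suc i) (s (Suc i) x) \<in> vmod J)"
      using homotopy_inverse[OF R J A' A \<beta> \<alpha>] by (elim exE)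
    have zv: "z \<in> vec (X' i)" using z by simp
    have sz: "s i z \<in> vec (X' (Suc i))" using s0 zv by simp
    have "\<alpha> i (\<beta> i z) - z - D' i (s i z) \<in> vmod m"
    proof (cases i)
      case 0
      then show ?thesis by (intro Jm) (use s0 zv in simp)
    next
      case (Suc k)
      have 1: "\<alpha> i (\<beta> i z) - z - s k (D' k z) - D' i (s i z) \<in> vmod m" by (rule Jm) (use s0 zv Suc in simp)
      have 2: "s k (D' k z) \<in> vmod m" by (rule lin_vmod[OF _ m(1)]) (use z Suc s0 in simp_all)
      show ?thesis using vmod_add[OF m(1) 1 2] by (simp add: algebra_simps)
    qed
    moreover have "\<alpha> i (\<beta> i z) - z \<in> vec (X' i)" by (rule vec_diff[OF a(2)[OF b(2)[OF zv]] zv])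
    ultimately show ?thesis using sz by blast
  qed
  have aZ: "\<alpha> i x \<in> ?Z" if x: "x \<in> vec (X i)" for x
  proof -
    have "D' k (\<alpha> i x) \<in> vmod m" if i: "i = Suc k" for k
    proof -
      have xk: "x \<in> vec (X (Suc k))" using x i by simp
      have "\<alpha> k (D k x) - (\<alpha> k (D k x) - D' k (\<alpha> (Suc k) x)) \<in> vmod m"
        by (rule vmod_diff[OF m(1) lin_vmod[OF a(1) m(1) min[OF xk]] Jm[OF a(4)[OF xk]]])
      then show ?thesis using i by simp
    qed
    then show ?thesis using a(2)[OF x] by simp
  qed
  have W_iff: "\<alpha> i x \<in> ?W \<longleftrightarrow> x \<in> vmod m" if x: "x \<in> vec (X i)" for x
  proof
    assume "x \<in> vmod m"
    then have "\<alpha> i x - D' i 0 \<in> vmod m" using lin_vmod[OF a(1) m(1), of x] by (simp add: lin_0[OF d'(1)])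
    then show "\<alpha> i x \<in> ?W" using a(2)[OF x] vec_zero by blast
  next
    assume "\<alpha> i x \<in> ?W"
    then obtain z where z: "z \<in> vec (X' (Suc i))" "\<alpha> i x - D' i z \<in> vmod m" by blast
    have 1: "\<beta> i (\<alpha> i x) - \<beta> i (D' i z) \<in> vmod m"
      using lin_vmod[OF b(1) m(1) z(2), of i] by (simp add: lin_diff[OF b(1)])
    have 2: "\<beta> i (D' i z) - D i (\<beta> (Suc i) z) \<in> vmod m" by (rule Jm[OF b(4)[OF z(1)]])
    have 3: "D i (\<beta> (Suc i) z) \<in> vmod m" by (rule min[OF b(2)[OF z(1)]])
    have "\<beta> i (\<alpha> i x) \<in> vmod m"
      using vmod_add[OF m(1) vmod_add[OF m(1) 1 2] 3] by (simp add: algebra_simps)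
    from vmod_diff[OF m(1) this ba[OF x]] show "x \<in> vmod m" by simp
  qed
  have "presents \<kappa> Q (vec (X i)) (vec (X i) \<inter> vmod m) (\<lambda>x. \<eta> (\<alpha> i x))"
  proof (rule presentsI)
    show "submod (vec (X i) :: ('i \<Rightarrow>\<^sub>0 'p) set)" by (rule submod_vec)
    show "submod (vec (X i) \<inter> vmod m :: ('i \<Rightarrow>\<^sub>0 'p) set)" by (rule submod_Int[OF submod_vec submod_vmod[OF m(1)]])
    show "(\<lambda>x. \<eta> (\<alpha> i x)) ` vec (X i) = carrier Q"
    proof (intro equalityI subsetI)
      fix u assume "u \<in> carrier Q"
      then obtain z where z: "z \<in> ?Z" "u = \<eta> z" by (rule presents_carrier[OF Q])
      have zv: "z \<in> vec (X' i)" using z by simp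
      have "\<eta> (\<alpha> i (\<beta> i z)) = \<eta> z" using q(8)[OF aZ[OF b(2)[OF zv]] z(1)] ab[OF z(1)] by blast
      then show "u \<in> (\<lambda>x. \<eta> (\<alpha> i x)) ` vec (X i)"
        using z(2) b(2)[OF zv] by (intro image_eqI[of _ _ "\<beta> i z"]) simp_all
    next
      fix u assume "u \<in> (\<lambda>x. \<eta> (\<alpha> i x)) ` vec (X i)"
      then obtain x where x: "x \<in> vec (X i)" "u = \<eta> (\<alpha> i x)" by blast
      then show "u \<in> carrier Q" using q(9)[OF aZ[OF x(1)]] by simp
    qed
    show "\<eta> (\<alpha> i 0) = \<zero>\<^bsub>Q\<^esub>" using q(5) by (simp add: lin_0[OF a(1)])
    fix x :: "'i \<Rightarrow>\<^sub>0 'p" assume x: "x \<in> vec (X i)"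
    show "\<eta> (\<alpha> i (smul r x)) = \<kappa> r \<odot>\<^bsub>Q\<^esub> \<eta> (\<alpha> i x)" for r
      using q(7)[OF aZ[OF x]] by (simp add: lin_smul[OF a(1)])
    fix y :: "'i \<Rightarrow>\<^sub>0 'p" assume y: "y \<in> vec (X i)"
    show "\<eta> (\<alpha> i (x + y)) = \<eta> (\<alpha> i x) \<oplus>\<^bsub>Q\<^esub> \<eta> (\<alpha> i y)"
      using q(6)[OF aZ[OF x] aZ[OF y]] by (simp add: lin_add[OF a(1)])
    have "\<eta> (\<alpha> i x) = \<eta> (\<alpha> i y) \<longleftrightarrow> \<alpha> i (x - y) \<in> ?W"
      using q(8)[OF aZ[OF x] aZ[OF y]] by (simp only: lin_diff[OF a(1)])
    also have "\<dots> \<longleftrightarrow> x - y \<in> vec (X i) \<inter> vmod m"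
      using W_iff[OF vec_diff[OF x y]] vec_diff[OF x y] by blast
    finally show "\<eta> (\<alpha> i x) = \<eta> (\<alpha> i y) \<longleftrightarrow> x - y \<in> vec (X i) \<inter> vmod m" .
  qed auto
  then show ?thesis by blast
qed

text \<open>The module \<open>tor\<close> is the homology modulo \<open>ker_K\<close> of the resolution that its definition selects.\<close>

lemma (in scalar_extension) tor_presents:
  assumes M: "module R M" and ex: "\<exists>n \<delta> \<epsilon>. free_resolution R M n \<delta> \<epsilon>"
  shows "\<exists>X' D' \<theta>' \<eta>. vec_resolution \<pi> M ker_R (X' :: nat \<Rightarrow> nat set) D' \<theta>' \<and>
    presents \<kappa> (tor R M K \<phi> i) {x \<in> vec (X' i). \<forall>k. i = Suc k \<longrightarrow> D' k x \<in> vmod ker_K}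
      {x \<in> vec (X' i). \<exists>z\<in>vec (X' (Suc i)). x - D' i z \<in> vmod ker_K} \<eta>"
proof -
  obtain n \<delta> where nd: "(SOME (n, \<delta>). \<exists>\<epsilon>. free_resolution R M n \<delta> \<epsilon>) = (n, \<delta>)" by force
  have "\<exists>p. case p of (n, \<delta>) \<Rightarrow> \<exists>\<epsilon>. free_resolution R M n \<delta> \<epsilon>" using ex by auto
  from someI_ex[OF this] obtain \<epsilon> where F: "free_resolution R M n \<delta> \<epsilon>" unfolding nd by auto
  let ?\<tau> = "\<lambda>x j. \<pi> (lookup x j)"
  let ?X = "\<lambda>i. {..<n i}"
  let ?F = "\<lambda>i. free_mod R (?X i)"
  obtain D where A: "vec_resolution \<pi> M ker_R ?X D (\<lambda>x. \<epsilon> (?\<tau> x))"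
    and D: "\<And>i x. x \<in> vec (?X (Suc i)) \<Longrightarrow> \<delta> i (?\<tau> x) = ?\<tau> (D i x)"
    using free_resolution_vec[OF R.ring_cover_axioms M F] by blast
  note d = vec_resolutionD[OF A]
  have P: "presents \<pi> (?F j) (vec (?X j)) (vec (?X j) \<inter> vmod ker_R) ?\<tau>" for j
    by (rule presents_free_mod[OF R.ring_cover_axioms])
  let ?T = "\<lambda>j. base_change R K \<phi> (?F j)"
  let ?b = "\<lambda>j x. tensor_pure R (alg_mod K \<phi>) (?F j) \<one>\<^bsub>K\<^esub> (?\<tau> x)"
  let ?B = "\<lambda>j. base_change_map R K \<phi> (?F (Suc j)) (?F j) (\<delta> j)"
  have PT: "presents \<kappa> (?T j) (vec (?X j)) (vec (?X j) \<inter> vmod ker_K) (?b j)" for j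
    by (rule base_change_presents[OF P])
  note pt = presentsD[OF PT]
  have B: "?B j (?b (Suc j) x) = ?b j (D j x)" if "x \<in> vec (?X (Suc j))" for j x
    by (rule base_change_map_eq[OF P P d(1)]) (use d(2) D that in auto)
  let ?Z = "{x \<in> vec (?X i). \<forall>k. i = Suc k \<longrightarrow> D k x \<in> vmod ker_K}"
  let ?W = "{x \<in> vec (?X i). \<exists>z\<in>vec (?X (Suc i)). x - D i z \<in> vmod ker_K}"
  have Z: "(if i = 0 then carrier (?T 0) else mod_kernel (?T i) (?T (i - 1)) (?B (i - 1))) = ?b i ` ?Z"
  proof (cases i)
    case 0
    then show ?thesis using pt(4)[of 0] by simp
  next
    case (Suc k)
    have "mod_kernel (?T (Suc k)) (?T k) (?B k) = {?b (Suc k) x | x. x \<in> vec (?X (Suc k)) \<and> ?b k (D k x) = \<zero>\<^bsub>?T k\<^esub>}"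
      unfolding mod_kernel_def pt(4)[symmetric] using B by auto
    also have "\<dots> = ?b (Suc k) ` {x \<in> vec (?X (Suc k)). D k x \<in> vmod ker_K}"
      using pt(10)[OF d(2)] d(2) by blast
    finally show ?thesis using Suc by simp
  qed
  have idK: "is_ideal ker_K" by (rule is_ideal_ker_K)
  have sub: "submod ?Z" "submod ?W" "vec (?X i) \<inter> vmod ker_K \<subseteq> ?W" "?W \<subseteq> ?Z" "?Z \<subseteq> vec (?X i)"
  proof -
    show "submod ?Z"
      unfolding submod_def using idK
      by (auto simp: vec_zero vec_add vec_smul lin_0[OF d(1)] lin_add[OF d(1)] lin_smul[OF d(1)] vmod_zero vmod_add vmod_smul)
    show "submod ?W" by (rule submod_boundaries[OF d(1) idK])
    show "vec (?X i) \<inter> vmod ker_K \<subseteq> ?W"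
    proof
      fix x assume x: "x \<in> vec (?X i) \<inter> vmod ker_K"
      then have "x - D i 0 \<in> vmod ker_K" by (simp add: lin_0[OF d(1)])
      then show "x \<in> ?W" using x vec_zero by blast
    qed
    show "?W \<subseteq> ?Z"
    proof
      fix x assume "x \<in> ?W"
      then obtain z where z: "x \<in> vec (?X i)" "z \<in> vec (?X (Suc i))" "x - D i z \<in> vmod ker_K" by blast
      have "D k x \<in> vmod ker_K" if i: "i = Suc k" for k
      proof -
        have zk: "z \<in> vec (?X (Suc (Suc k)))" using z(2) i by simp
        have "D k (D i z) \<in> vmod ker_K" using d(3)[OF zk] vmod_mono[OF ker_sub] i by blast
        from vmod_add[OF idK lin_vmod[OF d(1) idK z(3), of k] this] show ?thesis
          by (simp add: lin_diff[OF d(1)])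
      qed
      then show "x \<in> ?Z" using z(1) by simp
    qed
    show "?Z \<subseteq> vec (?X i)" by blast
  qed
  have W: "?B i ` carrier (?T (Suc i)) = ?b i ` ?W"
  proof (intro equalityI subsetI)
    fix u assume "u \<in> ?B i ` carrier (?T (Suc i))"
    then obtain v where v: "v \<in> carrier (?T (Suc i))" "u = ?B i v" by blast
    obtain z where z: "z \<in> vec (?X (Suc i))" "v = ?b (Suc i) z" using v(1) by (rule presents_carrier[OF PT])
    have "D i z - D i z \<in> vmod ker_K" using vmod_zero[OF idK] by simp
    then have "D i z \<in> ?W" using d(2)[OF z(1)] z(1) by blast
    moreover have "u = ?b i (D i z)" using B[OF z(1)] v z by simp
    ultimately show "u \<in> ?b i ` ?W" by blast
  next
    fix u assume "u \<in> ?b i ` ?W"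
    then obtain x z where x: "u = ?b i x" "x \<in> vec (?X i)" "z \<in> vec (?X (Suc i))" "x - D i z \<in> vmod ker_K" by blast
    have "?b i x = ?b i (D i z)"
      using pt(8)[OF x(2) d(2)[OF x(3)]] vec_diff[OF x(2) d(2)[OF x(3)]] x(4) by blast
    then have "u = ?B i (?b (Suc i) z)" using B[OF x(3)] x(1) by simp
    then show "u \<in> ?B i ` carrier (?T (Suc i))" using pt(9)[OF x(3)] by blast
  qed
  have tor: "tor R M K \<phi> i = quot_mod ((?T i)\<lparr>carrier := ?b i ` ?Z\<rparr>) (?b i ` ?W)"
    unfolding tor_def nd using Z W by simp
  have "\<exists>\<eta>. presents \<kappa> (tor R M K \<phi> i) ?Z ?W \<eta>"
  proof -
    have "presents \<kappa> ((?T i)\<lparr>carrier := ?b i ` ?Z\<rparr>) ?Z (vec (?X i) \<inter> vmod ker_K) (?b i)"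
      by (rule presents_sub[OF PT sub(1) _ sub(5)]) (use sub(3,4) in blast)
    from presents_quot[OF K.ring_cover_axioms this sub(2,3,4)] show ?thesis unfolding tor by blast
  qed
  then obtain \<eta> where "presents \<kappa> (tor R M K \<phi> i) ?Z ?W \<eta>" ..
  with A show ?thesis by (intro exI[of _ ?X] exI[of _ D] exI[of _ "\<lambda>x. \<epsilon> (?\<tau> x)"] exI[of _ \<eta>]) simp
qed

theorem (in scalar_extension) tor_rank:
  assumes A: "vec_resolution \<pi> M ker_R X D \<theta>" and fin: "\<And>i. finite (X i)"
    and m: "is_maximal ker_K" and min: "\<And>i x. x \<in> vec (X (Suc i)) \<Longrightarrow> D i x \<in> vmod ker_K"
  shows "mod_rank K (tor R M K \<phi> i) = card (X i)"
proof -
  have M: "module R M" by (rule presents_module[OF R.ring_cover_axioms vec_resolutionD(5)[OF A]])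
  have "\<exists>n \<delta> \<epsilon>. free_resolution R M n \<delta> \<epsilon>"
    using vec_resolution_free[OF R.ring_cover_axioms A refl fin] by blast
  from tor_presents[OF M this, of i]
  obtain X' :: "nat \<Rightarrow> nat set" and D' \<theta>' \<eta> where A': "vec_resolution \<pi> M ker_R X' D' \<theta>'"
    and Q: "presents \<kappa> (tor R M K \<phi> i) {x \<in> vec (X' i). \<forall>k. i = Suc k \<longrightarrow> D' k x \<in> vmod ker_K}
      {x \<in> vec (X' i). \<exists>z\<in>vec (X' (Suc i)). x - D' i z \<in> vmod ker_K} \<eta>"
    by (elim exE conjE)
  have "\<exists>\<zeta>. presents \<kappa> (tor R M K \<phi> i) (vec (X i)) (vec (X i) \<inter> vmod ker_K) \<zeta>"
    by (rule homology_presented[OF R.ring_cover_axioms is_ideal_ker_R is_ideal_ker_K ker_sub A A' _ Q]) (rule min)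
  then obtain \<zeta> where "presents \<kappa> (tor R M K \<phi> i) (vec (X i)) (vec (X i) \<inter> vmod ker_K) \<zeta>" ..
  then show ?thesis by (rule presents_rank[OF K.ring_cover_axioms refl m fin])
qed

section \<open>Counting the generators\<close>

text \<open>A generator is either divisible by the largest variable or belongs to the previous level.\<close>

lemma gens_step:
  assumes lev: "\<And>b. b \<in> B \<Longrightarrow> 1 \<le> lev b" and par: "\<And>b. b \<in> B \<Longrightarrow> par b \<le> 1"
  shows "gens B lev par (Suc p) (n + 2) =
    gens B lev par p (n + 2) \<union> (\<lambda>(e, b). (add_mset (Suc p) e, b)) ` gens B lev par (Suc p) n" (is "?L = ?A \<union> ?C")
proof
  show "?L \<subseteq> ?A \<union> ?C"
  proof safe
    fix e b assume eb: "(e, b) \<in> ?L" "(e, b) \<notin> ?C"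
    have "Suc p \<notin># e"
    proof
      assume "Suc p \<in># e"
      then obtain e' where e': "e = add_mset (Suc p) e'" by (metis multi_member_split)
      then have "(e', b) \<in> gens B lev par (Suc p) n" using eb(1) by (auto simp: gens_def)
      then show False using eb(2) e' by force
    qed
    then have sub: "set_mset e \<subseteq> {lev b..p}"
      using eb(1) by (force simp: gens_def le_Suc_eq)
    have "e \<noteq> {#}" using eb(1) par[of b] by (auto simp: gens_def)
    then obtain q where "q \<in># e" by auto
    then have "lev b \<le> p" using sub by force
    then show "(e, b) \<in> ?A" using eb(1) sub by (auto simp: gens_def)
  qed
  show "?A \<union> ?C \<subseteq> ?L" by (force simp: gens_def)
qed

lemma gens_0:
  assumes s: "s \<le> 1"
  shows "gens B lev par p s = (\<lambda>b. ({#}, b)) ` {b \<in> B. lev b \<le> p \<and> par b = s}"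
proof -
  have "e = {#}" if "2 * size e + par b = s" for e :: "nat multiset" and b using that s by (cases e) auto
  then show ?thesis by (fastforce simp: gens_def)
qed

text \<open>By induction on the level and the degree, with Pascal's rule for the recursion of \<open>gens_step\<close>.\<close>

lemma card_gens:
  assumes B: "finite B" and lev: "\<And>b. b \<in> B \<Longrightarrow> 1 \<le> lev b" and par: "\<And>b. b \<in> B \<Longrightarrow> par b \<le> 1"
    and s: "s \<le> 1"
  shows "finite (gens B lev par p (2 * z + s)) \<and> card (gens B lev par p (2 * z + s)) =
    (\<Sum>q=1..p. ((p - q + z) choose (p - q)) * card {b \<in> B. lev b = q \<and> par b = s})"
proof (induction p arbitrary: z)
  case 0
  have "gens B lev par 0 n = {}" for n using lev by (force simp: gens_def)
  then show ?case by simp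
next
  case (Suc p)
  note IHp = Suc.IH
  let ?r = "\<lambda>q. card {b \<in> B. lev b = q \<and> par b = s}"
  show ?case
  proof (induction z)
    case 0
    have inj: "inj (\<lambda>b. ({#} :: nat multiset, b))" by (auto simp: inj_on_def)
    have "{b \<in> B. lev b \<le> Suc p \<and> par b = s} =
        {b \<in> B. lev b \<le> p \<and> par b = s} \<union> {b \<in> B. lev b = Suc p \<and> par b = s}" by auto
    then have "card (gens B lev par (Suc p) s) = card (gens B lev par p s) + ?r (Suc p)"
      using B unfolding gens_0[OF s] card_image[OF inj_on_subset[OF inj subset_UNIV]]
      by (simp add: card_Un_disjoint disjoint_iff)
    moreover have "finite (gens B lev par (Suc p) s)" unfolding gens_0[OF s] using B by simp
    ultimately show ?case using Suc.IH[of 0] by simp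
  next
    case (Suc z)
    let ?y = "\<lambda>(e, b). (add_mset (Suc p) e, b)"
    let ?A = "gens B lev par p (2 * Suc z + s)" and ?C = "?y ` gens B lev par (Suc p) (2 * z + s)"
    have eq: "gens B lev par (Suc p) (2 * Suc z + s) = ?A \<union> ?C"
      using gens_step[where p = p and n = "2 * z + s", OF lev par] by simp
    have disj: "?A \<inter> ?C = {}" by (auto simp: gens_def)
    have "inj_on ?y (gens B lev par (Suc p) (2 * z + s))" by (auto simp: inj_on_def)
    then have C: "card ?C = card (gens B lev par (Suc p) (2 * z + s))" by (rule card_image)
    have fin: "finite ?A" "finite ?C" using Suc.IH IHp[of "Suc z"] by auto
    have "card (gens B lev par (Suc p) (2 * Suc z + s)) = card ?A + card (gens B lev par (Suc p) (2 * z + s))"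
      unfolding eq using card_Un_disjoint[OF fin disj] C by simp
    also have "\<dots> = (\<Sum>q=1..p. ((p - q + Suc z) choose (p - q)) * ?r q) +
        (\<Sum>q=1..Suc p. ((Suc p - q + z) choose (Suc p - q)) * ?r q)"
      using Suc.IH IHp[of "Suc z"] by simp
    also have "\<dots> = (\<Sum>q=1..p. ((p - q + Suc z) choose (p - q)) * ?r q + ((Suc p - q + z) choose (Suc p - q)) * ?r q) + ?r (Suc p)"
      by (simp add: sum.distrib)
    also have "\<dots> = (\<Sum>q=1..p. ((Suc p - q + Suc z) choose (Suc p - q)) * ?r q) + ?r (Suc p)"
      by (intro arg_cong2[where f = "(+)"] sum.cong refl)
        (simp add: Suc_diff_le add_mult_distrib[symmetric])
    finally show ?case using fin unfolding eq by simp
  qed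
qed

section \<open>Generating functions\<close>

text \<open>The expansion of \<open>1 / (1 - x\<^sup>2)\<^bsup>k + 1\<^esup>\<close>.\<close>

definition even_binomial_series :: "nat \<Rightarrow> rat fps"
  where "even_binomial_series k = Abs_fps (\<lambda>n. if even n then of_nat ((k + n div 2) choose k) else 0)"

lemma even_binomial_series_mult: "even_binomial_series k * (1 - fps_X\<^sup>2) ^ (k + 1) = 1"
proof (induction k)
  case 0
  show ?case
    by (rule fps_ext) (auto simp: even_binomial_series_def right_diff_distrib fps_X_power_mult_right_nth)
next
  case (Suc k)
  have "even_binomial_series (Suc k) * (1 - fps_X\<^sup>2) = even_binomial_series k"
  proof (rule fps_ext)
    fix n
    show "fps_nth (even_binomial_series (Suc k) * (1 - fps_X\<^sup>2)) n = fps_nth (even_binomial_series k) n"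
    proof (cases "even n \<and> n \<ge> 2")
      case True
      then obtain j where j: "n = 2 * Suc j" by (metis evenE not0_implies_Suc mult_0_right not_numeral_le_zero)
      have "of_nat ((Suc k + Suc j) choose Suc k) =
          (of_nat ((Suc k + j) choose Suc k) + of_nat ((k + Suc j) choose k) :: rat)"
        by (simp flip: of_nat_add)
      then show ?thesis
        using j by (simp add: even_binomial_series_def right_diff_distrib fps_X_power_mult_right_nth)
    next
      case False
      then have "odd n \<or> n = 0" by (cases n rule: nat.exhaust) (auto, presburger)
      then show ?thesis
        by (auto simp: even_binomial_series_def right_diff_distrib fps_X_power_mult_right_nth)
    qed
  qed
  then show ?case using Suc by (simp add: mult.assoc[symmetric])
qed

lemma inverse_one_minus_X2_power: "1 / (1 - fps_X\<^sup>2) ^ (k + 1) = even_binomial_series k"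
proof -
  have 0: "fps_nth ((1 - fps_X\<^sup>2 :: rat fps) ^ (k + 1)) 0 \<noteq> 0" by (simp add: fps_nth_power_0)
  have "(1 - fps_X\<^sup>2) ^ (k + 1) * even_binomial_series k = 1"
    using even_binomial_series_mult[of k] by (simp only: mult.commute)
  then have "inverse ((1 - fps_X\<^sup>2) ^ (k + 1)) = even_binomial_series k" by (rule fps_inverse_unique)
  then show ?thesis using fps_divide_unit[OF 0, of 1] by simp
qed

lemma poincare_coeff:
  "fps_nth (1 / (1 - fps_X\<^sup>2) ^ (k + 1) * (fps_X * of_nat r1 + of_nat r0)) n =
    (if even n then of_nat (((k + n div 2) choose k) * r0) else of_nat (((k + n div 2) choose k) * r1) :: rat)"
proof -
  have "(1 / (1 - fps_X\<^sup>2) ^ (k + 1) * (fps_X * of_nat r1 + of_nat r0) :: rat fps) =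
      fps_X * even_binomial_series k * fps_const (of_nat r1) + even_binomial_series k * fps_const (of_nat r0)"
    by (simp only: inverse_one_minus_X2_power fps_of_nat distrib_left mult.assoc mult.left_commute)
  then show ?thesis
    by (cases n) (auto simp: even_binomial_series_def elim!: oddE)
qed

context hmf_cover
begin

section \<open>The resolution of the module of a higher matrix factorization\<close>

abbreviation R where "R \<equiv> hmf_ring S c f"
abbreviation \<phi> where "\<phi> \<equiv> quot_proj S (seq_ideal S f c)"
abbreviation \<rho> where "\<rho> \<equiv> \<lambda>a. \<phi> (\<pi> a)"

lemma scalar_extension_R: "scalar_extension S \<pi> R \<rho> \<phi>"
proof -
  have "ring_cover R \<rho>"
    using quotient_cover(1)[OF seq_ideal_ideal[OF order_refl]] by (simp add: hmf_ring_def quot_proj_def)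
  then show ?thesis
    by (intro scalar_extension.intro scalar_extension_axioms.intro ring_cover_axioms) auto
qed

sublocale Ext: scalar_extension S \<pi> R \<rho> \<phi> by (rule scalar_extension_R)

lemma ker_\<rho>: "{a. \<rho> a = \<zero>\<^bsub>R\<^esub>} = J c"
proof -
  interpret I: ideal "seq_ideal S f c" S by (rule seq_ideal_ideal) simp
  have "seq_ideal S f c +>\<^bsub>S\<^esub> \<pi> a = seq_ideal S f c \<longleftrightarrow> \<pi> a \<in> seq_ideal S f c" for a
    using I.a_rcos_const I.a_rcos_self[OF closed[of a]] by auto
  then show ?thesis by (simp add: J_def hmf_ring_def quot_proj_def FactRing_def)
qed

text \<open>Extension of scalars to \<open>R\<close> changes the relations on the vectors from the kernel of \<open>\<pi>\<close> to \<open>J c\<close>, and the cokernel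
  divides out the image of \<open>D\<close>.\<close>

lemma module_presents:
  assumes D: "lin D" "\<And>x. x \<in> vec (X c 1) \<Longrightarrow> D x \<in> vec (X c 0) \<and> \<Theta>0 (D x) = d (\<Theta>1 x)"
  shows "\<exists>\<theta>. presents \<rho> (hmf_module S c f A0 A1 d) (vec (X c 0))
    {x \<in> vec (X c 0). \<exists>z\<in>vec (X c 1). x - D z \<in> vmod (J c)} \<theta>"
proof -
  have P0: "presents \<pi> A0 (vec (X c 0)) (vec (X c 0) \<inter> vmod ker) \<Theta>0"
    and P1: "presents \<pi> A1 (vec (X c 1)) (vec (X c 1) \<inter> vmod ker) \<Theta>1"
    using presents0[of c] presents1[of c] by (simp_all only: filt_mod_top order_refl)
  let ?B0 = "base_change S R \<phi> A0" and ?B1 = "base_change S R \<phi> A1"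
  let ?p0 = "\<lambda>x. tensor_pure S (alg_mod R \<phi>) A0 \<one>\<^bsub>R\<^esub> (\<Theta>0 x)" and ?p1 = "\<lambda>x. tensor_pure S (alg_mod R \<phi>) A1 \<one>\<^bsub>R\<^esub> (\<Theta>1 x)"
  let ?d = "base_change_map S R \<phi> A1 A0 d"
  have B0: "presents \<rho> ?B0 (vec (X c 0)) (vec (X c 0) \<inter> vmod (J c)) ?p0"
    and B1: "presents \<rho> ?B1 (vec (X c 1)) (vec (X c 1) \<inter> vmod (J c)) ?p1"
    using Ext.base_change_presents[OF P0] Ext.base_change_presents[OF P1] by (simp_all only: ker_\<rho>)
  note b0 = presentsD[OF B0] and b1 = presentsD[OF B1]
  have d: "?d (?p1 z) = ?p0 (D z)" if "z \<in> vec (X c 1)" for z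
    by (rule Ext.base_change_map_eq[OF P1 P0 D(1)]) (use D(2) that in auto)
  let ?W = "{x \<in> vec (X c 0). \<exists>z\<in>vec (X c 1). x - D z \<in> vmod (J c)}"
  have J: "is_ideal (J c)" by (rule is_ideal_J) simp
  have image: "?d ` carrier ?B1 = ?p0 ` ?W"
  proof (intro equalityI subsetI)
    fix u assume "u \<in> ?d ` carrier ?B1"
    then obtain v where v: "v \<in> carrier ?B1" "u = ?d v" by blast
    obtain z where z: "z \<in> vec (X c 1)" "v = ?p1 z" using v(1) by (rule presents_carrier[OF B1])
    have "D z - D z \<in> vmod (J c)" using vmod_zero[OF J] by simp
    then have "D z \<in> ?W" using D(2)[OF z(1)] z(1) by blast
    then show "u \<in> ?p0 ` ?W" using v(2) z d by blast
  next
    fix u assume "u \<in> ?p0 ` ?W"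
    then obtain x z where x: "u = ?p0 x" "x \<in> vec (X c 0)" "z \<in> vec (X c 1)" "x - D z \<in> vmod (J c)" by blast
    have Dz: "D z \<in> vec (X c 0)" using D(2)[OF x(3)] by blast
    have "?p0 x = ?p0 (D z)" using b0(8)[OF x(2) Dz] vec_diff[OF x(2) Dz] x(4) by blast
    then have "u = ?d (?p1 z)" using d[OF x(3)] x(1) by simp
    then show "u \<in> ?d ` carrier ?B1" using b1(9)[OF x(3)] by blast
  qed
  have sub: "submod ?W" by (rule submod_boundaries[OF D(1) J])
  have "vec (X c 0) \<inter> vmod (J c) \<subseteq> ?W"
  proof
    fix x assume x: "x \<in> vec (X c 0) \<inter> vmod (J c)"
    then have "x - D 0 \<in> vmod (J c)" by (simp add: lin_0[OF D(1)])
    then show "x \<in> ?W" using x vec_zero by blast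
  qed
  from presents_quot[OF Ext.K.ring_cover_axioms B0 sub this]
  show ?thesis by (auto simp: hmf_module_def Let_def mod_coker_def image)
qed

lemma hmf_resolution:
  assumes N: "ideal (max_ideal S) S" "J c \<subseteq> pre (max_ideal S)" and minimal: "hmf_minimal S c A0 F0 A1 d h"
  shows "\<exists>D \<theta>. vec_resolution \<rho> (hmf_module S c f A0 A1 d) (J c) (X c) (\<lambda>_. D) \<theta> \<and>
    (\<forall>i. \<forall>x\<in>vec (X c (Suc i)). D x \<in> vmod (pre (max_ideal S)))"
proof -
  obtain ff D H where core: "hmf_core c J ff gens_all lev par D H"
    and DL: "\<And>p x. p \<le> c \<Longrightarrow> x \<in> vec (X p 1) \<Longrightarrow> D x \<in> vec (X p 0) \<and> \<Theta>0 (D x) = d (\<Theta>1 x)"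
    and HL: "\<And>p x. p \<in> {1..c} \<Longrightarrow> x \<in> vec (X p 0) \<Longrightarrow>
      H p x \<in> vec (X p 1) \<and> \<Theta>1 (H p x) = hmf_part c A0 F0 h p (\<Theta>0 x)"
    using core_exists by blast
  interpret core: hmf_core c J ff gens_all lev par D H by (rule core)
  let ?m = "pre (max_ideal S)"
  have m: "is_ideal ?m" by (rule is_ideal_pre[OF N(1)])
  have P0: "presents \<pi> A0 (vec (X c 0)) (vec (X c 0) \<inter> vmod ker) \<Theta>0"
    and P1: "presents \<pi> A1 (vec (X c 1)) (vec (X c 1) \<inter> vmod ker) \<Theta>1"
    using presents0[of c] presents1[of c] by (simp_all only: filt_mod_top order_refl)
  have D_min: "D x \<in> vmod ?m" if x: "x \<in> core.T c 1" for x
  proof -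
    have x: "x \<in> vec (X c 1)" using x by (simp add: core.T_def)
    have "\<Theta>0 (D x) \<in> ideal_smult S (max_ideal S) A0"
      using minimal DL[OF _ x] presentsD(9)[OF P1 x] by (auto simp: hmf_minimal_def)
    then show ?thesis
      using ideal_smult_presented[OF ring_cover_axioms P0 N(1)] DL[OF _ x] by (simp add: pre_def)
  qed
  have H_min: "H (Suc q) x \<in> vmod ?m" if q: "q < c" and x: "x \<in> core.T (Suc q) 0" for q x
  proof -
    have q': "Suc q \<in> {1..c}" "Suc q \<le> c" using q by auto
    have x: "x \<in> vec (X (Suc q) 0)" using x by (simp add: core.T_def)
    have "\<Theta>0 x \<in> F0 (Suc q)" using presentsD(9)[OF presents0[OF q'(2)] x] by (simp add: filt_mod_def)
    then have "hmf_part c A0 F0 h (Suc q) (\<Theta>0 x) \<in> ideal_smult S (max_ideal S) A1"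
      using minimal hmf_part_source(1)[OF q'(1)] by (auto simp: hmf_minimal_def hmf_part_def)
    then have 1: "\<Theta>1 (H (Suc q) x) \<in> ideal_smult S (max_ideal S) A1" using HL[OF q'(1) x] by simp
    have "X (Suc q) 1 \<subseteq> X c 1" using q by (auto simp: gens_def)
    then have 2: "H (Suc q) x \<in> vec (X c 1)" using HL[OF q'(1) x] vec_mono by blast
    show ?thesis using ideal_smult_presented[OF ring_cover_axioms P1 N(1) 2 1] by (simp add: pre_def)
  qed
  have "\<exists>E. lin E \<and> (\<forall>n. \<forall>x\<in>core.T c (Suc n). E x \<in> core.T c n \<and> E x \<in> vmod ?m) \<and>
    (\<forall>x\<in>core.T c 1. E x = D x) \<and> (\<forall>n. \<forall>x\<in>core.T c n. E (E x) \<in> vmod (J c)) \<and>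
    (\<forall>n. \<forall>x\<in>core.T c (Suc n). E x \<in> vmod (J c) \<longrightarrow> (\<exists>z\<in>core.T c (n + 2). x - E z \<in> vmod (J c)))"
    by (rule core.resolution_exists[OF m N(2)]) (erule D_min, erule (1) H_min)
  then obtain E where E: "lin E" "\<forall>n. \<forall>x\<in>core.T c (Suc n). E x \<in> core.T c n \<and> E x \<in> vmod ?m"
    "\<forall>x\<in>core.T c 1. E x = D x" "\<forall>n. \<forall>x\<in>core.T c n. E (E x) \<in> vmod (J c)"
    "\<forall>n. \<forall>x\<in>core.T c (Suc n). E x \<in> vmod (J c) \<longrightarrow> (\<exists>z\<in>core.T c (n + 2). x - E z \<in> vmod (J c))"
    by (elim exE conjE)
  have T: "core.T c n = vec (X c n)" for n by (simp add: core.T_def)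
  have EL: "E x \<in> vec (X c 0) \<and> \<Theta>0 (E x) = d (\<Theta>1 x)" if x: "x \<in> vec (X c 1)" for x
    using DL[OF order_refl x] E(3) x by (simp add: T)
  obtain \<theta> where "presents \<rho> (hmf_module S c f A0 A1 d) (vec (X c 0))
      {x \<in> vec (X c 0). \<exists>z\<in>vec (X c 1). x - E z \<in> vmod (J c)} \<theta>"
    using module_presents[OF E(1) EL] ..
  then have "vec_resolution \<rho> (hmf_module S c f A0 A1 d) (J c) (X c) (\<lambda>_. E) \<theta>"
    using E(1,2,4,5) unfolding vec_resolution_def by (simp add: T)
  then show ?thesis using E(2) unfolding T by blast
qed

lemma gens_all_rank:
  shows "q \<in> {1..c} \<Longrightarrow> card {b \<in> gens_all. lev b = q \<and> par b = 0} = mod_rank S (filt_quot A0 F0 q)"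
    and "q \<in> {1..c} \<Longrightarrow> card {b \<in> gens_all. lev b = q \<and> par b = 1} = mod_rank S (filt_quot A1 F1 q)"
proof -
  assume q: "q \<in> {1..c}"
  have "{b \<in> gens_all. lev b = q \<and> par b = 0} = (\<lambda>u. Inl (q, u)) ` C0.qbasis q"
    using q by (auto simp: gens_all_def lev_def par_def C0.idx_def)
  moreover have "{b \<in> gens_all. lev b = q \<and> par b = 1} = (\<lambda>u. Inr (q, u)) ` C1.qbasis q"
    using q by (auto simp: gens_all_def lev_def par_def C1.idx_def)
  ultimately show "card {b \<in> gens_all. lev b = q \<and> par b = 0} = mod_rank S (filt_quot A0 F0 q)"
    "card {b \<in> gens_all. lev b = q \<and> par b = 1} = mod_rank S (filt_quot A1 F1 q)"
    by (simp_all add: card_image inj_on_def C0.card_qbasis C1.card_qbasis)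
qed

lemma card_X:
  assumes s: "s \<le> 1"
  shows "finite (X c (2 * z + s)) \<and> card (X c (2 * z + s)) =
    (\<Sum>q=1..c. ((c - q + z) choose (c - q)) * card {b \<in> gens_all. lev b = q \<and> par b = s})"
proof (rule card_gens[OF _ _ _ s])
  show "finite gens_all" using C0.finite_idx C1.finite_idx by (simp add: gens_all_def)
  show "1 \<le> lev b" if "b \<in> gens_all" for b
    using that by (auto simp: gens_all_def lev_def C0.idx_def C1.idx_def)
  show "par b \<le> 1" for b by (auto simp: par_def split: sum.splits)
qed

lemma finite_X: "finite (X c n)"
proof (cases "even n")
  case True
  then show ?thesis using card_X[of 0 "n div 2"] by simp
next
  case False
  then show ?thesis using card_X[of 1 "n div 2"] by simp
qed

text \<open>The residue field of \<open>R\<close> is covered as well, with the preimage of the maximal ideal of \<open>S\<close> as kernel: maximal ideals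
  of \<open>R\<close> correspond to maximal ideals of the covering ring that contain \<open>J c\<close>, and there is only one, since \<open>S\<close> is local
  and \<open>J c\<close> is proper.\<close>

lemma betti_eq_card:
  assumes S: "noeth_local_ring S" and minimal: "hmf_minimal S c A0 F0 A1 d h"
  shows "betti R (hmf_module S c f A0 A1 d) i = card (X c i)"
proof -
  have ex1: "\<exists>!I. maximalideal I S" using S by (simp add: noeth_local_ring_def)
  then have N: "maximalideal (max_ideal S) S" unfolding max_ideal_def by (rule theI')
  then have idN: "ideal (max_ideal S) S" by (rule maximalideal.axioms(1))
  let ?m = "pre (max_ideal S)"
  have m: "is_maximal ?m" by (rule maximal_pre[OF N])
  have ker_sub: "pre {\<zero>\<^bsub>S\<^esub>} \<subseteq> J c" using ker_J[of c] by (simp add: pre_def)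
  have unique: "m' = ?m" if m': "is_maximal m'" "J c \<subseteq> m'" for m'
  proof -
    have k: "pre {\<zero>\<^bsub>S\<^esub>} \<subseteq> m'" using ker_sub m'(2) by blast
    have "\<pi> ` m' = max_ideal S" using maximal_image(1)[OF m'(1) k] N ex1 by blast
    then show ?thesis using maximal_image(2)[OF m'(1) k] by simp
  qed
  have "1 \<notin> J c"
  proof
    assume "1 \<in> J c"
    then have "\<one>\<^bsub>S\<^esub> \<in> seq_ideal S f c" by (simp add: J_def one)
    then have "seq_ideal S f c = carrier S" using ideal.one_imp_carrier[OF seq_ideal_ideal[OF order_refl]] by simp
    then show False using regular by (simp add: regular_sequence_def)
  qed
  then obtain m' where "is_maximal m'" "J c \<subseteq> m'" using is_maximal_exists[OF is_ideal_J[OF order_refl]] by blast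
  then have Jm: "J c \<subseteq> ?m" using unique by blast
  have preR: "Ext.K.pre {\<zero>\<^bsub>R\<^esub>} = J c" using ker_\<rho> by (simp add: Ext.K.pre_def)
  note maxR = Ext.K.max_ideal_eq[of ?m, unfolded preR, OF m Jm unique]
  have idR: "ideal (max_ideal R) R" using maxR(1) by (rule maximalideal.axioms(1))
  let ?K = "residue_field R" and ?\<psi> = "quot_proj R (max_ideal R)"
  have ringK: "ring_cover ?K (\<lambda>a. ?\<psi> (\<rho> a))"
    using Ext.K.quotient_cover(1)[OF idR] by (simp add: residue_field_def quot_proj_def)
  interpret K: scalar_extension R \<rho> ?K "\<lambda>a. ?\<psi> (\<rho> a)" ?\<psi>
    by (intro scalar_extension.intro scalar_extension_axioms.intro Ext.K.ring_cover_axioms ringK) auto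
  have kerK: "{a. ?\<psi> (\<rho> a) = \<zero>\<^bsub>?K\<^esub>} = ?m"
  proof -
    interpret I: ideal "max_ideal R" R by (rule idR)
    have "max_ideal R +>\<^bsub>R\<^esub> \<rho> a = max_ideal R \<longleftrightarrow> \<rho> a \<in> max_ideal R" for a
      using I.a_rcos_const I.a_rcos_self[OF Ext.K.closed[of a]] by auto
    then have "{a. ?\<psi> (\<rho> a) = \<zero>\<^bsub>?K\<^esub>} = {a. \<rho> a \<in> max_ideal R}"
      by (simp add: residue_field_def quot_proj_def FactRing_def)
    also have "\<dots> = Ext.K.pre (max_ideal R)" by (simp only: Ext.K.pre_def)
    finally show ?thesis by (simp only: maxR(2))
  qed
  obtain D \<theta> where A: "vec_resolution \<rho> (hmf_module S c f A0 A1 d) (J c) (X c) (\<lambda>_. D) \<theta>"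
    and min: "\<forall>i. \<forall>x\<in>vec (X c (Suc i)). D x \<in> vmod ?m"
    using hmf_resolution[OF idN Jm minimal] by (elim exE conjE)
  have "mod_rank ?K (tor R (hmf_module S c f A0 A1 d) ?K ?\<psi> i) = card (X c i)"
    by (rule K.tor_rank[unfolded kerK ker_\<rho>, OF A finite_X m]) (use min in blast)
  then show ?thesis by (simp add: betti_def)
qed

lemma betti_even_odd:
  assumes "noeth_local_ring S" "hmf_minimal S c A0 F0 A1 d h"
  shows "betti R (hmf_module S c f A0 A1 d) (2 * z) =
      (\<Sum>p=1..c. ((c - p + z) choose (c - p)) * mod_rank S (filt_quot A0 F0 p))"
    and "betti R (hmf_module S c f A0 A1 d) (2 * z + 1) =
      (\<Sum>p=1..c. ((c - p + z) choose (c - p)) * mod_rank S (filt_quot A1 F1 p))"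
  using card_X[of 0 z] card_X[of 1 z] gens_all_rank unfolding betti_eq_card[OF assms]
  by (auto intro!: sum.cong)

end

section \<open>The Poincare series and the Betti numbers\<close>

theorem corollary5p7:
  fixes S :: "('s, 'x) ring_scheme" and c :: nat and f :: "nat \<Rightarrow> 's"
    and A0 :: "('s, 'a) module" and F0 :: "nat \<Rightarrow> 'a set"
    and A1 :: "('s, 'b) module" and F1 :: "nat \<Rightarrow> 'b set"
    and d :: "'b \<Rightarrow> 'a" and h :: "(nat \<Rightarrow> 'a) \<Rightarrow> 'b"
  defines "R \<equiv> hmf_ring S c f"
    and "M \<equiv> hmf_module S c f A0 A1 d"
  assumes "noeth_local_ring S"
    and "regular_sequence S c f"
    and "higher_matrix_factorization S c A0 F0 A1 F1 f d h"
    and "hmf_minimal S c A0 F0 A1 d h"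
  shows "poincare_series R M =
      (\<Sum>p=1..c. 1 / (1 - fps_X\<^sup>2) ^ (c - p + 1) *
         (fps_X * of_nat (mod_rank S (filt_quot A1 F1 p)) + of_nat (mod_rank S (filt_quot A0 F0 p)))) \<and>
    (\<forall>z. betti R M (2 * z) =
      (\<Sum>p=1..c. ((c - p + z) choose (c - p)) * mod_rank S (filt_quot A0 F0 p))) \<and>
    (\<forall>z. betti R M (2 * z + 1) =
      (\<Sum>p=1..c. ((c - p + z) choose (c - p)) * mod_rank S (filt_quot A1 F1 p)))"
proof -
  have "cring S" using assms(3) by (simp add: noeth_local_ring_def)
  then obtain \<pi> :: "('s, 'x) rcover \<Rightarrow> 's" where \<pi>: "ring_cover S \<pi>" using ring_cover_exists by blast
  interpret hmf_cover S c A0 F0 A1 F1 f d h \<pi>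
    by (intro hmf_cover.intro hmf_cover_axioms.intro \<pi> assms)
  note even = betti_even_odd(1)[OF assms(3,6), folded R_def M_def]
    and odd = betti_even_odd(2)[OF assms(3,6), folded R_def M_def]
  have "fps_nth (poincare_series R M) n = fps_nth
      (\<Sum>p=1..c. 1 / (1 - fps_X\<^sup>2) ^ (c - p + 1) *
         (fps_X * of_nat (mod_rank S (filt_quot A1 F1 p)) + of_nat (mod_rank S (filt_quot A0 F0 p)))) n" for n
  proof (cases "even n")
    case True
    then obtain z where "n = 2 * z" by (elim evenE)
    then show ?thesis
      by (simp only: fps_sum_nth poincare_coeff) (simp add: poincare_series_def even)
  next
    case False
    then obtain z where "n = 2 * z + 1" by (elim oddE)
    then show ?thesis
      by (simp only: fps_sum_nth poincare_coeff) (simp add: poincare_series_def odd[simplified])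
  qed
  then show ?thesis using even odd by (simp add: fps_eq_iff)
qed

end
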